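(* Let $\hat\varphi:\hat X\to\mathbb{R}$ be H\"older continuous (with respect to $\hat d$) and let $\sigma\in(0,1)$. If $P(\hat{\mathcal S}_\sigma,\hat\varphi;\hat g)<P(\hat\varphi;\hat g)$, then $(\hat X,\hat g)$ has a unique equilibrium state for $\hat\varphi$.
   Context: Setting. $(X,d_X)$ is a compact metric space and $g:X\to X$ is a local homeomorphism. There is a bounded function $\sigma(\cdot):X\to\mathbb{R}^+$ (not to be confused with the constant $\sigma\in(0,1)$) such that each $x\in X$ has a neighborhood $U_x$ for which $g_x:=g|_{U_x}:U_x\to g(U_x)$ is invertible and $d_X(g_x^{-1}(y),g_x^{-1}(z))\le\sigma(x)\,d_X(y,z)$ for all $y,z\in g(U_x)$. There is $\epsilon_0>0$ such that for all $x\in X$, $B_{\epsilon_0}(x)\subset U_x$ and $B_{\epsilon_0}(g(x))\subset g(U_x)$. The map $g$ is topologically exact: for each nonempty open $U\subset X$ there is $N$ with $g^N(U)=X$. Natural extension. $\hat X=\{\hat x=(x_0,x_1,x_2,\dots): x_i\in X,\ g(x_{i+1})=x_i\ \forall i\ge0\}$, with metric $\hat d(\hat x,\hat y)=\sum_{n=0}^\infty a^{-n}d_X(x_n,y_n)$ for a fixed $a>1$, and $\hat g:\hat X\to\hat X$ is the homeomorphism $\hat g(x_0,x_1,\dots)=(g(x_0),x_0,x_1,\dots)$. Orbit segments. $\mathbb{N}=\{1,2,\dots\}$; a pair $(x,n)$ represents the orbit segment $x,\dots,g^{n-1}(x)$. For $\sigma\in(0,1)$, $n\in\mathbb{N}$,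 $0\le j\le n-1$, put $\Sigma_\sigma^{j,n}=\{x\in X:\frac1{n-j}\sum_{i=j}^{n-1}\log\sigma(g^ix)<\log\sigma\}$. Let $\mathcal S_\sigma=\{(x,n)\in X\times\mathbb{N}: x\notin\Sigma_\sigma^{0,n}\}$ and $\hat{\mathcal S}_\sigma=\{(\hat x,n)\in\hat X\times\mathbb{N}:(x_0,n)\in\mathcal S_\sigma\}$. Pressure. For a continuous map $f:Y\to Y$ of a compact metric space $(Y,d)$ and continuous $\varphi:Y\to\mathbb{R}$, let $S_n\varphi(x)=\sum_{k=0}^{n-1}\varphi(f^kx)$ and $d_n(x,y)=\max_{0\le k<n}d(f^kx,f^ky)$. A set $E$ is $(n,\epsilon)$-separated if $d_n(x,y)\ge\epsilon$ for all distinct $x,y\in E$. For $\mathcal D\subset Y\times\mathbb{N}$ let $\mathcal D_n=\{x:(x,n)\in\mathcal D\}$, $\Lambda^{\mathrm{sep}}_n(\mathcal D,\varphi,\epsilon;f)=\sup\{\sum_{x\in E}e^{S_n\varphi(x)}:E\subset\mathcal D_n\text{ is }(n,\epsilon)\text{-separated}\}$, $P(\mathcal D,\varphi,\epsilon;f)=\limsup_{n\to\infty}\frac1n\log\Lambda^{\mathrm{sep}}_n(\mathcal D,\varphi,\epsilon;f)$ (with $\log 0=-\infty$), and $P(\mathcal D,\varphi;f)=\lim_{\epsilon\to0}P(\mathcal D,\varphi,\epsilon;f)$. Write $P(\varphi;f)=P(Y\times\mathbb{N},\varphi;f)$, which equals $\sup_\mu(h_\mu(f)+\int\varphi\,d\mu)$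 over $f$-invariant Borel probability measures $\mu$; an equilibrium state for $\varphi$ is an $f$-invariant Borel probability measure attaining this supremum. *)

theory Defs
  imports "HOL-Probability.Probability"
begin

section \<open>The base system and its natural extension\<close>

definition local_homeomorphism :: "('a::topological_space \<Rightarrow> 'b::topological_space) \<Rightarrow> bool" where
  "local_homeomorphism f \<longleftrightarrow>
     (\<forall>x. \<exists>U V h. x \<in> U \<and> open U \<and> open V \<and> homeomorphism U V f h)"

definition topologically_exact :: "('a::topological_space \<Rightarrow> 'a) \<Rightarrow> bool" where
  "topologically_exact f \<longleftrightarrow>
     (\<forall>U. open U \<longrightarrow> U \<noteq> {} \<longrightarrow> (\<exists>N\<ge>1. (f ^^ N) ` U = UNIV))"

definition nat_ext :: "('a \<Rightarrow> 'a) \<Rightarrow> (nat \<Rightarrow> 'a) set" where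
  "nat_ext g = {x. \<forall>i. g (x (Suc i)) = x i}"

definition nat_ext_map :: "('a \<Rightarrow> 'a) \<Rightarrow> (nat \<Rightarrow> 'a) \<Rightarrow> (nat \<Rightarrow> 'a)" where
  "nat_ext_map g x = case_nat (g (x 0)) x"

definition nat_ext_dist :: "real \<Rightarrow> (nat \<Rightarrow> 'a::metric_space) \<Rightarrow> (nat \<Rightarrow> 'a) \<Rightarrow> real" where
  "nat_ext_dist a x y = (\<Sum>n. dist (x n) (y n) / a ^ n)"

text \<open>The type \<^typ>\<open>nat \<Rightarrow> 'a\<close> already carries other metric and topological structures, so the
  natural extension is treated as a carrier set with an explicit metric, in the sense of
  \<^locale>\<open>Metric_space\<close>.\<close>

lemma Metric_space_nat_ext:
  fixes g :: "'a::metric_space \<Rightarrow> 'a"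
  assumes "compact (UNIV :: 'a set)" "a > 1"
  shows "Metric_space (nat_ext g) (nat_ext_dist a)"
proof -
  obtain B where B: "dist x y \<le> B" for x y :: 'a
    using compact_imp_bounded[OF assms(1)] by (metis UNIV_I bounded_two_points)
  have sm: "summable (\<lambda>n. dist (x n) (y n) / a ^ n)" for x y :: "nat \<Rightarrow> 'a"
  proof (rule summable_comparison_test)
    have "summable (\<lambda>n. B * (1 / a) ^ n)"
      using assms(2) by (intro summable_mult summable_geometric) auto
    then show "summable (\<lambda>n. B / a ^ n)"
      by (simp add: power_one_over divide_simps)
    show "\<exists>N. \<forall>n\<ge>N. norm (dist (x n) (y n) / a ^ n) \<le> B / a ^ n"
      using B assms(2) by (intro exI[of _ 0]) (auto simp: divide_right_mono)
  qed
  show ?thesis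
  proof
    fix x y z :: "nat \<Rightarrow> 'a"
    show "0 \<le> nat_ext_dist a x y"
      unfolding nat_ext_dist_def using assms(2) by (intro suminf_nonneg sm) auto
    show "nat_ext_dist a x y = nat_ext_dist a y x"
      by (simp add: nat_ext_dist_def dist_commute)
    show "nat_ext_dist a x y = 0 \<longleftrightarrow> x = y"
      unfolding nat_ext_dist_def using assms(2)
      by (subst suminf_eq_zero_iff[OF sm]) (auto simp: fun_eq_iff)
    show "nat_ext_dist a x z \<le> nat_ext_dist a x y + nat_ext_dist a y z"
      unfolding nat_ext_dist_def using assms(2)
      by (subst suminf_add[OF sm sm])
        (intro suminf_le sm summable_add,
          auto simp: add_divide_distrib[symmetric] divide_right_mono dist_triangle)
  qed
qed

definition hoelder_continuous_on :: "'b set \<Rightarrow> ('b \<Rightarrow> 'b \<Rightarrow> real) \<Rightarrow> ('b \<Rightarrow> real) \<Rightarrow> bool" where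
  "hoelder_continuous_on Y d \<phi> \<longleftrightarrow>
     (\<exists>C \<alpha>. 0 < \<alpha> \<and> \<alpha> \<le> 1 \<and> (\<forall>x\<in>Y. \<forall>y\<in>Y. \<bar>\<phi> x - \<phi> y\<bar> \<le> C * d x y powr \<alpha>))"


section \<open>Orbit segments\<close>

definition contr_set :: "('a \<Rightarrow> 'a) \<Rightarrow> ('a \<Rightarrow> real) \<Rightarrow> real \<Rightarrow> nat \<Rightarrow> nat \<Rightarrow> 'a set" where
  "contr_set g s \<sigma> j n =
     {x. 1 / real (n - j) * (\<Sum>i=j..<n. ln (s ((g ^^ i) x))) < ln \<sigma>}"

definition bad_segments :: "('a \<Rightarrow> 'a) \<Rightarrow> ('a \<Rightarrow> real) \<Rightarrow> real \<Rightarrow> ('a \<times> nat) set" where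
  "bad_segments g s \<sigma> = {(x, n). n \<ge> 1 \<and> x \<notin> contr_set g s \<sigma> 0 n}"

definition bad_segments_ext ::
  "('a \<Rightarrow> 'a) \<Rightarrow> ('a \<Rightarrow> real) \<Rightarrow> real \<Rightarrow> ((nat \<Rightarrow> 'a) \<times> nat) set" where
  "bad_segments_ext g s \<sigma> = {(x, n). x \<in> nat_ext g \<and> (x 0, n) \<in> bad_segments g s \<sigma>}"


section \<open>Topological pressure of a collection of orbit segments\<close>

definition birkhoff_sum :: "('b \<Rightarrow> 'b) \<Rightarrow> ('b \<Rightarrow> real) \<Rightarrow> nat \<Rightarrow> 'b \<Rightarrow> real" where
  "birkhoff_sum f \<phi> n x = (\<Sum>k<n. \<phi> ((f ^^ k) x))"

text \<open>Only used for \<open>n \<ge> 1\<close>; \<^const>\<open>Max\<close> of the empty set is unspecified.\<close>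

definition bowen_dist :: "('b \<Rightarrow> 'b \<Rightarrow> real) \<Rightarrow> ('b \<Rightarrow> 'b) \<Rightarrow> nat \<Rightarrow> 'b \<Rightarrow> 'b \<Rightarrow> real" where
  "bowen_dist d f n x y = Max ((\<lambda>k. d ((f ^^ k) x) ((f ^^ k) y)) ` {..<n})"

definition separated_set ::
  "('b \<Rightarrow> 'b \<Rightarrow> real) \<Rightarrow> ('b \<Rightarrow> 'b) \<Rightarrow> nat \<Rightarrow> real \<Rightarrow> 'b set \<Rightarrow> bool" where
  "separated_set d f n \<epsilon> E \<longleftrightarrow> (\<forall>x\<in>E. \<forall>y\<in>E. x \<noteq> y \<longrightarrow> \<epsilon> \<le> bowen_dist d f n x y)"

text \<open>Restricting to finite \<open>E\<close> loses nothing: subsets of separated sets are separated and the summands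
  are positive (for \<open>\<epsilon> > 0\<close> and continuous \<open>f\<close> on a compact space all separated sets are finite). It
  excludes infinite sets, over which \<^const>\<open>sum\<close> is \<open>0\<close> by convention.\<close>

definition part_sum ::
  "('b \<Rightarrow> 'b \<Rightarrow> real) \<Rightarrow> ('b \<Rightarrow> 'b) \<Rightarrow> ('b \<times> nat) set \<Rightarrow> ('b \<Rightarrow> real) \<Rightarrow> real \<Rightarrow> nat \<Rightarrow> ereal" where
  "part_sum d f D \<phi> \<epsilon> n =
     (SUP E \<in> {E. finite E \<and> E \<subseteq> {x. (x, n) \<in> D} \<and> separated_set d f n \<epsilon> E}.
        ereal (\<Sum>x\<in>E. exp (birkhoff_sum f \<phi> n x)))"

definition ereal_ln :: "ereal \<Rightarrow> ereal" where
  "ereal_ln x = (if x \<le> 0 then -\<infinity> else if x = \<infinity> then \<infinity> else ereal (ln (real_of_ereal x)))"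

definition pressure_at ::
  "('b \<Rightarrow> 'b \<Rightarrow> real) \<Rightarrow> ('b \<Rightarrow> 'b) \<Rightarrow> ('b \<times> nat) set \<Rightarrow> ('b \<Rightarrow> real) \<Rightarrow> real \<Rightarrow> ereal" where
  "pressure_at d f D \<phi> \<epsilon> = limsup (\<lambda>n. ereal (1 / real n) * ereal_ln (part_sum d f D \<phi> \<epsilon> n))"

definition pressure_on ::
  "('b \<Rightarrow> 'b \<Rightarrow> real) \<Rightarrow> ('b \<Rightarrow> 'b) \<Rightarrow> ('b \<times> nat) set \<Rightarrow> ('b \<Rightarrow> real) \<Rightarrow> ereal" where
  "pressure_on d f D \<phi> = Lim (at_right 0) (pressure_at d f D \<phi>)"

definition pressure ::
  "'b set \<Rightarrow> ('b \<Rightarrow> 'b \<Rightarrow> real) \<Rightarrow> ('b \<Rightarrow> 'b) \<Rightarrow> ('b \<Rightarrow> real) \<Rightarrow> ereal" where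
  "pressure Y d f \<phi> = pressure_on d f (Y \<times> {1..}) \<phi>"


section \<open>Measure-theoretic entropy and equilibrium states\<close>

definition invariant_measures ::
  "'b set \<Rightarrow> ('b \<Rightarrow> 'b \<Rightarrow> real) \<Rightarrow> ('b \<Rightarrow> 'b) \<Rightarrow> 'b measure set" where
  "invariant_measures Y d f =
     {\<mu>. prob_space \<mu> \<and> sets \<mu> = sigma_sets Y {U. openin (Metric_space.mtopology Y d) U} \<and>
         f \<in> measurable \<mu> \<mu> \<and> distr \<mu> \<mu> f = \<mu>}"

definition partition_entropy :: "'b measure \<Rightarrow> 'b set set \<Rightarrow> real" where
  "partition_entropy \<mu> P = - (\<Sum>A\<in>P. measure \<mu> A * ln (measure \<mu> A))"

definition pullback_partition :: "'b measure \<Rightarrow> ('b \<Rightarrow> 'b) \<Rightarrow> nat \<Rightarrow> 'b set set \<Rightarrow> 'b set set" where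
  "pullback_partition \<mu> f k P = (\<lambda>A. (f ^^ k) -` A \<inter> space \<mu>) ` P - {{}}"

definition entropy_wrt :: "'b measure \<Rightarrow> ('b \<Rightarrow> 'b) \<Rightarrow> 'b set set \<Rightarrow> real" where
  "entropy_wrt \<mu> f P =
     lim (\<lambda>n. partition_entropy \<mu> (common_refinement ((\<lambda>k. pullback_partition \<mu> f k P) ` {..<n}))
              / real n)"

text \<open>The Kolmogorov--Sinai entropy \<open>h\<^sub>\<mu>(f)\<close>.\<close>

definition ks_entropy :: "'b measure \<Rightarrow> ('b \<Rightarrow> 'b) \<Rightarrow> ereal" where
  "ks_entropy \<mu> f =
     (SUP P \<in> {P. finite P \<and> P \<subseteq> sets \<mu> \<and> partition_on (space \<mu>) P}. ereal (entropy_wrt \<mu> f P))"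

definition free_energy :: "('b \<Rightarrow> 'b) \<Rightarrow> ('b \<Rightarrow> real) \<Rightarrow> 'b measure \<Rightarrow> ereal" where
  "free_energy f \<phi> \<mu> = ks_entropy \<mu> f + ereal (\<integral>x. \<phi> x \<partial>\<mu>)"

definition equilibrium_state ::
  "'b set \<Rightarrow> ('b \<Rightarrow> 'b \<Rightarrow> real) \<Rightarrow> ('b \<Rightarrow> 'b) \<Rightarrow> ('b \<Rightarrow> real) \<Rightarrow> 'b measure \<Rightarrow> bool" where
  "equilibrium_state Y d f \<phi> \<mu> \<longleftrightarrow>
     \<mu> \<in> invariant_measures Y d f \<and>
     free_energy f \<phi> \<mu> = (SUP \<nu> \<in> invariant_measures Y d f. free_energy f \<phi> \<nu>)"

end

theory Submission
  imports Defs "HOL-Probability.Probability"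
begin

text \<open>
  Up to bounded error the Birkhoff sums of \<open>\<phi>\<close> depend on the coordinate \<open>x 0\<close> only, so they are replaced by sums \<open>\<Phi> n\<close> on the
  base. Let \<open>rate\<close> be the exponential growth rate of the transfer-operator sums of \<open>exp (\<Phi> n z)\<close> over the \<open>n\<close>th preimages
  \<open>z\<close> of a point. Orbit segments split into a good prefix, along which inverse branches contract, and a bad suffix; by the pressure
  gap the suffixes grow at a rate \<open>b < rate\<close>, and good prefixes can be glued by exactness. Hence the sums are at most a constant
  times \<open>exp (n * rate)\<close>, and so are the sums over separated sets. The usual proof of the variational principle then bounds every
  free energy by \<open>rate\<close>, and Misiurewicz's construction on preimage sets attains it.

  For uniqueness, perturb \<open>\<phi>\<close> by \<open>t * \<psi> (x 0)\<close> with \<open>\<psi>\<close> Lipschitz. If two equilibrium states gave \<open>\<psi>\<close> different integrals, the growth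
  rate would have different one-sided slopes at \<open>t = 0\<close>, and a fixed proportion of the preimages of every point, measured by
  \<open>exp (\<Phi> n z)\<close>, would have averages of \<open>\<psi>\<close> near either slope. Gluing blocks of the two kinds would produce arbitrarily many disjoint
  families of preimages, each with a fixed proportion of the total. So the base marginals agree, and they determine an
  invariant measure on the natural extension.
\<close>

section \<open>Expanding systems and transfer-operator sums\<close>

text \<open>Outside good prefixes inverse branches may expand, so Bowen balls need not have bounded
  distortion. Bad segments are controlled only through separated sets, at every scale \<delta>, with
  a distortion that grows like a small multiple of their length; the gap \<open>rate - b\<close>
  pays for it. Upper bounds with a constant, rather than a subexponential factor, come from gluing:
  a sum over good segments at one point is dominated by a full sum at every point, and a lower bound
  valid at every point cannot exceed the growth rate. Such bounds are what the final counting needs: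
  many disjoint families, each with a fixed proportion, contradict only an estimate by a constant
  times \<open>exp (n * rate)\<close>. Perturbations use \<psi> with values in [0,1] and
  \<open>t \<ge> 0\<close>: the rate does not drop and the bad growth rises by at most
  \<open>t\<close>, so the gap survives for small \<open>t\<close>. The left slope of \<psi> is
  reached through \<open>1 - \<psi>\<close>. Existence works at the single scale
  \<open>\<epsilon>\<^sub>0\<close>, at which the preimages of a point are separated; the upper
  bound for free energies has to treat arbitrary partitions, hence all scales.\<close>

lemma fekete:
  fixes a :: "nat \<Rightarrow> real"
  assumes sub: "\<And>m n. a (m + n) \<le> a m + a n" and lb: "\<And>n. - real n * B \<le> a n"
  obtains r where "(\<lambda>n. a n / real n) \<longlonglongrightarrow> r" "\<And>n. n \<ge> 1 \<Longrightarrow> real n * r \<le> a n"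
proof -
  define r where "r = Inf ((\<lambda>n. a n / real n) ` {1..})"
  have bdd: "bdd_below ((\<lambda>n. a n / real n) ` {1..})"
    using lb by (intro bdd_belowI[of _ "-B"]) (auto simp: field_simps)
  have le: "real n * r \<le> a n" if "n \<ge> 1" for n
  proof -
    have "r \<le> a n / real n"
      unfolding r_def using that bdd by (intro cINF_lower) auto
    then show ?thesis using that by (simp add: field_simps)
  qed
  have mult: "a (k * n) \<le> real k * a n + a 0" for k n
  proof (induction k)
    case (Suc k)
    have "a (Suc k * n) \<le> a n + a (k * n)" using sub[of n "k * n"] by simp
    then show ?case using Suc by (simp add: algebra_simps)
  qed simp
  have "(\<lambda>n. a n / real n) \<longlonglongrightarrow> r"
  proof (rule LIMSEQ_I)
    fix e :: real assume e: "e > 0"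
    obtain q where q: "q \<ge> 1" "a q / real q < r + e / 2"
    proof -
      have "Inf ((\<lambda>n. a n / real n) ` {1..}) < r + e / 2" using e by (simp add: r_def)
      then show thesis using that by (subst (asm) cInf_less_iff) (use bdd in auto)
    qed
    \<comment> \<open>\<open>A\<close> bounds what is left over when \<open>n\<close> is divided by
      \<open>q\<close>: the value at the remainder, the possibly nonzero \<open>a 0\<close>, and the
      correction of the linear term.\<close>
    define A where "A = Max ((\<lambda>j. \<bar>a j\<bar>) ` {..q}) + \<bar>a 0\<bar> + real q * \<bar>a q / real q\<bar>"
    have A: "\<bar>a j\<bar> + \<bar>a 0\<bar> + real q * \<bar>a q / real q\<bar> \<le> A" if "j < q" for j
      unfolding A_def using that by (intro add_right_mono Max_ge) auto
    have A0: "A \<ge> 0" using A[of 0] q(1) by fastforce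
    obtain N where N: "real N > 2 * A / e + 1" using reals_Archimedean2 by blast
    have "norm (a n / real n - r) < e" if n: "n \<ge> N" for n
    proof -
      have "0 \<le> 2 * A / e" using A0 e by simp
      then have n0: "real n > 2 * A / e" "real n \<ge> 1" using N n by linarith+
      define k j where "k = n div q" and "j = n mod q"
      have nkj: "n = k * q + j" "j < q" using q(1) by (auto simp: k_def j_def)
      have "a n \<le> real k * a q + a 0 + a j"
        using sub[of "k * q" j] mult[of k q] nkj(1)[symmetric] by simp
      also have "real k * a q = real (k * q) * (a q / real q)" using q(1) by simp
      also have "real (k * q) * (a q / real q) = real n * (a q / real q) - real j * (a q / real q)"
        using nkj(1) by (simp add: algebra_simps)
      finally have "a n \<le> real n * (a q / real q) - real j * (a q / real q) + a 0 + a j" .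
      moreover have "- (real j * (a q / real q)) \<le> real q * \<bar>a q / real q\<bar>"
      proof -
        have "- (real j * (a q / real q)) \<le> real j * \<bar>a q / real q\<bar>"
          by (metis abs_ge_minus_self abs_mult abs_of_nat)
        also have "\<dots> \<le> real q * \<bar>a q / real q\<bar>" using nkj(2) by (intro mult_right_mono) auto
        finally show ?thesis .
      qed
      ultimately have "a n \<le> real n * (a q / real q) + A" using A[OF nkj(2)] by linarith
      then have "a n / real n \<le> a q / real q + A / real n"
        using n0 by (simp add: field_simps)
      also have "A / real n < e / 2"
        using n0 e A0 by (simp add: field_simps)
      finally have "a n / real n < r + e" using q(2) by linarith
      moreover have "r \<le> a n / real n" using le[of n] n0 by (simp add: field_simps)
      ultimately show ?thesis using e by auto
    qed
    then show "\<exists>N. \<forall>n\<ge>N. norm (a n / real n - r) < e" by blast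
  qed
  then show thesis using that le by blast
qed

text \<open>The hypotheses on \<open>g\<close> enter through these consequences. \<open>lift\<close>
  compares a lifted point with the centre \<open>x\<close> alone, at rate \<open>s x\<close>, as is
  suited to following one reference orbit backwards. \<open>exact\<close> is uniform in the centre
  and in all large times, so that connecting times can be chosen once and for all.\<close>

locale expanding_system =
  fixes g :: "'a::metric_space \<Rightarrow> 'a" and s :: "'a \<Rightarrow> real" and \<sigma> \<epsilon>\<^sub>0 :: real
  assumes compact_base: "compact (UNIV :: 'a set)"
    and cont_g: "continuous_on UNIV g"
    and s_pos: "s x > 0"
    and \<sigma>_pos: "\<sigma> > 0" and \<sigma>_less: "\<sigma> < 1"
    and \<epsilon>0_pos: "\<epsilon>\<^sub>0 > 0"
    and lift: "dist y (g x) < \<epsilon>\<^sub>0 \<Longrightarrow> \<exists>z. g z = y \<and> dist z x \<le> s x * dist y (g x)"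
    and g_inj: "g z = g z' \<Longrightarrow> dist z z' < \<epsilon>\<^sub>0 \<Longrightarrow> z = z'"
    and exact: "e > 0 \<Longrightarrow> \<exists>\<tau>. \<forall>N\<ge>\<tau>. \<forall>x. (g ^^ N) ` ball x e = UNIV"
begin

text \<open>\<open>good n x\<close> says that \<open>n\<close> is a hyperbolic time of \<open>x\<close> with rate \<open>\<sigma>\<close>. Every orbit segment is a good one followed by a
  bad one: take the longest bad suffix.\<close>

definition good :: "nat \<Rightarrow> 'a \<Rightarrow> bool" where
  "good n x \<longleftrightarrow> (\<forall>j<n. (\<Sum>i=j..<n. ln (s ((g ^^ i) x))) \<le> real (n - j) * ln \<sigma>)"

definition bad :: "nat \<Rightarrow> 'a \<Rightarrow> bool" where
  "bad n x \<longleftrightarrow> n \<ge> 1 \<and> real n * ln \<sigma> \<le> (\<Sum>i<n. ln (s ((g ^^ i) x)))"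

text \<open>Bowen closeness over the times below \<open>n\<close>. At \<open>n = 0\<close> it always
  holds, so a \<open>bsep 0\<close> set has at most one point; an empty bad suffix therefore needs
  separate treatment later.\<close>

definition bclose :: "nat \<Rightarrow> real \<Rightarrow> 'a \<Rightarrow> 'a \<Rightarrow> bool" where
  "bclose n \<delta> x y \<longleftrightarrow> (\<forall>j<n. dist ((g ^^ j) x) ((g ^^ j) y) < \<delta>)"

definition bsep :: "nat \<Rightarrow> real \<Rightarrow> 'a set \<Rightarrow> bool" where
  "bsep n \<delta> E \<longleftrightarrow> (\<forall>x\<in>E. \<forall>y\<in>E. x \<noteq> y \<longrightarrow> \<not> bclose n \<delta> x y)"

lemma decomposition:
  obtains l where "l \<le> n" "good (n - l) x" "l = 0 \<or> bad l ((g ^^ (n - l)) x)"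
proof -
  define P where "P l \<longleftrightarrow> l \<le> n \<and> (l = 0 \<or> bad l ((g ^^ (n - l)) x))" for l
  have P0: "P 0" by (simp add: P_def)
  define l where "l = Greatest P"
  have l: "P l" unfolding l_def by (rule GreatestI_nat[of P 0 n]) (auto simp: P_def)
  have max: "k \<le> l" if "P k" for k unfolding l_def using that by (rule Greatest_le_nat[of P _ n]) (auto simp: P_def)
  let ?S = "\<lambda>i j. \<Sum>k=i..<j. ln (s ((g ^^ k) x))"
  have shift: "(\<Sum>i<k. ln (s ((g ^^ i) ((g ^^ (n - k)) x)))) = ?S (n - k) n" if "k \<le> n" for k
  proof -
    have "?S (n - k) n = (\<Sum>i=0..<k. ln (s ((g ^^ (i + (n - k))) x)))"
      using sum.shift_bounds_nat_ivl[of "\<lambda>i. ln (s ((g ^^ i) x))" 0 "n - k" k] that by simp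
    then show ?thesis by (simp add: funpow_add lessThan_atLeast0)
  qed
  have "good (n - l) x"
    unfolding good_def
  proof (intro allI impI)
    fix j assume j: "j < n - l"
    \<comment> \<open>A suffix longer than the maximal one is not bad; removing the maximal bad
      suffix, whose average is at least \<open>ln \<sigma>\<close>, leaves an average below
      \<open>ln \<sigma>\<close>.\<close>
    have "\<not> P (n - j)" using max[of "n - j"] j by auto
    then have "?S j n < real (n - j) * ln \<sigma>"
      using j shift[of "n - j"] by (auto simp: P_def bad_def)
    moreover have "?S j n = ?S j (n - l) + ?S (n - l) n"
      using j by (intro sum.atLeastLessThan_concat[symmetric]) auto
    moreover have "real l * ln \<sigma> \<le> ?S (n - l) n"
      using l shift[of l] by (auto simp: P_def bad_def)
    moreover have "real (n - j) * ln \<sigma> = real (n - l - j) * ln \<sigma> + real l * ln \<sigma>"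
      using j by (simp add: algebra_simps of_nat_diff)
    ultimately show "?S j (n - l) \<le> real (n - l - j) * ln \<sigma>" by linarith
  qed
  then show thesis using that[of l] l by (auto simp: P_def)
qed

text \<open>Lifting goes backwards from time \<open>n\<close>, one inverse branch at a time. The
  distance after each lift is bounded by the product of the rates so far; these products stay at
  most 1, so the lifted point remains within \<open>\<epsilon>\<^sub>0\<close> of the orbit and the
  next lift exists.\<close>

lemma pullback_prod:
  assumes "\<And>j. j < n \<Longrightarrow> (\<Prod>i=j..<n. s ((g ^^ i) x)) \<le> 1" and "dist w ((g ^^ n) x) < \<epsilon>\<^sub>0"
  shows "\<exists>z. (g ^^ n) z = w \<and>
    (\<forall>j\<le>n. dist ((g ^^ j) z) ((g ^^ j) x) \<le> (\<Prod>i=j..<n. s ((g ^^ i) x)) * dist w ((g ^^ n) x))"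
proof -
  let ?p = "\<lambda>j. \<Prod>i=j..<n. s ((g ^^ i) x)"
  let ?d = "dist w ((g ^^ n) x)"
  have "\<exists>z. (g ^^ k) z = w \<and> (\<forall>j\<le>k. dist ((g ^^ j) z) ((g ^^ (n - k + j)) x) \<le> ?p (n - k + j) * ?d)"
    if "k \<le> n" for k
    using that
  proof (induction k)
    case 0
    then show ?case by (intro exI[of _ w]) auto
  next
    case (Suc k)
    then obtain z where z: "(g ^^ k) z = w"
      "\<And>j. j \<le> k \<Longrightarrow> dist ((g ^^ j) z) ((g ^^ (n - k + j)) x) \<le> ?p (n - k + j) * ?d" by auto
    have nk: "n - k = Suc (n - Suc k)" using Suc.prems by auto
    have d0: "dist z (g ((g ^^ (n - Suc k)) x)) \<le> ?p (n - k) * ?d"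
      using z(2)[of 0] nk by simp
    have "?p (n - k) \<le> 1" using assms(1)[of "n - k"] by (cases "n - k < n") auto
    then have "?p (n - k) * ?d \<le> ?d"
      by (intro mult_left_le_one_le) (auto intro!: prod_nonneg simp: less_imp_le[OF s_pos])
    then have "dist z (g ((g ^^ (n - Suc k)) x)) < \<epsilon>\<^sub>0" using d0 assms(2) by linarith
    from lift[OF this] obtain z' where z': "g z' = z"
      "dist z' ((g ^^ (n - Suc k)) x) \<le> s ((g ^^ (n - Suc k)) x) * dist z (g ((g ^^ (n - Suc k)) x))"
      by blast
    have eqp: "?p (n - Suc k) = s ((g ^^ (n - Suc k)) x) * ?p (n - k)"
      using Suc.prems by (subst prod.atLeast_Suc_lessThan) (auto simp: nk)
    have "dist z' ((g ^^ (n - Suc k)) x) \<le> s ((g ^^ (n - Suc k)) x) * (?p (n - k) * ?d)"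
      using z'(2) d0 less_imp_le[OF s_pos] by (meson mult_left_mono order_trans)
    then have first: "dist z' ((g ^^ (n - Suc k)) x) \<le> ?p (n - Suc k) * ?d"
      by (simp add: eqp mult.assoc)
    show ?case
    proof (intro exI[of _ z'] conjI allI impI)
      show "(g ^^ Suc k) z' = w" using z(1) z'(1) by (simp add: funpow_swap1)
      fix j assume j: "j \<le> Suc k"
      show "dist ((g ^^ j) z') ((g ^^ (n - Suc k + j)) x) \<le> ?p (n - Suc k + j) * ?d"
      proof (cases j)
        case 0 then show ?thesis using first by simp
      next
        case (Suc i)
        have e: "n - Suc k + j = n - k + i" using nk Suc by simp
        have "(g ^^ j) z' = (g ^^ i) z" using Suc z'(1) by (simp add: funpow_swap1)
        moreover have "i \<le> k" using j Suc by simp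
        ultimately show ?thesis using z(2)[of i] by (simp only: e)
      qed
    qed
  qed
  from this[of n] show ?thesis by auto
qed

text \<open>Exponentiating the inequalities in \<open>good\<close> bounds every product of rates by
  a power of \<sigma>, so at a hyperbolic time there is an inverse branch that contracts
  exponentially towards the past.\<close>

lemma pullback:
  assumes "good n x" "dist w ((g ^^ n) x) < \<epsilon>\<^sub>0"
  shows "\<exists>z. (g ^^ n) z = w \<and>
    (\<forall>j\<le>n. dist ((g ^^ j) z) ((g ^^ j) x) \<le> \<sigma> ^ (n - j) * dist w ((g ^^ n) x))"
proof -
  have p: "(\<Prod>i=j..<n. s ((g ^^ i) x)) \<le> \<sigma> ^ (n - j)" if "j \<le> n" for j
  proof (cases "j = n")
    case False
    have pos: "(\<Prod>i=j..<n. s ((g ^^ i) x)) > 0" by (intro prod_pos) (auto simp: s_pos)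
    have "ln (\<Prod>i=j..<n. s ((g ^^ i) x)) = (\<Sum>i=j..<n. ln (s ((g ^^ i) x)))"
      by (intro ln_prod) (auto simp: s_pos less_imp_neq[THEN not_sym])
    also have "\<dots> \<le> real (n - j) * ln \<sigma>" using assms(1) that False by (auto simp: good_def)
    also have "\<dots> = ln (\<sigma> ^ (n - j))" using \<sigma>_pos by (simp add: ln_realpow)
    finally show ?thesis using pos \<sigma>_pos by (subst (asm) ln_le_cancel_iff) auto
  qed auto
  have "(\<Prod>i=j..<n. s ((g ^^ i) x)) \<le> 1" if "j < n" for j
    using p[of j] that power_le_one[of \<sigma> "n - j"] \<sigma>_pos \<sigma>_less by auto
  from pullback_prod[OF this assms(2)] obtain z where z: "(g ^^ n) z = w"
    "\<And>j. j \<le> n \<Longrightarrow> dist ((g ^^ j) z) ((g ^^ j) x) \<le> (\<Prod>i=j..<n. s ((g ^^ i) x)) * dist w ((g ^^ n) x)"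
    by blast
  have "dist ((g ^^ j) z) ((g ^^ j) x) \<le> \<sigma> ^ (n - j) * dist w ((g ^^ n) x)" if "j \<le> n" for j
    by (rule order_trans[OF z(2)[OF that] mult_right_mono[OF p[OF that] zero_le_dist]])
  with z(1) show ?thesis by (intro exI[of _ z] conjI allI impI)
qed

lemma bclose_mono: "bclose n \<delta> x y \<Longrightarrow> \<delta> \<le> \<delta>' \<Longrightarrow> bclose n \<delta>' x y"
  by (force simp: bclose_def)

lemma finite_net:
  assumes "\<delta> > 0"
  obtains C :: "'a set" where "finite C" "\<And>x. \<exists>c\<in>C. dist x c < \<delta>"
proof -
  obtain C :: "'a set" where "finite C" "UNIV \<subseteq> (\<Union>c\<in>C. ball c \<delta>)"
    using compact_base[unfolded compact_eq_totally_bounded] assms by blast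
  moreover have "\<exists>c\<in>C. dist x c < \<delta>" for x
    using subsetD[OF \<open>UNIV \<subseteq> (\<Union>c\<in>C. ball c \<delta>)\<close> UNIV_I[of x]] by (auto simp: dist_commute)
  ultimately show thesis using that by blast
qed

text \<open>Pigeonhole: record at each time a net point within \<open>\<delta> / 2\<close>; points
  with the same record are close.\<close>

lemma bsep_card_bound:
  assumes "\<delta> > 0"
  obtains N where "\<And>E. bsep n \<delta> E \<Longrightarrow> finite E \<and> card E \<le> N"
proof -
  obtain C :: "'a set" where C: "finite C" "\<And>x. \<exists>c\<in>C. dist x c < \<delta> / 2" using finite_net[OF half_gt_zero[OF assms]] by blast
  then obtain c where c: "\<And>x. c x \<in> C" "\<And>x. dist x (c x) < \<delta> / 2" by metis
  have "finite E \<and> card E \<le> card ({..<n} \<rightarrow>\<^sub>E C)" if E: "bsep n \<delta> E" for E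
  proof -
    have fin: "finite ({..<n} \<rightarrow>\<^sub>E C)" using C(1) by (intro finite_PiE) auto
    let ?f = "\<lambda>x. restrict (\<lambda>j. c ((g ^^ j) x)) {..<n}"
    have "inj_on ?f E"
    proof (rule inj_onI, rule ccontr)
      fix x y assume xy: "x \<in> E" "y \<in> E" "?f x = ?f y" "x \<noteq> y"
      have "bclose n \<delta> x y" unfolding bclose_def
      proof (intro allI impI)
        fix j assume "j < n"
        then have "c ((g ^^ j) x) = c ((g ^^ j) y)" using xy(3) by (metis lessThan_iff restrict_apply')
        then show "dist ((g ^^ j) x) ((g ^^ j) y) < \<delta>"
          using c(2)[of "(g ^^ j) x"] c(2)[of "(g ^^ j) y"] by (metis dist_commute dist_triangle_half_l)
      qed
      then show False using E xy by (auto simp: bsep_def)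
    qed
    moreover have "?f ` E \<subseteq> {..<n} \<rightarrow>\<^sub>E C" by (rule image_subsetI) (simp add: c(1))
    ultimately show ?thesis using fin by (meson card_inj_on_le inj_on_finite)
  qed
  then show thesis using that by blast
qed

lemma surj_iter: "\<exists>x. (g ^^ n) x = y"
proof -
  obtain \<tau> where \<tau>: "\<And>N x. N \<ge> \<tau> \<Longrightarrow> (g ^^ N) ` ball x 1 = UNIV" using exact[of 1] by (metis zero_less_one)
  then obtain x where "(g ^^ (n + \<tau>)) x = y" by (metis UNIV_I imageE le_add2)
  then show ?thesis by (auto simp: funpow_add)
qed

text \<open>Local injectivity is used from the common image backwards: once the images under
  \<open>g\<close> agree, closeness at time 0 identifies the points. So the \<open>n\<close>th
  preimages of any point are separated at the fixed scale \<open>\<epsilon>\<^sub>0\<close>.\<close>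

lemma preimages_bclose:
  assumes "(g ^^ n) z = (g ^^ n) z'" "bclose n \<epsilon>\<^sub>0 z z'"
  shows "z = z'"
  using assms
proof (induction n arbitrary: z z')
  case (Suc n)
  have "g z = g z'"
  proof (rule Suc.IH)
    show "(g ^^ n) (g z) = (g ^^ n) (g z')" using Suc.prems(1) by (simp add: funpow_swap1)
    show "bclose n \<epsilon>\<^sub>0 (g z) (g z')" unfolding bclose_def
    proof (intro allI impI)
      fix j assume "j < n"
      then have "dist ((g ^^ Suc j) z) ((g ^^ Suc j) z') < \<epsilon>\<^sub>0"
        using Suc.prems(2) unfolding bclose_def by blast
      then show "dist ((g ^^ j) (g z)) ((g ^^ j) (g z')) < \<epsilon>\<^sub>0" by (simp add: funpow_swap1)
    qed
  qed
  moreover have "dist z z' < \<epsilon>\<^sub>0"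
    using Suc.prems(2) unfolding bclose_def by (metis funpow_0 zero_less_Suc)
  ultimately show ?case by (rule g_inj)
qed auto

lemma bsep_preimages: "bsep n \<epsilon>\<^sub>0 {z. (g ^^ n) z = y \<and> Q z}"
  unfolding bsep_def using preimages_bclose[of n] by blast

lemma finite_preimages [simp]: "finite {z. (g ^^ n) z = y \<and> Q z}"
  using bsep_card_bound[OF \<epsilon>0_pos, of n] bsep_preimages by metis

lemma finite_preimages_all [simp]: "finite {z. (g ^^ n) z = y}"
  using finite_preimages[of n y "\<lambda>_. True"] by (simp only: simp_thms)

lemma maximal_bsep:
  assumes "\<delta> > 0"
  obtains F where "finite F" "F \<subseteq> A" "bsep n \<delta> F" "\<And>x. x \<in> A \<Longrightarrow> \<exists>w\<in>F. bclose n \<delta> x w"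
proof -
  obtain N where N: "\<And>E. bsep n \<delta> E \<Longrightarrow> finite E \<and> card E \<le> N" using bsep_card_bound[OF assms] by metis
  define P where "P F \<longleftrightarrow> F \<subseteq> A \<and> bsep n \<delta> F" for F
  have "P {}" by (auto simp: P_def bsep_def)
  moreover have "\<forall>y. P y \<longrightarrow> card y < Suc N" using N by (auto simp: P_def less_Suc_eq_le)
  ultimately obtain F where F: "P F" "\<And>G. P G \<Longrightarrow> card G \<le> card F"
    using ex_has_greatest_nat[of P "{}" card "Suc N"] by blast
  have finF: "finite F" using F(1) N by (auto simp: P_def)
  have "\<exists>w\<in>F. bclose n \<delta> x w" if x: "x \<in> A" for x
  proof (rule ccontr)
    assume no: "\<not> ?thesis"
    show False
    proof (cases "x \<in> F")
      case True
      then show False using no assms by (auto simp: bclose_def)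
    next
      case False
      have "\<not> bclose n \<delta> w x" if "w \<in> F" for w using no that by (auto simp: bclose_def dist_commute)
      then have "P (insert x F)" using F(1) x no unfolding P_def bsep_def by blast
      from F(2)[OF this] show False using False finF by simp
    qed
  qed
  then show thesis using that[of F] F(1) finF by (auto simp: P_def)
qed

end

text \<open>\<open>\<Phi> n\<close> stands for a Birkhoff sum transported to the base. It is only
  almost additive because the history chosen for \<open>(g ^^ m) x\<close> differs from the one
  carried along from \<open>x\<close>. Distortion is bounded along shadowing
  (\<open>Phi_shadow\<close>); for arbitrary Bowen-close segments, in particular bad ones, there is
  only an error of small linear growth (\<open>Phi_unif\<close>).\<close>

locale potential = expanding_system g s \<sigma> \<epsilon>\<^sub>0
  for g :: "'a::metric_space \<Rightarrow> 'a" and s \<sigma> \<epsilon>\<^sub>0 +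
  fixes \<Phi> :: "nat \<Rightarrow> 'a \<Rightarrow> real" and C0 C1 B :: real
  assumes Phi_add: "\<bar>\<Phi> (m + n) x - \<Phi> m x - \<Phi> n ((g ^^ m) x)\<bar> \<le> C0"
    and Phi_shadow: "(\<And>j. j \<le> n \<Longrightarrow> dist ((g ^^ j) z) ((g ^^ j) x) \<le> \<epsilon>\<^sub>0 * \<sigma> ^ (n - j))
      \<Longrightarrow> \<bar>\<Phi> n z - \<Phi> n x\<bar> \<le> C1"
    and Phi_unif: "\<eta> > 0 \<Longrightarrow> \<exists>\<delta>>0. \<exists>C. \<forall>n x z. bclose n \<delta> z x \<longrightarrow> \<bar>\<Phi> n z - \<Phi> n x\<bar> \<le> C + real n * \<eta>"
    and Phi_bound: "\<bar>\<Phi> n x\<bar> \<le> real n * B"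
begin

section \<open>Sums over preimages and their exponential growth\<close>

lemma C0_nonneg: "C0 \<ge> 0" by (rule order_trans[OF abs_ge_zero Phi_add])
lemma Phi_0 [simp]: "\<Phi> 0 x = 0" using Phi_bound[of 0 x] by simp
lemma B_nonneg: "B \<ge> 0" using order_trans[OF abs_ge_zero Phi_bound[of 1 undefined]] by simp

text \<open>For exactly additive \<open>\<Phi>\<close> this is the \<open>n\<close>th power of the
  transfer operator, applied to the indicator of \<open>Q\<close>, at \<open>y\<close>.\<close>

definition psum :: "('a \<Rightarrow> bool) \<Rightarrow> nat \<Rightarrow> 'a \<Rightarrow> real" where
  "psum Q n y = (\<Sum>z | (g ^^ n) z = y \<and> Q z. exp (\<Phi> n z))"

abbreviation tsum :: "nat \<Rightarrow> 'a \<Rightarrow> real" where "tsum \<equiv> psum (\<lambda>_. True)"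

definition tsup :: "nat \<Rightarrow> real" where "tsup n = (SUP y. tsum n y)"

lemma psum_nonneg [simp]: "psum Q n y \<ge> 0"
  by (auto simp: psum_def intro: sum_nonneg)

lemma psum_mono:
  assumes "\<And>z. (g ^^ n) z = y \<Longrightarrow> Q z \<Longrightarrow> Q' z"
  shows "psum Q n y \<le> psum Q' n y"
  unfolding psum_def
proof (rule sum_mono2[OF finite_preimages])
  show "{z. (g ^^ n) z = y \<and> Q z} \<subseteq> {z. (g ^^ n) z = y \<and> Q' z}" using assms by blast
qed simp

lemma tsum_bdd: "bdd_above (range (tsum n))"
proof -
  obtain N where N: "\<And>E. bsep n \<epsilon>\<^sub>0 E \<Longrightarrow> finite E \<and> card E \<le> N" using bsep_card_bound[OF \<epsilon>0_pos] by blast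
  have "tsum n y \<le> real N * exp (real n * B)" for y
  proof -
    have "tsum n y \<le> real (card {z. (g ^^ n) z = y \<and> True}) * exp (real n * B)"
      unfolding psum_def
    proof (rule sum_bounded_above)
      fix z show "exp (\<Phi> n z) \<le> exp (real n * B)" using Phi_bound[of n z] by simp
    qed
    also have "\<dots> \<le> real N * exp (real n * B)"
      by (rule mult_right_mono) (simp_all only: N[OF bsep_preimages] of_nat_le_iff exp_ge_zero)
    finally show ?thesis .
  qed
  then show ?thesis by (intro bdd_aboveI2)
qed

lemma tsum_le_tsup: "tsum n y \<le> tsup n"
  unfolding tsup_def by (rule cSUP_upper[OF UNIV_I tsum_bdd])

lemma tsup_le: "(\<And>y. tsum n y \<le> c) \<Longrightarrow> tsup n \<le> c"
  unfolding tsup_def by (rule cSUP_least) simp_all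

lemma tsum_ge: "tsum n y \<ge> exp (- real n * B)"
proof -
  obtain z where z: "(g ^^ n) z = y" using surj_iter by blast
  have "- real n * B \<le> \<Phi> n z" using Phi_bound[of n z] by simp
  then have "exp (- real n * B) \<le> exp (\<Phi> n z)" by (simp only: exp_le_cancel_iff)
  also have "\<dots> \<le> tsum n y" unfolding psum_def
    by (rule member_le_sum) (simp_all add: z)
  finally show ?thesis .
qed

lemma tsup_ge: "tsup n \<ge> exp (- real n * B)" by (rule order_trans[OF tsum_ge tsum_le_tsup])
lemma tsup_pos: "tsup n > 0" by (rule less_le_trans[OF exp_gt_zero tsup_ge])

text \<open>Preimages of \<open>y\<close> are grouped by the point \<open>w\<close> reached after
  \<open>m\<close> steps: \<open>Q\<close> tests the beginning of the segment, \<open>R\<close> its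
  end. Almost additivity then gives product estimates in both directions at the cost of a factor
  \<open>exp C0\<close>.\<close>

lemma psum_split:
  "psum (\<lambda>z. Q z \<and> R ((g ^^ m) z)) (m + n) y =
     (\<Sum>w | (g ^^ n) w = y \<and> R w. \<Sum>z | (g ^^ m) z = w \<and> Q z. exp (\<Phi> (m + n) z))"
proof -
  have pow: "(g ^^ (m + n)) z = (g ^^ n) ((g ^^ m) z)" for z
    using funpow_add[of n m g] by (simp add: add.commute[of m n])
  have "{z. (g ^^ (m + n)) z = y \<and> Q z \<and> R ((g ^^ m) z)} =
      (\<Union>w\<in>{w. (g ^^ n) w = y \<and> R w}. {z. (g ^^ m) z = w \<and> Q z})"
    by (rule set_eqI) (simp add: pow conj_ac)
  then have "psum (\<lambda>z. Q z \<and> R ((g ^^ m) z)) (m + n) y =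
      (\<Sum>z\<in>(\<Union>w\<in>{w. (g ^^ n) w = y \<and> R w}. {z. (g ^^ m) z = w \<and> Q z}). exp (\<Phi> (m + n) z))"
    unfolding psum_def by (simp only:)
  also have "\<dots> = (\<Sum>w | (g ^^ n) w = y \<and> R w. \<Sum>z | (g ^^ m) z = w \<and> Q z. exp (\<Phi> (m + n) z))"
  proof (rule sum.UNION_disjoint)
    show "\<forall>w\<in>{w. (g ^^ n) w = y \<and> R w}. \<forall>w'\<in>{w. (g ^^ n) w = y \<and> R w}. w \<noteq> w' \<longrightarrow>
        {z. (g ^^ m) z = w \<and> Q z} \<inter> {z. (g ^^ m) z = w' \<and> Q z} = {}" by auto
  qed simp_all
  finally show ?thesis .
qed

lemma psum_split_le:
  "psum (\<lambda>z. Q z \<and> R ((g ^^ m) z)) (m + n) y \<le>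
     exp C0 * (\<Sum>w | (g ^^ n) w = y \<and> R w. exp (\<Phi> n w) * psum Q m w)"
  unfolding psum_split[of Q R m n y] unfolding psum_def sum_distrib_left
proof (intro sum_mono)
  fix w z assume "z \<in> {z. (g ^^ m) z = w \<and> Q z}"
  then have "\<Phi> (m + n) z \<le> C0 + (\<Phi> n w + \<Phi> m z)" using Phi_add[of m n z] by auto
  then show "exp (\<Phi> (m + n) z) \<le> exp C0 * (exp (\<Phi> n w) * exp (\<Phi> m z))"
    by (metis exp_add exp_le_cancel_iff)
qed

lemma psum_split_ge:
  "psum (\<lambda>z. Q z \<and> R ((g ^^ m) z)) (m + n) y \<ge>
     exp (-C0) * (\<Sum>w | (g ^^ n) w = y \<and> R w. exp (\<Phi> n w) * psum Q m w)"
  unfolding psum_split[of Q R m n y] unfolding psum_def sum_distrib_left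
proof (intro sum_mono)
  fix w z assume "z \<in> {z. (g ^^ m) z = w \<and> Q z}"
  then have "\<Phi> (m + n) z \<ge> - C0 + (\<Phi> n w + \<Phi> m z)" using Phi_add[of m n z] by auto
  then show "exp (\<Phi> (m + n) z) \<ge> exp (-C0) * (exp (\<Phi> n w) * exp (\<Phi> m z))"
    by (metis exp_add exp_le_cancel_iff)
qed

lemma psum_split_le_bound:
  assumes "\<And>w. psum Q m w \<le> c"
  shows "psum (\<lambda>z. Q z \<and> R ((g ^^ m) z)) (m + n) y \<le> exp C0 * c * psum R n y"
proof -
  have "(\<Sum>w | (g ^^ n) w = y \<and> R w. exp (\<Phi> n w) * psum Q m w) \<le>
      (\<Sum>w | (g ^^ n) w = y \<and> R w. exp (\<Phi> n w) * c)"
    using assms by (intro sum_mono mult_left_mono) auto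
  also have "\<dots> = c * psum R n y" by (simp add: psum_def sum_distrib_left mult.commute)
  finally have "exp C0 * (\<Sum>w | (g ^^ n) w = y \<and> R w. exp (\<Phi> n w) * psum Q m w)
      \<le> exp C0 * (c * psum R n y)" by simp
  then show ?thesis using psum_split_le[of Q R m n y] unfolding mult.assoc by linarith
qed

lemma psum_split_ge_bound:
  assumes "\<And>w. psum Q m w \<ge> c"
  shows "psum (\<lambda>z. Q z \<and> R ((g ^^ m) z)) (m + n) y \<ge> exp (-C0) * c * psum R n y"
proof -
  have "c * psum R n y = (\<Sum>w | (g ^^ n) w = y \<and> R w. exp (\<Phi> n w) * c)"
    by (simp add: psum_def sum_distrib_left mult.commute)
  also have "\<dots> \<le> (\<Sum>w | (g ^^ n) w = y \<and> R w. exp (\<Phi> n w) * psum Q m w)"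
    using assms by (intro sum_mono mult_left_mono) auto
  finally have "exp (-C0) * (c * psum R n y)
     \<le> exp (-C0) * (\<Sum>w | (g ^^ n) w = y \<and> R w. exp (\<Phi> n w) * psum Q m w)" by simp
  then show ?thesis using psum_split_ge[where Q=Q and R=R and m=m and n=n and y=y]
    unfolding mult.assoc by linarith
qed

lemma tsup_submult: "tsup (m + n) \<le> exp C0 * tsup m * tsup n"
proof (rule tsup_le)
  fix y
  have "tsum (m + n) y \<le> exp C0 * tsup m * tsum n y"
    using psum_split_le_bound[of "\<lambda>_. True" m "tsup m" "\<lambda>_. True" n y] tsum_le_tsup by simp
  also have "\<dots> \<le> exp C0 * tsup m * tsup n"
    using tsum_le_tsup tsup_pos[of m] by (intro mult_left_mono) auto
  finally show "tsum (m + n) y \<le> exp C0 * tsup m * tsup n" .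
qed

text \<open>\<open>ln (tsup n) + C0\<close> is subadditive. The limit in Fekete's lemma is also a
  lower bound for the quotients, which yields the lower estimate for every \<open>n\<close> and not
  only asymptotically.\<close>

lemma growth_rate:
  obtains r where "(\<lambda>n. ln (tsup n) / real n) \<longlonglongrightarrow> r" "\<And>n. exp (-C0) * exp (real n * r) \<le> tsup n"
proof -
  define a where "a n = ln (tsup n) + C0" for n
  have "a (m + n) \<le> a m + a n" for m n
  proof -
    have "ln (tsup (m + n)) \<le> ln (exp C0 * tsup m * tsup n)"
      using tsup_submult tsup_pos by (subst ln_le_cancel_iff) auto
    also have "\<dots> = C0 + ln (tsup m) + ln (tsup n)" 
      using tsup_pos[of m] tsup_pos[of n] by (simp add: ln_mult_pos)
    finally show ?thesis by (simp add: a_def)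
  qed
  moreover have "- real n * B \<le> a n" for n
  proof -
    have "- real n * B \<le> ln (tsup n)" using tsup_ge[of n] tsup_pos[of n] by (metis exp_le_cancel_iff exp_ln)
    then show ?thesis using C0_nonneg by (simp add: a_def)
  qed
  ultimately obtain r where r: "(\<lambda>n. a n / real n) \<longlonglongrightarrow> r" "\<And>n. n \<ge> 1 \<Longrightarrow> real n * r \<le> a n"
    using fekete by blast
  have "(\<lambda>n. C0 / real n) \<longlonglongrightarrow> 0" by (rule lim_const_over_n)
  from tendsto_diff[OF r(1) this] have "(\<lambda>n. ln (tsup n) / real n) \<longlonglongrightarrow> r"
    by (simp add: a_def add_divide_distrib)
  moreover have "exp (-C0) * exp (real n * r) \<le> tsup n" for n
  proof (cases "n \<ge> 1")
    case True
    have "exp (real n * r - C0) \<le> exp (ln (tsup n))" using r(2)[OF True] by (simp add: a_def)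
    then show ?thesis using tsup_pos[of n] by (simp add: exp_diff exp_minus field_simps)
  next
    case False
    have "tsum 0 y = 1" for y
      by (simp add: psum_def)
    then have "tsup 0 \<ge> 1" using tsum_le_tsup[of 0] by metis
    moreover have "exp (-C0) \<le> 1" using C0_nonneg by simp
    ultimately have "exp (-C0) \<le> tsup 0" by linarith
    then show ?thesis using False by (simp add: not_le)
  qed
  ultimately show thesis using that by blast
qed

text \<open>A lower bound valid over all points can be inserted at every intermediate point, hence
  it multiplies, up to the splitting constant.\<close>

lemma tsum_ge_power:
  assumes "\<And>y. tsum n y \<ge> c" "c > 0"
  shows "tsum (k * n) y \<ge> (exp (-C0) * c) ^ k"
proof (induction k arbitrary: y)
  case 0
  then show ?case by (simp add: psum_def)
next
  case (Suc k)
  have "exp (-C0) * c * tsum (k * n) y \<le> tsum (n + k * n) y"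
    using psum_split_ge_bound[of c "\<lambda>_. True" n "\<lambda>_. True" "k * n" y] assms(1) by simp
  moreover have "exp (-C0) * c * (exp (-C0) * c) ^ k \<le> exp (-C0) * c * tsum (k * n) y"
    using Suc assms(2) by (intro mult_left_mono) auto
  ultimately have "exp (-C0) * c * (exp (-C0) * c) ^ k \<le> tsum (n + k * n) y"
    by (rule order_trans[rotated])
  then show ?case by simp
qed

end

section \<open>Gluing and uniform bounds for the sums\<close>

context expanding_system
begin

lemma exact_uniform:
  assumes "e > 0"
  obtains \<tau> where "\<tau> \<ge> 1" "\<And>N x y. N \<ge> \<tau> \<Longrightarrow> \<exists>z. dist z x < e \<and> (g ^^ N) z = y"
proof -
  obtain \<tau> where \<tau>: "\<And>N x. N \<ge> \<tau> \<Longrightarrow> (g ^^ N) ` ball x e = UNIV" using exact[OF assms] by blast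
  have "\<exists>z. dist z x < e \<and> (g ^^ N) z = y" if "N \<ge> Suc \<tau>" for N x y
  proof -
    have "y \<in> (g ^^ N) ` ball x e" using \<tau>[of N x] that by simp
    then show ?thesis by (auto simp: dist_commute)
  qed
  then show thesis using that[of "Suc \<tau>"] by simp
qed

lemma shadow_lt:
  assumes "d < e" "d \<ge> 0"
  shows "\<sigma> ^ k * d < e"
proof -
  have "\<sigma> ^ k * d \<le> d" using \<sigma>_pos \<sigma>_less assms(2) by (intro mult_left_le_one_le) (auto intro: power_le_one)
  then show ?thesis using assms(1) by simp
qed

end

section \<open>Gluing good segments, and upper bounds with constants\<close>

context potential
begin

lemma psum_le_sum:
  assumes "finite I" "\<And>z. (g ^^ n) z = y \<Longrightarrow> Q z \<Longrightarrow> \<exists>i\<in>I. R i z"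
  shows "psum Q n y \<le> (\<Sum>i\<in>I. psum (R i) n y)"
proof -
  have "psum Q n y \<le> (\<Sum>z | (g ^^ n) z = y \<and> Q z. \<Sum>i\<in>I. if R i z then exp (\<Phi> n z) else 0)"
    unfolding psum_def
  proof (rule sum_mono)
    fix z assume "z \<in> {z. (g ^^ n) z = y \<and> Q z}"
    then obtain i where i: "i \<in> I" "R i z" using assms(2) by blast
    have "exp (\<Phi> n z) = (if R i z then exp (\<Phi> n z) else 0)" using i by simp
    also have "\<dots> \<le> (\<Sum>i\<in>I. if R i z then exp (\<Phi> n z) else 0)"
      using assms(1) i by (intro member_le_sum[of i I]) auto
    finally show "exp (\<Phi> n z) \<le> (\<Sum>i\<in>I. if R i z then exp (\<Phi> n z) else 0)" .
  qed
  also have "\<dots> = (\<Sum>i\<in>I. \<Sum>z | (g ^^ n) z = y \<and> Q z. if R i z then exp (\<Phi> n z) else 0)"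
    by (rule sum.swap)
  also have "\<dots> \<le> (\<Sum>i\<in>I. psum (R i) n y)"
  proof (rule sum_mono)
    fix i
    have "(\<Sum>z | (g ^^ n) z = y \<and> Q z. if R i z then exp (\<Phi> n z) else 0) =
        (\<Sum>z \<in> {z \<in> {z. (g ^^ n) z = y \<and> Q z}. R i z}. exp (\<Phi> n z))"
      by (rule sum.inter_filter[symmetric]) simp
    also have "\<dots> \<le> psum (R i) n y"
      unfolding psum_def by (rule sum_mono2) auto
    finally show "(\<Sum>z | (g ^^ n) z = y \<and> Q z. if R i z then exp (\<Phi> n z) else 0) \<le> psum (R i) n y" .
  qed
  finally show ?thesis .
qed

text \<open>Each good \<open>z\<close> over \<open>w\<close> is replaced by the point shadowing it over a nearby \<open>w'\<close> from which \<open>y\<close> is reached in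
  \<open>N\<close> steps; this is injective since preimages of one point are \<open>\<epsilon>\<^sub>0\<close>-separated.\<close>

lemma glue:
  assumes "0 < \<epsilon>" "2 * \<epsilon> \<le> \<epsilon>\<^sub>0" "\<exists>w'. dist w' w < \<epsilon> \<and> (g ^^ N) w' = y"
  shows "psum (\<lambda>z. good n z \<and> Q z) n w \<le> exp (C1 + C0 + real N * B) *
    psum (\<lambda>z'. \<exists>z. Q z \<and> (\<forall>j\<le>n. dist ((g ^^ j) z') ((g ^^ j) z) \<le> \<sigma> ^ (n - j) * \<epsilon>)) (n + N) y"
    (is "_ \<le> exp ?K * psum ?R _ _")
proof -
  obtain w' where w': "dist w' w < \<epsilon>" "(g ^^ N) w' = y" using assms(3) by blast
  let ?S = "{z. (g ^^ n) z = w \<and> good n z \<and> Q z}"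
  have "\<forall>z\<in>?S. \<exists>z'. (g ^^ n) z' = w' \<and>
    (\<forall>j\<le>n. dist ((g ^^ j) z') ((g ^^ j) z) \<le> \<sigma> ^ (n - j) * dist w' w)"
  proof
    fix z assume "z \<in> ?S"
    then have z: "good n z" "(g ^^ n) z = w" by auto
    have d: "dist w' ((g ^^ n) z) < \<epsilon>\<^sub>0" using w'(1) z(2) assms(1,2) by simp
    show "\<exists>z'. (g ^^ n) z' = w' \<and>
        (\<forall>j\<le>n. dist ((g ^^ j) z') ((g ^^ j) z) \<le> \<sigma> ^ (n - j) * dist w' w)"
      using pullback[OF z(1) d] unfolding z(2) .
  qed
  from bchoice[OF this] obtain h where h0: "\<forall>z\<in>?S. (g ^^ n) (h z) = w' \<and>
    (\<forall>j\<le>n. dist ((g ^^ j) (h z)) ((g ^^ j) z) \<le> \<sigma> ^ (n - j) * dist w' w)" ..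
  have h: "(g ^^ n) (h z) = w'"
    "j \<le> n \<Longrightarrow> dist ((g ^^ j) (h z)) ((g ^^ j) z) \<le> \<sigma> ^ (n - j) * dist w' w" if "z \<in> ?S" for z j
    using bspec[OF h0 that] by simp_all
  have h2: "dist ((g ^^ j) (h z)) ((g ^^ j) z) \<le> \<sigma> ^ (n - j) * \<epsilon>" if "z \<in> ?S" "j \<le> n" for z j
    by (rule order_trans[OF h(2)[OF that] mult_left_mono]) (use w'(1) \<sigma>_pos in simp_all)
  have inj: "inj_on h ?S"
  proof (rule inj_onI)
    fix z1 z2 assume z: "z1 \<in> ?S" "z2 \<in> ?S" "h z1 = h z2"
    have "bclose n \<epsilon>\<^sub>0 z1 z2" unfolding bclose_def
    proof (intro allI impI)
      fix j assume j: "j < n"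
      have "dist ((g ^^ j) (h z)) ((g ^^ j) z) < \<epsilon>" if "z \<in> ?S" for z
        using h(2)[OF that, of j] j shadow_lt[OF w'(1), of "n - j"] by simp
      from this[OF z(1)] this[OF z(2)] z(3) assms(2)
      show "dist ((g ^^ j) z1) ((g ^^ j) z2) < \<epsilon>\<^sub>0"
        using dist_triangle3[of "(g ^^ j) z1" "(g ^^ j) z2" "(g ^^ j) (h z2)"] by simp
    qed
    moreover have "(g ^^ n) z1 = (g ^^ n) z2" using z by simp
    ultimately show "z1 = z2" by (rule preimages_bclose[rotated])
  qed
  \<comment> \<open>\<open>C1\<close> pays for replacing \<open>z\<close> by its shadow,
    \<open>C0\<close> for splitting off the connecting piece, and \<open>real N * B\<close> for the
    sum over that piece.\<close>
  have "psum (\<lambda>z. good n z \<and> Q z) n w \<le> (\<Sum>z\<in>?S. exp ?K * exp (\<Phi> (n + N) (h z)))"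
    unfolding psum_def
  proof (rule sum_mono)
    fix z assume z: "z \<in> ?S"
    have "\<bar>\<Phi> n (h z) - \<Phi> n z\<bar> \<le> C1"
    proof (rule Phi_shadow)
      fix j assume "j \<le> n"
      have "\<sigma> ^ (n - j) * \<epsilon> \<le> \<sigma> ^ (n - j) * \<epsilon>\<^sub>0" using assms \<sigma>_pos by (intro mult_left_mono) auto
      then show "dist ((g ^^ j) (h z)) ((g ^^ j) z) \<le> \<epsilon>\<^sub>0 * \<sigma> ^ (n - j)"
        using h2[OF z \<open>j \<le> n\<close>] by (simp add: mult.commute)
    qed
    moreover have "\<bar>\<Phi> N ((g ^^ n) (h z))\<bar> \<le> real N * B" by (rule Phi_bound)
    ultimately have "\<Phi> n z \<le> ?K + \<Phi> (n + N) (h z)" using Phi_add[of n N "h z"] by linarith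
    then show "exp (\<Phi> n z) \<le> exp ?K * exp (\<Phi> (n + N) (h z))" by (simp flip: exp_add)
  qed
  also have "\<dots> = exp ?K * (\<Sum>z\<in>h ` ?S. exp (\<Phi> (n + N) z))"
    by (subst sum.reindex[OF inj]) (simp add: sum_distrib_left)
  also have "\<dots> \<le> exp ?K * psum ?R (n + N) y"
    unfolding psum_def
  proof (intro mult_left_mono sum_mono2 image_subsetI)
    fix z assume z: "z \<in> ?S"
    have "(g ^^ (n + N)) (h z) = y"
      using h(1)[OF z] w'(2) by (subst add.commute) (simp add: funpow_add)
    moreover have "?R (h z)" using h2[OF z] z by blast
    ultimately show "h z \<in> {z. (g ^^ (n + N)) z = y \<and> ?R z}" by simp
  qed simp_all
  finally show ?thesis .
qed

text \<open>The two endpoints are unrelated: by gluing, the sum over good segments at any one point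
  is dominated by the full sum at every other, at the price of the connecting time \<tau>.\<close>

lemma good_le_tsum:
  obtains C \<tau> where "C > 0" "\<tau> \<ge> 1" "\<And>n w y. psum (good n) n w \<le> C * tsum (n + \<tau>) y"
proof -
  obtain \<tau> where \<tau>: "\<tau> \<ge> 1" "\<And>N x y. N \<ge> \<tau> \<Longrightarrow> \<exists>z. dist z x < \<epsilon>\<^sub>0 / 2 \<and> (g ^^ N) z = y"
    using exact_uniform[of "\<epsilon>\<^sub>0 / 2"] \<epsilon>0_pos by auto
  have "psum (good n) n w \<le> exp (C1 + C0 + real \<tau> * B) * tsum (n + \<tau>) y" for n w y
  proof -
    have "psum (good n) n w \<le> exp (C1 + C0 + real \<tau> * B) *
      psum (\<lambda>z'. \<exists>z. True \<and> (\<forall>j\<le>n. dist ((g ^^ j) z') ((g ^^ j) z) \<le> \<sigma> ^ (n - j) * (\<epsilon>\<^sub>0 / 2))) (n + \<tau>) y"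
      using glue[of "\<epsilon>\<^sub>0 / 2" w \<tau> y n "\<lambda>_. True"] \<tau>(2)[of \<tau> w y] \<epsilon>0_pos by simp
    also have "\<dots> \<le> exp (C1 + C0 + real \<tau> * B) * tsum (n + \<tau>) y"
      by (intro mult_left_mono psum_mono) auto
    finally show ?thesis .
  qed
  then show thesis using that[of "exp (C1 + C0 + real \<tau> * B)" \<tau>] \<tau>(1) by auto
qed

text \<open>A lower bound at every point is iterated by \<open>tsum_ge_power\<close> along the
  multiples of \<open>n\<close>; letting the number of blocks tend to infinity compares it with the
  growth rate.\<close>

lemma lower_bound_le_rate:
  assumes r: "(\<lambda>n. ln (tsup n) / real n) \<longlonglongrightarrow> r" and c: "\<And>y. tsum n y \<ge> c" "c > 0" and n: "n \<ge> 1"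
  shows "c \<le> exp C0 * exp (real n * r)"
proof -
  define q where "q = exp (-C0) * c"
  have q0: "q > 0" using c(2) by (simp add: q_def)
  have sm: "strict_mono (\<lambda>k. Suc k * n)" using n by (intro strict_monoI) auto
  have "(\<lambda>k. ln (tsup (Suc k * n)) / real (Suc k * n)) \<longlonglongrightarrow> r"
    using LIMSEQ_subseq_LIMSEQ[OF r sm] by (simp add: o_def)
  moreover have "ln q / real n \<le> ln (tsup (Suc k * n)) / real (Suc k * n)" for k
  proof -
    have "q ^ Suc k \<le> tsup (Suc k * n)"
      unfolding q_def by (rule order_trans[OF tsum_ge_power tsum_le_tsup[of _ undefined]]) (use c in auto)
    then have "ln (q ^ Suc k) \<le> ln (tsup (Suc k * n))"
      using q0 tsup_pos by (subst ln_le_cancel_iff) auto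
    then have "real (Suc k) * ln q \<le> ln (tsup (Suc k * n))" using q0 by (simp only: ln_realpow)
    then have "real (Suc k) * ln q / real (Suc k * n) \<le> ln (tsup (Suc k * n)) / real (Suc k * n)"
      by (rule divide_right_mono) simp
    moreover have "real (Suc k) * ln q / real (Suc k * n) = ln q / real n"
      by (simp only: of_nat_mult) (rule mult_divide_mult_cancel_left, simp)
    ultimately show ?thesis by linarith
  qed
  ultimately have "ln q / real n \<le> r" by (intro LIMSEQ_le_const) auto
  then have "ln q \<le> real n * r" using n by (simp add: field_simps)
  then have "exp (ln q) \<le> exp (real n * r)" by (simp only: exp_le_cancel_iff)
  then have "q \<le> exp (real n * r)" using q0 by simp
  then show ?thesis unfolding q_def by (simp add: exp_minus field_simps)
qed

text \<open>By \<open>good_le_tsum\<close>, a multiple of \<open>psum (good n) n w\<close> bounds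
  \<open>tsum (n + \<tau>)\<close> from below at every point, and such bounds cannot exceed the
  growth rate. In this way a statement about a limit becomes an estimate with a constant.\<close>

lemma good_upper:
  assumes r: "(\<lambda>n. ln (tsup n) / real n) \<longlonglongrightarrow> r"
  obtains C where "C > 0" "\<And>n w. psum (good n) n w \<le> C * exp (real n * r)"
proof -
  obtain C \<tau> where C: "C > 0" "\<tau> \<ge> 1" "\<And>n w y. psum (good n) n w \<le> C * tsum (n + \<tau>) y"
    using good_le_tsum by blast
  have "psum (good n) n w \<le> C * exp C0 * exp (real \<tau> * r) * exp (real n * r)" for n w
  proof (cases "psum (good n) n w = 0")
    case False
    then have pos: "psum (good n) n w > 0" using psum_nonneg[of "good n" n w] by linarith
    have "psum (good n) n w / C \<le> exp C0 * exp (real (n + \<tau>) * r)"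
    proof (rule lower_bound_le_rate[OF r])
      show "psum (good n) n w / C \<le> tsum (n + \<tau>) y" for y
        using C(3)[of n w y] C(1) by (simp only: pos_divide_le_eq mult.commute)
    qed (use C pos in auto)
    then show ?thesis using C(1) by (simp add: field_simps exp_add)
  qed (use C in auto)
  then show thesis using that[of "C * exp C0 * exp (real \<tau> * r)"] C(1) by auto
qed

text \<open>One \<open>z\<close> may have several admissible lengths \<open>l\<close>; these
  properties cover the preimages and are used for upper bounds.\<close>

definition suffix_at :: "nat \<Rightarrow> nat \<Rightarrow> 'a \<Rightarrow> bool" where
  "suffix_at n l z \<longleftrightarrow> good (n - l) z \<and> (l = 0 \<or> bad l ((g ^^ (n - l)) z))"

lemma ex_suffix_at: "\<exists>l\<in>{..n}. suffix_at n l z"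
  using decomposition[of n z] unfolding suffix_at_def by (metis atMost_iff)

text \<open>The good prefix contributes the rate \<open>r\<close> and the bad suffix the rate
  \<open>b\<close>, so the estimate is geometric in the length \<open>l\<close> of the suffix, and
  summable once \<open>b < r\<close>.\<close>

lemma suffix_bound:
  assumes r: "(\<lambda>n. ln (tsup n) / real n) \<longlonglongrightarrow> r"
    and bad: "\<And>l y. l \<ge> 1 \<Longrightarrow> psum (bad l) l y \<le> Cb * exp (real l * b)"
  obtains C where "C > 0" "\<And>n l y. l \<le> n \<Longrightarrow> psum (suffix_at n l) n y \<le> C * exp (real n * r) * exp (b - r) ^ l"
proof -
  obtain Cg where Cg: "Cg > 0" "\<And>n w. psum (good n) n w \<le> Cg * exp (real n * r)"
    using good_upper[OF r] by blast
  let ?C = "exp C0 * Cg * (\<bar>Cb\<bar> + 1)"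
  have "psum (suffix_at n l) n y \<le> ?C * exp (real n * r) * exp (b - r) ^ l" if l: "l \<le> n" for n l y
  proof -
    let ?R = "\<lambda>w. l = 0 \<or> bad l w"
    have "psum ?R l y \<le> (\<bar>Cb\<bar> + 1) * exp (real l * b)"
    proof (cases "l = 0")
      case True
      have "psum ?R 0 y = 1" using True by (simp add: psum_def)
      then show ?thesis using True by simp
    next
      case False
      have "Cb * exp (real l * b) \<le> (\<bar>Cb\<bar> + 1) * exp (real l * b)" by (intro mult_right_mono) auto
      moreover have "psum ?R l y = psum (bad l) l y" using False by simp
      moreover have "psum (bad l) l y \<le> Cb * exp (real l * b)" using bad[of l y] False by simp
      ultimately show ?thesis by linarith
    qed
    then have "exp C0 * (Cg * exp (real (n - l) * r)) * psum ?R l y \<le>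
        exp C0 * (Cg * exp (real (n - l) * r)) * ((\<bar>Cb\<bar> + 1) * exp (real l * b))"
      using Cg(1) by (intro mult_left_mono) auto
    moreover have "psum (suffix_at n l) n y \<le> exp C0 * (Cg * exp (real (n - l) * r)) * psum ?R l y"
    proof -
      have "(n - l) + l = n" using l by simp
      then have eq: "psum (suffix_at n l) n y = psum (\<lambda>z. good (n - l) z \<and> ?R ((g ^^ (n - l)) z)) ((n - l) + l) y"
        by (simp only: suffix_at_def[abs_def])
      show ?thesis unfolding eq by (rule psum_split_le_bound) (rule Cg(2))
    qed
    moreover have "exp (real (n - l) * r) * exp (real l * b) = exp (real n * r) * exp (b - r) ^ l"
      using l by (simp add: of_nat_diff algebra_simps flip: exp_add exp_of_nat_mult)
    ultimately show ?thesis by (simp add: mult_ac)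
  qed
  then show thesis using that[of ?C] Cg(1) by auto
qed

lemma tsup_upper:
  assumes r: "(\<lambda>n. ln (tsup n) / real n) \<longlonglongrightarrow> r"
    and bad: "\<And>l y. l \<ge> 1 \<Longrightarrow> psum (bad l) l y \<le> Cb * exp (real l * b)" and b: "b < r"
  obtains C where "C > 0" "\<And>n. tsup n \<le> C * exp (real n * r)"
proof -
  obtain C where C: "C > 0"
    "\<And>n l y. l \<le> n \<Longrightarrow> psum (suffix_at n l) n y \<le> C * exp (real n * r) * exp (b - r) ^ l"
    using suffix_bound[OF r bad] by metis
  have q: "exp (b - r) < 1" using b by simp
  have "tsup n \<le> C / (1 - exp (b - r)) * exp (real n * r)" for n
  proof (rule tsup_le)
    fix y
    have "tsum n y \<le> (\<Sum>l\<in>{..n}. psum (suffix_at n l) n y)"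
      by (rule psum_le_sum) (use ex_suffix_at in auto)
    also have "\<dots> \<le> (\<Sum>l\<in>{..n}. C * exp (real n * r) * exp (b - r) ^ l)"
      using C(2) by (intro sum_mono) auto
    also have "\<dots> = C * exp (real n * r) * (\<Sum>l\<in>{..n}. exp (b - r) ^ l)"
      by (simp add: sum_distrib_left)
    also have "\<dots> \<le> C * exp (real n * r) * (1 / (1 - exp (b - r)))"
    proof (rule mult_left_mono)
      have "(\<Sum>l\<in>{..n}. exp (b - r) ^ l) \<le> (\<Sum>l. exp (b - r) ^ l)"
        using q by (intro sum_le_suminf summable_geometric) auto
      then show "(\<Sum>l\<in>{..n}. exp (b - r) ^ l) \<le> 1 / (1 - exp (b - r))"
        using q by (simp add: suminf_geometric)
    qed (use C(1) in auto)
    finally show "tsum n y \<le> C / (1 - exp (b - r)) * exp (real n * r)" by simp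
  qed
  then show thesis using that[of "C / (1 - exp (b - r))"] C(1) q by auto
qed

lemma bad_psum_bound:
  assumes "\<And>l E. l \<ge> 1 \<Longrightarrow> bsep l \<epsilon>\<^sub>0 E \<Longrightarrow> (\<forall>x\<in>E. bad l x) \<Longrightarrow> (\<Sum>x\<in>E. exp (\<Phi> l x)) \<le> c l" "l \<ge> 1"
  shows "psum (bad l) l y \<le> c l"
  unfolding psum_def using assms(2) bsep_preimages by (intro assms(1)) auto

text \<open>Each point of \<open>E\<close> is coded by a triple: the length \<open>l\<close> of its
  bad suffix, a point \<open>w\<close> from a maximal separated set of bad segments close to that
  suffix, and the preimage \<open>z\<close> of \<open>w\<close> that shadows the good prefix. The
  code is injective on \<open>E\<close>. Summing over codes gives a separated-set sum for
  \<open>w\<close>, a transfer-operator sum for \<open>z\<close> and a geometric series in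
  \<open>l\<close>.\<close>

lemma bsep_sum_bound:
  assumes C: "\<And>n. tsup n \<le> C * exp (real n * r)" and b: "b < r"
    and bad: "\<And>\<delta>. \<delta> > 0 \<Longrightarrow> \<exists>Cb. \<forall>l\<ge>1. \<forall>E. bsep l \<delta> E \<longrightarrow> (\<forall>x\<in>E. bad l x) \<longrightarrow>
      (\<Sum>x\<in>E. exp (\<Phi> l x)) \<le> Cb * exp (real l * b)"
    and \<delta>: "\<delta> > 0"
  obtains K where "\<And>n E. bsep n \<delta> E \<Longrightarrow> (\<Sum>x\<in>E. exp (\<Phi> n x)) \<le> K * exp (real n * r)"
proof -
  \<comment> \<open>Half of the gap: the linear distortion on a suffix of length \<open>l\<close>
    costs \<open>exp (l * \<eta>)\<close>, and the series over \<open>l\<close> still converges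
    because \<open>\<eta> + b < r\<close>.\<close>
  define \<eta> where "\<eta> = (r - b) / 2"
  have \<eta>: "\<eta> > 0" "\<eta> + b < r" using b by (auto simp: \<eta>_def field_simps)
  obtain \<delta>1 C3 where \<delta>1: "\<delta>1 > 0"
    "\<And>n x z. bclose n \<delta>1 z x \<Longrightarrow> \<bar>\<Phi> n z - \<Phi> n x\<bar> \<le> C3 + real n * \<eta>"
    using Phi_unif[OF \<eta>(1)] by blast
  define \<delta>' where "\<delta>' = min \<delta>1 (min (\<delta> / 2) \<epsilon>\<^sub>0)"
  have \<delta>': "\<delta>' > 0" "\<delta>' \<le> \<delta>1" "2 * \<delta>' \<le> \<delta>" "\<delta>' \<le> \<epsilon>\<^sub>0" using \<delta>1(1) \<delta> \<epsilon>0_pos by (auto simp: \<delta>'_def)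
  have \<delta>'1: "bclose n \<delta>' z x \<Longrightarrow> \<bar>\<Phi> n z - \<Phi> n x\<bar> \<le> C3 + real n * \<eta>" for n x z
    using \<delta>1(2) bclose_mono \<delta>'(2) by blast
  obtain Cb where Cb: "\<And>l E. l \<ge> 1 \<Longrightarrow> bsep l \<delta>' E \<Longrightarrow> (\<forall>x\<in>E. bad l x) \<Longrightarrow>
      (\<Sum>x\<in>E. exp (\<Phi> l x)) \<le> Cb * exp (real l * b)"
    using bad[OF \<delta>'(1)] by blast
  obtain NN :: "'a set" where NN: "finite NN" "\<And>x. \<exists>c\<in>NN. dist x c < \<delta>'" using finite_net[OF \<delta>'(1)] by blast
  have "\<exists>F. finite F \<and> F \<subseteq> {x. bad l x} \<and> bsep l \<delta>' F \<and> (\<forall>x. bad l x \<longrightarrow> (\<exists>w\<in>F. bclose l \<delta>' x w))" for l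
    using maximal_bsep[OF \<delta>'(1), of "{x. bad l x}" l] by (metis mem_Collect_eq)
  then obtain F0 where F0: "\<And>l. finite (F0 l)" "\<And>l. F0 l \<subseteq> {x. bad l x}" "\<And>l. bsep l \<delta>' (F0 l)"
    "\<And>l x. bad l x \<Longrightarrow> \<exists>w\<in>F0 l. bclose l \<delta>' x w" by metis
  \<comment> \<open>Closeness over an empty suffix says nothing, so for \<open>l = 0\<close> the
    endpoint of the prefix is approximated by a finite net instead.\<close>
  define F where "F l = (if l = 0 then NN else F0 l)" for l :: nat
  have finF: "finite (F l)" for l using NN F0 by (auto simp: F_def)
  define K1 where "K1 = exp (C0 + C1 + \<bar>C3\<bar>)"
  define C' where "C' = \<bar>C\<bar>"
  define Cb' where "Cb' = \<bar>Cb\<bar> + real (card NN)"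
  have Fsum: "(\<Sum>w\<in>F l. exp (\<Phi> l w)) \<le> Cb' * exp (real l * b)" for l
  proof (cases "l = 0")
    case False
    then have "(\<Sum>w\<in>F l. exp (\<Phi> l w)) \<le> Cb * exp (real l * b)"
      using Cb[of l "F0 l"] F0(2,3)[of l] by (auto simp: F_def)
    also have "\<dots> \<le> Cb' * exp (real l * b)" by (intro mult_right_mono) (auto simp: Cb'_def)
    finally show ?thesis .
  qed (auto simp: F_def Cb'_def)
  have tsum': "tsum n y \<le> C' * exp (real n * r)" for n y
  proof -
    have "C * exp (real n * r) \<le> C' * exp (real n * r)" by (intro mult_right_mono) (auto simp: C'_def)
    then show ?thesis using tsum_le_tsup[of n y] C[of n] by linarith
  qed
  have "(\<Sum>x\<in>E. exp (\<Phi> n x)) \<le> K1 * Cb' * C' / (1 - exp (\<eta> + b - r)) * exp (real n * r)"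
    if E: "bsep n \<delta> E" for n E
  proof -
    let ?I = "SIGMA l:{..n}. SIGMA w:F l. {z. (g ^^ (n - l)) z = w}"
    let ?h = "\<lambda>(l, w, z). K1 * exp (real l * \<eta>) * (exp (\<Phi> l w) * exp (\<Phi> (n - l) z))"
    have finE: "finite E" using bsep_card_bound[OF \<delta>, of n] E by metis
    define P where "P x l w z \<longleftrightarrow> l \<le> n \<and> w \<in> F l \<and> (g ^^ (n - l)) z = w \<and>
        (\<forall>j<n - l. dist ((g ^^ j) x) ((g ^^ j) z) < \<delta>') \<and> bclose l \<delta>' ((g ^^ (n - l)) x) w \<and>
        exp (\<Phi> n x) \<le> ?h (l, w, z)" for x l w z
    have ex: "\<exists>l w z. P x l w z" for x
    proof -
      obtain l where l: "l \<le> n" "good (n - l) x" "l = 0 \<or> bad l ((g ^^ (n - l)) x)"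
        using decomposition by blast
      have "\<exists>w\<in>F l. bclose l \<delta>' ((g ^^ (n - l)) x) w \<and> dist ((g ^^ (n - l)) x) w < \<delta>'"
      proof (cases "l = 0")
        case True
        then show ?thesis using NN(2)[of "(g ^^ (n - l)) x"] by (auto simp: F_def bclose_def)
      next
        case False
        then obtain w where w: "w \<in> F0 l" "bclose l \<delta>' ((g ^^ (n - l)) x) w" using l(3) F0(4) by blast
        moreover have "dist ((g ^^ 0) ((g ^^ (n - l)) x)) ((g ^^ 0) w) < \<delta>'"
          using w(2) False unfolding bclose_def by blast
        ultimately show ?thesis using False by (auto simp: F_def)
      qed
      then obtain w where w: "w \<in> F l" "bclose l \<delta>' ((g ^^ (n - l)) x) w" "dist w ((g ^^ (n - l)) x) < \<delta>'"
        by (auto simp: dist_commute)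
      have "dist w ((g ^^ (n - l)) x) < \<epsilon>\<^sub>0" using w(3) \<delta>'(4) by linarith
      from pullback[OF l(2) this] obtain z where z0: "(g ^^ (n - l)) z = w \<and>
        (\<forall>j\<le>n - l. dist ((g ^^ j) z) ((g ^^ j) x) \<le> \<sigma> ^ (n - l - j) * dist w ((g ^^ (n - l)) x))" ..
      have z: "(g ^^ (n - l)) z = w"
        "\<And>j. j \<le> n - l \<Longrightarrow> dist ((g ^^ j) z) ((g ^^ j) x) \<le> \<sigma> ^ (n - l - j) * dist w ((g ^^ (n - l)) x)"
        using z0 by simp_all
      have zx: "dist ((g ^^ j) x) ((g ^^ j) z) < \<delta>'" if "j < n - l" for j
        using z(2)[of j] that shadow_lt[OF w(3), of "n - l - j"] by (simp add: dist_commute)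
      have "\<bar>\<Phi> (n - l) z - \<Phi> (n - l) x\<bar> \<le> C1"
      proof (rule Phi_shadow)
        fix j assume j: "j \<le> n - l"
        have "\<sigma> ^ (n - l - j) * dist w ((g ^^ (n - l)) x) \<le> \<sigma> ^ (n - l - j) * \<epsilon>\<^sub>0"
          using w(3) \<delta>'(4) \<sigma>_pos by (intro mult_left_mono) auto
        then show "dist ((g ^^ j) z) ((g ^^ j) x) \<le> \<epsilon>\<^sub>0 * \<sigma> ^ (n - l - j)"
          using z(2)[OF j] by (simp add: mult.commute)
      qed
      moreover have "\<bar>\<Phi> l ((g ^^ (n - l)) x) - \<Phi> l w\<bar> \<le> C3 + real l * \<eta>" by (rule \<delta>'1[OF w(2)])
      moreover have "\<bar>\<Phi> n x - \<Phi> (n - l) x - \<Phi> l ((g ^^ (n - l)) x)\<bar> \<le> C0"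
        using Phi_add[of "n - l" l x] l(1) by simp
      ultimately have "\<Phi> n x \<le> (C0 + C1 + \<bar>C3\<bar>) + real l * \<eta> + (\<Phi> l w + \<Phi> (n - l) z)" by linarith
      then have "exp (\<Phi> n x) \<le> exp ((C0 + C1 + \<bar>C3\<bar>) + real l * \<eta> + (\<Phi> l w + \<Phi> (n - l) z))"
        by (simp only: exp_le_cancel_iff)
      also have "\<dots> = ?h (l, w, z)" by (simp add: K1_def exp_add)
      finally have "P x l w z" unfolding P_def using l(1) w(1,2) z(1) zx by blast
      then show ?thesis by blast
    qed
    then obtain fl fw fz where P: "\<And>x. P x (fl x) (fw x) (fz x)" by metis
    have f: "\<And>x. fl x \<le> n" "\<And>x. fw x \<in> F (fl x)" "\<And>x. (g ^^ (n - fl x)) (fz x) = fw x"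
      "\<And>x j. j < n - fl x \<Longrightarrow> dist ((g ^^ j) x) ((g ^^ j) (fz x)) < \<delta>'"
      "\<And>x. bclose (fl x) \<delta>' ((g ^^ (n - fl x)) x) (fw x)"
      "\<And>x. exp (\<Phi> n x) \<le> ?h (fl x, fw x, fz x)"
      using P unfolding P_def by blast+
    let ?f = "\<lambda>x. (fl x, fw x, fz x)"
    \<comment> \<open>Two points with the same code are within \<open>2 * \<delta>'\<close> of each
      other: over the prefix through the common \<open>z\<close>, over the suffix through the common
      \<open>w\<close>.\<close>
    have inj: "inj_on ?f E"
    proof (rule inj_onI, rule ccontr)
      fix x y assume xy: "x \<in> E" "y \<in> E" "?f x = ?f y" "x \<noteq> y"
      have "bclose n \<delta> x y" unfolding bclose_def
      proof (intro allI impI)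
        fix j assume j: "j < n"
        show "dist ((g ^^ j) x) ((g ^^ j) y) < \<delta>"
        proof (cases "j < n - fl x")
          case True
          then show ?thesis using f(4)[of j x] f(4)[of j y] xy(3) \<delta>'(3)
              dist_triangle2[of "(g ^^ j) x" "(g ^^ j) y" "(g ^^ j) (fz x)"] by simp
        next
          case False
          define i where "i = j - (n - fl x)"
          have i: "i < fl x" "j = i + (n - fl x)" using False j f(1)[of x] by (auto simp: i_def)
          have "dist ((g ^^ j) x) ((g ^^ i) (fw x)) < \<delta>'"
            using f(5)[of x] i unfolding bclose_def by (simp add: funpow_add)
          moreover have "dist ((g ^^ j) y) ((g ^^ i) (fw x)) < \<delta>'"
            using f(5)[of y] i xy(3) unfolding bclose_def by (simp add: funpow_add)
          ultimately show ?thesis using \<delta>'(3)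
            dist_triangle2[of "(g ^^ j) x" "(g ^^ j) y" "(g ^^ i) (fw x)"] by simp
        qed
      qed
      then show False using E xy by (auto simp: bsep_def)
    qed
    have fin: "finite ?I" using finF by (intro finite_SigmaI) auto
    have h0: "?h i \<ge> 0" for i by (cases i) (auto simp: K1_def)
    have "(\<Sum>x\<in>E. exp (\<Phi> n x)) \<le> (\<Sum>x\<in>E. ?h (?f x))" using f(6) by (rule sum_mono)
    also have "\<dots> = sum ?h (?f ` E)" by (subst sum.reindex[OF inj]) simp
    also have "\<dots> \<le> sum ?h ?I"
    proof (rule sum_mono2[OF fin])
      show "?f ` E \<subseteq> ?I" using f(1,2,3) by blast
    qed (use h0 in blast)
    also have "\<dots> = (\<Sum>l\<in>{..n}. \<Sum>w\<in>F l. \<Sum>z | (g ^^ (n - l)) z = w. ?h (l, w, z))"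
    proof -
      have "sum ?h ?I = (\<Sum>l\<in>{..n}. \<Sum>p\<in>(SIGMA w:F l. {z. (g ^^ (n - l)) z = w}). ?h (l, p))"
        using finF by (subst sum.Sigma) (auto intro!: finite_SigmaI sum.cong)
      also have "\<dots> = (\<Sum>l\<in>{..n}. \<Sum>w\<in>F l. \<Sum>z | (g ^^ (n - l)) z = w. ?h (l, w, z))"
        using finF by (intro sum.cong refl) (subst sum.Sigma, auto intro!: sum.cong)
      finally show ?thesis .
    qed
    also have "\<dots> \<le> (\<Sum>l\<in>{..n}. K1 * Cb' * C' * exp (real n * r) * exp (\<eta> + b - r) ^ l)"
    proof (rule sum_mono)
      fix l assume l: "l \<in> {..n}"
      have "(\<Sum>w\<in>F l. \<Sum>z | (g ^^ (n - l)) z = w. ?h (l, w, z)) =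
          K1 * exp (real l * \<eta>) * (\<Sum>w\<in>F l. exp (\<Phi> l w) * tsum (n - l) w)"
        by (simp add: psum_def sum_distrib_left mult.assoc)
      also have "\<dots> \<le> K1 * exp (real l * \<eta>) * (\<Sum>w\<in>F l. exp (\<Phi> l w) * (C' * exp (real (n - l) * r)))"
        using tsum' by (intro mult_left_mono sum_mono) (auto simp: K1_def)
      also have "\<dots> = K1 * exp (real l * \<eta>) * (C' * exp (real (n - l) * r)) * (\<Sum>w\<in>F l. exp (\<Phi> l w))"
        by (simp add: sum_distrib_left sum_distrib_right mult_ac)
      also have "\<dots> \<le> K1 * exp (real l * \<eta>) * (C' * exp (real (n - l) * r)) * (Cb' * exp (real l * b))"
        using Fsum by (intro mult_left_mono) (auto simp: K1_def C'_def)
      also have "\<dots> = K1 * Cb' * C' * (exp (real l * \<eta>) * exp (real (n - l) * r) * exp (real l * b))"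
        by (simp add: mult_ac)
      also have "exp (real l * \<eta>) * exp (real (n - l) * r) * exp (real l * b)
          = exp (real n * r) * exp (\<eta> + b - r) ^ l"
        using l by (simp add: of_nat_diff algebra_simps flip: exp_add exp_of_nat_mult)
      finally show "(\<Sum>w\<in>F l. \<Sum>z | (g ^^ (n - l)) z = w. ?h (l, w, z)) \<le>
          K1 * Cb' * C' * exp (real n * r) * exp (\<eta> + b - r) ^ l" by (simp add: mult_ac)
    qed
    also have "\<dots> = K1 * Cb' * C' * exp (real n * r) * (\<Sum>l\<in>{..n}. exp (\<eta> + b - r) ^ l)"
      by (simp add: sum_distrib_left)
    also have "\<dots> \<le> K1 * Cb' * C' * exp (real n * r) * (1 / (1 - exp (\<eta> + b - r)))"
    proof (rule mult_left_mono)
      have "(\<Sum>l\<in>{..n}. exp (\<eta> + b - r) ^ l) \<le> (\<Sum>l. exp (\<eta> + b - r) ^ l)"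
        using \<eta> by (intro sum_le_suminf summable_geometric) auto
      then show "(\<Sum>l\<in>{..n}. exp (\<eta> + b - r) ^ l) \<le> 1 / (1 - exp (\<eta> + b - r))"
        using \<eta> by (simp add: suminf_geometric)
    qed (auto simp: K1_def Cb'_def C'_def)
    finally show ?thesis by simp
  qed
  then show thesis using that by blast
qed

end

section \<open>Concentration of Birkhoff averages\<close>

definition bsum :: "('a \<Rightarrow> 'a) \<Rightarrow> ('a \<Rightarrow> real) \<Rightarrow> nat \<Rightarrow> 'a \<Rightarrow> real" where
  "bsum g \<psi> n z = (\<Sum>i<n. \<psi> ((g ^^ i) z))"

lemma bsum_add: "bsum g \<psi> (m + n) z = bsum g \<psi> m z + bsum g \<psi> n ((g ^^ m) z)"
proof (induction n)
  case (Suc n)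
  have "(g ^^ (m + n)) z = (g ^^ n) ((g ^^ m) z)" by (subst add.commute) (simp add: funpow_add)
  then show ?case using Suc by (simp add: bsum_def)
qed (simp add: bsum_def)

lemma bsum_bounds:
  assumes "\<And>x. 0 \<le> \<psi> x" "\<And>x. \<psi> x \<le> 1"
  shows "0 \<le> bsum g \<psi> n z" "bsum g \<psi> n z \<le> real n"
proof -
  show "0 \<le> bsum g \<psi> n z" unfolding bsum_def using assms(1) by (intro sum_nonneg)
  have "bsum g \<psi> n z \<le> (\<Sum>i<n. 1)" unfolding bsum_def using assms(2) by (intro sum_mono)
  then show "bsum g \<psi> n z \<le> real n" by simp
qed

context potential
begin

text \<open>The full preimage sum for the perturbed potential
  \<open>\<Phi> n + t * bsum g \<psi> n\<close>; as a function of \<open>t\<close> it is the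
  exponential moment of \<open>bsum\<close> with respect to the weights
  \<open>exp (\<Phi> n z)\<close>.\<close>

definition msum :: "('a \<Rightarrow> real) \<Rightarrow> real \<Rightarrow> nat \<Rightarrow> 'a \<Rightarrow> real" where
  "msum \<psi> t n y = (\<Sum>z | (g ^^ n) z = y. exp (\<Phi> n z + t * bsum g \<psi> n z))"

definition concentrated :: "('a \<Rightarrow> real) \<Rightarrow> real \<Rightarrow> real \<Rightarrow> nat \<Rightarrow> 'a \<Rightarrow> bool" where
  "concentrated \<psi> D \<eta> n z \<longleftrightarrow> \<bar>bsum g \<psi> n z - real n * D\<bar> \<le> \<eta> * real n"

lemma markov_psum:
  assumes "t \<ge> 0"
  shows "psum (\<lambda>z. bsum g \<psi> n z > u) n y \<le> exp (- t * u) * msum \<psi> t n y"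
proof -
  have "psum (\<lambda>z. bsum g \<psi> n z > u) n y \<le>
      (\<Sum>z | (g ^^ n) z = y \<and> bsum g \<psi> n z > u. exp (- t * u) * exp (\<Phi> n z + t * bsum g \<psi> n z))"
    unfolding psum_def
  proof (rule sum_mono)
    fix z assume "z \<in> {z. (g ^^ n) z = y \<and> u < bsum g \<psi> n z}"
    then have "t * u \<le> t * bsum g \<psi> n z" using assms by (intro mult_left_mono) auto
    then show "exp (\<Phi> n z) \<le> exp (- t * u) * exp (\<Phi> n z + t * bsum g \<psi> n z)" by (simp flip: exp_add)
  qed
  also have "\<dots> \<le> (\<Sum>z | (g ^^ n) z = y. exp (- t * u) * exp (\<Phi> n z + t * bsum g \<psi> n z))"
    by (rule sum_mono2) auto
  also have "\<dots> = exp (- t * u) * msum \<psi> t n y" by (simp add: msum_def sum_distrib_left)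
  finally show ?thesis .
qed

text \<open>The exponential moment at \<open>t\<close> of order \<open>1 / n\<close> bounds below-average values of \<open>bsum\<close> away from carrying all of the sum,
  Markov's inequality at a fixed \<open>t\<close> excludes above-average ones.\<close>

lemma concentration_somewhere:
  assumes \<psi>: "\<And>x. 0 \<le> \<psi> x" "\<And>x. \<psi> x \<le> 1"
    and C: "\<And>n. tsup n \<le> C * exp (real n * r)" and c0: "c0 > 0" "c0 \<le> C"
    and D: "D \<ge> 0"
    and t0: "t0 > 0" and lower: "\<And>t n. 0 < t \<Longrightarrow> t \<le> t0 \<Longrightarrow> \<exists>y. msum \<psi> t n y \<ge> c0 * exp (real n * (r + t * D))"
    and upper: "\<And>\<eta>. \<eta> > 0 \<Longrightarrow> \<exists>t>0. \<exists>C1. \<forall>n y. msum \<psi> t n y \<le> C1 * exp (real n * (r + t * D + t * \<eta>))"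
    and \<eta>: "\<eta> > 0"
  shows "\<exists>n0. \<forall>n\<ge>n0. \<exists>y. psum (concentrated \<psi> D \<eta> n) n y \<ge> c0\<^sup>2 / (8 * C) * exp (real n * r)"
proof -
  \<comment> \<open>\<open>R\<close> makes \<open>exp (- R * \<eta>)\<close> equal to
    \<open>c0 / (4 * C)\<close>. With \<open>t = R / n\<close>, points whose average of \<psi> is
    below \<open>D - \<eta>\<close> then account for at most a quarter of the lower bound for the
    moment.\<close>
  define R where "R = ln (4 * C / c0) / \<eta>"
  have C0: "C > 0" using c0 by linarith
  have R1: "4 * C / c0 > 1" using c0 by (simp add: field_simps)
  have R: "R > 0" using R1 \<eta> by (simp add: R_def)
  have expR: "exp (- R * \<eta>) = c0 / (4 * C)"
  proof -
    have "R * \<eta> = ln (4 * C / c0)" using \<eta> by (simp add: R_def)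
    then have "exp (- R * \<eta>) = inverse (4 * C / c0)" using R1 by (simp add: exp_minus)
    then show ?thesis by (simp add: field_simps)
  qed
  \<comment> \<open>The constant in \<open>upper\<close> depends on \<open>t\<close>, so the upper
    tail is treated with one fixed \<open>t1\<close>: it decays exponentially in \<open>n\<close>
    relative to \<open>exp (n * r)\<close>, and this absorbs the factor \<open>exp R\<close> by
    which the moment at \<open>t = R / n\<close> can weight it.\<close>
  obtain t1 C1 where t1: "t1 > 0" "\<And>n y. msum \<psi> t1 n y \<le> C1 * exp (real n * (r + t1 * D + t1 * (\<eta> / 2)))"
    using upper[of "\<eta> / 2"] \<eta> by (metis half_gt_zero)
  have "(\<lambda>n. exp R * \<bar>C1\<bar> * exp (- (t1 * \<eta> / 2)) ^ n) \<longlonglongrightarrow> exp R * \<bar>C1\<bar> * 0"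
    using t1(1) \<eta> by (intro tendsto_mult_left LIMSEQ_power_zero) auto
  then have "\<forall>\<^sub>F n in sequentially. exp R * \<bar>C1\<bar> * exp (- (t1 * \<eta> / 2)) ^ n < c0 / 4"
    using c0 by (intro order_tendstoD(2)) auto
  then obtain n1 where n1: "\<And>n. n \<ge> n1 \<Longrightarrow> exp R * \<bar>C1\<bar> * exp (- (t1 * \<eta> / 2)) ^ n < c0 / 4"
    unfolding eventually_sequentially by blast
  obtain n2 where n2: "real n2 > R / t0" using reals_Archimedean2 by blast
  have "\<exists>y. psum (concentrated \<psi> D \<eta> n) n y \<ge> c0\<^sup>2 / (8 * C) * exp (real n * r)"
    if n: "n \<ge> max n1 (max n2 1)" for n
  proof -
    define t where "t = R / real n"
    have n0: "real n > 0" "n \<ge> n1" using n by auto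
    have "R / t0 < real n" using n n2 by linarith
    then have t: "0 < t" "t \<le> t0" using R n0 t0 by (auto simp: t_def field_simps)
    have tn: "t * real n = R" using n0 by (simp add: t_def)
    obtain y where y: "msum \<psi> t n y \<ge> c0 * exp (real n * (r + t * D))" using lower[OF t] by blast
    have e1: "exp (real n * (r + t * D)) = exp (real n * r) * exp (R * D)"
    proof -
      have "real n * (r + t * D) = real n * r + (t * real n) * D" by (simp add: algebra_simps)
      then show ?thesis by (simp add: tn exp_add)
    qed
    let ?X = "exp (real n * r)"
    let ?A = "\<lambda>z. bsum g \<psi> n z < real n * (D - \<eta>)"
    let ?B = "\<lambda>z. bsum g \<psi> n z > real n * (D + \<eta>)"
    have pt: "exp (\<Phi> n z + t * bsum g \<psi> n z) \<le>
        exp (R * (D - \<eta>)) * exp (\<Phi> n z) +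
        (if ?B z then exp R * exp (\<Phi> n z) else 0) +
        (if concentrated \<psi> D \<eta> n z then exp (R * (D + \<eta>)) * exp (\<Phi> n z) else 0)" for z
    proof -
      have s: "t * bsum g \<psi> n z \<le> R * u" if "bsum g \<psi> n z \<le> real n * u" for u
      proof -
        have "t * bsum g \<psi> n z \<le> t * (real n * u)" using that t by (intro mult_left_mono) auto
        then show ?thesis by (simp add: tn flip: mult.assoc)
      qed
      have nn: "0 \<le> exp (R * (D - \<eta>)) * exp (\<Phi> n z)" "0 \<le> (if ?B z then exp R * exp (\<Phi> n z) else 0)"
        "0 \<le> (if concentrated \<psi> D \<eta> n z then exp (R * (D + \<eta>)) * exp (\<Phi> n z) else 0)" by simp_all
      consider (a) "?A z" | (b) "?B z" | (c) "concentrated \<psi> D \<eta> n z"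
        unfolding concentrated_def abs_le_iff by (force simp: algebra_simps)
      then show ?thesis
      proof cases
        case a
        then have "exp (\<Phi> n z + t * bsum g \<psi> n z) \<le> exp (R * (D - \<eta>)) * exp (\<Phi> n z)"
          using s[of "D - \<eta>"] by (simp flip: exp_add)
        then show ?thesis using nn by linarith
      next
        case b
        have "exp (\<Phi> n z + t * bsum g \<psi> n z) \<le> exp R * exp (\<Phi> n z)"
          using s[of 1] bsum_bounds(2)[of \<psi> g n z] \<psi> by (simp flip: exp_add)
        then have "exp (\<Phi> n z + t * bsum g \<psi> n z) \<le> (if ?B z then exp R * exp (\<Phi> n z) else 0)"
          using b by simp
        then show ?thesis using nn by linarith
      next
        case c
        then have "bsum g \<psi> n z \<le> real n * (D + \<eta>)"
          unfolding concentrated_def abs_le_iff by (simp add: algebra_simps)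
        then have "exp (\<Phi> n z + t * bsum g \<psi> n z) \<le> exp (R * (D + \<eta>)) * exp (\<Phi> n z)"
          using s[of "D + \<eta>"] by (simp flip: exp_add)
        then have "exp (\<Phi> n z + t * bsum g \<psi> n z) \<le>
          (if concentrated \<psi> D \<eta> n z then exp (R * (D + \<eta>)) * exp (\<Phi> n z) else 0)"
          using c by simp
        then show ?thesis using nn by linarith
      qed
    qed
    have ind: "(\<Sum>z | (g ^^ n) z = y. if Q z then a * exp (\<Phi> n z) else 0) = a * psum Q n y" for Q a
    proof -
      have "(\<Sum>z | (g ^^ n) z = y. if Q z then a * exp (\<Phi> n z) else 0) =
         (\<Sum>z \<in> {z \<in> {z. (g ^^ n) z = y}. Q z}. a * exp (\<Phi> n z))"
        by (rule sum.inter_filter[symmetric]) simp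
      also have "{z \<in> {z. (g ^^ n) z = y}. Q z} = {z. (g ^^ n) z = y \<and> Q z}" by simp
      finally show ?thesis by (simp add: psum_def sum_distrib_left)
    qed
    have "msum \<psi> t n y \<le> (\<Sum>z | (g ^^ n) z = y. exp (R * (D - \<eta>)) * exp (\<Phi> n z) +
        (if ?B z then exp R * exp (\<Phi> n z) else 0) +
        (if concentrated \<psi> D \<eta> n z then exp (R * (D + \<eta>)) * exp (\<Phi> n z) else 0))"
      unfolding msum_def by (rule sum_mono) (rule pt)
    also have "\<dots> = exp (R * (D - \<eta>)) * tsum n y + exp R * psum ?B n y +
        exp (R * (D + \<eta>)) * psum (concentrated \<psi> D \<eta> n) n y"
      unfolding sum.distrib ind by (simp add: psum_def sum_distrib_left)
    finally have main: "c0 * (?X * exp (R * D)) \<le> exp (R * (D - \<eta>)) * tsum n y + exp R * psum ?B n y +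
        exp (R * (D + \<eta>)) * psum (concentrated \<psi> D \<eta> n) n y"
      using y e1 by simp
    have b1: "exp (R * (D - \<eta>)) * tsum n y \<le> c0 / 4 * (?X * exp (R * D))"
    proof -
      have "exp (R * (D - \<eta>)) * tsum n y \<le> exp (R * (D - \<eta>)) * (C * ?X)"
        using tsum_le_tsup[of n y] C[of n] by (intro mult_left_mono) auto
      also have "\<dots> = exp (R * D) * exp (- R * \<eta>) * (C * ?X)"
        by (simp add: algebra_simps flip: exp_add)
      also have "\<dots> = exp (R * D) * (c0 / (4 * C)) * (C * ?X)" unfolding expR ..
      also have "\<dots> = c0 / 4 * (?X * exp (R * D))" using C0 by simp
      finally show ?thesis .
    qed
    have b2: "exp R * psum ?B n y \<le> c0 / 4 * (?X * exp (R * D))"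
    proof -
      have "psum ?B n y \<le> exp (- t1 * (real n * (D + \<eta>))) * msum \<psi> t1 n y"
        using t1(1) by (intro markov_psum) auto
      also have "\<dots> \<le> exp (- t1 * (real n * (D + \<eta>))) * (\<bar>C1\<bar> * exp (real n * (r + t1 * D + t1 * (\<eta> / 2))))"
      proof (rule mult_left_mono)
        have "C1 * exp (real n * (r + t1 * D + t1 * (\<eta> / 2))) \<le> \<bar>C1\<bar> * exp (real n * (r + t1 * D + t1 * (\<eta> / 2)))"
          by (intro mult_right_mono) auto
        then show "msum \<psi> t1 n y \<le> \<bar>C1\<bar> * exp (real n * (r + t1 * D + t1 * (\<eta> / 2)))"
          using t1(2)[of n y] by linarith
      qed simp
      also have "\<dots> = \<bar>C1\<bar> * exp (- t1 * (real n * (D + \<eta>)) + real n * (r + t1 * D + t1 * (\<eta> / 2)))"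
        by (simp only: exp_add mult_ac)
      also have "- t1 * (real n * (D + \<eta>)) + real n * (r + t1 * D + t1 * (\<eta> / 2)) =
          real n * r + real n * (- (t1 * \<eta> / 2))" by (simp add: algebra_simps)
      also have "\<bar>C1\<bar> * exp (real n * r + real n * (- (t1 * \<eta> / 2))) = \<bar>C1\<bar> * exp (- (t1 * \<eta> / 2)) ^ n * ?X"
        by (simp only: exp_add exp_of_nat_mult mult_ac)
      finally have "exp R * psum ?B n y \<le> exp R * (\<bar>C1\<bar> * exp (- (t1 * \<eta> / 2)) ^ n * ?X)"
        by (intro mult_left_mono) auto
      also have "\<dots> = (exp R * \<bar>C1\<bar> * exp (- (t1 * \<eta> / 2)) ^ n) * ?X" by (simp only: mult_ac)
      also have "\<dots> \<le> c0 / 4 * ?X" using n1[OF n0(2)] by (intro mult_right_mono) auto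
      also have "\<dots> \<le> c0 / 4 * (?X * exp (R * D))"
        using c0 R D by (intro mult_left_mono) auto
      finally show ?thesis .
    qed
    \<comment> \<open>Half of the moment remains for the concentrated points, whose extra weight is
      at most \<open>exp (R * (D + \<eta>))\<close>; dividing by it leaves \<open>c0 / 2\<close>
      times \<open>c0 / (4 * C)\<close>.\<close>
    have "c0 / 2 * (?X * exp (R * D)) \<le> exp (R * (D + \<eta>)) * psum (concentrated \<psi> D \<eta> n) n y"
      using main b1 b2 by linarith
    then have m1: "exp (- R * \<eta>) * exp (- R * D) * (c0 / 2 * (?X * exp (R * D))) \<le>
        exp (- R * \<eta>) * exp (- R * D) * (exp (R * (D + \<eta>)) * psum (concentrated \<psi> D \<eta> n) n y)"
      by (intro mult_left_mono) auto
    have m2: "exp (- R * \<eta>) * exp (- R * D) * (exp (R * (D + \<eta>)) * p) = p" for p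
    proof -
      have "exp (- R * \<eta>) * exp (- R * D) * exp (R * (D + \<eta>)) = 1"
        by (simp add: algebra_simps flip: exp_add)
      then show ?thesis by (metis mult.assoc mult_1)
    qed
    have m3: "exp (- R * \<eta>) * exp (- R * D) * (c0 / 2 * (?X * exp (R * D))) = c0\<^sup>2 / (8 * C) * ?X"
    proof -
      have "exp (- R * D) * exp (R * D) = 1" by (simp flip: exp_add)
      moreover have "exp (- R * \<eta>) * exp (- R * D) * (c0 / 2 * (?X * exp (R * D))) =
          exp (- R * \<eta>) * (c0 / 2 * ?X) * (exp (- R * D) * exp (R * D))" by (simp only: mult_ac)
      ultimately have "exp (- R * \<eta>) * exp (- R * D) * (c0 / 2 * (?X * exp (R * D))) = c0 / (4 * C) * (c0 / 2 * ?X)"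
        unfolding expR by simp
      then show ?thesis by (simp add: power2_eq_square)
    qed
    show ?thesis using m1 unfolding m2 m3 by blast
  qed
  then show ?thesis by blast
qed

text \<open>A long bad suffix carries a small proportion of the sum. Cutting off a suffix of bounded length leaves good
  segments, which can be glued to end at any point.\<close>

lemma concentration_everywhere:
  assumes r: "(\<lambda>n. ln (tsup n) / real n) \<longlonglongrightarrow> r"
    and bad: "\<And>l y. l \<ge> 1 \<Longrightarrow> psum (bad l) l y \<le> Cb * exp (real l * b)" and b: "b < r"
    and \<psi>: "\<And>x. 0 \<le> \<psi> x" "\<And>x. \<psi> x \<le> 1" "\<And>x y. \<bar>\<psi> x - \<psi> y\<bar> \<le> L * dist x y"
    and D: "D \<ge> 0" "D \<le> 1" and c1: "c1 > 0"
    and some: "\<And>\<eta>. \<eta> > 0 \<Longrightarrow> \<exists>n0. \<forall>n\<ge>n0. \<exists>y. psum (concentrated \<psi> D \<eta> n) n y \<ge> c1 * exp (real n * r)"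
  obtains c where "c > 0"
    "\<And>\<eta>. \<eta> > 0 \<Longrightarrow> \<exists>n0. \<forall>n\<ge>n0. \<forall>y. psum (concentrated \<psi> D \<eta> n) n y \<ge> c * exp (real n * r)"
proof -
  obtain Cs where Cs: "Cs > 0"
    "\<And>n l y. l \<le> n \<Longrightarrow> psum (suffix_at n l) n y \<le> Cs * exp (real n * r) * exp (b - r) ^ l"
    using suffix_bound[OF r bad] by metis
  define q where "q = exp (b - r)"
  have q: "q < 1" "q > 0" using b by (auto simp: q_def)
  \<comment> \<open>By the geometric bound, bad suffixes of length at least \<open>l0\<close> carry
    less than half of the concentrated sum.\<close>
  obtain l0 where l0: "Cs / (1 - q) * q ^ l0 < c1 / 2"
  proof -
    have "(\<lambda>n. Cs / (1 - q) * q ^ n) \<longlonglongrightarrow> Cs / (1 - q) * 0"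
      using q by (intro tendsto_mult_left LIMSEQ_power_zero) auto
    then have "\<forall>\<^sub>F n in sequentially. Cs / (1 - q) * q ^ n < c1 / 2"
      using c1 by (intro order_tendstoD(2)) auto
    then show thesis using that unfolding eventually_sequentially by blast
  qed
  obtain \<tau> where \<tau>: "\<tau> \<ge> 1" "\<And>N x y. N \<ge> \<tau> \<Longrightarrow> \<exists>z. dist z x < \<epsilon>\<^sub>0 / 2 \<and> (g ^^ N) z = y"
    using exact_uniform[of "\<epsilon>\<^sub>0 / 2"] \<epsilon>0_pos by (metis half_gt_zero)
  define T where "T = (\<Sum>l<l0. tsup l) + 1"
  have T: "T > 0" "\<And>l. l < l0 \<Longrightarrow> tsup l \<le> T"
  proof -
    have nn: "\<And>l. tsup l \<ge> 0" using tsup_pos less_imp_le by blast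
    then show "T > 0" unfolding T_def by (simp add: add_nonneg_pos sum_nonneg)
    show "tsup l \<le> T" if "l < l0" for l
      using member_le_sum[of l "{..<l0}" tsup] that nn unfolding T_def by simp
  qed
  define c2 where "c2 = c1 / (2 * (real l0 + 1)) / (exp C0 * T)"
  have c2: "c2 > 0" using c1 T(1) by (simp add: c2_def)
  define K0 where "K0 = C1 + C0 + real (l0 + \<tau>) * B"
  define c where "c = exp (- K0) * c2 * exp (- real \<tau> * r)"
  have c: "c > 0" using c2 by (simp add: c_def)
  define LC where "LC = \<bar>L\<bar> * \<epsilon>\<^sub>0 / (1 - \<sigma>)"
  have LC: "LC \<ge> 0" using \<sigma>_less \<epsilon>0_pos by (simp add: LC_def)
  \<comment> \<open>The errors of the Birkhoff sum that do not grow with \<open>n\<close>: shadowing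
    (\<open>LC\<close>), the discarded suffix, the added piece of length \<open>l + \<tau>\<close>,
    and the shift of the centre from \<open>n * D\<close> to \<open>m * D\<close>.\<close>
  define K where "K = LC + 2 * real l0 + 2 * real \<tau>"
  have "\<exists>n0. \<forall>n\<ge>n0. \<forall>y. psum (concentrated \<psi> D \<eta> n) n y \<ge> c * exp (real n * r)" if \<eta>: "\<eta> > 0" for \<eta>
  proof -
    obtain n0 where n0: "\<And>n. n \<ge> n0 \<Longrightarrow> \<exists>y. psum (concentrated \<psi> D (\<eta> / 2) n) n y \<ge> c1 * exp (real n * r)"
      using some[of "\<eta> / 2"] \<eta> by (metis half_gt_zero)
    obtain n1 where n1: "real n1 > 2 * K / \<eta>" using reals_Archimedean2 by blast
    have "psum (concentrated \<psi> D \<eta> m) m y' \<ge> c * exp (real m * r)"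
      if m: "m \<ge> max n0 (max n1 l0) + \<tau>" for m y'
    proof -
      define n where "n = m - \<tau>"
      have n: "m = n + \<tau>" "n \<ge> n0" "n \<ge> n1" "n \<ge> l0" using m by (auto simp: n_def)
      let ?X = "exp (real n * r)"
      obtain y where y: "psum (concentrated \<psi> D (\<eta> / 2) n) n y \<ge> c1 * ?X" using n0[OF n(2)] by blast
      let ?Q = "\<lambda>l z. concentrated \<psi> D (\<eta> / 2) n z \<and> suffix_at n l z"
      have "psum (concentrated \<psi> D (\<eta> / 2) n) n y \<le> (\<Sum>l\<in>{..n}. psum (?Q l) n y)"
        by (rule psum_le_sum) (use ex_suffix_at in auto)
      also have "\<dots> = (\<Sum>l\<in>{..<l0}. psum (?Q l) n y) + (\<Sum>l\<in>{l0..n}. psum (?Q l) n y)"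
        using n(4) by (subst sum.union_disjoint[symmetric]) (auto intro!: sum.cong)
      also have "(\<Sum>l\<in>{l0..n}. psum (?Q l) n y) \<le> (c1 / 2) * ?X"
      proof -
        have "(\<Sum>l\<in>{l0..n}. psum (?Q l) n y) \<le> (\<Sum>l\<in>{l0..n}. Cs * ?X * q ^ l)"
        proof (rule sum_mono)
          fix l assume "l \<in> {l0..n}"
          then show "psum (?Q l) n y \<le> Cs * ?X * q ^ l"
            using order_trans[OF psum_mono[of n y "?Q l" "suffix_at n l"] Cs(2)[of l n y]]
            by (simp add: q_def)
        qed
        also have "\<dots> = Cs * ?X * (\<Sum>l\<in>{l0..n}. q ^ l)" by (simp add: sum_distrib_left)
        also have "\<dots> \<le> Cs * ?X * (q ^ l0 / (1 - q))"
        proof (rule mult_left_mono)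
          have "(\<Sum>l\<in>{l0..n}. q ^ l) = q ^ l0 * (1 - q ^ (Suc n - l0)) / (1 - q)"
            using q n(4) by (simp add: sum_gp field_simps flip: power_add)
          also have "\<dots> \<le> q ^ l0 / (1 - q)"
            using q by (intro divide_right_mono mult_left_le) auto
          finally show "(\<Sum>l\<in>{l0..n}. q ^ l) \<le> q ^ l0 / (1 - q)" .
        qed (use Cs(1) in auto)
        also have "\<dots> = (Cs / (1 - q) * q ^ l0) * ?X" by simp
        also have "\<dots> \<le> (c1 / 2) * ?X" using l0 by (intro mult_right_mono) auto
        finally show ?thesis .
      qed
      finally have sum_ge: "(c1 / 2) * ?X \<le> (\<Sum>l\<in>{..<l0}. psum (?Q l) n y)" using y by simp
      \<comment> \<open>Pigeonhole over the \<open>l0\<close> short suffix lengths; the extra 1 in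
        the denominator makes the contradiction strict.\<close>
      have "\<exists>l<l0. psum (?Q l) n y \<ge> c1 / (2 * (real l0 + 1)) * ?X"
      proof (rule ccontr)
        assume no: "\<not> ?thesis"
        have "(\<Sum>l\<in>{..<l0}. psum (?Q l) n y) \<le> (\<Sum>l\<in>{..<l0}. c1 / (2 * (real l0 + 1)) * ?X)"
          using no by (intro sum_mono) (auto simp: not_le less_imp_le)
        also have "\<dots> = real l0 / (real l0 + 1) * ((c1 / 2) * ?X)" by (simp add: field_simps)
        also have "\<dots> < 1 * ((c1 / 2) * ?X)" using c1 by (intro mult_strict_right_mono) auto
        finally show False using sum_ge by simp
      qed
      then obtain l where l: "l < l0" "psum (?Q l) n y \<ge> c1 / (2 * (real l0 + 1)) * ?X" by blast
      have ln: "(n - l) + l = n" using l(1) n(4) by simp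
      let ?M = "\<lambda>z. \<bar>bsum g \<psi> (n - l) z - real n * D\<bar> \<le> \<eta> / 2 * real n + real l0"
      have "psum (?Q l) n y \<le> psum (\<lambda>z. (good (n - l) z \<and> ?M z) \<and> True) n y"
      proof (rule psum_mono)
        fix z assume z: "?Q l z"
        have "bsum g \<psi> n z = bsum g \<psi> (n - l) z + bsum g \<psi> l ((g ^^ (n - l)) z)"
          using bsum_add[of g \<psi> "n - l" l z] ln by simp
        moreover have "0 \<le> bsum g \<psi> l ((g ^^ (n - l)) z)" "bsum g \<psi> l ((g ^^ (n - l)) z) \<le> real l0"
          using bsum_bounds[of \<psi> g l "(g ^^ (n - l)) z"] \<psi> l(1) by auto
        moreover have "\<bar>bsum g \<psi> n z - real n * D\<bar> \<le> \<eta> / 2 * real n"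
          using z unfolding concentrated_def by blast
        ultimately have "?M z" by linarith
        then show "(good (n - l) z \<and> ?M z) \<and> True"
          using z unfolding suffix_at_def by blast
      qed
      then have ge: "c1 / (2 * (real l0 + 1)) * ?X \<le> psum (\<lambda>z. (good (n - l) z \<and> ?M z) \<and> True) ((n - l) + l) y"
        using l(2) unfolding ln by linarith
      \<comment> \<open>Cutting off the suffix turns the sum at \<open>y\<close> into a weighted sum
        over the intermediate points \<open>w\<close>, so some \<open>w\<close> carries a fixed
        proportion. From there gluing moves the endpoint to an arbitrary \<open>y'\<close>.\<close>
      have "\<exists>w. psum (\<lambda>z. good (n - l) z \<and> ?M z) (n - l) w \<ge> c2 * ?X"
      proof (rule ccontr)
        assume "\<not> ?thesis"
        then have lt: "\<And>w. psum (\<lambda>z. good (n - l) z \<and> ?M z) (n - l) w < c2 * ?X" by (simp add: not_le)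
        obtain w where w: "(g ^^ l) w = y" using surj_iter by blast
        have "psum (\<lambda>z. (good (n - l) z \<and> ?M z) \<and> True) ((n - l) + l) y \<le>
            exp C0 * (\<Sum>w | (g ^^ l) w = y \<and> True. exp (\<Phi> l w) * psum (\<lambda>z. good (n - l) z \<and> ?M z) (n - l) w)"
          by (rule psum_split_le)
        also have "\<dots> < exp C0 * (\<Sum>w | (g ^^ l) w = y \<and> True. exp (\<Phi> l w) * (c2 * ?X))"
          using lt w by (intro mult_strict_left_mono sum_strict_mono) auto
        also have "\<dots> = exp C0 * (c2 * ?X) * tsum l y" by (simp add: psum_def sum_distrib_left mult_ac)
        also have "\<dots> \<le> exp C0 * (c2 * ?X) * T"
          using order_trans[OF tsum_le_tsup T(2)[OF l(1)]] c2 by (intro mult_left_mono) auto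
        also have "\<dots> = c1 / (2 * (real l0 + 1)) * ?X" using T(1) by (simp add: c2_def)
        finally show False using ge by linarith
      qed
      then obtain w where w: "psum (\<lambda>z. good (n - l) z \<and> ?M z) (n - l) w \<ge> c2 * ?X" by blast
      let ?K = "C1 + C0 + real (l + \<tau>) * B"
      let ?R = "\<lambda>z'. \<exists>z. ?M z \<and> (\<forall>j\<le>n - l. dist ((g ^^ j) z') ((g ^^ j) z) \<le> \<sigma> ^ (n - l - j) * (\<epsilon>\<^sub>0 / 2))"
      have "c2 * ?X \<le> exp ?K * psum ?R ((n - l) + (l + \<tau>)) y'"
        using w glue[of "\<epsilon>\<^sub>0 / 2" w "l + \<tau>" y' "n - l" ?M] \<tau>(2)[of "l + \<tau>" w y'] \<epsilon>0_pos by simp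
      also have "(n - l) + (l + \<tau>) = m" using ln n(1) by simp
      also have "exp ?K * psum ?R m y' \<le> exp K0 * psum ?R m y'"
        using l(1) B_nonneg by (intro mult_right_mono) (auto simp: K0_def intro!: mult_right_mono)
      also have "\<dots> \<le> exp K0 * psum (concentrated \<psi> D \<eta> m) m y'"
      proof (intro mult_left_mono psum_mono)
        fix z' assume "?R z'"
        then obtain z where z: "?M z"
          "\<And>j. j \<le> n - l \<Longrightarrow> dist ((g ^^ j) z') ((g ^^ j) z) \<le> \<sigma> ^ (n - l - j) * (\<epsilon>\<^sub>0 / 2)" by blast
        have "\<bar>bsum g \<psi> (n - l) z' - bsum g \<psi> (n - l) z\<bar> \<le> LC"
        proof -
          have "\<bar>bsum g \<psi> (n - l) z' - bsum g \<psi> (n - l) z\<bar> \<le>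
              (\<Sum>i<n - l. \<bar>\<psi> ((g ^^ i) z') - \<psi> ((g ^^ i) z)\<bar>)"
            unfolding bsum_def sum_subtractf[symmetric] by (rule sum_abs)
          also have "\<dots> \<le> (\<Sum>i<n - l. \<bar>L\<bar> * \<epsilon>\<^sub>0 * \<sigma> ^ (n - l - Suc i))"
          proof (rule sum_mono)
            fix i assume i: "i \<in> {..<n - l}"
            have "\<bar>\<psi> ((g ^^ i) z') - \<psi> ((g ^^ i) z)\<bar> \<le> L * dist ((g ^^ i) z') ((g ^^ i) z)" by (rule \<psi>(3))
            also have "\<dots> \<le> \<bar>L\<bar> * dist ((g ^^ i) z') ((g ^^ i) z)" by (intro mult_right_mono) auto
            also have "\<dots> \<le> \<bar>L\<bar> * (\<sigma> ^ (n - l - i) * (\<epsilon>\<^sub>0 / 2))" using i z(2)[of i] by (intro mult_left_mono) auto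
            also have "\<dots> \<le> \<bar>L\<bar> * (\<sigma> ^ (n - l - Suc i) * \<epsilon>\<^sub>0)"
              using \<sigma>_pos \<sigma>_less \<epsilon>0_pos by (intro mult_left_mono mult_mono power_decreasing) auto
            finally show "\<bar>\<psi> ((g ^^ i) z') - \<psi> ((g ^^ i) z)\<bar> \<le> \<bar>L\<bar> * \<epsilon>\<^sub>0 * \<sigma> ^ (n - l - Suc i)"
              by (simp add: mult_ac)
          qed
          also have "\<dots> = \<bar>L\<bar> * \<epsilon>\<^sub>0 * (\<Sum>i<n - l. \<sigma> ^ (n - l - Suc i))" by (simp add: sum_distrib_left)
          also have "(\<Sum>i<n - l. \<sigma> ^ (n - l - Suc i)) = (\<Sum>i<n - l. \<sigma> ^ i)"
            by (rule sum.nat_diff_reindex)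
          also have "\<bar>L\<bar> * \<epsilon>\<^sub>0 * (\<Sum>i<n - l. \<sigma> ^ i) \<le> \<bar>L\<bar> * \<epsilon>\<^sub>0 * (1 / (1 - \<sigma>))"
          proof (rule mult_left_mono)
            have "(\<Sum>i<n - l. \<sigma> ^ i) \<le> (\<Sum>i. \<sigma> ^ i)"
              using \<sigma>_pos \<sigma>_less by (intro sum_le_suminf summable_geometric) auto
            then show "(\<Sum>i<n - l. \<sigma> ^ i) \<le> 1 / (1 - \<sigma>)"
              using \<sigma>_pos \<sigma>_less by (simp add: suminf_geometric)
          qed (use \<epsilon>0_pos in auto)
          finally show ?thesis by (simp add: LC_def)
        qed
        moreover have "bsum g \<psi> m z' = bsum g \<psi> (n - l) z' + bsum g \<psi> (l + \<tau>) ((g ^^ (n - l)) z')"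
          using bsum_add[of g \<psi> "n - l" "l + \<tau>" z'] ln n(1) by simp
        moreover have "0 \<le> bsum g \<psi> (l + \<tau>) ((g ^^ (n - l)) z')"
          "bsum g \<psi> (l + \<tau>) ((g ^^ (n - l)) z') \<le> real l0 + real \<tau>"
          using bsum_bounds[of \<psi> g "l + \<tau>" "(g ^^ (n - l)) z'"] \<psi> l(1) by auto
        moreover have "real m * D = real n * D + real \<tau> * D" by (simp add: n(1) algebra_simps)
        moreover have "0 \<le> real \<tau> * D" "real \<tau> * D \<le> real \<tau>" using D by (auto intro: mult_left_le)
        ultimately have "\<bar>bsum g \<psi> m z' - real m * D\<bar> \<le> \<eta> / 2 * real n + K"
          using z(1) unfolding K_def by linarith
        also have "K \<le> \<eta> / 2 * real n"
        proof -
          have "2 * K / \<eta> \<le> real n" using n1 n(3) by linarith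
          then show ?thesis using \<eta> by (simp add: field_simps)
        qed
        also have "\<eta> / 2 * real n + \<eta> / 2 * real n \<le> \<eta> * real m" using \<eta> n(1) by simp
        finally show "concentrated \<psi> D \<eta> m z'" by (simp add: concentrated_def)
      qed simp
      finally have "exp (- K0) * (c2 * ?X) \<le> exp (- K0) * (exp K0 * psum (concentrated \<psi> D \<eta> m) m y')"
        by (intro mult_left_mono) auto
      moreover have "exp (- K0) * (exp K0 * p) = p" for p by (simp flip: mult.assoc exp_add)
      moreover have "c * exp (real m * r) = exp (- K0) * (c2 * ?X)"
      proof -
        have "exp (- real \<tau> * r) * exp (real m * r) = ?X"
          by (simp add: n(1) algebra_simps flip: exp_add)
        then show ?thesis unfolding c_def by (simp add: mult_ac)
      qed
      ultimately show ?thesis by simp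
    qed
    then show ?thesis by blast
  qed
  then show thesis using that c by blast
qed

text \<open>Consider the preimages whose averages are near \<open>D1\<close> over the first \<open>i\<close> of \<open>k + 1\<close> blocks of equal length and near \<open>D2\<close>
  over the rest. For different \<open>i\<close> the total averages differ, so these sets are disjoint, and each carries a fixed proportion
  of the sum.\<close>

lemma no_two_concentrations:
  assumes C: "\<And>n. tsup n \<le> C * exp (real n * r)" and c: "c1 > 0" "c2 > 0"
    and D: "D2 < D1"
    and c1: "\<And>\<eta>. \<eta> > 0 \<Longrightarrow> \<exists>n0. \<forall>n\<ge>n0. \<forall>y. psum (concentrated \<psi> D1 \<eta> n) n y \<ge> c1 * exp (real n * r)"
    and c2: "\<And>\<eta>. \<eta> > 0 \<Longrightarrow> \<exists>n0. \<forall>n\<ge>n0. \<forall>y. psum (concentrated \<psi> D2 \<eta> n) n y \<ge> c2 * exp (real n * r)"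
  shows False
proof -
  define c where "c = exp (- C0) * c1 * c2"
  have c0: "c > 0" using c by (simp add: c_def)
  \<comment> \<open>More than \<open>C / c\<close> disjoint families, each of weight at least
    \<open>c\<close> times the exponential, exceed the total allowed by \<open>C\<close>.\<close>
  obtain k :: nat where k: "real k > C / c" using reals_Archimedean2 by blast
  \<comment> \<open>Passing from \<open>i\<close> to \<open>i + 1\<close> shifts the total by
    \<open>m * (D1 - D2)\<close>; with this \<eta> the errors of two sums over all
    \<open>Suc k\<close> blocks add up to half of that.\<close>
  define \<eta> where "\<eta> = (D1 - D2) / (4 * real (Suc k))"
  have \<eta>: "\<eta> > 0" using D by (simp add: \<eta>_def)
  obtain n1 n2 where n1: "\<And>n y. n \<ge> n1 \<Longrightarrow> psum (concentrated \<psi> D1 \<eta> n) n y \<ge> c1 * exp (real n * r)"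
    and n2: "\<And>n y. n \<ge> n2 \<Longrightarrow> psum (concentrated \<psi> D2 \<eta> n) n y \<ge> c2 * exp (real n * r)"
    using c1[OF \<eta>] c2[OF \<eta>] by blast
  define m where "m = max n1 n2 + 1"
  define N where "N = Suc k * m"
  have m: "m \<ge> 1" by (simp add: m_def)
  define A where "A i z \<longleftrightarrow> concentrated \<psi> D1 \<eta> (i * m) z \<and> concentrated \<psi> D2 \<eta> ((Suc k - i) * m) ((g ^^ (i * m)) z)" for i z
  have split: "i * m + (Suc k - i) * m = N" if "i \<in> {1..k}" for i
  proof -
    have "i + (Suc k - i) = Suc k" using that by simp
    then show ?thesis unfolding N_def add_mult_distrib[symmetric] by (simp only:)
  qed
  have mult_ge: "u \<le> i * m" if "u \<le> m" "i \<ge> 1" for u i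
    using order_trans[OF that(1) mult_le_mono1[OF that(2), of m, unfolded nat_mult_1]] .
  have lower: "c * exp (real N * r) \<le> psum (A i) N y" if i: "i \<in> {1..k}" for i y
  proof -
    have i1: "i * m \<ge> n1"
      using i by (intro mult_ge) (auto simp: m_def)
    have i2: "(Suc k - i) * m \<ge> n2"
      using i by (intro mult_ge) (auto simp: m_def)
    have s1: "exp (- C0) * (c1 * exp (real (i * m) * r)) * psum (concentrated \<psi> D2 \<eta> ((Suc k - i) * m)) ((Suc k - i) * m) y
        \<le> psum (A i) (i * m + (Suc k - i) * m) y"
      unfolding A_def[abs_def] by (rule psum_split_ge_bound) (rule n1[OF i1])
    have s2: "exp (- C0) * (c1 * exp (real (i * m) * r)) * (c2 * exp (real ((Suc k - i) * m) * r)) \<le>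
        exp (- C0) * (c1 * exp (real (i * m) * r)) * psum (concentrated \<psi> D2 \<eta> ((Suc k - i) * m)) ((Suc k - i) * m) y"
      using n2[OF i2, of y] c by (intro mult_left_mono) auto
    have s3: "exp (real (i * m) * r) * exp (real ((Suc k - i) * m) * r) = exp (real N * r)"
      unfolding split[OF i, symmetric] by (simp only: of_nat_add distrib_right exp_add)
    have s4: "exp (- C0) * (c1 * exp (real (i * m) * r)) * (c2 * exp (real ((Suc k - i) * m) * r)) =
        c * (exp (real (i * m) * r) * exp (real ((Suc k - i) * m) * r))"
      unfolding c_def by (simp only: mult_ac)
    show ?thesis using order_trans[OF s2 s1] unfolding s4 s3 split[OF i] .
  qed
  have disj: "\<not> (A i z \<and> A j z)" if ij: "i \<in> {1..k}" "j \<in> {1..k}" "i < j" for i j z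
  proof
    assume A: "A i z \<and> A j z"
    have e: "bsum g \<psi> N z = bsum g \<psi> (i * m) z + bsum g \<psi> ((Suc k - i) * m) ((g ^^ (i * m)) z)"
      if "i \<in> {1..k}" for i
      using bsum_add[of g \<psi> "i * m" "(Suc k - i) * m" z] split[OF that] by simp
    have re: "real (i * m) + real ((Suc k - i) * m) = real N" if "i \<in> {1..k}" for i
      using split[OF that] by (metis of_nat_add)
    have "\<bar>bsum g \<psi> N z - (real (i * m) * D1 + real ((Suc k - i) * m) * D2)\<bar> \<le> \<eta> * real N"
      if "i \<in> {1..k}" "A i z" for i
    proof -
      have "\<eta> * real (i * m) + \<eta> * real ((Suc k - i) * m) = \<eta> * real N"
        unfolding re[OF that(1), symmetric] by (simp only: distrib_left)
      then show ?thesis using that(2) e[OF that(1)] unfolding A_def concentrated_def by linarith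
    qed
    from this[OF ij(1)] this[OF ij(2)] A
    have "(real (j * m) * D1 + real ((Suc k - j) * m) * D2) - (real (i * m) * D1 + real ((Suc k - i) * m) * D2)
        \<le> 2 * (\<eta> * real N)" by linarith
    moreover have "(real (j * m) * D1 + real ((Suc k - j) * m) * D2) - (real (i * m) * D1 + real ((Suc k - i) * m) * D2)
        = (real j - real i) * (real m * (D1 - D2))"
    proof -
      have "real ((Suc k - i) * m) = real N - real (i * m)" "real ((Suc k - j) * m) = real N - real (j * m)"
        using re[OF ij(1)] re[OF ij(2)] by linarith+
      then show ?thesis by (simp only: of_nat_mult) (simp add: algebra_simps)
    qed
    moreover have "1 * (real m * (D1 - D2)) \<le> (real j - real i) * (real m * (D1 - D2))"
      using ij(3) D by (intro mult_right_mono) auto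
    moreover have "2 * (\<eta> * real N) = real m * (D1 - D2) / 2"
      unfolding \<eta>_def N_def by (simp add: field_simps)
    moreover have "real m * (D1 - D2) > 0" using m D by simp
    ultimately show False by linarith
  qed
  define y where "y = (undefined :: 'a)"
  have "real k * (c * exp (real N * r)) \<le> (\<Sum>i\<in>{1..k}. psum (A i) N y)"
    using sum_bounded_below[of "{1..k}" "c * exp (real N * r)" "\<lambda>i. psum (A i) N y"] lower by simp
  also have "\<dots> = (\<Sum>z\<in>(\<Union>i\<in>{1..k}. {z. (g ^^ N) z = y \<and> A i z}). exp (\<Phi> N z))"
    unfolding psum_def
  proof (rule sum.UNION_disjoint[symmetric])
    have "A i z \<Longrightarrow> A j z \<Longrightarrow> i = j" if "i \<in> {1..k}" "j \<in> {1..k}" for i j z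
      using disj[OF that] disj[OF that(2,1)] by (cases i j rule: linorder_cases) blast+
    then show "\<forall>i\<in>{1..k}. \<forall>j\<in>{1..k}. i \<noteq> j \<longrightarrow>
        {z. (g ^^ N) z = y \<and> A i z} \<inter> {z. (g ^^ N) z = y \<and> A j z} = {}" by blast
  qed simp_all
  also have "\<dots> \<le> tsum N y"
    unfolding psum_def by (rule sum_mono2) auto
  also have "\<dots> \<le> C * exp (real N * r)" using tsum_le_tsup[of N y] C[of N] by linarith
  finally have "real k * c \<le> C" by (simp flip: mult.assoc)
  then show False using k c0 by (simp add: field_simps)
qed

end

section \<open>The growth rate and its perturbations\<close>

context potential
begin

definition rate :: real where "rate = lim (\<lambda>n. ln (tsup n) / real n)"

lemma rate_lim: "(\<lambda>n. ln (tsup n) / real n) \<longlonglongrightarrow> rate"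
  and rate_lower: "exp (- C0) * exp (real n * rate) \<le> tsup n"
proof -
  obtain r where r: "(\<lambda>n. ln (tsup n) / real n) \<longlonglongrightarrow> r" "\<And>n. exp (-C0) * exp (real n * r) \<le> tsup n"
    using growth_rate by blast
  have "rate = r" unfolding rate_def by (rule limI[OF r(1)])
  then show "(\<lambda>n. ln (tsup n) / real n) \<longlonglongrightarrow> rate" "exp (- C0) * exp (real n * rate) \<le> tsup n"
    using r by auto
qed

text \<open>The supremum defining \<open>tsup\<close> need not be attained; the factor 1/2 leaves
  room for an actual point.\<close>

lemma ex_tsum_ge: "\<exists>y. exp (- C0) / 2 * exp (real n * rate) \<le> tsum n y"
proof (rule ccontr)
  assume "\<not> ?thesis"
  then have "tsup n \<le> exp (- C0) / 2 * exp (real n * rate)" by (intro tsup_le) (simp add: not_le less_imp_le)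
  then show False using rate_lower[of n] tsup_pos[of n] by simp
qed

text \<open>This rests on the limit alone, so it is available before \<open>b < rate\<close> has
  been established; the strict inequality \<open>rate < r\<close> absorbs the subexponential
  factor.\<close>

lemma tsup_le_exp:
  assumes "rate < r"
  obtains C where "C > 0" "\<And>n. tsup n \<le> C * exp (real n * r)"
proof -
  have "\<forall>\<^sub>F n in sequentially. ln (tsup n) / real n < r" using order_tendstoD(2)[OF rate_lim assms] .
  then obtain n0 where n0: "\<And>n. n \<ge> n0 \<Longrightarrow> ln (tsup n) / real n < r" unfolding eventually_sequentially by blast
  define C where "C = 1 + (\<Sum>n\<le>n0. tsup n * exp (- real n * r))"
  have nn: "tsup n * exp (- real n * r) \<ge> 0" for n using less_imp_le[OF tsup_pos] by simp
  have C1: "C \<ge> 1" using nn by (simp add: C_def sum_nonneg)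
  have "tsup n \<le> C * exp (real n * r)" for n
  proof (cases "n \<le> n0")
    case True
    then have "tsup n * exp (- real n * r) \<le> C"
      using member_le_sum[of n "{..n0}" "\<lambda>n. tsup n * exp (- real n * r)"] nn unfolding C_def by simp
    then have "tsup n * exp (- real n * r) * exp (real n * r) \<le> C * exp (real n * r)" by (intro mult_right_mono) auto
    moreover have "tsup n * exp (- real n * r) * exp (real n * r) = tsup n"
      by (simp add: mult.assoc flip: exp_add)
    ultimately show ?thesis by linarith
  next
    case False
    then have "ln (tsup n) < real n * r" using n0[of n] by (simp add: field_simps)
    then have "exp (ln (tsup n)) < exp (real n * r)" by (simp only: exp_less_cancel_iff)
    then have "tsup n \<le> 1 * exp (real n * r)" using tsup_pos[of n] by simp
    also have "\<dots> \<le> C * exp (real n * r)" using C1 by (intro mult_right_mono) auto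
    finally show ?thesis .
  qed
  then show thesis using that[of C] C1 by auto
qed

text \<open>A bound with a constant that expresses that the pressure of the bad segments is at most
  \<open>b\<close>. All scales \<delta> occur, since pressure and the entropy of arbitrary
  partitions are seen only as the scale tends to 0.\<close>

definition bad_growth :: "real \<Rightarrow> bool" where
  "bad_growth b \<longleftrightarrow> (\<forall>\<delta>>0. \<exists>Cb. \<forall>l\<ge>1. \<forall>E. bsep l \<delta> E \<longrightarrow> (\<forall>x\<in>E. bad l x) \<longrightarrow>
      (\<Sum>x\<in>E. exp (\<Phi> l x)) \<le> Cb * exp (real l * b))"

lemma bad_growth_psum:
  assumes "bad_growth b"
  obtains Cb where "\<And>l y. l \<ge> 1 \<Longrightarrow> psum (bad l) l y \<le> Cb * exp (real l * b)"
proof -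
  obtain Cb where Cb: "\<And>l E. l \<ge> 1 \<Longrightarrow> bsep l \<epsilon>\<^sub>0 E \<Longrightarrow> (\<forall>x\<in>E. bad l x) \<Longrightarrow>
      (\<Sum>x\<in>E. exp (\<Phi> l x)) \<le> Cb * exp (real l * b)"
    using assms \<epsilon>0_pos unfolding bad_growth_def by blast
  show thesis by (rule that[of Cb]) (rule bad_psum_bound[OF Cb])
qed

lemma tsup_le_rate:
  assumes "bad_growth b" "b < rate"
  obtains C where "C > 0" "\<And>n. tsup n \<le> C * exp (real n * rate)"
proof -
  obtain Cb where Cb: "\<And>l y. l \<ge> 1 \<Longrightarrow> psum (bad l) l y \<le> Cb * exp (real l * b)"
    using bad_growth_psum[OF assms(1)] by blast
  show thesis by (rule tsup_upper[OF rate_lim Cb assms(2)]) (use that in blast)+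
qed

lemma bsep_sum_le:
  assumes C: "\<And>n. tsup n \<le> C * exp (real n * r)" and b: "b < r" and bad: "bad_growth b" and \<delta>: "\<delta> > 0"
  shows "\<exists>K. \<forall>n E. bsep n \<delta> E \<longrightarrow> (\<Sum>x\<in>E. exp (\<Phi> n x)) \<le> K * exp (real n * r)"
proof -
  obtain K where "\<And>n E. bsep n \<delta> E \<Longrightarrow> (\<Sum>x\<in>E. exp (\<Phi> n x)) \<le> K * exp (real n * r)"
    by (rule bsep_sum_bound[OF C b _ \<delta>]) (use bad[unfolded bad_growth_def] in blast)+
  then show ?thesis by blast
qed

lemma sum_geometric_le:
  "(\<Sum>i<n. \<sigma> ^ (n - Suc i)) \<le> 1 / (1 - \<sigma>)"
proof -
  have "(\<Sum>i<n. \<sigma> ^ (n - Suc i)) = (\<Sum>i<n. \<sigma> ^ i)" by (rule sum.nat_diff_reindex)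
  also have "\<dots> \<le> (\<Sum>i. \<sigma> ^ i)"
    using \<sigma>_pos \<sigma>_less by (intro sum_le_suminf summable_geometric) auto
  also have "\<dots> = 1 / (1 - \<sigma>)" using \<sigma>_pos \<sigma>_less by (simp add: suminf_geometric)
  finally show ?thesis .
qed

text \<open>The added Birkhoff sum is exactly additive, so \<open>C0\<close> stays; along shadowing
  its distortion is a geometric series in \<sigma> by the Lipschitz bound.\<close>

lemma potential_perturb:
  assumes \<psi>: "\<And>x. 0 \<le> \<psi> x" "\<And>x. \<psi> x \<le> 1" "\<And>x y. \<bar>\<psi> x - \<psi> y\<bar> \<le> L * dist x y"
    and t: "t \<ge> 0"
  shows "potential g s \<sigma> \<epsilon>\<^sub>0 (\<lambda>n z. \<Phi> n z + t * bsum g \<psi> n z) C0 (C1 + t * (\<bar>L\<bar> * \<epsilon>\<^sub>0 / (1 - \<sigma>))) (B + t)"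
proof
  show "\<bar>\<Phi> (m + n) x + t * bsum g \<psi> (m + n) x - (\<Phi> m x + t * bsum g \<psi> m x) -
        (\<Phi> n ((g ^^ m) x) + t * bsum g \<psi> n ((g ^^ m) x))\<bar> \<le> C0" for m n x
    using Phi_add[of m n x] by (simp add: bsum_add algebra_simps)
next
  fix n x z assume a: "\<And>j. j \<le> n \<Longrightarrow> dist ((g ^^ j) z) ((g ^^ j) x) \<le> \<epsilon>\<^sub>0 * \<sigma> ^ (n - j)"
  have "\<bar>bsum g \<psi> n z - bsum g \<psi> n x\<bar> \<le> (\<Sum>i<n. \<bar>\<psi> ((g ^^ i) z) - \<psi> ((g ^^ i) x)\<bar>)"
    unfolding bsum_def sum_subtractf[symmetric] by (rule sum_abs)
  also have "\<dots> \<le> (\<Sum>i<n. \<bar>L\<bar> * \<epsilon>\<^sub>0 * \<sigma> ^ (n - Suc i))"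
  proof (rule sum_mono)
    fix i assume i: "i \<in> {..<n}"
    have "\<bar>\<psi> ((g ^^ i) z) - \<psi> ((g ^^ i) x)\<bar> \<le> L * dist ((g ^^ i) z) ((g ^^ i) x)" by (rule \<psi>(3))
    also have "\<dots> \<le> \<bar>L\<bar> * dist ((g ^^ i) z) ((g ^^ i) x)" by (intro mult_right_mono) auto
    also have "\<dots> \<le> \<bar>L\<bar> * (\<epsilon>\<^sub>0 * \<sigma> ^ (n - i))" using i a[of i] by (intro mult_left_mono) auto
    also have "\<dots> \<le> \<bar>L\<bar> * (\<epsilon>\<^sub>0 * \<sigma> ^ (n - Suc i))"
      using \<sigma>_pos \<sigma>_less \<epsilon>0_pos by (intro mult_left_mono power_decreasing) auto
    finally show "\<bar>\<psi> ((g ^^ i) z) - \<psi> ((g ^^ i) x)\<bar> \<le> \<bar>L\<bar> * \<epsilon>\<^sub>0 * \<sigma> ^ (n - Suc i)"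
      by (simp add: mult_ac)
  qed
  also have "\<dots> = \<bar>L\<bar> * \<epsilon>\<^sub>0 * (\<Sum>i<n. \<sigma> ^ (n - Suc i))" by (simp add: sum_distrib_left)
  also have "\<dots> \<le> \<bar>L\<bar> * \<epsilon>\<^sub>0 * (1 / (1 - \<sigma>))"
    using sum_geometric_le \<epsilon>0_pos by (intro mult_left_mono) auto
  finally have "t * \<bar>bsum g \<psi> n z - bsum g \<psi> n x\<bar> \<le> t * (\<bar>L\<bar> * \<epsilon>\<^sub>0 / (1 - \<sigma>))"
    using t by (intro mult_left_mono) auto
  moreover have "\<bar>\<Phi> n z - \<Phi> n x\<bar> \<le> C1" by (rule Phi_shadow) (rule a)
  moreover have "\<bar>\<Phi> n z + t * bsum g \<psi> n z - (\<Phi> n x + t * bsum g \<psi> n x)\<bar> \<le>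
      \<bar>\<Phi> n z - \<Phi> n x\<bar> + \<bar>t * (bsum g \<psi> n z - bsum g \<psi> n x)\<bar>"
    by (simp add: algebra_simps)
  ultimately show "\<bar>\<Phi> n z + t * bsum g \<psi> n z - (\<Phi> n x + t * bsum g \<psi> n x)\<bar> \<le> C1 + t * (\<bar>L\<bar> * \<epsilon>\<^sub>0 / (1 - \<sigma>))"
    using t by (simp add: abs_mult)
next
  fix \<eta> :: real assume \<eta>: "\<eta> > 0"
  obtain \<delta> C where \<delta>: "\<delta> > 0" "\<And>n x z. bclose n \<delta> z x \<Longrightarrow> \<bar>\<Phi> n z - \<Phi> n x\<bar> \<le> C + real n * (\<eta> / 2)"
    using Phi_unif[of "\<eta> / 2"] \<eta> by (metis half_gt_zero)
  define \<delta>' where "\<delta>' = min \<delta> (\<eta> / (2 * (t + 1) * (\<bar>L\<bar> + 1)))"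
  have \<delta>': "\<delta>' > 0" "\<delta>' \<le> \<delta>" using \<delta>(1) \<eta> t by (auto simp: \<delta>'_def)
  have small: "t * (\<bar>L\<bar> * \<delta>') \<le> \<eta> / 2"
  proof -
    have "t * (\<bar>L\<bar> * \<delta>') \<le> (t + 1) * ((\<bar>L\<bar> + 1) * (\<eta> / (2 * (t + 1) * (\<bar>L\<bar> + 1))))"
      using t \<delta>' by (intro mult_mono) (auto simp: \<delta>'_def)
    also have "\<dots> = \<eta> / 2"
    proof -
      have e: "u * (v * (\<eta> / (2 * u * v))) = \<eta> / 2" if "u > 0" "v > 0" for u v :: real
        using that by simp
      show ?thesis by (rule e) (use t in linarith)+
    qed
    finally show ?thesis .
  qed
  have "\<bar>\<Phi> n z + t * bsum g \<psi> n z - (\<Phi> n x + t * bsum g \<psi> n x)\<bar> \<le> C + real n * \<eta>"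
    if cl: "bclose n \<delta>' z x" for n x z
  proof -
    have "\<bar>bsum g \<psi> n z - bsum g \<psi> n x\<bar> \<le> (\<Sum>i<n. \<bar>\<psi> ((g ^^ i) z) - \<psi> ((g ^^ i) x)\<bar>)"
      unfolding bsum_def sum_subtractf[symmetric] by (rule sum_abs)
    also have "\<dots> \<le> (\<Sum>i<n. \<bar>L\<bar> * \<delta>')"
    proof (rule sum_mono)
      fix i assume i: "i \<in> {..<n}"
      have "\<bar>\<psi> ((g ^^ i) z) - \<psi> ((g ^^ i) x)\<bar> \<le> L * dist ((g ^^ i) z) ((g ^^ i) x)" by (rule \<psi>(3))
      also have "\<dots> \<le> \<bar>L\<bar> * dist ((g ^^ i) z) ((g ^^ i) x)" by (intro mult_right_mono) auto
      also have "\<dots> \<le> \<bar>L\<bar> * \<delta>'" using i cl unfolding bclose_def by (intro mult_left_mono) (auto simp: less_imp_le)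
      finally show "\<bar>\<psi> ((g ^^ i) z) - \<psi> ((g ^^ i) x)\<bar> \<le> \<bar>L\<bar> * \<delta>'" .
    qed
    also have "\<dots> = real n * (\<bar>L\<bar> * \<delta>')" by simp
    finally have "t * \<bar>bsum g \<psi> n z - bsum g \<psi> n x\<bar> \<le> t * (real n * (\<bar>L\<bar> * \<delta>'))"
      using t by (intro mult_left_mono) auto
    also have "\<dots> = real n * (t * (\<bar>L\<bar> * \<delta>'))" by (simp only: mult_ac)
    also have "\<dots> \<le> real n * (\<eta> / 2)" using small by (intro mult_left_mono) auto
    finally have "\<bar>t * (bsum g \<psi> n z - bsum g \<psi> n x)\<bar> \<le> real n * (\<eta> / 2)" using t by (simp add: abs_mult)
    moreover have "\<bar>\<Phi> n z - \<Phi> n x\<bar> \<le> C + real n * (\<eta> / 2)"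
      by (rule \<delta>(2)[OF bclose_mono[OF cl \<delta>'(2)]])
    moreover have "real n * (\<eta> / 2) + real n * (\<eta> / 2) = real n * \<eta>" by simp
    ultimately show ?thesis unfolding right_diff_distrib by linarith
  qed
  then show "\<exists>\<delta>>0. \<exists>C. \<forall>n x z. bclose n \<delta> z x \<longrightarrow>
      \<bar>\<Phi> n z + t * bsum g \<psi> n z - (\<Phi> n x + t * bsum g \<psi> n x)\<bar> \<le> C + real n * \<eta>"
    using \<delta>'(1) by blast
next
  fix n x
  have "\<bar>t * bsum g \<psi> n x\<bar> \<le> t * real n"
    using bsum_bounds[of \<psi> g n x] \<psi> t by (simp add: abs_mult mult_left_mono)
  then show "\<bar>\<Phi> n x + t * bsum g \<psi> n x\<bar> \<le> real n * (B + t)"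
    using Phi_bound[of n x] by (simp add: algebra_simps)
qed

definition prate :: "('a \<Rightarrow> real) \<Rightarrow> real \<Rightarrow> real" where
  "prate \<psi> t = potential.rate g (\<lambda>n z. \<Phi> n z + t * bsum g \<psi> n z)"

text \<open>Since \<psi> takes values in [0,1], the bad growth rises by at most \<open>t\<close>,
  while the rate does not decrease (\<open>prate_bounds\<close>): the gap persists as long as
  \<open>b + t < rate\<close>.\<close>

lemma bad_growth_perturb:
  assumes \<psi>: "\<And>x. 0 \<le> \<psi> x" "\<And>x. \<psi> x \<le> 1" "\<And>x y. \<bar>\<psi> x - \<psi> y\<bar> \<le> L * dist x y"
    and t: "t \<ge> 0" and bad: "bad_growth b"
  shows "potential.bad_growth g s \<sigma> (\<lambda>n z. \<Phi> n z + t * bsum g \<psi> n z) (b + t)"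
proof -
  interpret P: potential g s \<sigma> \<epsilon>\<^sub>0 "\<lambda>n z. \<Phi> n z + t * bsum g \<psi> n z" C0 "C1 + t * (\<bar>L\<bar> * \<epsilon>\<^sub>0 / (1 - \<sigma>))" "B + t"
    by (rule potential_perturb) (use \<psi> t in auto)
  show ?thesis unfolding P.bad_growth_def
  proof (intro allI impI)
    fix \<delta> :: real assume "\<delta> > 0"
    then obtain Cb where Cb: "\<And>l E. l \<ge> 1 \<Longrightarrow> bsep l \<delta> E \<Longrightarrow> (\<forall>x\<in>E. bad l x) \<Longrightarrow>
        (\<Sum>x\<in>E. exp (\<Phi> l x)) \<le> Cb * exp (real l * b)"
      using bad unfolding bad_growth_def by blast
    have "(\<Sum>x\<in>E. exp (\<Phi> l x + t * bsum g \<psi> l x)) \<le> Cb * exp (real l * (b + t))"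
      if "l \<ge> 1" "bsep l \<delta> E" "\<forall>x\<in>E. bad l x" for l E
    proof -
      have "(\<Sum>x\<in>E. exp (\<Phi> l x + t * bsum g \<psi> l x)) \<le> (\<Sum>x\<in>E. exp (real l * t) * exp (\<Phi> l x))"
      proof (rule sum_mono)
        fix x
        have "t * bsum g \<psi> l x \<le> t * real l" using bsum_bounds(2)[of \<psi> g l x] \<psi> t by (intro mult_left_mono) auto
        then show "exp (\<Phi> l x + t * bsum g \<psi> l x) \<le> exp (real l * t) * exp (\<Phi> l x)"
          by (simp add: mult.commute flip: exp_add)
      qed
      also have "\<dots> = exp (real l * t) * (\<Sum>x\<in>E. exp (\<Phi> l x))" by (simp add: sum_distrib_left)
      also have "\<dots> \<le> exp (real l * t) * (Cb * exp (real l * b))" using Cb[OF that] by (intro mult_left_mono) auto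
      also have "\<dots> = Cb * exp (real l * (b + t))" by (simp add: exp_add algebra_simps)
      finally show ?thesis .
    qed
    then show "\<exists>Cb. \<forall>l\<ge>1. \<forall>E. bsep l \<delta> E \<longrightarrow> (\<forall>x\<in>E. bad l x) \<longrightarrow>
        (\<Sum>x\<in>E. exp (\<Phi> l x + t * bsum g \<psi> l x)) \<le> Cb * exp (real l * (b + t))" by blast
  qed
qed

lemma prate_bounds:
  assumes \<psi>: "\<And>x. 0 \<le> \<psi> x" "\<And>x. \<psi> x \<le> 1" "\<And>x y. \<bar>\<psi> x - \<psi> y\<bar> \<le> L * dist x y"
    and t: "t \<ge> 0"
  shows "rate \<le> prate \<psi> t" "prate \<psi> t \<le> rate + t"
proof -
  interpret P: potential g s \<sigma> \<epsilon>\<^sub>0 "\<lambda>n z. \<Phi> n z + t * bsum g \<psi> n z" C0 "C1 + t * (\<bar>L\<bar> * \<epsilon>\<^sub>0 / (1 - \<sigma>))" "B + t"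
    by (rule potential_perturb) (use \<psi> t in auto)
  have pr: "prate \<psi> t = P.rate" by (simp add: prate_def)
  have b: "0 \<le> t * bsum g \<psi> n z" "t * bsum g \<psi> n z \<le> real n * t" for n z
    using bsum_bounds[of \<psi> g n z] \<psi> t mult_right_mono[of "bsum g \<psi> n z" "real n" t] by (auto simp: mult.commute)
  have le1: "tsup n \<le> P.tsup n" for n
  proof (rule tsup_le)
    fix y
    have "tsum n y \<le> P.tsum n y" unfolding psum_def P.psum_def using b by (intro sum_mono) auto
    then show "tsum n y \<le> P.tsup n" using P.tsum_le_tsup[of n y] by linarith
  qed
  have le2: "P.tsup n \<le> exp (real n * t) * tsup n" for n
  proof (rule P.tsup_le)
    fix y
    have "P.tsum n y \<le> exp (real n * t) * tsum n y"
      unfolding psum_def P.psum_def sum_distrib_left using b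
      by (intro sum_mono) (simp add: add.commute flip: exp_add)
    also have "\<dots> \<le> exp (real n * t) * tsup n" using tsum_le_tsup by (intro mult_left_mono) auto
    finally show "P.tsum n y \<le> exp (real n * t) * tsup n" .
  qed
  show "rate \<le> prate \<psi> t" unfolding pr
  proof (rule LIMSEQ_le[OF rate_lim P.rate_lim], intro exI allI impI)
    fix n show "ln (tsup n) / real n \<le> ln (P.tsup n) / real n"
      using le1[of n] tsup_pos[of n] P.tsup_pos[of n] by (intro divide_right_mono) auto
  qed
  show "prate \<psi> t \<le> rate + t" unfolding pr
  proof (rule LIMSEQ_le[OF P.rate_lim tendsto_add[OF rate_lim tendsto_const]], intro exI allI impI)
    fix n :: nat assume n: "1 \<le> n"
    have "ln (P.tsup n) \<le> ln (exp (real n * t) * tsup n)"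
      using le2[of n] tsup_pos[of n] P.tsup_pos[of n] by (subst ln_le_cancel_iff) auto
    also have "\<dots> = real n * t + ln (tsup n)" using tsup_pos[of n] by (simp add: ln_mult_pos)
    finally show "ln (P.tsup n) / real n \<le> ln (tsup n) / real n + t" using n by (simp add: field_simps)
  qed
qed

text \<open>\<open>D\<close> is the infimum of the difference quotients of \<open>prate\<close> over
  \<open>0 < t \<le> t0\<close>. Hence the lower bound for the moments holds with slope
  \<open>D\<close> at every such \<open>t\<close>, and for each \<eta> some \<open>t\<close> gives
  the upper bound with slope \<open>D + \<eta>\<close>.\<close>

lemma concentration_of_slope:
  assumes bad: "bad_growth b" "b < rate"
    and \<psi>: "\<And>x. 0 \<le> \<psi> x" "\<And>x. \<psi> x \<le> 1" "\<And>x y. \<bar>\<psi> x - \<psi> y\<bar> \<le> L * dist x y"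
    and t0: "t0 > 0" "b + t0 < rate" and v: "\<And>t. 0 < t \<Longrightarrow> t \<le> t0 \<Longrightarrow> rate + t * v \<le> prate \<psi> t"
  obtains D c where "v \<le> D" "c > 0"
    "\<And>\<eta>. \<eta> > 0 \<Longrightarrow> \<exists>n0. \<forall>n\<ge>n0. \<forall>y. psum (concentrated \<psi> D \<eta> n) n y \<ge> c * exp (real n * rate)"
proof -
  have pp: "potential g s \<sigma> \<epsilon>\<^sub>0 (\<lambda>n z. \<Phi> n z + t * bsum g \<psi> n z) C0 (C1 + t * (\<bar>L\<bar> * \<epsilon>\<^sub>0 / (1 - \<sigma>))) (B + t)"
    if "t \<ge> 0" for t by (rule potential_perturb) (use \<psi> that in auto)
  have ms: "msum \<psi> t n y = potential.psum g (\<lambda>n z. \<Phi> n z + t * bsum g \<psi> n z) (\<lambda>_. True) n y" if "t \<ge> 0" for t n y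
    by (simp add: msum_def potential.psum_def[OF pp[OF that]])
  define D where "D = (INF t\<in>{0<..t0}. (prate \<psi> t - rate) / t)"
  have pb: "0 \<le> (prate \<psi> t - rate) / t \<and> (prate \<psi> t - rate) / t \<le> 1" if "t \<in> {0<..t0}" for t
    using prate_bounds[of \<psi> L t] \<psi> that by (auto simp: field_simps)
  have bdd: "bdd_below ((\<lambda>t. (prate \<psi> t - rate) / t) ` {0<..t0})" using pb by (intro bdd_belowI2) auto
  have ne: "{0<..t0} \<noteq> {}" using t0 by auto
  have D_le: "D \<le> (prate \<psi> t - rate) / t" if "t \<in> {0<..t0}" for t
    unfolding D_def using bdd that by (rule cINF_lower)
  have D0: "D \<ge> 0" unfolding D_def using pb ne by (intro cINF_greatest) auto
  have D1: "D \<le> 1" using order_trans[OF D_le[of t0]] pb[of t0] t0 by simp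
  have vD: "v \<le> D" unfolding D_def
    using v ne by (intro cINF_greatest) (auto simp: field_simps)
  obtain Cb where Cb: "\<And>l y. l \<ge> 1 \<Longrightarrow> psum (bad l) l y \<le> Cb * exp (real l * b)"
    using bad_growth_psum[OF bad(1)] by blast
  obtain C' where C': "C' > 0" "\<And>n. tsup n \<le> C' * exp (real n * rate)" using tsup_le_rate[OF bad] by blast
  define c0 where "c0 = exp (- C0) / 2"
  define C where "C = max C' c0"
  have c0: "c0 > 0" "c0 \<le> C" by (auto simp: c0_def C_def)
  have C: "tsup n \<le> C * exp (real n * rate)" for n
  proof -
    have "C' * exp (real n * rate) \<le> C * exp (real n * rate)" by (intro mult_right_mono) (auto simp: C_def)
    then show ?thesis using C'(2)[of n] by linarith
  qed
  have lower: "\<exists>y. msum \<psi> t n y \<ge> c0 * exp (real n * (rate + t * D))" if t: "0 < t" "t \<le> t0" for t n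
  proof -
    interpret P: potential g s \<sigma> \<epsilon>\<^sub>0 "\<lambda>n z. \<Phi> n z + t * bsum g \<psi> n z" C0 "C1 + t * (\<bar>L\<bar> * \<epsilon>\<^sub>0 / (1 - \<sigma>))" "B + t"
      by (rule pp) (use t in simp)
    have pr: "prate \<psi> t = P.rate" by (simp add: prate_def)
    have "rate + t * D \<le> P.rate" using D_le[of t] t unfolding pr by (simp add: field_simps)
    then have "c0 * exp (real n * (rate + t * D)) \<le> c0 * exp (real n * P.rate)"
      using c0 by (intro mult_left_mono) (auto intro!: mult_left_mono)
    then show ?thesis using P.ex_tsum_ge[of n] t unfolding ms[OF less_imp_le[OF t(1)]] c0_def
      by (meson order_trans)
  qed
  have upper: "\<exists>t>0. \<exists>K. \<forall>n y. msum \<psi> t n y \<le> K * exp (real n * (rate + t * D + t * \<eta>))" if \<eta>: "\<eta> > 0" for \<eta>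
  proof -
    have "D < D + \<eta>" using \<eta> by simp
    then obtain t where t: "t \<in> {0<..t0}" "(prate \<psi> t - rate) / t < D + \<eta>"
      unfolding D_def using cINF_less_iff[OF ne bdd] by blast
    interpret P: potential g s \<sigma> \<epsilon>\<^sub>0 "\<lambda>n z. \<Phi> n z + t * bsum g \<psi> n z" C0 "C1 + t * (\<bar>L\<bar> * \<epsilon>\<^sub>0 / (1 - \<sigma>))" "B + t"
      by (rule pp) (use t in simp)
    have pr: "prate \<psi> t = P.rate" by (simp add: prate_def)
    have t1: "0 < t" "t \<le> t0" using t by auto
    have "P.bad_growth (b + t)" by (rule bad_growth_perturb) (use \<psi> t1 bad in auto)
    moreover have "b + t < P.rate" using prate_bounds(1)[of \<psi> L t] \<psi> t1 t0 unfolding pr by fastforce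
    ultimately obtain K where K: "K > 0" "\<And>n. P.tsup n \<le> K * exp (real n * P.rate)" using P.tsup_le_rate by blast
    have "P.rate \<le> rate + t * D + t * \<eta>" using t unfolding pr by (simp add: field_simps)
    then have "K * exp (real n * P.rate) \<le> K * exp (real n * (rate + t * D + t * \<eta>))" for n
      using K(1) by (intro mult_left_mono) (auto intro!: mult_left_mono)
    then have "msum \<psi> t n y \<le> K * exp (real n * (rate + t * D + t * \<eta>))" for n y
      unfolding ms[OF less_imp_le[OF t1(1)]] by (intro order_trans[OF order_trans[OF P.tsum_le_tsup K(2)]])
    then show ?thesis using t1(1) by blast
  qed
  have Cpos: "C > 0" using c0 by linarith
  have some: "\<exists>n0. \<forall>n\<ge>n0. \<exists>y. psum (concentrated \<psi> D \<eta> n) n y \<ge> c0\<^sup>2 / (8 * C) * exp (real n * rate)"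
    if "\<eta> > 0" for \<eta>
    by (rule concentration_somewhere[OF \<psi>(1,2) C c0 D0 t0(1) lower upper that])
  have pos: "c0\<^sup>2 / (8 * C) > 0" using c0(1) Cpos by simp
  show thesis
    by (rule concentration_everywhere[OF rate_lim Cb bad(2) \<psi> D0 D1 pos some, OF _ _ that[OF vD]])
qed

text \<open>Concentration of \<open>1 - \<psi>\<close> at \<open>D2\<close> is concentration of
  \<psi> at \<open>1 - D2\<close>. If \<open>v1 > v2\<close>, then \<open>1 - D2 < D1\<close>, and
  two concentrations at different values, both uniform in the endpoint, exclude each other.\<close>

theorem slopes_agree:
  assumes bad: "bad_growth b" "b < rate"
    and \<psi>: "\<And>x. 0 \<le> \<psi> x" "\<And>x. \<psi> x \<le> 1" "\<And>x y. \<bar>\<psi> x - \<psi> y\<bar> \<le> L * dist x y"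
    and t0: "t0 > 0" "b + t0 < rate"
    and v1: "\<And>t. 0 < t \<Longrightarrow> t \<le> t0 \<Longrightarrow> rate + t * v1 \<le> prate \<psi> t"
    and v2: "\<And>t. 0 < t \<Longrightarrow> t \<le> t0 \<Longrightarrow> rate + t * (1 - v2) \<le> prate (\<lambda>x. 1 - \<psi> x) t"
  shows "v1 \<le> v2"
proof (rule ccontr)
  assume "\<not> v1 \<le> v2"
  obtain D1 c1 where D1: "v1 \<le> D1" "c1 > 0"
    "\<And>\<eta>. \<eta> > 0 \<Longrightarrow> \<exists>n0. \<forall>n\<ge>n0. \<forall>y. psum (concentrated \<psi> D1 \<eta> n) n y \<ge> c1 * exp (real n * rate)"
    using concentration_of_slope[OF bad \<psi> t0 v1] by blast
  have \<psi>': "\<And>x. 0 \<le> 1 - \<psi> x" "\<And>x. 1 - \<psi> x \<le> 1" "\<And>x y. \<bar>(1 - \<psi> x) - (1 - \<psi> y)\<bar> \<le> L * dist x y"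
    using \<psi>(1,2) \<psi>(3) by (auto simp: abs_minus_commute)
  obtain D2 c2 where D2: "1 - v2 \<le> D2" "c2 > 0"
    "\<And>\<eta>. \<eta> > 0 \<Longrightarrow> \<exists>n0. \<forall>n\<ge>n0. \<forall>y. psum (concentrated (\<lambda>x. 1 - \<psi> x) D2 \<eta> n) n y \<ge> c2 * exp (real n * rate)"
    using concentration_of_slope[OF bad \<psi>' t0 v2] by blast
  have "bsum g (\<lambda>x. 1 - \<psi> x) n z = real n - bsum g \<psi> n z" for n z by (simp add: bsum_def sum_subtractf)
  then have "bsum g (\<lambda>x. 1 - \<psi> x) n z - real n * D2 = - (bsum g \<psi> n z - real n * (1 - D2))" for n z
    by (simp add: algebra_simps)
  then have "concentrated (\<lambda>x. 1 - \<psi> x) D2 \<eta> n = concentrated \<psi> (1 - D2) \<eta> n" for \<eta> n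
    unfolding concentrated_def by (simp only: abs_minus_cancel)
  note D2' = D2(3)[unfolded this]
  obtain C where C: "\<And>n. tsup n \<le> C * exp (real n * rate)" using tsup_le_rate[OF bad] by blast
  have "1 - D2 < D1" using D1(1) D2(1) \<open>\<not> v1 \<le> v2\<close> by linarith
  from no_two_concentrations[OF C D1(2) D2(2) this D1(3) D2'] show False by blast
qed

end

section \<open>Entropy of itineraries\<close>

text \<open>Entropy of the partition into fibres, stated for a map so that joint entropies are
  entropies of pairs.\<close>

definition shannon :: "'b measure \<Rightarrow> ('b \<Rightarrow> 'c) \<Rightarrow> real" where
  "shannon M X = - (\<Sum>v\<in>X ` space M. measure M (X -` {v} \<inter> space M) * ln (measure M (X -` {v} \<inter> space M)))"

definition itinerary :: "('b \<Rightarrow> 'b) \<Rightarrow> ('b \<Rightarrow> 'c) \<Rightarrow> nat \<Rightarrow> 'b \<Rightarrow> 'c list" where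
  "itinerary f c n x = map (\<lambda>k. c ((f ^^ k) x)) [0..<n]"

lemma itinerary_Suc: "itinerary f c (Suc n) x = itinerary f c n x @ [c ((f ^^ n) x)]"
  by (simp add: itinerary_def)

lemma itinerary_add: "itinerary f c (m + n) x = itinerary f c m x @ itinerary f c n ((f ^^ m) x)"
proof (induction n)
  case (Suc n)
  have "(f ^^ (m + n)) x = (f ^^ n) ((f ^^ m) x)" by (subst add.commute) (simp add: funpow_add)
  then show ?case using Suc by (simp add: itinerary_Suc)
qed (simp add: itinerary_def)

lemma itinerary_eq_iff:
  "itinerary f c n x = itinerary f c n y \<longleftrightarrow> (\<forall>k<n. c ((f ^^ k) x) = c ((f ^^ k) y))"
  by (auto simp: itinerary_def map_eq_conv)

lemma shannon_cong: "(\<And>x. x \<in> space M \<Longrightarrow> X x = Y x) \<Longrightarrow> shannon M X = shannon M Y"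
  unfolding shannon_def
  by (intro arg_cong[where f=uminus] sum.cong image_cong refl arg_cong2[where f="(*)"] arg_cong[where f=ln]
      arg_cong[where f="measure M"]) auto

section \<open>Shannon entropy of finite-valued maps\<close>

context prob_space
begin

lemma shannon_eq_entropy:
  assumes "simple_function M X"
  shows "shannon M X = entropy (exp 1) (count_space (X ` space M)) X"
proof -
  interpret information_space M "exp 1" by unfold_locales simp
  have "simple_distributed M X (\<lambda>v. measure M (X -` {v} \<inter> space M))"
    by (rule simple_distributedI[OF assms _ refl]) simp
  from entropy_simple_distributed[OF this] show ?thesis
    by (simp add: shannon_def log_def)
qed

lemma shannon_pair:
  assumes "simple_function M X" "simple_function M Y"
  shows "shannon M (\<lambda>x. (X x, Y x)) \<le> shannon M X + shannon M Y"
proof -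
  interpret information_space M "exp 1" by unfold_locales simp
  show ?thesis
    using conditional_entropy_less_eq_entropy[OF assms(2,1)] entropy_chain_rule[OF assms] assms
    by (simp add: shannon_eq_entropy)
qed

text \<open>The condition makes \<open>Y\<close> a function of \<open>X\<close> on the space, and
  applying a function does not increase entropy.\<close>

lemma shannon_data:
  assumes X: "simple_function M X" and Y: "\<And>x y. x \<in> space M \<Longrightarrow> y \<in> space M \<Longrightarrow> X x = X y \<Longrightarrow> Y x = Y y"
  shows "shannon M Y \<le> shannon M X"
proof -
  interpret information_space M "exp 1" by unfold_locales simp
  define h where "h v = Y (SOME x. x \<in> space M \<and> X x = v)" for v
  have "h (X x) = Y x" if "x \<in> space M" for x
  proof -
    have "\<exists>y. y \<in> space M \<and> X y = X x" using that by blast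
    from someI_ex[OF this] show ?thesis unfolding h_def using Y that by blast
  qed
  then have "shannon M Y = shannon M (h \<circ> X)" by (intro shannon_cong) simp
  also have "\<dots> \<le> shannon M X"
    using entropy_data_processing[OF X, of h] X
    by (simp add: shannon_eq_entropy simple_function_compose1 comp_def)
  finally show ?thesis .
qed

lemma shannon_le_card:
  assumes "simple_function M X"
  shows "shannon M X \<le> ln (card (X ` space M))"
proof -
  interpret information_space M "exp 1" by unfold_locales simp
  show ?thesis using entropy_le_card[OF simple_distributedI[OF assms _ refl]] assms
    by (simp add: shannon_eq_entropy log_def)
qed

lemma sum_prob_fibres:
  assumes "simple_function M X"
  shows "(\<Sum>v\<in>X ` space M. prob (X -` {v} \<inter> space M)) = 1"
proof -
  have fin: "finite (X ` space M)" and ms: "\<And>v. X -` {v} \<inter> space M \<in> sets M"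
    using simple_functionD[OF assms] by auto
  have "(\<Sum>v\<in>X ` space M. prob (X -` {v} \<inter> space M)) = prob (\<Union>v\<in>X ` space M. X -` {v} \<inter> space M)"
    using ms by (intro finite_measure_finite_Union[symmetric] fin) (auto simp: disjoint_family_on_def)
  also have "(\<Union>v\<in>X ` space M. X -` {v} \<inter> space M) = space M" by auto
  finally show ?thesis by (simp add: prob_space)
qed

lemma shannon_nonneg:
  assumes "simple_function M X"
  shows "shannon M X \<ge> 0"
proof -
  have "measure M A * ln (measure M A) \<le> 0" for A
    using mult_nonneg_nonpos[of "measure M A" "ln (measure M A)"] prob_le_1[of A]
    by (cases "measure M A = 0") (auto simp: zero_less_measure_iff)
  then show ?thesis by (auto simp: shannon_def intro!: sum_nonpos)
qed

text \<open>The finite variational inequality: \<open>ln u \<le> u - 1\<close> is applied to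
  \<open>u = exp (a v) / (Z * p)\<close>, with \<open>p\<close> the probability of the fibre over
  \<open>v\<close>, and averaged over \<open>v\<close>.\<close>

lemma gibbs:
  assumes "simple_function M X"
  shows "shannon M X + (\<Sum>v\<in>X ` space M. prob (X -` {v} \<inter> space M) * a v) \<le> ln (\<Sum>v\<in>X ` space M. exp (a v))"
proof -
  let ?V = "X ` space M" and ?p = "\<lambda>v. prob (X -` {v} \<inter> space M)"
  have fin: "finite ?V" using simple_functionD[OF assms] by auto
  have ne: "?V \<noteq> {}" using not_empty by auto
  define Z where "Z = (\<Sum>v\<in>?V. exp (a v))"
  have Z: "Z > 0" unfolding Z_def using fin ne by (intro sum_pos) auto
  have "- (?p v * ln (?p v)) + ?p v * a v - ?p v * ln Z \<le> exp (a v) / Z - ?p v" for v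
  proof (cases "?p v = 0")
    case False
    then have p: "?p v > 0" by (simp add: zero_less_measure_iff)
    have "ln (exp (a v) / (Z * ?p v)) \<le> exp (a v) / (Z * ?p v) - 1" using p Z by (intro ln_le_minus_one) auto
    moreover have "ln (exp (a v) / (Z * ?p v)) = a v - ln Z - ln (?p v)"
      using p Z by (simp add: ln_div ln_mult_pos)
    ultimately have "?p v * (a v - ln Z - ln (?p v)) \<le> ?p v * (exp (a v) / (Z * ?p v) - 1)"
      using p by (intro mult_left_mono) auto
    moreover have "?p v * (exp (a v) / (Z * ?p v) - 1) = exp (a v) / Z - ?p v"
      using p Z by (simp add: field_simps)
    ultimately show ?thesis by (simp add: algebra_simps)
  qed (use Z in simp)
  then have "(\<Sum>v\<in>?V. - (?p v * ln (?p v)) + ?p v * a v - ?p v * ln Z) \<le> (\<Sum>v\<in>?V. exp (a v) / Z - ?p v)"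
    by (intro sum_mono)
  also have "\<dots> = 0"
    using Z sum_prob_fibres[OF assms] by (simp add: sum_subtractf Z_def flip: sum_divide_distrib)
  finally show ?thesis
    using sum_prob_fibres[OF assms]
    by (simp add: sum_subtractf sum.distrib sum_negf shannon_def flip: sum_distrib_right Z_def)
qed

text \<open>\<open>gibbs\<close> with weight \<open>0\<close> at \<open>v0\<close> and
  \<open>- L\<close> elsewhere: a large \<open>L\<close> makes the first term small, and then a
  small probability of avoiding \<open>v0\<close> the second.\<close>

lemma shannon_small:
  assumes "simple_function M X" "card (X ` space M) \<le> k" "L \<ge> 0" "X -` {v0} \<inter> space M \<in> sets M"
  shows "shannon M X \<le> real k * exp (- L) + L * prob {x \<in> space M. X x \<noteq> v0}"
proof -
  let ?V = "X ` space M" and ?p = "\<lambda>v. prob (X -` {v} \<inter> space M)"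
  have fin: "finite ?V" using simple_functionD[OF assms(1)] by auto
  define a where "a v = (if v = v0 then 0 else - L)" for v
  have "(\<Sum>v\<in>?V. exp (a v)) \<le> 1 + real k * exp (- L)"
  proof -
    have "(\<Sum>v\<in>?V. exp (a v)) \<le> (\<Sum>v\<in>?V. (if v = v0 then 1 else 0) + exp (- L))"
      by (intro sum_mono) (auto simp: a_def)
    also have "\<dots> \<le> 1 + real (card ?V) * exp (- L)" using fin by (auto simp: sum.distrib)
    also have "\<dots> \<le> 1 + real k * exp (- L)" using assms(2) by (intro add_left_mono mult_right_mono) auto
    finally show ?thesis .
  qed
  moreover have "(\<Sum>v\<in>?V. exp (a v)) > 0" using fin not_empty by (intro sum_pos) auto
  ultimately have "ln (\<Sum>v\<in>?V. exp (a v)) \<le> ln (1 + real k * exp (- L))" by (subst ln_le_cancel_iff) auto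
  also have "\<dots> \<le> real k * exp (- L)" by (intro ln_add_one_self_le_self) auto
  finally have 1: "ln (\<Sum>v\<in>?V. exp (a v)) \<le> real k * exp (- L)" .
  have "(\<Sum>v\<in>?V. ?p v * a v) = (\<Sum>v\<in>?V - {v0}. ?p v * (- L))"
    using fin by (intro sum.mono_neutral_cong_right) (auto simp: a_def)
  also have "\<dots> = - L * (\<Sum>v\<in>?V - {v0}. ?p v)" by (simp add: sum_distrib_left mult.commute sum_negf)
  also have "(\<Sum>v\<in>?V - {v0}. ?p v) = prob (\<Union>v\<in>?V - {v0}. X -` {v} \<inter> space M)"
    using fin simple_functionD[OF assms(1)]
    by (intro finite_measure_finite_Union[symmetric]) (auto simp: disjoint_family_on_def)
  also have "(\<Union>v\<in>?V - {v0}. X -` {v} \<inter> space M) = {x \<in> space M. X x \<noteq> v0}" by auto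
  finally show ?thesis using gibbs[OF assms(1), of a] 1 by linarith
qed

lemma integral_le_fibre_sum:
  assumes X: "simple_function M X" and S: "integrable M S" "\<And>x. x \<in> space M \<Longrightarrow> S x \<le> a (X x)"
  shows "integral\<^sup>L M S \<le> (\<Sum>v\<in>X ` space M. prob (X -` {v} \<inter> space M) * a v)"
proof -
  have ind: "integrable M (indicat_real (X -` {v} \<inter> space M))" for v
    using simple_functionD[OF X] by (intro integrable_real_indicator) (auto simp: emeasure_eq_measure)
  have int: "integrable M (\<lambda>x. \<Sum>v\<in>X ` space M. indicator (X -` {v} \<inter> space M) x * a v)"
    using ind by (intro Bochner_Integration.integrable_sum integrable_mult_left)
  have eq: "a (X x) = (\<Sum>v\<in>X ` space M. indicator (X -` {v} \<inter> space M) x * a v)" if x: "x \<in> space M" for x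
  proof -
    have "(\<Sum>v\<in>X ` space M. indicator (X -` {v} \<inter> space M) x * a v) = (\<Sum>v\<in>{X x}. a v)"
      using simple_functionD[OF X] x by (intro sum.mono_neutral_cong_right) auto
    then show ?thesis by simp
  qed
  have "integral\<^sup>L M S \<le> (\<integral>x. (\<Sum>v\<in>X ` space M. indicator (X -` {v} \<inter> space M) x * a v) \<partial>M)"
    using S eq int by (intro integral_mono) auto
  also have "\<dots> = (\<Sum>v\<in>X ` space M. prob (X -` {v} \<inter> space M) * a v)"
    using simple_functionD[OF X] ind by (subst Bochner_Integration.integral_sum) auto
  finally show ?thesis .
qed

lemma simple_function_funpow:
  assumes "f \<in> measurable M M" "simple_function M c"
  shows "simple_function M (\<lambda>x. c ((f ^^ k) x))"
proof -
  have "f ^^ k \<in> measurable M M" using assms(1) by (induction k) auto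
  then show ?thesis using simple_function_comp[of "f ^^ k" M M c] assms(2) by simp
qed

lemma simple_function_itinerary:
  assumes "f \<in> measurable M M" "simple_function M c"
  shows "simple_function M (itinerary f c n)"
proof (induction n)
  case (Suc n)
  have "simple_function M (\<lambda>x. itinerary f c n x @ [c ((f ^^ n) x)])"
    by (rule simple_function_compose2[OF Suc simple_function_funpow[OF assms]])
  then show ?case by (simp add: itinerary_Suc[abs_def])
qed (simp add: itinerary_def[abs_def])

lemma shannon_invariant:
  assumes "f \<in> measurable M M" "distr M M f = M" "simple_function M X"
  shows "shannon M (\<lambda>x. X ((f ^^ k) x)) = shannon M X"
proof -
  have f: "f ^^ k \<in> measurable M M" using assms(1) by (induction k) auto
  have "distr M M (f ^^ k) = M"
  proof (induction k)
    case (Suc k)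
    have "f ^^ k \<in> measurable M M" using assms(1) by (induction k) auto
    then have "distr M M (f ^^ Suc k) = distr (distr M M (f ^^ k)) M f"
      unfolding funpow.simps by (rule distr_distr[OF assms(1), symmetric])
    then show ?case unfolding Suc assms(2) .
  qed (simp add: id_def)
  then have eq: "prob ((\<lambda>x. X ((f ^^ k) x)) -` {v} \<inter> space M) = prob (X -` {v} \<inter> space M)" for v
  proof -
    have "prob (X -` {v} \<inter> space M) = measure (distr M M (f ^^ k)) (X -` {v} \<inter> space M)"
      using \<open>distr M M (f ^^ k) = M\<close> by simp
    also have "\<dots> = prob ((f ^^ k) -` (X -` {v} \<inter> space M) \<inter> space M)"
      using simple_functionD[OF assms(3)] f by (intro measure_distr) auto
    also have "(f ^^ k) -` (X -` {v} \<inter> space M) \<inter> space M = (\<lambda>x. X ((f ^^ k) x)) -` {v} \<inter> space M"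
      using measurable_space[OF f] by auto
    finally show ?thesis by simp
  qed
  show ?thesis unfolding shannon_def eq
  proof (intro arg_cong[where f=uminus] sum.mono_neutral_left)
    show "(\<lambda>x. X ((f ^^ k) x)) ` space M \<subseteq> X ` space M" using measurable_space[OF f] by auto
    show "\<forall>v\<in>X ` space M - (\<lambda>x. X ((f ^^ k) x)) ` space M.
        prob (X -` {v} \<inter> space M) * ln (prob (X -` {v} \<inter> space M)) = 0"
    proof
      fix v assume "v \<in> X ` space M - (\<lambda>x. X ((f ^^ k) x)) ` space M"
      then have "(\<lambda>x. X ((f ^^ k) x)) -` {v} \<inter> space M = {}" by (force simp: image_iff)
      then have "prob (X -` {v} \<inter> space M) = 0" unfolding eq[symmetric] by simp
      then show "prob (X -` {v} \<inter> space M) * ln (prob (X -` {v} \<inter> space M)) = 0" by simp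
    qed
  qed (use simple_functionD[OF assms(3)] in auto)
qed

section \<open>Subadditivity along itineraries and Kolmogorov-Sinai entropy\<close>

lemma shannon_itinerary_add:
  assumes f: "f \<in> measurable M M" "distr M M f = M" and c: "simple_function M c"
  shows "shannon M (itinerary f c (m + n)) \<le> shannon M (itinerary f c m) + shannon M (itinerary f c n)"
proof -
  note sf = simple_function_itinerary[OF f(1) c]
  note sf2 = simple_function_funpow[OF f(1) sf]
  have "shannon M (itinerary f c (m + n)) \<le> shannon M (\<lambda>x. (itinerary f c m x, itinerary f c n ((f ^^ m) x)))"
    by (rule shannon_data) (use sf sf2 in \<open>auto simp: itinerary_add\<close>)
  also have "\<dots> \<le> shannon M (itinerary f c m) + shannon M (\<lambda>x. itinerary f c n ((f ^^ m) x))"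
    by (rule shannon_pair[OF sf sf2])
  also have "shannon M (\<lambda>x. itinerary f c n ((f ^^ m) x)) = shannon M (itinerary f c n)"
    by (rule shannon_invariant[OF f sf])
  finally show ?thesis .
qed

lemma shannon_itinerary_le:
  assumes f: "f \<in> measurable M M" "distr M M f = M" and c: "simple_function M c"
  shows "shannon M (itinerary f c n) \<le> real n * shannon M c"
proof (induction n)
  case 0
  have "(\<lambda>x. itinerary f c 0 x) ` space M = {[]}" using not_empty by (auto simp: itinerary_def)
  then show ?case using shannon_le_card[OF simple_function_itinerary[OF f(1) c], of 0] by simp
next
  case (Suc n)
  have "shannon M (itinerary f c 1) \<le> shannon M c"
    by (rule shannon_data[OF c]) (auto simp: itinerary_def)
  then show ?case using Suc shannon_itinerary_add[OF f c, of n 1] by (simp add: algebra_simps)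
qed

lemma itinerary_entropy_rate:
  assumes f: "f \<in> measurable M M" "distr M M f = M" and c: "simple_function M c"
  obtains h where "(\<lambda>n. shannon M (itinerary f c n) / real n) \<longlonglongrightarrow> h"
    "\<And>n. real n * h \<le> shannon M (itinerary f c n)"
proof -
  obtain h where h: "(\<lambda>n. shannon M (itinerary f c n) / real n) \<longlonglongrightarrow> h"
    "\<And>n. n \<ge> 1 \<Longrightarrow> real n * h \<le> shannon M (itinerary f c n)"
    by (rule fekete[of "\<lambda>n. shannon M (itinerary f c n)" 0])
      (use shannon_itinerary_add[OF f c] shannon_nonneg[OF simple_function_itinerary[OF f(1) c]] in auto)
  have "real n * h \<le> shannon M (itinerary f c n)" for n
    using h(2)[of n] shannon_nonneg[OF simple_function_itinerary[OF f(1) c], of n] by (cases n) auto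
  then show thesis using that h(1) by blast
qed

text \<open>A nonempty cell of the refinement is determined by any of its points, through the cells
  visited at the times below \<open>n\<close>. For \<open>n \<ge> 1\<close> the cell at time 0
  confines the intersection to the space.\<close>

lemma common_refinement_fibres:
  assumes n: "n \<ge> 1" and f: "f \<in> space M \<rightarrow> space M" and P: "partition_on (space M) P"
    and c: "\<And>x. x \<in> space M \<Longrightarrow> x \<in> c x" "\<And>x. x \<in> space M \<Longrightarrow> c x \<in> P"
  shows "common_refinement ((\<lambda>k. pullback_partition M f k P) ` {..<n}) =
     (\<lambda>v. itinerary f c n -` {v} \<inter> space M) ` (itinerary f c n ` space M)"
proof -
  have fk: "(f ^^ k) x \<in> space M" if "x \<in> space M" for x k
    using that f by (induction k) (auto simp: Pi_iff)
  have uniq: "A = c x" if "A \<in> P" "x \<in> A" for A x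
  proof -
    have x: "x \<in> space M" using P that by (auto simp: partition_on_def)
    show ?thesis using P that c[OF x] by (auto simp: partition_on_def disjoint_def)
  qed
  define cell where "cell k x = (f ^^ k) -` (c ((f ^^ k) x)) \<inter> space M" for k x
  have cell_in: "cell k x \<in> pullback_partition M f k P" "x \<in> cell k x" if "x \<in> space M" for k x
    using that c[OF fk[OF that]] by (auto simp: cell_def pullback_partition_def)
  have cell_uniq: "B = cell k x" if "B \<in> pullback_partition M f k P" "x \<in> B" for B k x
    using that uniq unfolding pullback_partition_def cell_def by auto
  have fib: "(\<Inter>k<n. cell k x) = itinerary f c n -` {itinerary f c n x} \<inter> space M" if x: "x \<in> space M" for x
  proof (intro set_eqI iffI)
    fix y assume y: "y \<in> (\<Inter>k<n. cell k x)"
    then have "y \<in> cell 0 x" using n by (meson INT_E lessThan_iff less_le_trans zero_less_one)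
    then have ys: "y \<in> space M" by (simp add: cell_def)
    have "c ((f ^^ k) y) = c ((f ^^ k) x)" if "k < n" for k
    proof -
      have "y \<in> cell k x" using y that by (meson INT_E lessThan_iff)
      then have "(f ^^ k) y \<in> c ((f ^^ k) x)" by (simp add: cell_def)
      then show ?thesis using uniq[OF c(2)[OF fk[OF x]]] by simp
    qed
    then show "y \<in> itinerary f c n -` {itinerary f c n x} \<inter> space M" using ys by (simp add: itinerary_eq_iff)
  next
    fix y assume "y \<in> itinerary f c n -` {itinerary f c n x} \<inter> space M"
    then have y: "y \<in> space M" "\<And>k. k < n \<Longrightarrow> c ((f ^^ k) y) = c ((f ^^ k) x)" by (auto simp: itinerary_eq_iff)
    show "y \<in> (\<Inter>k<n. cell k x)"
    proof (rule INT_I)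
      fix k assume "k \<in> {..<n}"
      then show "y \<in> cell k x" using y(1) c(1)[OF fk[OF y(1)], of k] y(2)[of k] by (simp add: cell_def)
    qed
  qed
  let ?PP = "(\<lambda>k. pullback_partition M f k P) ` {..<n}"
  show ?thesis
  proof (intro set_eqI iffI)
    fix B assume "B \<in> common_refinement ?PP"
    then obtain F where F: "F \<in> (\<Pi> Q\<in>?PP. Q)" "B = \<Inter>(F ` ?PP)" "B \<noteq> {}"
      unfolding common_refinement by blast
    then obtain x where x: "x \<in> B" by blast
    have FB: "F (pullback_partition M f k P) = cell k x" if "k < n" for k
      using F(1,2) x that by (intro cell_uniq) auto
    then have "B = (\<Inter>k<n. cell k x)" unfolding F(2) by auto
    moreover have "x \<in> cell 0 x"
      using x n unfolding \<open>B = (\<Inter>k<n. cell k x)\<close> by (meson INT_E lessThan_iff less_le_trans zero_less_one)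
    then have "x \<in> space M" by (simp add: cell_def)
    ultimately show "B \<in> (\<lambda>v. itinerary f c n -` {v} \<inter> space M) ` (itinerary f c n ` space M)"
      using fib by blast
  next
    fix B assume "B \<in> (\<lambda>v. itinerary f c n -` {v} \<inter> space M) ` (itinerary f c n ` space M)"
    then obtain x where x: "x \<in> space M" "B = (\<Inter>k<n. cell k x)" using fib by blast
    define F where "F Q = (THE A. A \<in> Q \<and> x \<in> A)" for Q
    have F: "F (pullback_partition M f k P) = cell k x" for k
      unfolding F_def using cell_in[OF x(1)] cell_uniq by (intro the_equality) auto
    have "F \<in> (\<Pi> Q\<in>?PP. Q)" using cell_in(1)[OF x(1)] F by auto
    moreover have "B = \<Inter>(F ` ?PP)" using x(2) F by auto
    moreover have "x \<in> B" unfolding x(2) using cell_in(2)[OF x(1)] by (intro INT_I)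
    then have "B \<noteq> {}" by blast
    ultimately show "B \<in> common_refinement ?PP" unfolding common_refinement by blast
  qed
qed

lemma entropy_wrt_eq:
  assumes f: "f \<in> measurable M M" and P: "partition_on (space M) P"
    and c: "\<And>x. x \<in> space M \<Longrightarrow> x \<in> c x" "\<And>x. x \<in> space M \<Longrightarrow> c x \<in> P"
  shows "entropy_wrt M f P = lim (\<lambda>n. shannon M (itinerary f c n) / real n)"
proof -
  have fs: "f \<in> space M \<rightarrow> space M" using measurable_space[OF f] by auto
  have "partition_entropy M (common_refinement ((\<lambda>k. pullback_partition M f k P) ` {..<n})) / real n =
      shannon M (itinerary f c n) / real n" for n
  \<comment> \<open>For \<open>n = 0\<close> both quotients are divisions by zero, hence 0.\<close>
  proof (cases "n \<ge> 1")
    case True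
    have inj: "inj_on (\<lambda>v. itinerary f c n -` {v} \<inter> space M) (itinerary f c n ` space M)"
      by (auto simp: inj_on_def)
    have eq: "common_refinement ((\<lambda>k. pullback_partition M f k P) ` {..<n}) =
        (\<lambda>v. itinerary f c n -` {v} \<inter> space M) ` (itinerary f c n ` space M)"
      by (rule common_refinement_fibres[OF True fs P]) (use c in auto)
    have "partition_entropy M (common_refinement ((\<lambda>k. pullback_partition M f k P) ` {..<n})) =
        shannon M (itinerary f c n)"
      unfolding partition_entropy_def eq shannon_def
      by (subst sum.reindex[OF inj]) simp
    then show ?thesis by simp
  qed simp
  then show ?thesis unfolding entropy_wrt_def by (simp only:)
qed

text \<open>The upper half of the variational principle in abstract form. In the application
  \<open>e\<close> codes points by a spanning set, \<open>W\<close> marks at small entropy the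
  points badly placed in their cell, and the first \<open>k0\<close> symbols are recorded outright;
  together they determine the itinerary of \<open>c\<close>. \<open>gibbs\<close> bounds the entropy
  of \<open>e\<close> plus the integral by the logarithm of the sum over codes.\<close>

lemma entropy_pressure_bound:
  assumes f: "f \<in> measurable M M" "distr M M f = M" and c: "simple_function M c"
    and S: "\<And>n. integrable M (S n)" "\<And>n. integral\<^sup>L M (S n) = real n * I"
    and ex: "\<And>\<eta>. \<eta> > 0 \<Longrightarrow> \<exists>(W :: 'a \<Rightarrow> 'd) k0 C. simple_function M W \<and> shannon M W \<le> \<eta> \<and>
      (\<forall>n. \<exists>(e :: 'a \<Rightarrow> 'e) a. simple_function M e \<and> (\<forall>x\<in>space M. S n x \<le> a (e x)) \<and>
         (\<Sum>v\<in>e ` space M. exp (a v)) \<le> C * exp (real n * (r + \<eta>)) \<and>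
         (\<forall>x\<in>space M. \<forall>y\<in>space M. e x = e y \<longrightarrow> itinerary f W n x = itinerary f W n y \<longrightarrow>
            itinerary f c k0 x = itinerary f c k0 y \<longrightarrow> itinerary f c n x = itinerary f c n y))"
  shows "lim (\<lambda>n. shannon M (itinerary f c n) / real n) + I \<le> r"
proof (rule field_le_epsilon)
  fix \<epsilon> :: real assume "\<epsilon> > 0"
  \<comment> \<open>One half pays for the entropy of \<open>W\<close> per step, the other for the
    growth rate \<open>r + \<eta>\<close>.\<close>
  define \<eta> where "\<eta> = \<epsilon> / 2"
  have \<eta>: "\<eta> > 0" using \<open>\<epsilon> > 0\<close> by (simp add: \<eta>_def)
  obtain h where h: "(\<lambda>n. shannon M (itinerary f c n) / real n) \<longlonglongrightarrow> h"
    "\<And>n. real n * h \<le> shannon M (itinerary f c n)" using itinerary_entropy_rate[OF f c] by blast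
  obtain W :: "'a \<Rightarrow> 'd" and k0 C where W: "simple_function M W" "shannon M W \<le> \<eta>" and
    ex': "\<And>n. \<exists>(e :: 'a \<Rightarrow> 'e) a. simple_function M e \<and> (\<forall>x\<in>space M. S n x \<le> a (e x)) \<and>
         (\<Sum>v\<in>e ` space M. exp (a v)) \<le> C * exp (real n * (r + \<eta>)) \<and>
         (\<forall>x\<in>space M. \<forall>y\<in>space M. e x = e y \<longrightarrow> itinerary f W n x = itinerary f W n y \<longrightarrow>
            itinerary f c k0 x = itinerary f c k0 y \<longrightarrow> itinerary f c n x = itinerary f c n y)"
    using ex[OF \<eta>] by blast
  define K where "K = shannon M (itinerary f c k0)"
  have bound: "real n * (h + I) \<le> ln (C + 1) + real n * (r + \<epsilon>) + K \<and> C \<ge> 0" for n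
  proof -
    obtain e :: "'a \<Rightarrow> 'e" and a where e: "simple_function M e" "\<forall>x\<in>space M. S n x \<le> a (e x)"
      "(\<Sum>v\<in>e ` space M. exp (a v)) \<le> C * exp (real n * (r + \<eta>))"
      "\<forall>x\<in>space M. \<forall>y\<in>space M. e x = e y \<longrightarrow> itinerary f W n x = itinerary f W n y \<longrightarrow>
            itinerary f c k0 x = itinerary f c k0 y \<longrightarrow> itinerary f c n x = itinerary f c n y"
      using ex'[of n] by blast
    note sW = simple_function_itinerary[OF f(1) W(1)] and sc = simple_function_itinerary[OF f(1) c]
    have "shannon M (itinerary f c n) \<le> shannon M (\<lambda>x. (e x, (itinerary f W n x, itinerary f c k0 x)))"
    proof (rule shannon_data[OF simple_function_Pair[OF e(1) simple_function_Pair[OF sW sc]]])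
      fix x y assume xy: "x \<in> space M" "y \<in> space M"
        "(e x, itinerary f W n x, itinerary f c k0 x) = (e y, itinerary f W n y, itinerary f c k0 y)"
      then show "itinerary f c n x = itinerary f c n y"
        using bspec[OF bspec[OF e(4) xy(1)] xy(2)] by simp
    qed
    also have "\<dots> \<le> shannon M e + shannon M (\<lambda>x. (itinerary f W n x, itinerary f c k0 x))"
      by (rule shannon_pair[OF e(1) simple_function_Pair[OF sW sc]])
    also have "shannon M (\<lambda>x. (itinerary f W n x, itinerary f c k0 x)) \<le> shannon M (itinerary f W n) + K"
      unfolding K_def by (rule shannon_pair[OF sW sc])
    also have "shannon M (itinerary f W n) \<le> real n * \<eta>"
      using shannon_itinerary_le[OF f W(1), of n] W(2) by (meson mult_left_mono of_nat_0_le_iff order_trans)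
    finally have f1: "real n * h \<le> shannon M e + (real n * \<eta> + K)" using h(2)[of n] by simp
    have f2: "real n * I \<le> (\<Sum>v\<in>e ` space M. prob (e -` {v} \<inter> space M) * a v)"
      using integral_le_fibre_sum[OF e(1) S(1)[of n], of a] e(2) S(2)[of n] by simp
    have pos: "0 < (\<Sum>v\<in>e ` space M. exp (a v))"
      using simple_functionD[OF e(1)] not_empty by (intro sum_pos) auto
    have "0 < C * exp (real n * (r + \<eta>))" using pos e(3) by linarith
    then have C: "C > 0" by (simp add: zero_less_mult_iff)
    have "ln (\<Sum>v\<in>e ` space M. exp (a v)) \<le> ln (C * exp (real n * (r + \<eta>)))"
      using e(3) pos by (subst ln_le_cancel_iff) auto
    moreover have "ln (C * exp (real n * (r + \<eta>))) \<le> ln (C + 1) + real n * (r + \<eta>)"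
      using C by (simp add: ln_mult_pos)
    moreover have "real n * (r + \<eta>) + real n * \<eta> = real n * (r + \<epsilon>)" by (simp add: \<eta>_def algebra_simps)
    ultimately show ?thesis using gibbs[OF e(1), of a] C f1 f2 unfolding distrib_left by linarith
  qed
  have "h + I \<le> (ln (C + 1) + K) / real n + (r + \<epsilon>)" if "n \<ge> 1" for n
    using bound[of n] that by (simp add: field_simps)
  moreover have "(\<lambda>n. (ln (C + 1) + K) / real n + (r + \<epsilon>)) \<longlonglongrightarrow> 0 + (r + \<epsilon>)"
    by (intro tendsto_intros lim_const_over_n)
  ultimately have "h + I \<le> 0 + (r + \<epsilon>)" by (intro LIMSEQ_le_const) auto
  moreover have "lim (\<lambda>n. shannon M (itinerary f c n) / real n) = h" by (rule limI[OF h(1)])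
  ultimately show "lim (\<lambda>n. shannon M (itinerary f c n) / real n) + I \<le> r + \<epsilon>" by simp
qed

end

section \<open>Probability measures on compact sets\<close>

lemma sets_restrict_borel_closed:
  fixes K :: "'b::metric_space set"
  assumes "closed K"
  shows "sets (restrict_space borel K) = sigma_sets K ((\<inter>) K ` Collect closed)"
proof -
  have b: "sets (borel :: 'b measure) = sigma_sets UNIV (Collect closed)" by (simp add: borel_eq_closed)
  show ?thesis unfolding sets_restrict_space b
    by (rule sigma_sets_Int) (use assms in auto)
qed

locale borel_prob = prob_space M for M :: "'b::metric_space measure" +
  fixes K :: "'b set"
  assumes sets_M: "sets M = sets (restrict_space borel K)" and compact_K: "compact K"
begin

lemma space_M: "space M = K"
  using sets_eq_imp_space_eq[OF sets_M] by (simp add: space_restrict_space)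

lemma Int_K_sets [simp]: "B \<in> sets borel \<Longrightarrow> B \<inter> K \<in> sets M"
  unfolding sets_M sets_restrict_space by auto

lemma sets_M_eq: "A \<in> sets M \<longleftrightarrow> (\<exists>B\<in>sets borel. A = B \<inter> K)"
  unfolding sets_M sets_restrict_space by auto

lemma cont_measurable: "continuous_on K u \<Longrightarrow> u \<in> borel_measurable M"
  using borel_measurable_continuous_on_restrict[of K u] measurable_cong_sets[OF sets_M refl] by blast

lemma cont_integrable:
  fixes u :: "'b \<Rightarrow> real"
  assumes "continuous_on K u"
  shows "integrable M u"
proof -
  have "bounded (u ` K)" using compact_continuous_image[OF assms compact_K] compact_imp_bounded by blast
  then obtain B where "\<And>x. x \<in> K \<Longrightarrow> norm (u x) \<le> B" by (auto simp: bounded_iff)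
  then show ?thesis using cont_measurable[OF assms] space_M
    by (intro integrable_const_bound[where B=B]) auto
qed

text \<open>The sets that can be squeezed in this way form a sigma-algebra; closed sets belong to it
  because their distance neighbourhoods decrease to them.\<close>

lemma closed_open_approx:
  assumes "B \<in> sets borel" "e > 0"
  shows "\<exists>C D. closed C \<and> open D \<and> C \<subseteq> B \<and> B \<subseteq> D \<and> measure M ((D - C) \<inter> K) < e"
proof -
  have "B \<in> sigma_sets UNIV (Collect closed)" using assms(1) by (simp add: borel_eq_closed)
  then show ?thesis using assms(2)
  proof (induction arbitrary: e)
    case (Basic F)
    show ?case
    proof (cases "F = {}")
      case True
      then show ?thesis using Basic by (intro exI[of _ "{}"]) auto
    next
      case False
      define D where "D n = {x. infdist x F < 1 / real (Suc n)}" for n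
      have opD: "open (D n)" for n unfolding D_def by (intro open_Collect_less continuous_intros)
      have FD: "F \<subseteq> D n" for n by (auto simp: D_def)
      have dec: "decseq (\<lambda>n. (D n - F) \<inter> K)"
      proof (rule decseq_SucI)
        fix n
        have "1 / real (Suc (Suc n)) \<le> 1 / real (Suc n)" by (simp add: frac_le)
        then show "(D (Suc n) - F) \<inter> K \<subseteq> (D n - F) \<inter> K" by (auto simp: D_def)
      qed
      have sets: "range (\<lambda>n. (D n - F) \<inter> K) \<subseteq> sets M"
        using opD Basic by (auto intro!: Int_K_sets sets.Diff)
      have "(\<Inter>n. (D n - F) \<inter> K) = {}"
      proof -
        have "x \<in> F" if "\<And>n. x \<in> D n" for x
        proof -
          have "infdist x F \<le> 0"
          proof (rule field_le_epsilon)
            fix e :: real assume "e > 0"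
            then obtain n where "1 / real (Suc n) < e" using nat_approx_posE by blast
            then show "infdist x F \<le> 0 + e" using that[of n] by (simp add: D_def)
          qed
          then have "infdist x F = 0" using infdist_nonneg[of x F] by linarith
          then show ?thesis using Basic False in_closed_iff_infdist_zero by blast
        qed
        then show ?thesis by auto
      qed
      then have "(\<lambda>n. measure M ((D n - F) \<inter> K)) \<longlonglongrightarrow> 0"
        using finite_Lim_measure_decseq[OF sets dec] by simp
      then have "\<forall>\<^sub>F n in sequentially. measure M ((D n - F) \<inter> K) < e"
        using Basic(2) by (intro order_tendstoD(2)) auto
      then obtain n where "measure M ((D n - F) \<inter> K) < e" unfolding eventually_sequentially by blast
      then show ?thesis using Basic opD FD by blast
    qed
  next
    case Empty
    show ?case by (rule exI[of _ "{}"], rule exI[of _ "{}"]) (use Empty in simp)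
  next
    case (Compl A)
    obtain C D where CD: "closed C" "open D" "C \<subseteq> A" "A \<subseteq> D" "measure M ((D - C) \<inter> K) < e"
      using Compl.IH[OF Compl.prems] by blast
    have "- C - - D = D - C" by auto
    then show ?case using CD by (intro exI[of _ "- D"] exI[of _ "- C"]) (simp add: Compl_eq_Diff_UNIV[symmetric] closed_Compl open_Compl)
  next
    case (Union A)
    have "\<exists>C D. closed C \<and> open D \<and> C \<subseteq> A i \<and> A i \<subseteq> D \<and> measure M ((D - C) \<inter> K) < e / 2 * (1 / 2) ^ Suc i" for i
      by (rule Union.IH) (use Union.prems in simp)
    then obtain C D where CD: "\<And>i. closed (C i)" "\<And>i. open (D i)" "\<And>i. C i \<subseteq> A i" "\<And>i. A i \<subseteq> D i"
      "\<And>i. measure M ((D i - C i) \<inter> K) < e / 2 * (1 / 2) ^ Suc i" by metis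
    \<comment> \<open>A union of infinitely many closed sets need not be closed, so it is cut off at
      \<open>N\<close>; \<open>E N\<close> decreases to a set covered by the individual errors, of
      total measure at most \<open>e / 2\<close>.\<close>
    define E where "E N = ((\<Union>i. D i) - (\<Union>i<N. C i)) \<inter> K" for N :: nat
    have bor: "D i \<in> sets borel" "C i \<in> sets borel" for i using CD by auto
    have "range E \<subseteq> sets M" unfolding E_def using bor by (auto intro!: Int_K_sets sets.Diff)
    moreover have "decseq E" unfolding E_def decseq_def by fastforce
    ultimately have lim: "(\<lambda>N. measure M (E N)) \<longlonglongrightarrow> measure M (\<Inter>N. E N)"
      by (rule finite_Lim_measure_decseq)
    have sm: "(\<lambda>i. e / 2 * (1 / 2) ^ Suc i) sums (e / 2)"
    proof -
      have "(\<lambda>i. (1 / 2 :: real) ^ Suc i) sums 1" using power_half_series by simp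
      from sums_mult[OF this, of "e / 2"] show ?thesis by simp
    qed
    have sm2: "summable (\<lambda>i. measure M ((D i - C i) \<inter> K))"
      using CD(5) by (intro summable_comparison_test'[OF sums_summable[OF sm], of 0]) (auto simp: less_imp_le)
    have "measure M (\<Inter>N. E N) \<le> measure M (\<Union>i. (D i - C i) \<inter> K)"
    proof (rule finite_measure_mono)
      show "(\<Inter>N. E N) \<subseteq> (\<Union>i. (D i - C i) \<inter> K)"
      proof
        fix x assume x: "x \<in> (\<Inter>N. E N)"
        then have "x \<in> E 0" by blast
        then obtain i where i: "x \<in> D i" "x \<in> K" unfolding E_def by blast
        have "x \<in> E (Suc i)" using x by blast
        then show "x \<in> (\<Union>i. (D i - C i) \<inter> K)" using i unfolding E_def by blast
      qed
      show "(\<Union>i. (D i - C i) \<inter> K) \<in> sets M" using bor by (intro sets.countable_UN) auto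
    qed
    also have "\<dots> \<le> (\<Sum>i. measure M ((D i - C i) \<inter> K))"
      using bor sm2 by (intro finite_measure_subadditive_countably) (auto intro!: Int_K_sets)
    also have "\<dots> \<le> (\<Sum>i. e / 2 * (1 / 2) ^ Suc i)"
      using CD(5) sm2 sums_summable[OF sm] by (intro suminf_le) (auto simp: less_imp_le)
    also have "\<dots> = e / 2" using sums_unique[OF sm] by simp
    also have "\<dots> < e" using Union by simp
    finally have "\<forall>\<^sub>F N in sequentially. measure M (E N) < e" using lim by (intro order_tendstoD(2))
    then obtain N where N: "measure M (E N) < e" unfolding eventually_sequentially by blast
    show ?case
    proof (intro exI conjI)
      show "closed (\<Union>i<N. C i)" using CD(1) by (intro closed_UN) simp_all
      show "open (\<Union>i. D i)" using CD(2) by (intro open_UN) simp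
      show "(\<Union>i<N. C i) \<subseteq> (\<Union>i. A i)" using CD(3) by blast
      show "(\<Union>i. A i) \<subseteq> (\<Union>i. D i)" using CD(4) by blast
      show "measure M (((\<Union>i. D i) - (\<Union>i<N. C i)) \<inter> K) < e" using N unfolding E_def .
    qed
  qed
qed

lemma compact_approx:
  assumes "A \<in> sets M" "e > 0"
  obtains C where "compact C" "C \<subseteq> A" "measure M (A - C) < e"
proof -
  obtain B where B: "B \<in> sets borel" "A = B \<inter> K" using assms(1) by (auto simp: sets_M_eq)
  obtain C D where CD: "closed C" "open D" "C \<subseteq> B" "B \<subseteq> D" "measure M ((D - C) \<inter> K) < e"
    using closed_open_approx[OF B(1) assms(2)] by blast
  have "measure M (A - (C \<inter> K)) \<le> measure M ((D - C) \<inter> K)"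
    using CD B by (intro finite_measure_mono Int_K_sets) auto
  moreover have "compact (C \<inter> K)" using closed_Int_compact[OF CD(1) compact_K] .
  ultimately show thesis using that[of "C \<inter> K"] CD B by auto
qed

end

text \<open>The integrands decrease to the indicator of \<open>F\<close> composed with \<pi>, and
  are Lipschitz in the value of \<pi>, so integrals of Lipschitz functions determine the measures of
  closed sets. \<open>F\<close> is nonempty because \<open>infdist\<close> to the empty set is
  0.\<close>

lemma (in prob_space) measure_closed_limit:
  fixes \<pi> :: "'a \<Rightarrow> 'c::metric_space"
  assumes \<pi>: "\<pi> \<in> borel_measurable M" and F: "closed F" "F \<noteq> {}"
  shows "(\<lambda>k. \<integral>x. max 0 (1 - real k * infdist (\<pi> x) F) \<partial>M) \<longlonglongrightarrow> measure M (\<pi> -` F \<inter> space M)"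
proof -
  have sets: "\<pi> -` F \<inter> space M \<in> sets M" using F by (intro measurable_sets[OF \<pi>]) auto
  have "(\<lambda>k. \<integral>x. max 0 (1 - real k * infdist (\<pi> x) F) \<partial>M) \<longlonglongrightarrow> (\<integral>x. indicator (\<pi> -` F \<inter> space M) x \<partial>M)"
  proof (rule integral_dominated_convergence[where w="\<lambda>_. 1"])
    show "(\<lambda>x. max 0 (1 - real k * infdist (\<pi> x) F)) \<in> borel_measurable M" for k
      using \<pi> by (intro borel_measurable_max borel_measurable_const borel_measurable_diff borel_measurable_times
          measurable_compose[OF \<pi> borel_measurable_continuous_onI] continuous_intros)
    show "AE x in M. (\<lambda>k. max 0 (1 - real k * infdist (\<pi> x) F)) \<longlonglongrightarrow> indicator (\<pi> -` F \<inter> space M) x"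
    proof (rule AE_I2)
      fix x assume x: "x \<in> space M"
      show "(\<lambda>k. max 0 (1 - real k * infdist (\<pi> x) F)) \<longlonglongrightarrow> indicator (\<pi> -` F \<inter> space M) x"
      proof (cases "\<pi> x \<in> F")
        case True
        then show ?thesis using x by simp
      next
        case False
        then have pos: "infdist (\<pi> x) F > 0"
          using F in_closed_iff_infdist_zero[of F "\<pi> x"] infdist_nonneg[of "\<pi> x" F] by linarith
        obtain k0 :: nat where k0: "real k0 > 1 / infdist (\<pi> x) F" using reals_Archimedean2 by blast
        have "max 0 (1 - real k * infdist (\<pi> x) F) = 0" if "k \<ge> k0" for k
        proof -
          have "1 / infdist (\<pi> x) F < real k" using k0 that by linarith
          then show ?thesis using pos by (simp add: field_simps)
        qed
        then have "\<forall>\<^sub>F k in sequentially. max 0 (1 - real k * infdist (\<pi> x) F) = 0"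
          unfolding eventually_sequentially by blast
        then show ?thesis using False by (simp add: tendsto_eventually)
      qed
    qed
    show "AE x in M. norm (max 0 (1 - real k * infdist (\<pi> x) F)) \<le> 1" for k
      by (intro AE_I2) (simp add: mult_nonneg_nonneg[OF of_nat_0_le_iff infdist_nonneg])
    show "(indicator (\<pi> -` F \<inter> space M) :: 'a \<Rightarrow> real) \<in> borel_measurable M"
      using sets by simp
  qed simp
  then show ?thesis using sets by simp
qed

lemma borel_prob_eqI:
  assumes "borel_prob M K" "borel_prob N K"
    and eq: "\<And>F. closed F \<Longrightarrow> F \<noteq> {} \<Longrightarrow> measure M (F \<inter> K) = measure N (F \<inter> K)"
  shows "M = N"
proof -
  interpret M: borel_prob M K by fact
  interpret N: borel_prob N K by fact
  have cl: "closed K" using M.compact_K compact_imp_closed by blast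
  show ?thesis
  proof (rule measure_eqI_generator_eq[where E="(\<inter>) K ` Collect closed" and A="\<lambda>_. K" and \<Omega>=K])
    show "Int_stable ((\<inter>) K ` Collect closed)"
    proof (rule Int_stableI)
      fix a b assume "a \<in> (\<inter>) K ` Collect closed" "b \<in> (\<inter>) K ` Collect closed"
      then obtain A B where "closed A" "closed B" "a = K \<inter> A" "b = K \<inter> B" by auto
      then show "a \<inter> b \<in> (\<inter>) K ` Collect closed" by (intro image_eqI[of _ _ "A \<inter> B"]) auto
    qed
    fix X assume "X \<in> (\<inter>) K ` Collect closed"
    then obtain F where "closed F" "X = F \<inter> K" by auto
    then show "emeasure M X = emeasure N X"
      using eq[of F] by (cases "F = {}") (auto simp: M.emeasure_eq_measure N.emeasure_eq_measure)
  qed (use M.sets_M N.sets_M sets_restrict_borel_closed[OF cl] cl in auto)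
qed

lemma borel_prob_eqI_integral:
  assumes "borel_prob M K" "borel_prob N K"
    and eq: "\<And>u :: 'b::metric_space \<Rightarrow> real. continuous_on K u \<Longrightarrow> integral\<^sup>L M u = integral\<^sup>L N u"
  shows "M = N"
proof (rule borel_prob_eqI[OF assms(1,2)])
  interpret M: borel_prob M K by fact
  interpret N: borel_prob N K by fact
  fix F :: "'b set" assume F: "closed F" "F \<noteq> {}"
  let ?u = "\<lambda>k x. max 0 (1 - real k * infdist x F)"
  have cu: "continuous_on K (?u k)" for k by (intro continuous_intros)
  have id: "(\<lambda>x. x) \<in> borel_measurable M" "(\<lambda>x. x) \<in> borel_measurable N"
    using M.cont_measurable[of "\<lambda>x. x"] N.cont_measurable[of "\<lambda>x. x"] by auto
  have "(\<lambda>k. integral\<^sup>L M (?u k)) \<longlonglongrightarrow> measure M (F \<inter> K)"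
    using M.measure_closed_limit[OF id(1) F] by (simp add: M.space_M)
  moreover have "(\<lambda>k. integral\<^sup>L M (?u k)) \<longlonglongrightarrow> measure N (F \<inter> K)"
    using N.measure_closed_limit[OF id(2) F] by (simp add: N.space_M eq[OF cu])
  ultimately show "measure M (F \<inter> K) = measure N (F \<inter> K)" by (rule LIMSEQ_unique)
qed

text \<open>A possibly discontinuous embedding into an interval with uniformly continuous inverse, which transports Helly's selection
  theorem to \<open>K\<close>.\<close>

lemma compact_code:
  fixes K :: "'b::metric_space set"
  assumes "compact K"
  obtains p :: "'b \<Rightarrow> real" where "\<And>x. 0 \<le> p x" "\<And>x. p x \<le> 1"
    "\<And>e. e > 0 \<Longrightarrow> \<exists>d>0. \<forall>x\<in>K. \<forall>y\<in>K. \<bar>p x - p y\<bar> < d \<longrightarrow> dist x y < e"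
proof -
  have "\<exists>(k :: nat) (a :: 'b \<Rightarrow> nat). (\<forall>x. a x \<le> k) \<and> (\<forall>x\<in>K. \<forall>y\<in>K. a x = a y \<longrightarrow> dist x y < 1 / real (Suc n))" for n
  proof -
    have "1 / real (Suc n) / 2 > 0" by simp
    then obtain C where C: "finite C" "K \<subseteq> (\<Union>c\<in>C. ball c (1 / real (Suc n) / 2))"
      using assms[unfolded compact_eq_totally_bounded] by blast
    obtain h :: "'b \<Rightarrow> nat" where h: "inj_on h C" using finite_imp_inj_to_nat_seg[OF C(1)] by blast
    have "\<exists>c\<in>C. dist c x < 1 / real (Suc n) / 2" if "x \<in> K" for x
      using subsetD[OF C(2) that] by auto
    then obtain c where c: "\<And>x. x \<in> K \<Longrightarrow> c x \<in> C" "\<And>x. x \<in> K \<Longrightarrow> dist (c x) x < 1 / real (Suc n) / 2" by metis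
    define a where "a x = (if x \<in> K then h (c x) else 0)" for x
    have "a x \<le> (\<Sum>c\<in>C. h c)" for x
      using c(1)[of x] C(1) by (auto simp: a_def intro: member_le_sum)
    moreover have "dist x y < 1 / real (Suc n)" if "x \<in> K" "y \<in> K" "a x = a y" for x y
    proof -
      have "c x = c y" using that h c(1) by (auto simp: a_def inj_on_def)
      then show ?thesis using c(2)[OF that(1)] c(2)[OF that(2)] dist_triangle_half_r by metis
    qed
    ultimately show ?thesis by (intro exI[of _ "\<Sum>c\<in>C. h c"] exI[of _ a]) blast
  qed
  then obtain k :: "nat \<Rightarrow> nat" and a :: "nat \<Rightarrow> 'b \<Rightarrow> nat" where a: "\<And>n x. a n x \<le> k n"
    "\<And>n x y. x \<in> K \<Longrightarrow> y \<in> K \<Longrightarrow> a n x = a n y \<Longrightarrow> dist x y < 1 / real (Suc n)" by metis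
  \<comment> \<open>Mixed-radix weights: the digit at position \<open>n\<close> is at most
    \<open>k n\<close>, so all digits after position \<open>n\<close> together contribute at most
    \<open>V n / 3\<close>, and the first differing digit decides how far apart two codes
    are.\<close>
  define V where "V n = (\<Prod>i\<le>n. 1 / (4 * (real (k i) + 1)))" for n
  have V0: "V n > 0" for n unfolding V_def by (intro prod_pos) auto
  have V4: "real (a (Suc n) x) * V (Suc n) \<le> V n / 4" for n x
  proof -
    have "V (Suc n) = V n * (1 / (4 * (real (k (Suc n)) + 1)))" by (simp add: V_def)
    then have "real (a (Suc n) x) * V (Suc n) = V n / 4 * (real (a (Suc n) x) / (real (k (Suc n)) + 1))" by simp
    also have "\<dots> \<le> V n / 4 * 1" using a(1)[of "Suc n" x] V0[of n] by (intro mult_left_mono) auto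
    finally show ?thesis by simp
  qed
  have Vdec: "V (n + j) \<le> V n * (1 / 4) ^ j" for n j
  proof (induction j)
    case (Suc j)
    have "V (Suc (n + j)) = V (n + j) * (1 / (4 * (real (k (Suc (n + j))) + 1)))" by (simp add: V_def)
    also have "\<dots> \<le> V (n + j) * (1 / 4)" using V0[of "n + j"] by (intro mult_left_mono) (auto simp: field_simps)
    also have "\<dots> \<le> V n * (1 / 4) ^ j * (1 / 4)" using Suc by (intro mult_right_mono) auto
    finally show ?case by simp
  qed simp
  have tb: "real (a (Suc (n + j)) x) * V (Suc (n + j)) \<le> V n / 4 * (1 / 4) ^ j" for n j x
    using V4[of "n + j" x] Vdec[of n j] by simp
  have geo: "(\<lambda>j. V n / 4 * (1 / 4) ^ j) sums (V n / 3)" for n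
    using sums_mult[OF geometric_sums[of "1 / 4 :: real"], of "V n / 4"] by simp
  define p where "p x = (\<Sum>n. real (a n x) * V n)" for x
  have sm_tail: "summable (\<lambda>j. real (a (Suc (n + j)) x) * V (Suc (n + j)))" for n x
    using tb V0 by (intro summable_comparison_test'[OF sums_summable[OF geo[of n]], of 0]) (auto simp: less_imp_le)
  have sm: "summable (\<lambda>n. real (a n x) * V n)" for x
    using sm_tail[of 0 x] summable_Suc_iff[of "\<lambda>n. real (a n x) * V n"] by simp
  have tail: "0 \<le> (\<Sum>j. real (a (Suc (n + j)) x) * V (Suc (n + j)))"
    "(\<Sum>j. real (a (Suc (n + j)) x) * V (Suc (n + j))) \<le> V n / 3" for n x
  proof -
    show "0 \<le> (\<Sum>j. real (a (Suc (n + j)) x) * V (Suc (n + j)))"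
      using V0 by (intro suminf_nonneg sm_tail) (auto simp: less_imp_le)
    show "(\<Sum>j. real (a (Suc (n + j)) x) * V (Suc (n + j))) \<le> V n / 3"
      using suminf_le[OF tb sm_tail sums_summable[OF geo], of n x] unfolding sums_unique[OF geo[of n], symmetric] .
  qed
  have split: "p x = (\<Sum>i\<le>n. real (a i x) * V i) + (\<Sum>j. real (a (Suc (n + j)) x) * V (Suc (n + j)))" for x n
    unfolding p_def using suminf_split_initial_segment[OF sm[of x], of "Suc n"]
    by (simp add: lessThan_Suc_atMost add.commute)
  have p0: "0 \<le> p x" for x unfolding p_def using V0 by (intro suminf_nonneg sm) (auto simp: less_imp_le)
  have p1: "p x \<le> 1" for x
  proof -
    have "real (a 0 x) * V 0 \<le> 1 / 4" using a(1)[of 0 x] by (simp add: V_def field_simps)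
    moreover have "V 0 \<le> 1 / 4" by (simp add: V_def field_simps)
    ultimately show ?thesis using split[of x 0] tail(2)[of 0 x] by simp
  qed
  have agree: "a n x = a n y" if "\<bar>p x - p y\<bar> < V n / 2" for n x y
  proof (rule ccontr)
    assume "a n x \<noteq> a n y"
    define m where "m = (LEAST m. a m x \<noteq> a m y)"
    have m: "a m x \<noteq> a m y" unfolding m_def by (rule LeastI[of _ n]) fact
    have mn: "m \<le> n" unfolding m_def by (rule Least_le) fact
    have less: "a i x = a i y" if "i < m" for i using not_less_Least that unfolding m_def by blast
    have "(\<Sum>i\<le>m. real (a i x) * V i) - (\<Sum>i\<le>m. real (a i y) * V i) = (real (a m x) - real (a m y)) * V m"
    proof -
      have "(\<Sum>i<m. real (a i x) * V i) = (\<Sum>i<m. real (a i y) * V i)" using less by (intro sum.cong) auto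
      then show ?thesis by (simp add: lessThan_Suc_atMost[symmetric] algebra_simps)
    qed
    then have e: "p x - p y = (real (a m x) - real (a m y)) * V m +
       ((\<Sum>j. real (a (Suc (m + j)) x) * V (Suc (m + j))) - (\<Sum>j. real (a (Suc (m + j)) y) * V (Suc (m + j))))"
      using split[of x m] split[of y m] by linarith
    have "\<bar>(real (a m x) - real (a m y)) * V m\<bar> \<ge> V m"
    proof -
      have "1 \<le> \<bar>real (a m x) - real (a m y)\<bar>" using m by linarith
      then show ?thesis using V0[of m] by (simp add: abs_mult)
    qed
    then have "\<bar>p x - p y\<bar> \<ge> V m - V m / 3" using e tail[of m x] tail[of m y] by linarith
    moreover have "V n \<le> V m"
    proof -
      have "V n \<le> V m * (1 / 4) ^ (n - m)" using Vdec[of m "n - m"] mn by simp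
      also have "\<dots> \<le> V m" using V0[of m] by (intro mult_left_le power_le_one) auto
      finally show ?thesis .
    qed
    ultimately show False using that V0[of n] V0[of m] by linarith
  qed
  show thesis
  proof (rule that[OF p0 p1])
    fix e :: real assume "e > 0"
    then obtain n where n: "1 / real (Suc n) < e" using nat_approx_posE by blast
    show "\<exists>d>0. \<forall>x\<in>K. \<forall>y\<in>K. \<bar>p x - p y\<bar> < d \<longrightarrow> dist x y < e"
    proof (intro exI[of _ "V n / 2"] conjI ballI impI)
      show "V n / 2 > 0" using V0[of n] by simp
      fix x y assume "x \<in> K" "y \<in> K" "\<bar>p x - p y\<bar> < V n / 2"
      then show "dist x y < e" using a(2)[OF _ _ agree] n by (meson less_trans)
    qed
  qed
qed

text \<open>\<open>Q t x\<close> says that \<open>x\<close> is a limit of points whose codes tend to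
  \<open>t\<close>. Compactness gives such an \<open>x\<close>, and uniform continuity of the
  inverse of \<open>p\<close> makes it unique and continuous in \<open>t\<close>, so the inverse
  extends to the closure.\<close>

lemma compact_decode:
  fixes K :: "'b::metric_space set" and p :: "'b \<Rightarrow> real"
  assumes K: "compact K"
    and p: "\<And>e :: real. e > 0 \<Longrightarrow> \<exists>d>0. \<forall>x\<in>K. \<forall>y\<in>K. \<bar>p x - p y\<bar> < d \<longrightarrow> dist x y < e"
  obtains q where "continuous_on (closure (p ` K)) q" "\<And>t. t \<in> closure (p ` K) \<Longrightarrow> q t \<in> K"
    "\<And>x. x \<in> K \<Longrightarrow> q (p x) = x"
proof -
  define Q where "Q t x \<longleftrightarrow> x \<in> K \<and> (\<forall>e>0. \<exists>y\<in>K. \<bar>p y - t\<bar> < e \<and> dist y x < e)" for t x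
  have ex: "\<exists>x. Q t x" if "t \<in> closure (p ` K)" for t
  proof -
    from that[unfolded closure_sequential] obtain s where s: "(\<forall>n. s n \<in> p ` K) \<and> s \<longlonglongrightarrow> t" ..
    have "\<exists>y. y \<in> K \<and> s n = p y" for n
    proof -
      have "s n \<in> p ` K" using s by simp
      then show ?thesis by blast
    qed
    then obtain y where y: "\<And>n. y n \<in> K" "\<And>n. s n = p (y n)" by metis
    have "\<forall>n. y n \<in> K" using y(1) by simp
    with K[unfolded compact_def] obtain x r where xr: "x \<in> K" "strict_mono r" "(y \<circ> r) \<longlonglongrightarrow> x"
      by blast
    have "\<exists>y\<in>K. \<bar>p y - t\<bar> < e \<and> dist y x < e" if "e > 0" for e
    proof -
      have "(s \<circ> r) \<longlonglongrightarrow> t" using conjunct2[OF s] xr(2) by (rule LIMSEQ_subseq_LIMSEQ)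
      then have "\<forall>\<^sub>F n in sequentially. dist ((s \<circ> r) n) t < e" using that by (rule tendstoD)
      moreover have "\<forall>\<^sub>F n in sequentially. dist ((y \<circ> r) n) x < e" using xr(3) that by (rule tendstoD)
      ultimately have "\<forall>\<^sub>F n in sequentially. dist ((s \<circ> r) n) t < e \<and> dist ((y \<circ> r) n) x < e"
        by (rule eventually_conj)
      then obtain n where "dist ((s \<circ> r) n) t < e" "dist ((y \<circ> r) n) x < e"
        unfolding eventually_sequentially by blast
      then show ?thesis using y by (intro bexI[of _ "y (r n)"]) (auto simp: dist_real_def)
    qed
    then show ?thesis using xr(1) unfolding Q_def by blast
  qed
  have close: "\<exists>d>0. \<forall>t u x y. \<bar>t - u\<bar> < d \<longrightarrow> Q t x \<longrightarrow> Q u y \<longrightarrow> dist x y < e" if e: "e > 0" for e :: real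
  proof -
    obtain d where d: "d > 0" "\<And>x y. x \<in> K \<Longrightarrow> y \<in> K \<Longrightarrow> \<bar>p x - p y\<bar> < d \<Longrightarrow> dist x y < e / 3"
      using p[of "e / 3"] e by auto
    have "dist x y < e" if tu: "\<bar>t - u\<bar> < d / 3" and Qx: "Q t x" and Qy: "Q u y" for t u x y
    proof -
      have m: "min (d / 3) (e / 3) > 0" using d e by simp
      obtain x' where x': "x' \<in> K" "\<bar>p x' - t\<bar> < d / 3" "dist x' x < e / 3"
        using Qx m unfolding Q_def by (metis min_less_iff_conj)
      obtain y' where y': "y' \<in> K" "\<bar>p y' - u\<bar> < d / 3" "dist y' y < e / 3"
        using Qy m unfolding Q_def by (metis min_less_iff_conj)
      have "\<bar>p x' - p y'\<bar> < d" using x'(2) y'(2) tu by linarith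
      then have "dist x' y' < e / 3" using d(2) x'(1) y'(1) by blast
      moreover have "dist x y \<le> dist x' x + dist x' y" by (rule dist_triangle3)
      moreover have "dist x' y \<le> dist x' y' + dist y' y" by (rule dist_triangle)
      ultimately show ?thesis using x'(3) y'(3) by linarith
    qed
    then show ?thesis using d(1) by (intro exI[of _ "d / 3"]) auto
  qed
  define q where "q t = (SOME x. Q t x)" for t
  have q: "Q t (q t)" if "t \<in> closure (p ` K)" for t unfolding q_def by (rule someI_ex[OF ex[OF that]])
  show thesis
  proof (rule that)
    show "continuous_on (closure (p ` K)) q"
      unfolding continuous_on_iff
    proof (intro ballI allI impI)
      fix t and e :: real assume t: "t \<in> closure (p ` K)" and e: "e > 0"
      obtain d where "d > 0" "\<And>t u x y. \<bar>t - u\<bar> < d \<Longrightarrow> Q t x \<Longrightarrow> Q u y \<Longrightarrow> dist x y < e"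
        using close[OF e] by blast
      then show "\<exists>d>0. \<forall>u\<in>closure (p ` K). dist u t < d \<longrightarrow> dist (q u) (q t) < e"
        using q t by (intro exI[of _ d]) (auto simp: dist_real_def)
    qed
    show "q t \<in> K" if "t \<in> closure (p ` K)" for t using q[OF that] by (simp add: Q_def)
    show "q (p x) = x" if x: "x \<in> K" for x
    proof -
      have px: "p x \<in> closure (p ` K)" by (rule subsetD[OF closure_subset imageI[OF x]])
      have "Q (p x) x" unfolding Q_def by (intro conjI x allI impI bexI[of _ x]) simp_all
      have "dist (q (p x)) x \<le> 0"
      proof (rule field_le_epsilon)
        fix e :: real assume "e > 0"
        from close[OF this] obtain d where "d > 0" "\<And>t u x y. \<bar>t - u\<bar> < d \<Longrightarrow> Q t x \<Longrightarrow> Q u y \<Longrightarrow> dist x y < e" by blast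
        from this(2)[OF _ q[OF px] \<open>Q (p x) x\<close>] this(1) show "dist (q (p x)) x \<le> 0 + e" by simp
      qed
      then show ?thesis by simp
    qed
  qed
qed

text \<open>The measures are pushed to the unit interval by \<open>p\<close>, a weak limit is
  selected there, and it is pulled back by \<open>q\<close>. As \<open>p\<close> may be
  discontinuous, \<open>u\<close> itself cannot be transported; instead \<open>u \<circ> q\<close>
  is extended continuously from the closed set \<open>H\<close>, which carries the limit.\<close>

theorem pmf_weak_limit:
  fixes K :: "'b::metric_space set" and P :: "nat \<Rightarrow> 'b pmf"
  assumes K: "compact K" and P: "\<And>n. set_pmf (P n) \<subseteq> K"
  obtains r M where "strict_mono (r :: nat \<Rightarrow> nat)" "borel_prob M K"
    "\<And>u :: 'b \<Rightarrow> real. continuous_on K u \<Longrightarrow>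
       (\<lambda>n. measure_pmf.expectation (P (r n)) u) \<longlonglongrightarrow> integral\<^sup>L M u"
proof -
  obtain p :: "'b \<Rightarrow> real" where p: "\<And>x. 0 \<le> p x" "\<And>x. p x \<le> 1"
    "\<And>e. e > 0 \<Longrightarrow> \<exists>d>0. \<forall>x\<in>K. \<forall>y\<in>K. \<bar>p x - p y\<bar> < d \<longrightarrow> dist x y < e"
    using compact_code[OF K] by blast
  define H where "H = closure (p ` K)"
  obtain q where q: "continuous_on H q" "\<And>t. t \<in> H \<Longrightarrow> q t \<in> K" "\<And>x. x \<in> K \<Longrightarrow> q (p x) = x"
    using compact_decode[OF K p(3)] unfolding H_def by blast
  obtain k0 where k0: "k0 \<in> K" using P[of 0] set_pmf_not_empty[of "P 0"] by blast
  have clH: "closed H" by (simp add: H_def)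
  have pH: "p x \<in> H" if "x \<in> K" for x unfolding H_def by (rule subsetD[OF closure_subset imageI[OF that]])
  have Hne: "H \<noteq> {}" using pH[OF k0] by blast
  define m where "m n = distr (measure_pmf (P n)) borel p" for n
  have rd: "real_distribution (m n)" for n
    unfolding m_def by (rule prob_space.real_distribution_distr[OF prob_space_measure_pmf]) simp
  have "tight m"
    unfolding tight_def
  proof (intro conjI allI impI)
    show "real_distribution (m n)" for n by (rule rd)
    fix e :: real assume e: "e > 0"
    \<comment> \<open>The interval is open on the left, so it begins at -1 to include the code
      0.\<close>
    have "measure (m n) {-1<..1} > 1 - e" for n
    proof -
      have "measure (m n) {-1<..1} = measure (measure_pmf (P n)) (p -` {-1<..1})"
        unfolding m_def by (subst measure_distr) auto
      also have "p -` {-1<..1} = UNIV"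
      proof -
        have "-1 < p x" for x using p(1)[of x] by linarith
        then show ?thesis using p(2) by auto
      qed
      finally show ?thesis using e by simp
    qed
    then show "\<exists>a b. a < b \<and> (\<forall>n. 1 - e < measure (m n) {a<..b})" by (intro exI[of _ "-1"] exI[of _ 1]) auto
  qed
  from tight_imp_convergent_subsubsequence[OF this strict_mono_id]
  obtain r M0 where r: "strict_mono (r :: nat \<Rightarrow> nat)" and M0: "real_distribution M0" "weak_conv_m (m \<circ> id \<circ> r) M0"
    by blast
  interpret M0: real_distribution M0 by fact
  have conv: "(\<lambda>n. measure_pmf.expectation (P (r n)) (\<lambda>x. U (p x))) \<longlonglongrightarrow> integral\<^sup>L M0 U"
    if U: "continuous_on UNIV U" "\<And>t. \<bar>U t\<bar> \<le> B" for U :: "real \<Rightarrow> real" and B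
  proof -
    have "(\<lambda>n. integral\<^sup>L ((m \<circ> id \<circ> r) n) U) \<longlonglongrightarrow> integral\<^sup>L M0 U"
      by (rule weak_conv_imp_integral_bdd_continuous_conv[where B=B])
        (use M0 rd U in \<open>auto simp: continuous_on_eq_continuous_at comp_def\<close>)
    moreover have "integral\<^sup>L ((m \<circ> id \<circ> r) n) U = measure_pmf.expectation (P (r n)) (\<lambda>x. U (p x))" for n
      unfolding comp_def m_def id_def
      by (rule integral_distr) (use borel_measurable_continuous_onI[OF U(1)] in auto)
    ultimately show ?thesis by simp
  qed
  \<comment> \<open>A test function that vanishes exactly on \<open>H\<close> has integral 0 for
    every measure of the sequence, hence for the limit.\<close>
  have aeH: "AE t in M0. t \<in> H"
  proof -
    let ?U = "\<lambda>t. min 1 (infdist t H)"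
    have U: "continuous_on UNIV ?U" by (intro continuous_intros)
    have Ub: "\<bar>?U t\<bar> \<le> 1" for t using infdist_nonneg[of t H] by auto
    have "measure_pmf.expectation (P (r n)) (\<lambda>x. ?U (p x)) = measure_pmf.expectation (P (r n)) (\<lambda>x. 0)" for n
    proof (rule Bochner_Integration.integral_cong_AE)
      show "AE x in measure_pmf (P (r n)). ?U (p x) = 0"
        using P[of "r n"] pH by (auto simp: AE_measure_pmf_iff infdist_zero)
    qed auto
    then have "integral\<^sup>L M0 ?U = 0" using LIMSEQ_unique[OF conv[OF U Ub]] by simp
    moreover have "integrable M0 ?U"
      using borel_measurable_continuous_onI[OF U] Ub by (intro M0.integrable_const_bound[where B=1]) auto
    ultimately have "AE t in M0. ?U t = 0"
      using infdist_nonneg by (subst (asm) integral_nonneg_eq_0_iff_AE) auto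
    then show ?thesis
    proof eventually_elim
      case (elim t)
      then have "infdist t H = 0" by (simp add: min_def split: if_splits)
      then show ?case using in_closed_iff_infdist_zero[OF clH Hne] by blast
    qed
  qed
  define q' where "q' t = (if t \<in> H then q t else k0)" for t
  have q'K: "q' t \<in> K" for t using q(2) k0 by (auto simp: q'_def)
  have q'm: "q' \<in> measurable M0 (restrict_space borel K)"
  proof (rule measurable_restrict_space2)
    show "q' \<in> borel_measurable M0"
      unfolding q'_def measurable_cong_sets[OF M0.events_eq_borel refl]
      using clH q(1) by (intro borel_measurable_continuous_on_if) auto
  qed (use q'K in auto)
  define M where "M = distr M0 (restrict_space borel K) q'"
  have pM: "prob_space M" unfolding M_def using q'm by (rule M0.prob_space_distr)
  have bp: "borel_prob M K"
    by (intro borel_prob.intro borel_prob_axioms.intro pM) (simp_all add: M_def K)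
  show thesis
  proof (rule that[OF r bp])
    fix u :: "'b \<Rightarrow> real" assume u: "continuous_on K u"
    have cuq: "continuous_on H (\<lambda>t. u (q t))"
      using continuous_on_compose2[OF u q(1)] q(2) by auto
    have "compact H" unfolding H_def
      by (intro compact_closure[THEN iffD2] boundedI[where B=1]) (use p(1,2) in auto)
    then have "bounded ((\<lambda>t. u (q t)) ` H)" using cuq compact_continuous_image compact_imp_bounded by blast
    from this[unfolded bounded_pos] obtain B where B0: "B > 0 \<and> (\<forall>x\<in>(\<lambda>t. u (q t)) ` H. norm x \<le> B)" ..
    then have B: "0 \<le> B" "\<And>t. t \<in> H \<Longrightarrow> norm (u (q t)) \<le> B" by simp_all
    have clU: "closedin (top_of_set UNIV) H" using clH by simp
    obtain U :: "real \<Rightarrow> real" where U0: "continuous_on UNIV U" "\<And>t. t \<in> H \<Longrightarrow> U t = u (q t)"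
      "\<And>t. t \<in> UNIV \<Longrightarrow> norm (U t) \<le> B"
      by (rule Tietze[OF cuq clU B]) (assumption | rule that)+
    note U = U0(1,2) U0(3)[OF UNIV_I]
    have "measure_pmf.expectation (P (r n)) (\<lambda>x. U (p x)) = measure_pmf.expectation (P (r n)) u" for n
    proof (rule Bochner_Integration.integral_cong_AE)
      show "AE x in measure_pmf (P (r n)). U (p x) = u x"
        using P[of "r n"] pH U(2) q(3) by (auto simp: AE_measure_pmf_iff)
    qed auto
    moreover have "integral\<^sup>L M0 U = integral\<^sup>L M u"
    proof -
      have "integral\<^sup>L M u = (\<integral>t. u (q' t) \<partial>M0)"
        unfolding M_def using borel_measurable_continuous_on_restrict[OF u]
        by (intro integral_distr[OF q'm]) simp
      also have "\<dots> = integral\<^sup>L M0 U"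
      proof (rule integral_cong_AE)
        show "(\<lambda>t. u (q' t)) \<in> borel_measurable M0"
          using measurable_compose[OF q'm] borel_measurable_continuous_on_restrict[OF u] by blast
        show "U \<in> borel_measurable M0" using borel_measurable_continuous_onI[OF U(1)] by simp
        show "AE t in M0. u (q' t) = U t" using aeH by eventually_elim (simp add: q'_def U(2))
      qed
      finally show ?thesis by simp
    qed
    ultimately show "(\<lambda>n. measure_pmf.expectation (P (r n)) u) \<longlonglongrightarrow> integral\<^sup>L M u"
      using conv[OF U(1), of B] U(3) by simp
  qed
qed

section \<open>Invariant measures of large free energy\<close>

text \<open>The graph of the concave function \<open>- (x * ln x)\<close> lies below its tangent at
  \<open>q\<close>.\<close>

lemma neg_mult_ln_le:
  fixes p q :: real
  assumes "0 \<le> p" "0 < q"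
  shows "- (p * ln p) \<le> - (p * ln q) + (q - p)"
proof (cases "p = 0")
  case False
  then have p: "p > 0" using assms by simp
  have "ln (q / p) \<le> q / p - 1" using p assms by (intro ln_le_minus_one) simp
  then have "p * ln (q / p) \<le> p * (q / p - 1)" using p by (intro mult_left_mono) auto
  moreover have "p * (q / p - 1) = q - p" using p by (simp add: field_simps)
  moreover have "ln (q / p) = ln q - ln p" using p assms by (simp add: ln_div)
  ultimately show ?thesis by (simp add: algebra_simps)
qed (use assms in simp)

lemma simple_function_pmf: "finite (range X) \<Longrightarrow> simple_function (measure_pmf p) X"
  by (simp add: simple_function_def)

lemma shannon_superset:
  assumes "finite W" "X ` space M \<subseteq> W"
  shows "shannon M X = - (\<Sum>v\<in>W. measure M (X -` {v} \<inter> space M) * ln (measure M (X -` {v} \<inter> space M)))"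
  unfolding shannon_def
proof (intro arg_cong[where f=uminus] sum.mono_neutral_left assms ballI)
  fix v assume "v \<in> W - X ` space M"
  then have "X -` {v} \<inter> space M = {}" by auto
  then show "measure M (X -` {v} \<inter> space M) * ln (measure M (X -` {v} \<inter> space M)) = 0" by simp
qed

lemma finite_range_itinerary:
  assumes "finite (range c)"
  shows "finite (range (itinerary f c n))" "range (itinerary f c n) \<subseteq> {w. set w \<subseteq> range c \<and> length w = n}"
    "finite {w. set w \<subseteq> range c \<and> length w = n}"
proof -
  show fin: "finite {w. set w \<subseteq> range c \<and> length w = n}" using assms by (rule finite_lists_length_eq)
  show "range (itinerary f c n) \<subseteq> {w. set w \<subseteq> range c \<and> length w = n}" by (auto simp: itinerary_def)
  then show "finite (range (itinerary f c n))" using fin by (rule finite_subset)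
qed

text \<open>\<open>V\<close> is not assumed invariant, so blocks at different times have different
  entropies. For each offset \<open>j < q\<close> the times from \<open>j\<close> on are cut into
  blocks of length \<open>q\<close>; over all offsets, every starting time below \<open>n\<close>
  occurs at most once. The last term pays for the first \<open>j\<close> symbols.\<close>

lemma shannon_itinerary_blocks:
  fixes V :: "'b pmf" and f :: "'b \<Rightarrow> 'b" and c :: "'b \<Rightarrow> 'c"
  assumes c: "finite (range c)" and q: "q \<ge> 1"
  shows "real q * shannon (measure_pmf V) (itinerary f c n) \<le>
    (\<Sum>k<n. shannon (measure_pmf V) (\<lambda>x. itinerary f c q ((f ^^ k) x))) + real q * (real q * ln (real (card (range c))))"
proof -
  note V_nonneg = prob_space.shannon_nonneg[OF prob_space_measure_pmf]
    and V_pair = prob_space.shannon_pair[OF prob_space_measure_pmf]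
    and V_data = prob_space.shannon_data[OF prob_space_measure_pmf]
    and V_card = prob_space.shannon_le_card[OF prob_space_measure_pmf]
  have sf: "simple_function (measure_pmf V) (\<lambda>x. itinerary f c m (h x))" for m and h :: "'b \<Rightarrow> 'b"
    using finite_range_itinerary(1)[OF c, of f m] by (intro simple_function_pmf) (auto intro: finite_subset[rotated])
  have sf0: "simple_function (measure_pmf V) (itinerary f c m)" for m using sf[of m "\<lambda>x. x"] by simp
  define a where "a k = shannon (measure_pmf V) (\<lambda>x. itinerary f c q ((f ^^ k) x))" for k
  have a0: "a k \<ge> 0" for k unfolding a_def by (rule V_nonneg[OF sf])
  have blocks: "shannon (measure_pmf V) (itinerary f c (j + r * q)) \<le> shannon (measure_pmf V) (itinerary f c j) + (\<Sum>i<r. a (j + i * q))" for j r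
  proof (induction r)
    case (Suc r)
    have e: "j + Suc r * q = (j + r * q) + q" by simp
    have "itinerary f c (j + Suc r * q) x = itinerary f c (j + r * q) x @ itinerary f c q ((f ^^ (j + r * q)) x)" for x
      unfolding e by (rule itinerary_add)
    then have "shannon (measure_pmf V) (itinerary f c (j + Suc r * q)) \<le>
        shannon (measure_pmf V) (\<lambda>x. (itinerary f c (j + r * q) x, itinerary f c q ((f ^^ (j + r * q)) x)))"
      by (intro V_data simple_function_Pair sf sf0) simp
    also have "\<dots> \<le> shannon (measure_pmf V) (itinerary f c (j + r * q)) + a (j + r * q)"
      unfolding a_def by (rule V_pair[OF sf0 sf])
    finally show ?case using Suc by simp
  qed simp
  have start: "shannon (measure_pmf V) (itinerary f c j) \<le> real q * ln (real (card (range c)))" if "j < q" for j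
  proof -
    have "card (itinerary f c j ` space (measure_pmf V)) \<le> card {w. set w \<subseteq> range c \<and> length w = j}"
      using finite_range_itinerary(2)[OF c, where f=f and n=j] finite_range_itinerary(3)[OF c, of j] by (intro card_mono) auto
    also have "\<dots> = card (range c) ^ j" by (rule card_lists_length_eq[OF c])
    finally have le: "card (itinerary f c j ` space (measure_pmf V)) \<le> card (range c) ^ j" .
    have pos: "card (itinerary f c j ` space (measure_pmf V)) > 0" "card (range c) > 0"
      using finite_range_itinerary(1)[OF c, where f=f and n=j] c by (auto simp: card_gt_0_iff)
    have "shannon (measure_pmf V) (itinerary f c j) \<le> ln (real (card (itinerary f c j ` space (measure_pmf V))))" by (rule V_card[OF sf0])
    also have "\<dots> \<le> ln (real (card (range c) ^ j))" using le pos by (subst ln_le_cancel_iff) auto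
    also have "\<dots> = real j * ln (real (card (range c)))" using pos by (simp add: ln_realpow)
    also have "\<dots> \<le> real q * ln (real (card (range c)))" using that pos by (intro mult_right_mono) auto
    finally show ?thesis .
  qed
  \<comment> \<open>The number of blocks is rounded up: the blocks reach at least \<open>n\<close>,
    while the last one still begins below \<open>n\<close>.\<close>
  define r where "r j = (n + q - 1 - j) div q" for j
  have r1: "n \<le> j + r j * q" if "j < q" for j
  proof -
    have "n + q - 1 - j < (r j + 1) * q"
      unfolding r_def using q by (simp add: div_mult_mod_eq dividend_less_div_times)
    then show ?thesis using that by (simp add: algebra_simps)
  qed
  have r2: "j + i * q < n" if "j < q" "i < r j" for i j
  proof -
    have "Suc i * q \<le> r j * q" using that by (intro mult_le_mono1) simp
    also have "\<dots> \<le> n + q - 1 - j" unfolding r_def by (rule div_times_less_eq_dividend)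
    finally show ?thesis using that(1) q by simp
  qed
  have each: "shannon (measure_pmf V) (itinerary f c n) \<le> real q * ln (real (card (range c))) + (\<Sum>i<r j. a (j + i * q))" if "j < q" for j
  proof -
    have "shannon (measure_pmf V) (itinerary f c n) \<le> shannon (measure_pmf V) (itinerary f c (j + r j * q))"
      by (rule V_data[OF sf0]) (use r1[OF that] in \<open>auto simp: itinerary_eq_iff\<close>)
    then show ?thesis using blocks[of j "r j"] start[OF that] by linarith
  qed
  have "real q * shannon (measure_pmf V) (itinerary f c n) = (\<Sum>j<q. shannon (measure_pmf V) (itinerary f c n))" by simp
  also have "\<dots> \<le> (\<Sum>j<q. real q * ln (real (card (range c))) + (\<Sum>i<r j. a (j + i * q)))"
    using each by (intro sum_mono) auto
  also have "\<dots> = real q * (real q * ln (real (card (range c)))) + (\<Sum>j<q. \<Sum>i<r j. a (j + i * q))"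
    by (simp add: sum.distrib)
  also have "(\<Sum>j<q. \<Sum>i<r j. a (j + i * q)) = (\<Sum>p\<in>(SIGMA j:{..<q}. {..<r j}). a (fst p + snd p * q))"
    by (simp add: sum.Sigma split_beta)
  also have "\<dots> = (\<Sum>k\<in>(\<lambda>p. fst p + snd p * q) ` (SIGMA j:{..<q}. {..<r j}). a k)"
  proof (rule sum.reindex_cong[symmetric, OF _ refl refl])
    \<comment> \<open>Remainder and quotient modulo \<open>q\<close> recover offset and block number
      from the starting time.\<close>
    show "inj_on (\<lambda>p. fst p + snd p * q) (SIGMA j:{..<q}. {..<r j})"
    proof (rule inj_onI)
      fix p p' assume p: "p \<in> (SIGMA j:{..<q}. {..<r j})" "p' \<in> (SIGMA j:{..<q}. {..<r j})"
        "fst p + snd p * q = fst p' + snd p' * q"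
      have "fst p < q" "fst p' < q" using p by auto
      then have m: "(fst p + snd p * q) mod q = fst p" "(fst p' + snd p' * q) mod q = fst p'"
        "(fst p + snd p * q) div q = snd p" "(fst p' + snd p' * q) div q = snd p'" by auto
      have "fst p = fst p'" "snd p = snd p'" using m[unfolded p(3)] by simp_all
      then show "p = p'" by (simp add: prod_eq_iff)
    qed
  qed
  also have "\<dots> \<le> (\<Sum>k<n. a k)"
    using r2 a0 by (intro sum_mono2) auto
  finally show ?thesis by (simp add: a_def)
qed

text \<open>The case of equality in \<open>gibbs\<close>: \<open>X\<close> separates the points of
  \<open>E\<close>, so its fibres carry exactly the weights proportional to
  \<open>exp (S x)\<close>.\<close>

lemma shannon_separated:
  assumes E: "finite E" "E \<noteq> {}" and V: "\<And>x. pmf V x = (if x \<in> E then exp (S x) / (\<Sum>y\<in>E. exp (S y)) else 0)"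
    and X: "finite (range X)" "inj_on X E"
  shows "shannon (measure_pmf V) X = ln (\<Sum>y\<in>E. exp (S y)) - measure_pmf.expectation V S"
proof -
  define Z where "Z = (\<Sum>y\<in>E. exp (S y))"
  have Z: "Z > 0" unfolding Z_def using E by (intro sum_pos) auto
  have setV: "set_pmf V = E"
    by (rule set_eqI) (use Z in \<open>simp add: set_pmf_iff V Z_def[symmetric]\<close>)
  have sum1: "(\<Sum>x\<in>E. pmf V x) = 1" using E setV by (intro sum_pmf_eq_1) auto
  let ?m = "\<lambda>v. measure_pmf.prob V (X -` {v})"
  have m: "?m (X x) = pmf V x" if "x \<in> E" for x
  proof -
    have "?m (X x) = measure_pmf.prob V (X -` {X x} \<inter> set_pmf V)" by (simp add: measure_Int_set_pmf)
    also have "X -` {X x} \<inter> set_pmf V = {x}" using that X(2) setV by (auto simp: inj_on_def)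
    finally show ?thesis by (simp add: measure_pmf_single)
  qed
  have m0: "?m v = 0" if "v \<notin> X ` E" for v
  proof -
    have "?m v = measure_pmf.prob V (X -` {v} \<inter> set_pmf V)" by (simp add: measure_Int_set_pmf)
    also have "X -` {v} \<inter> set_pmf V = {}" using that setV by auto
    finally show ?thesis by simp
  qed
  have "shannon (measure_pmf V) X = - (\<Sum>v\<in>range X. ?m v * ln (?m v))" by (simp add: shannon_def)
  also have "(\<Sum>v\<in>range X. ?m v * ln (?m v)) = (\<Sum>v\<in>X ` E. ?m v * ln (?m v))"
    using X m0 by (intro sum.mono_neutral_right) auto
  also have "\<dots> = (\<Sum>x\<in>E. pmf V x * ln (pmf V x))"
    using m by (subst sum.reindex[OF X(2)]) simp
  also have "\<dots> = (\<Sum>x\<in>E. pmf V x * S x - ln Z * pmf V x)"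
  proof (rule sum.cong[OF refl])
    fix x assume "x \<in> E"
    then have e: "ln (pmf V x) = S x - ln Z" using V[of x] Z by (simp add: Z_def[symmetric] ln_div)
    show "pmf V x * ln (pmf V x) = pmf V x * S x - ln Z * pmf V x" unfolding e by (simp add: algebra_simps)
  qed
  also have "\<dots> = (\<Sum>x\<in>E. pmf V x * S x) - ln Z" using sum1 by (simp add: sum_subtractf flip: sum_distrib_left)
  also have "(\<Sum>x\<in>E. pmf V x * S x) = measure_pmf.expectation V S"
    using E setV by (subst integral_measure_pmf_real[of E]) (auto simp: mult.commute)
  finally show ?thesis by (simp add: Z_def)
qed

text \<open>The average of the push-forwards of \<open>V\<close> under \<open>f ^^ k\<close> for
  \<open>k < n\<close>, which is invariant up to an error of order \<open>1 / n\<close>.\<close>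

definition orbit_pmf :: "('b \<Rightarrow> 'b) \<Rightarrow> nat \<Rightarrow> 'b pmf \<Rightarrow> 'b pmf" where
  "orbit_pmf f n V = bind_pmf (pmf_of_set {..<n}) (\<lambda>k. map_pmf (f ^^ k) V)"

lemma orbit_pmf_expectation:
  assumes n: "n \<ge> 1" and fin: "finite (set_pmf V)"
  shows "measure_pmf.expectation (orbit_pmf f n V) u =
    (\<Sum>k<n. measure_pmf.expectation V (\<lambda>x. u ((f ^^ k) x))) / real n"
proof -
  have ne: "{..<n} \<noteq> {}" using n by (auto simp: lessThan_empty_iff)
  have fin2: "finite (set_pmf (orbit_pmf f n V))"
    using fin ne by (auto simp: orbit_pmf_def set_pmf_of_set)
  have "measure_pmf.expectation (orbit_pmf f n V) u =
      (\<Sum>k<n. (1 / real n) *\<^sub>R measure_pmf.expectation (map_pmf (f ^^ k) V) u)"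
    unfolding orbit_pmf_def using ne fin
    by (subst pmf_expectation_bind[of "{..<n}"]) (auto simp: set_pmf_of_set)
  then show ?thesis by (simp add: integral_map_pmf sum_divide_distrib)
qed

lemma orbit_pmf_prob:
  assumes n: "n \<ge> 1" and fin: "finite (set_pmf V)"
  shows "measure_pmf.prob (orbit_pmf f n V) A = (\<Sum>k<n. measure_pmf.prob V ((f ^^ k) -` A)) / real n"
proof -
  have ind: "(\<lambda>x. indicat_real A ((f ^^ k) x)) = indicat_real ((f ^^ k) -` A)" for k
    by (auto simp: indicator_def)
  have "measure_pmf.prob (orbit_pmf f n V) A = measure_pmf.expectation (orbit_pmf f n V) (indicat_real A)" by simp
  also have "\<dots> = (\<Sum>k<n. measure_pmf.expectation V (\<lambda>x. indicat_real A ((f ^^ k) x))) / real n"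
    by (rule orbit_pmf_expectation[OF assms])
  finally show ?thesis unfolding ind by simp
qed

text \<open>Concavity of entropy: for each symbol the tangent inequality is taken at the averaged
  probability and summed over \<open>k\<close>, where the correction terms cancel.\<close>

lemma shannon_orbit_pmf:
  fixes X :: "'b \<Rightarrow> 'c"
  assumes n: "n \<ge> 1" and fin: "finite (set_pmf V)" and X: "finite (range X)"
  shows "(\<Sum>k<n. shannon (measure_pmf V) (\<lambda>x. X ((f ^^ k) x))) \<le> real n * shannon (measure_pmf (orbit_pmf f n V)) X"
proof -
  let ?p = "\<lambda>k v. measure_pmf.prob V ((\<lambda>x. X ((f ^^ k) x)) -` {v})"
  let ?m = "\<lambda>v. measure_pmf.prob (orbit_pmf f n V) (X -` {v})"
  have m: "?m v = (\<Sum>k<n. ?p k v) / real n" for v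
    unfolding orbit_pmf_prob[OF n fin] by (simp add: vimage_def)
  have key: "(\<Sum>k<n. - (?p k v * ln (?p k v))) \<le> real n * (- (?m v * ln (?m v)))" for v
  proof (cases "?m v = 0")
    case True
    then have "(\<Sum>k<n. ?p k v) = 0" using m[of v] n by simp
    then have "\<forall>k\<in>{..<n}. ?p k v = 0" by (subst (asm) sum_nonneg_eq_0_iff) auto
    then show ?thesis using True by simp
  next
    case False
    then have q: "?m v > 0" by (simp add: zero_less_measure_iff)
    have "(\<Sum>k<n. - (?p k v * ln (?p k v))) \<le> (\<Sum>k<n. - (?p k v * ln (?m v)) + (?m v - ?p k v))"
      using q by (intro sum_mono neg_mult_ln_le) auto
    also have "\<dots> = - (\<Sum>k<n. ?p k v) * ln (?m v) + (real n * ?m v - (\<Sum>k<n. ?p k v))"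
      by (simp add: sum.distrib sum_subtractf sum_negf sum_distrib_right)
    also have "(\<Sum>k<n. ?p k v) = real n * ?m v" using m[of v] n by simp
    finally show ?thesis by simp
  qed
  have sub: "range (\<lambda>x. X ((f ^^ k) x)) \<subseteq> range X" for k by auto
  have "(\<Sum>k<n. shannon (measure_pmf V) (\<lambda>x. X ((f ^^ k) x))) = (\<Sum>k<n. \<Sum>v\<in>range X. - (?p k v * ln (?p k v)))"
    using shannon_superset[OF X, of _ "measure_pmf V"] sub by (simp add: sum_negf)
  also have "\<dots> = (\<Sum>v\<in>range X. \<Sum>k<n. - (?p k v * ln (?p k v)))" by (rule sum.swap)
  also have "\<dots> \<le> (\<Sum>v\<in>range X. real n * (- (?m v * ln (?m v))))" by (intro sum_mono key)
  also have "\<dots> = real n * shannon (measure_pmf (orbit_pmf f n V)) X"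
    by (simp add: shannon_def sum_distrib_left sum_negf)
  finally show ?thesis .
qed

section \<open>Continuity sets, whose probabilities pass to weak limits\<close>

context borel_prob
begin

text \<open>Squeezing between continuous functions on \<open>K\<close> plays the part of a null
  boundary: probabilities pass to weak limits, and the condition is inherited by complements,
  intersections and preimages under continuous measure-preserving maps.\<close>

definition cont_set :: "'b set \<Rightarrow> bool" where
  "cont_set A \<longleftrightarrow> (\<forall>e>0. \<exists>u v :: 'b \<Rightarrow> real. continuous_on K u \<and> continuous_on K v \<and>
     (\<forall>x\<in>K. 0 \<le> u x \<and> u x \<le> indicator A x \<and> indicator A x \<le> v x \<and> v x \<le> 1) \<and>
     (\<integral>x. v x - u x \<partial>M) < e)"

lemma cont_set_compl:
  assumes "cont_set A"
  shows "cont_set (- A)"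
  unfolding cont_set_def
proof (intro allI impI)
  fix e :: real assume "e > 0"
  then obtain u v :: "'b \<Rightarrow> real" where uv: "continuous_on K u" "continuous_on K v"
    "\<forall>x\<in>K. 0 \<le> u x \<and> u x \<le> indicator A x \<and> indicator A x \<le> v x \<and> v x \<le> 1"
    "(\<integral>x. v x - u x \<partial>M) < e" using assms unfolding cont_set_def by meson
  show "\<exists>u v :: 'b \<Rightarrow> real. continuous_on K u \<and> continuous_on K v \<and>
     (\<forall>x\<in>K. 0 \<le> u x \<and> u x \<le> indicator (- A) x \<and> indicator (- A) x \<le> v x \<and> v x \<le> 1) \<and>
     (\<integral>x. v x - u x \<partial>M) < e"
  proof (rule exI[of _ "\<lambda>x. 1 - v x"], rule exI[of _ "\<lambda>x. 1 - u x"], intro conjI)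
    show "\<forall>x\<in>K. 0 \<le> 1 - v x \<and> 1 - v x \<le> indicator (- A) x \<and> indicator (- A) x \<le> 1 - u x \<and> 1 - u x \<le> 1"
      using uv(3) by (auto simp: indicator_compl)
  qed (use uv in \<open>auto intro!: continuous_intros\<close>)
qed

lemma cont_set_Int:
  assumes "cont_set A" "cont_set B"
  shows "cont_set (A \<inter> B)"
  unfolding cont_set_def
proof (intro allI impI)
  fix e :: real assume "e > 0"
  then have e2: "e / 2 > 0" by simp
  obtain u v :: "'b \<Rightarrow> real" where uv: "continuous_on K u" "continuous_on K v"
    "\<And>x. x \<in> K \<Longrightarrow> 0 \<le> u x \<and> u x \<le> indicator A x \<and> indicator A x \<le> v x \<and> v x \<le> 1"
    "(\<integral>x. v x - u x \<partial>M) < e / 2" using assms(1) e2 unfolding cont_set_def by meson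
  obtain u' v' :: "'b \<Rightarrow> real" where uv': "continuous_on K u'" "continuous_on K v'"
    "\<And>x. x \<in> K \<Longrightarrow> 0 \<le> u' x \<and> u' x \<le> indicator B x \<and> indicator B x \<le> v' x \<and> v' x \<le> 1"
    "(\<integral>x. v' x - u' x \<partial>M) < e / 2" using assms(2) e2 unfolding cont_set_def by meson
  let ?u = "\<lambda>x. min (u x) (u' x)" and ?v = "\<lambda>x. min (v x) (v' x)"
  have c: "continuous_on K ?u" "continuous_on K ?v" using uv uv' by (auto intro: continuous_intros)
  have "(\<integral>x. ?v x - ?u x \<partial>M) \<le> (\<integral>x. (v x - u x) + (v' x - u' x) \<partial>M)"
  proof (rule integral_mono)
    fix x assume "x \<in> space M"
    then have "u x \<le> v x" "u' x \<le> v' x" using uv(3)[of x] uv'(3)[of x] space_M by force+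
    then show "?v x - ?u x \<le> (v x - u x) + (v' x - u' x)" by linarith
  qed (use c uv uv' in \<open>auto intro!: cont_integrable continuous_intros\<close>)
  also have "\<dots> = (\<integral>x. v x - u x \<partial>M) + (\<integral>x. v' x - u' x \<partial>M)"
    using uv uv' by (intro Bochner_Integration.integral_add cont_integrable continuous_intros)
  also have "\<dots> < e" using uv(4) uv'(4) by simp
  finally have "(\<integral>x. ?v x - ?u x \<partial>M) < e" .
  moreover have "0 \<le> ?u x \<and> ?u x \<le> indicator (A \<inter> B) x \<and> indicator (A \<inter> B) x \<le> ?v x \<and> ?v x \<le> 1" if "x \<in> K" for x
    using uv(3)[OF that] uv'(3)[OF that] by (auto simp: indicator_def split: if_splits)
  ultimately show "\<exists>u v :: 'b \<Rightarrow> real. continuous_on K u \<and> continuous_on K v \<and>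
     (\<forall>x\<in>K. 0 \<le> u x \<and> u x \<le> indicator (A \<inter> B) x \<and> indicator (A \<inter> B) x \<le> v x \<and> v x \<le> 1) \<and>
     (\<integral>x. v x - u x \<partial>M) < e"
    using c by blast
qed

lemma cont_set_UNIV: "cont_set UNIV"
  unfolding cont_set_def by (intro allI impI exI[of _ "\<lambda>_. 1"]) simp

lemma cont_set_INT:
  assumes "finite I" "\<And>i. i \<in> I \<Longrightarrow> cont_set (A i)"
  shows "cont_set (\<Inter>i\<in>I. A i)"
  using assms by (induction I rule: finite_induct) (auto intro: cont_set_UNIV cont_set_Int)

lemma cont_set_vimage:
  assumes A: "cont_set A" and f: "continuous_on K f" "f ` K \<subseteq> K" "f \<in> measurable M M" "distr M M f = M"
  shows "cont_set (f -` A)"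
  unfolding cont_set_def
proof (intro allI impI)
  fix e :: real assume e: "e > 0"
  obtain u v :: "'b \<Rightarrow> real" where uv: "continuous_on K u" "continuous_on K v"
    "\<And>x. x \<in> K \<Longrightarrow> 0 \<le> u x \<and> u x \<le> indicator A x \<and> indicator A x \<le> v x \<and> v x \<le> 1"
    "(\<integral>x. v x - u x \<partial>M) < e" using A e unfolding cont_set_def by meson
  have "(\<integral>x. v (f x) - u (f x) \<partial>M) = (\<integral>x. v x - u x \<partial>(distr M M f))"
    using uv(1,2) by (intro integral_distr[OF f(3), symmetric] borel_measurable_diff cont_measurable)
  then have "(\<integral>x. v (f x) - u (f x) \<partial>M) < e" using f(4) uv(4) by simp
  moreover have "continuous_on K (\<lambda>x. u (f x))" "continuous_on K (\<lambda>x. v (f x))"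
    using continuous_on_compose2[OF uv(1) f(1,2)] continuous_on_compose2[OF uv(2) f(1,2)] by auto
  moreover have "0 \<le> u (f x) \<and> u (f x) \<le> indicator (f -` A) x \<and> indicator (f -` A) x \<le> v (f x) \<and> v (f x) \<le> 1"
    if "x \<in> K" for x
    using uv(3)[of "f x"] f(2) that by (auto simp: indicator_def)
  ultimately show "\<exists>u v :: 'b \<Rightarrow> real. continuous_on K u \<and> continuous_on K v \<and>
     (\<forall>x\<in>K. 0 \<le> u x \<and> u x \<le> indicator (f -` A) x \<and> indicator (f -` A) x \<le> v x \<and> v x \<le> 1) \<and>
     (\<integral>x. v x - u x \<partial>M) < e" by blast
qed

text \<open>The functions are ramps of slope \<open>k\<close> on either side of the level
  \<open>t\<close>; their difference tends to the indicator of the level set, which is null.\<close>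

lemma cont_set_sublevel:
  fixes \<rho> :: "'b \<Rightarrow> real"
  assumes \<rho>: "continuous_on K \<rho>" and null: "measure M {x \<in> space M. \<rho> x = t} = 0"
  shows "cont_set {x. \<rho> x < t}"
  unfolding cont_set_def
proof (intro allI impI)
  fix e :: real assume e: "e > 0"
  define u where "u k x = min 1 (max 0 (real k * (t - \<rho> x)))" for k :: nat and x
  define v where "v k x = min 1 (max 0 (1 - real k * (\<rho> x - t)))" for k :: nat and x
  have cu: "continuous_on K (u k)" "continuous_on K (v k)" for k
    unfolding u_def v_def using \<rho> by (auto intro!: continuous_intros)
  have \<rho>m: "\<rho> \<in> borel_measurable M" using cont_measurable[OF \<rho>] .
  have sets: "{x \<in> space M. \<rho> x = t} \<in> sets M" using \<rho>m by measurable
  have "(\<lambda>k. \<integral>x. v k x - u k x \<partial>M) \<longlonglongrightarrow> (\<integral>x. indicator {x \<in> space M. \<rho> x = t} x \<partial>M)"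
  proof (rule integral_dominated_convergence[where w="\<lambda>_. 1"])
    show "(\<lambda>x. v k x - u k x) \<in> borel_measurable M" for k using cu by (intro borel_measurable_diff cont_measurable)
    show "AE x in M. (\<lambda>k. v k x - u k x) \<longlonglongrightarrow> indicator {x \<in> space M. \<rho> x = t} x"
    proof (rule AE_I2)
      fix x assume x: "x \<in> space M"
      consider "\<rho> x = t" | "\<rho> x < t" | "\<rho> x > t" by linarith
      then show "(\<lambda>k. v k x - u k x) \<longlonglongrightarrow> indicator {x \<in> space M. \<rho> x = t} x"
      proof cases
        case 1
        then show ?thesis using x by (simp add: u_def v_def)
      next
        case 2
        obtain k0 :: nat where k0: "real k0 > 1 / (t - \<rho> x)" using reals_Archimedean2 by blast
        have "v k x - u k x = 0" if "k \<ge> k0" for k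
        proof -
          have "1 / (t - \<rho> x) < real k" using k0 that by linarith
          then have "1 < real k * (t - \<rho> x)" using 2 by (simp add: field_simps)
          moreover have "real k * (\<rho> x - t) \<le> 0" using 2 by (simp add: mult_nonneg_nonpos)
          ultimately show ?thesis by (simp add: u_def v_def)
        qed
        then have "\<forall>\<^sub>F k in sequentially. v k x - u k x = 0" unfolding eventually_sequentially by blast
        then show ?thesis using 2 by (simp add: tendsto_eventually)
      next
        case 3
        obtain k0 :: nat where k0: "real k0 > 1 / (\<rho> x - t)" using reals_Archimedean2 by blast
        have "v k x - u k x = 0" if "k \<ge> k0" for k
        proof -
          have "1 / (\<rho> x - t) < real k" using k0 that by linarith
          then have "1 < real k * (\<rho> x - t)" using 3 by (simp add: field_simps)
          moreover have "real k * (t - \<rho> x) \<le> 0" using 3 by (simp add: mult_nonneg_nonpos)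
          ultimately show ?thesis by (simp add: u_def v_def)
        qed
        then have "\<forall>\<^sub>F k in sequentially. v k x - u k x = 0" unfolding eventually_sequentially by blast
        then show ?thesis using 3 by (simp add: tendsto_eventually)
      qed
    qed
    show "AE x in M. norm (v k x - u k x) \<le> 1" for k by (intro AE_I2) (auto simp: u_def v_def)
    show "(indicator {x \<in> space M. \<rho> x = t} :: 'b \<Rightarrow> real) \<in> borel_measurable M" using sets by simp
  qed simp
  then have "(\<lambda>k. \<integral>x. v k x - u k x \<partial>M) \<longlonglongrightarrow> 0" using null sets by simp
  then have "\<forall>\<^sub>F k in sequentially. (\<integral>x. v k x - u k x \<partial>M) < e" using e by (rule order_tendstoD(2))
  then obtain k where k: "(\<integral>x. v k x - u k x \<partial>M) < e" unfolding eventually_sequentially by blast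
  have "0 \<le> u k x \<and> u k x \<le> indicator {x. \<rho> x < t} x \<and> indicator {x. \<rho> x < t} x \<le> v k x \<and> v k x \<le> 1" for x
  proof (cases "\<rho> x < t")
    case True
    then have "real k * (\<rho> x - t) \<le> 0" by (simp add: mult_nonneg_nonpos)
    then show ?thesis using True by (simp add: u_def v_def)
  next
    case False
    then have "real k * (t - \<rho> x) \<le> 0" by (simp add: mult_nonneg_nonpos)
    then show ?thesis using False by (simp add: u_def v_def)
  qed
  then show "\<exists>u v :: 'b \<Rightarrow> real. continuous_on K u \<and> continuous_on K v \<and>
     (\<forall>x\<in>K. 0 \<le> u x \<and> u x \<le> indicator {x. \<rho> x < t} x \<and> indicator {x. \<rho> x < t} x \<le> v x \<and> v x \<le> 1) \<and>
     (\<integral>x. v x - u x \<partial>M) < e" using cu k by blast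
qed

lemma cont_set_limit:
  assumes A: "cont_set A" "A \<inter> K \<in> sets M" and P: "\<And>n. set_pmf (P n) \<subseteq> K"
    and conv: "\<And>u :: 'b \<Rightarrow> real. continuous_on K u \<Longrightarrow>
       (\<lambda>n. measure_pmf.expectation (P n) u) \<longlonglongrightarrow> integral\<^sup>L M u"
  shows "(\<lambda>n. measure_pmf.prob (P n) A) \<longlonglongrightarrow> measure M (A \<inter> K)"
proof (rule LIMSEQ_I)
  fix e :: real assume e: "e > 0"
  then have e2: "e / 2 > 0" by simp
  obtain u v :: "'b \<Rightarrow> real" where uv: "continuous_on K u" "continuous_on K v"
    "\<And>x. x \<in> K \<Longrightarrow> 0 \<le> u x \<and> u x \<le> indicator A x \<and> indicator A x \<le> v x \<and> v x \<le> 1"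
    "(\<integral>x. v x - u x \<partial>M) < e / 2" using A(1) e2 unfolding cont_set_def by meson
  have diff: "(\<integral>x. v x - u x \<partial>M) = integral\<^sup>L M v - integral\<^sup>L M u"
    using uv by (intro Bochner_Integration.integral_diff cont_integrable)
  have ind: "integral\<^sup>L M (indicator A) = measure M (A \<inter> K)"
  proof -
    have "integral\<^sup>L M (indicator A :: 'b \<Rightarrow> real) = integral\<^sup>L M (indicator (A \<inter> K))"
      using space_M by (intro Bochner_Integration.integral_cong) (auto simp: indicator_def)
    then show ?thesis using A(2) by simp
  qed
  have intA: "integrable M (indicator A :: 'b \<Rightarrow> real)"
  proof -
    have "integrable M (indicator (A \<inter> K) :: 'b \<Rightarrow> real)" using A(2) by (intro integrable_real_indicator) (auto simp: emeasure_eq_measure)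
    then show ?thesis
      using space_M by (subst Bochner_Integration.integrable_cong[OF refl, of _ _ "indicator (A \<inter> K)"]) (auto simp: indicator_def)
  qed
  have l: "integral\<^sup>L M u \<le> measure M (A \<inter> K)" "measure M (A \<inter> K) \<le> integral\<^sup>L M v"
    unfolding ind[symmetric]
    by (rule integral_mono[OF cont_integrable[OF uv(1)] intA], use uv(3) space_M in blast)
      (rule integral_mono[OF intA cont_integrable[OF uv(2)]], use uv(3) space_M in blast)
  have Pl: "measure_pmf.expectation (P n) u \<le> measure_pmf.prob (P n) A"
    "measure_pmf.prob (P n) A \<le> measure_pmf.expectation (P n) v" for n
  proof -
    have bnd: "AE x in measure_pmf (P n). norm (u x) \<le> 1" "AE x in measure_pmf (P n). norm (v x) \<le> 1"
      using P[of n] uv(3) by (auto simp: AE_measure_pmf_iff indicator_def abs_le_iff split: if_splits) force+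
    have i: "integrable (measure_pmf (P n)) u" "integrable (measure_pmf (P n)) v"
      using bnd by (auto intro!: measure_pmf.integrable_const_bound[where B=1])
    have iA: "integrable (measure_pmf (P n)) (indicat_real A)"
      by (auto intro!: measure_pmf.integrable_const_bound[where B=1])
    have eq: "measure_pmf.prob (P n) A = measure_pmf.expectation (P n) (indicat_real A)" by simp
    show "measure_pmf.expectation (P n) u \<le> measure_pmf.prob (P n) A"
      unfolding eq using P[of n] uv(3) by (intro integral_mono_AE i iA) (auto simp: AE_measure_pmf_iff)
    show "measure_pmf.prob (P n) A \<le> measure_pmf.expectation (P n) v"
      unfolding eq using P[of n] uv(3) by (intro integral_mono_AE i iA) (auto simp: AE_measure_pmf_iff)
  qed
  have "\<forall>\<^sub>F n in sequentially. dist (measure_pmf.expectation (P n) u) (integral\<^sup>L M u) < e / 2"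
    using conv[OF uv(1)] e2 by (rule tendstoD)
  moreover have "\<forall>\<^sub>F n in sequentially. dist (measure_pmf.expectation (P n) v) (integral\<^sup>L M v) < e / 2"
    using conv[OF uv(2)] e2 by (rule tendstoD)
  ultimately have "\<forall>\<^sub>F n in sequentially. norm (measure_pmf.prob (P n) A - measure M (A \<inter> K)) < e"
  proof eventually_elim
    case (elim n)
    then show ?case using Pl[of n] l uv(4) unfolding diff dist_real_def real_norm_def by linarith
  qed
  then show "\<exists>no. \<forall>n\<ge>no. norm (measure_pmf.prob (P n) A - measure M (A \<inter> K)) < e"
    unfolding eventually_sequentially .
qed

end

text \<open>At the limit 0, \<open>\<bar>x * ln x\<bar> \<le> 2 * sqrt x\<close> on [0,1] follows
  from \<open>- ln s \<le> 1 / s\<close> with \<open>s = sqrt x\<close>.\<close>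

lemma tendsto_mult_ln_self:
  fixes X :: "nat \<Rightarrow> real"
  assumes X: "X \<longlonglongrightarrow> x" and b: "\<And>n. 0 \<le> X n" "\<And>n. X n \<le> 1"
  shows "(\<lambda>n. X n * ln (X n)) \<longlonglongrightarrow> x * ln x"
proof (cases "x = 0")
  case False
  then show ?thesis using X by (intro tendsto_mult tendsto_ln)
next
  case True
  have bound: "norm (X n * ln (X n)) \<le> 2 * sqrt (X n)" for n
  proof (cases "X n = 0")
    case False
    define s where "s = sqrt (X n)"
    have s: "s > 0" "X n = s * s" using False b(1)[of n] by (auto simp: s_def)
    have "ln (1 / s) \<le> 1 / s - 1" using s by (intro ln_le_minus_one) auto
    then have "- ln s \<le> 1 / s" using s by (simp add: ln_div)
    then have "s * s * (- ln s) \<le> s * s * (1 / s)" using s by (intro mult_left_mono) auto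
    moreover have "X n * ln (X n) = 2 * (s * s * ln s)" using s by (simp add: ln_mult_pos algebra_simps)
    moreover have "X n * ln (X n) \<le> 0" using b(2)[of n] b(1)[of n] False by (intro mult_nonneg_nonpos) auto
    ultimately show ?thesis using s(1) by (simp add: s_def[symmetric])
  qed simp
  have "(\<lambda>n. 2 * sqrt (X n)) \<longlonglongrightarrow> 2 * sqrt 0" 
    by (rule tendsto_mult_left[OF tendsto_real_sqrt]) (use X True in simp)
  then have "(\<lambda>n. X n * ln (X n)) \<longlonglongrightarrow> 0"
    by (intro Lim_null_comparison[OF always_eventually[OF allI[OF bound]]]) simp
  then show ?thesis using True by simp
qed

lemma gibbs_pmf:
  assumes E: "finite E" "E \<noteq> {}"
  obtains V :: "'b pmf" where "\<And>x. pmf V x = (if x \<in> E then exp (S x) / (\<Sum>y\<in>E. exp (S y)) else 0)"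
    "set_pmf V = E"
proof -
  define Z where "Z = (\<Sum>y\<in>E. exp (S y :: real))"
  have Z: "Z > 0" unfolding Z_def using E by (intro sum_pos) auto
  let ?f = "\<lambda>x. if x \<in> E then exp (S x) / Z else 0"
  have "(\<integral>\<^sup>+ x. ennreal (?f x) \<partial>count_space UNIV) = (\<Sum>x\<in>E. ennreal (?f x))"
    using E by (intro nn_integral_count_space') auto
  also have "\<dots> = ennreal (\<Sum>x\<in>E. exp (S x) / Z)" using Z by (subst sum_ennreal) auto
  also have "(\<Sum>x\<in>E. exp (S x) / Z) = 1" using Z by (simp add: Z_def flip: sum_divide_distrib)
  finally have 1: "(\<integral>\<^sup>+ x. ennreal (?f x) \<partial>count_space UNIV) = 1" by simp
  have p: "pmf (embed_pmf ?f) x = ?f x" for x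
    by (rule pmf_embed_pmf) (use 1 Z in auto)
  show thesis
  proof (rule that)
    show "pmf (embed_pmf ?f) x = (if x \<in> E then exp (S x) / (\<Sum>y\<in>E. exp (S y)) else 0)" for x
      using p[of x] unfolding Z_def .
    show "set_pmf (embed_pmf ?f) = E" by (rule set_eqI) (use Z in \<open>simp add: set_pmf_iff p\<close>)
  qed
qed

section \<open>Partitions into continuity sets and limits of itinerary entropies\<close>

context borel_prob
begin

lemma continuous_measurable_self:
  assumes "continuous_on K f" "f ` K \<subseteq> K"
  shows "f \<in> measurable M M"
proof -
  have "f \<in> measurable (restrict_space borel K) (restrict_space borel K)"
    using assms by (intro measurable_restrict_space2 borel_measurable_continuous_on_restrict) (auto simp: space_restrict_space)
  then show ?thesis using measurable_cong_sets[OF sets_M sets_M] by blast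
qed

lemma cont_set_funpow:
  assumes "cont_set A" and f: "continuous_on K f" "f ` K \<subseteq> K" "f \<in> measurable M M" "distr M M f = M"
  shows "cont_set ((f ^^ k) -` A)"
proof (induction k)
  case (Suc k)
  have e: "(f ^^ Suc k) -` A = f -` ((f ^^ k) -` A)" by (auto simp: funpow_swap1)
  show ?case unfolding e by (rule cont_set_vimage[OF Suc f])
qed (use assms in simp)

text \<open>The law of \<rho> has only countably many atoms, so some level in the interval is
  null.\<close>

lemma null_radius:
  fixes \<rho> :: "'b \<Rightarrow> real"
  assumes \<rho>: "\<rho> \<in> borel_measurable M" and ab: "a < b"
  obtains t where "a < t" "t < b" "measure M {x \<in> space M. \<rho> x = t} = 0"
proof -
  interpret D: finite_borel_measure "distr M borel \<rho>"
    by (intro finite_borel_measure.intro finite_measure_distr \<rho> finite_borel_measure_axioms.intro) simp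
  have "{a<..<b} - {t. measure (distr M borel \<rho>) {t} > 0} \<noteq> {}"
  proof
    assume "{a<..<b} - {t. measure (distr M borel \<rho>) {t} > 0} = {}"
    then have "{a<..<b} \<subseteq> {t. measure (distr M borel \<rho>) {t} > 0}" by blast
    then have "countable {a<..<b}" using D.countable_atoms countable_subset by blast
    then show False using uncountable_open_interval[of a b] ab by simp
  qed
  then obtain t where t: "t \<in> {a<..<b}" "\<not> measure (distr M borel \<rho>) {t} > 0" by blast
  have "measure (distr M borel \<rho>) {t} = measure M (\<rho> -` {t} \<inter> space M)"
    using \<rho> by (intro measure_distr) auto
  also have "\<rho> -` {t} \<inter> space M = {x \<in> space M. \<rho> x = t}" by auto
  finally have "measure M {x \<in> space M. \<rho> x = t} = 0" using t(2) by (simp add: zero_less_measure_iff)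
  then show thesis using that t(1) by auto
qed

text \<open>A point receives the least index of a net point whose ball contains its image. Radii
  between \<open>\<delta> / 4\<close> and \<open>\<delta> / 2\<close> keep the balls covering and
  points of one cell closer than \<delta>; in this range they can be chosen with null
  spheres.\<close>

lemma small_cont_partition:
  fixes \<pi> :: "'b \<Rightarrow> 'c::metric_space" and C :: "'c set"
  assumes \<pi>: "continuous_on K \<pi>" and \<delta>: "\<delta> > 0" and C: "finite C" "\<And>y. \<exists>z\<in>C. dist y z < \<delta> / 4"
  obtains c :: "'b \<Rightarrow> nat" where "finite (range c)" "simple_function M c"
    "\<And>i. cont_set {x. c x = i}" "\<And>x y. c x = c y \<Longrightarrow> dist (\<pi> x) (\<pi> y) < \<delta>"
proof -
  obtain m and cs :: "nat \<Rightarrow> 'c" where cs: "C = cs ` {i. i < m}" using C(1) finite_imp_nat_seg_image_inj_on by blast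
  have d: "continuous_on K (\<lambda>x. dist (\<pi> x) (cs i))" for i using \<pi> by (intro continuous_intros)
  have "\<exists>t. \<delta> / 4 < t \<and> t < \<delta> / 2 \<and> measure M {x \<in> space M. dist (\<pi> x) (cs i) = t} = 0" for i
    by (rule null_radius[OF cont_measurable[OF d[of i]], of "\<delta> / 4" "\<delta> / 2"]) (use \<delta> in auto)
  then obtain t where t: "\<And>i. \<delta> / 4 < t i" "\<And>i. t i < \<delta> / 2"
    "\<And>i. measure M {x \<in> space M. dist (\<pi> x) (cs i) = t i} = 0" by metis
  define Q where "Q x i \<longleftrightarrow> i < m \<and> dist (\<pi> x) (cs i) < t i" for x i
  define c where "c x = (LEAST i. Q x i)" for x
  have ex: "\<exists>i. Q x i" for x
  proof -
    obtain z where "z \<in> C" "dist (\<pi> x) z < \<delta> / 4" using C(2) by blast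
    then obtain i where "i < m" "dist (\<pi> x) (cs i) < \<delta> / 4" using cs by auto
    then show ?thesis using t(1)[of i] unfolding Q_def by (intro exI[of _ i]) simp
  qed
  have cQ: "Q x (c x)" for x unfolding c_def using ex by (rule LeastI_ex)
  have cl: "\<not> Q x j" if "j < c x" for x j using that unfolding c_def by (rule not_less_Least)
  have iff: "c x = i \<longleftrightarrow> Q x i \<and> (\<forall>j<i. \<not> Q x j)" for x i
  proof
    assume "c x = i"
    then show "Q x i \<and> (\<forall>j<i. \<not> Q x j)" using cQ[of x] cl[of _ x] by blast
  next
    assume a: "Q x i \<and> (\<forall>j<i. \<not> Q x j)"
    show "c x = i" unfolding c_def
    proof (rule Least_equality)
      show "Q x i" using a by blast
      show "i \<le> j" if "Q x j" for j using a that by (meson not_le)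
    qed
  qed
  have Qc: "cont_set {x. Q x i}" for i
  proof (cases "i < m")
    case True
    then have "{x. Q x i} = {x. dist (\<pi> x) (cs i) < t i}" by (simp add: Q_def)
    then show ?thesis using cont_set_sublevel[OF d t(3)] by simp
  next
    case False
    then have "{x. Q x i} = - UNIV" by (simp add: Q_def)
    then show ?thesis using cont_set_compl[OF cont_set_UNIV] by simp
  qed
  have Qs: "{x \<in> space M. Q x i} \<in> sets M" for i
  proof -
    note [measurable] = cont_measurable[OF d[of i]]
    show ?thesis unfolding Q_def by measurable
  qed
  have cell: "{x. c x = i} = {x. Q x i} \<inter> (\<Inter>j\<in>{..<i}. - {x. Q x j})" for i unfolding iff by auto
  have cc: "cont_set {x. c x = i}" for i
    unfolding cell by (intro cont_set_Int Qc cont_set_INT cont_set_compl) auto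
  have csets: "{x \<in> space M. c x = i} \<in> sets M" for i
  proof -
    have "{x \<in> space M. c x = i} = {x \<in> space M. Q x i} - (\<Union>j\<in>{..<i}. {x \<in> space M. Q x j})"
      unfolding iff by auto
    then show ?thesis using Qs by auto
  qed
  have fin: "finite (range c)"
    by (rule finite_subset[of _ "{..<m}"]) (use cQ in \<open>auto simp: Q_def\<close>)
  have sf: "simple_function M c"
    unfolding simple_function_def
  proof (intro conjI ballI)
    show "finite (c ` space M)" using fin by (rule finite_subset[rotated]) auto
    fix i
    have "c -` {i} \<inter> space M = {x \<in> space M. c x = i}" by auto
    then show "c -` {i} \<inter> space M \<in> sets M" using csets by simp
  qed
  show thesis
  proof (rule that[OF fin sf cc])
    fix x y assume xy: "c x = c y"
    have "dist (\<pi> x) (cs (c x)) < \<delta> / 2" "dist (\<pi> y) (cs (c x)) < \<delta> / 2"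
      using cQ[of x] cQ[of y] t(2)[of "c x"] xy unfolding Q_def by auto
    then show "dist (\<pi> x) (\<pi> y) < \<delta>" by (metis dist_commute dist_triangle_half_r)
  qed
qed

text \<open>Each fibre of a finite itinerary is a finite intersection of preimages of cells, hence a
  continuity set, and entropy is a continuous function of finitely many probabilities.\<close>

lemma shannon_itinerary_limit:
  fixes c :: "'b \<Rightarrow> 'c"
  assumes f: "continuous_on K f" "f ` K \<subseteq> K" "f \<in> measurable M M" "distr M M f = M"
    and c: "finite (range c)" "simple_function M c" "\<And>i. cont_set {x. c x = i}"
    and P: "\<And>n. set_pmf (P n) \<subseteq> K"
    and conv: "\<And>u :: 'b \<Rightarrow> real. continuous_on K u \<Longrightarrow>
       (\<lambda>n. measure_pmf.expectation (P n) u) \<longlonglongrightarrow> integral\<^sup>L M u"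
  shows "(\<lambda>n. shannon (measure_pmf (P n)) (itinerary f c q)) \<longlonglongrightarrow> shannon M (itinerary f c q)"
proof -
  let ?W = "{w. set w \<subseteq> range c \<and> length w = q}"
  note fr = finite_range_itinerary(2)[OF c(1), where f=f and n=q] finite_range_itinerary(3)[OF c(1), of q]
  have lim: "(\<lambda>n. measure_pmf.prob (P n) (itinerary f c q -` {w})) \<longlonglongrightarrow> measure M (itinerary f c q -` {w} \<inter> K)"
    if w: "w \<in> ?W" for w
  proof -
    have "itinerary f c q -` {w} = (\<Inter>k\<in>{..<q}. (f ^^ k) -` {x. c x = w ! k})"
    proof (rule set_eqI)
      fix x
      have "itinerary f c q x = w \<longleftrightarrow> (\<forall>k<q. c ((f ^^ k) x) = w ! k)"
        using w unfolding itinerary_def list_eq_iff_nth_eq by simp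
      then show "x \<in> itinerary f c q -` {w} \<longleftrightarrow> x \<in> (\<Inter>k\<in>{..<q}. (f ^^ k) -` {x. c x = w ! k})"
        unfolding INT_iff Ball_def vimage_def mem_Collect_eq lessThan_iff singleton_iff .
    qed
    moreover have "cont_set (\<Inter>k\<in>{..<q}. (f ^^ k) -` {x. c x = w ! k})"
      by (rule cont_set_INT[OF finite_lessThan]) (rule cont_set_funpow[OF c(3) f])
    ultimately have A: "cont_set (itinerary f c q -` {w})" by (simp only:)
    have S: "itinerary f c q -` {w} \<inter> K \<in> sets M"
      using simple_functionD(2)[OF simple_function_itinerary[OF f(3) c(2)]] by (simp add: space_M)
    show ?thesis by (rule cont_set_limit[OF A S P conv])
  qed
  have sM: "shannon M (itinerary f c q) = - (\<Sum>w\<in>?W. measure M (itinerary f c q -` {w} \<inter> K) * ln (measure M (itinerary f c q -` {w} \<inter> K)))"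
    using shannon_superset[of ?W "itinerary f c q" M] fr by (simp add: space_M image_subset_iff)
  have sP: "shannon (measure_pmf (P n)) (itinerary f c q) =
      - (\<Sum>w\<in>?W. measure_pmf.prob (P n) (itinerary f c q -` {w}) * ln (measure_pmf.prob (P n) (itinerary f c q -` {w})))" for n
    using shannon_superset[of ?W "itinerary f c q" "measure_pmf (P n)"] fr by simp
  show ?thesis unfolding sM sP
    by (intro tendsto_minus tendsto_sum tendsto_mult_ln_self lim) auto
qed

end

text \<open>\<open>E n\<close> carries the measure with weights proportional to
  \<open>exp (S n x)\<close>, for which entropy plus integral equals the logarithm of the sum; its
  orbit averages have an invariant weak limit. Separation is asked for after applying \<pi>, at one
  scale \<delta>, so a single partition into cells of small \<pi>-diameter already gives
  \<open>\<rho>\<close>.\<close>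

theorem misiurewicz:
  fixes K :: "'b::metric_space set" and \<pi> :: "'b \<Rightarrow> 'c::metric_space" and \<phi> :: "'b \<Rightarrow> real"
    and C :: "'c set"
  assumes K: "compact K" and f: "continuous_on K f" "f ` K \<subseteq> K" and \<phi>: "continuous_on K \<phi>"
    and \<pi>: "continuous_on K \<pi>" and \<delta>: "\<delta> > 0" and C: "finite C" "\<And>y. \<exists>z\<in>C. dist y z < \<delta> / 4"
    and E: "\<And>n. n \<ge> 1 \<Longrightarrow> finite (E n)" "\<And>n. n \<ge> 1 \<Longrightarrow> E n \<noteq> {}" "\<And>n. n \<ge> 1 \<Longrightarrow> E n \<subseteq> K"
    and sep: "\<And>n x y. n \<ge> 1 \<Longrightarrow> x \<in> E n \<Longrightarrow> y \<in> E n \<Longrightarrow> x \<noteq> y \<Longrightarrow>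
      \<exists>k<n. \<delta> \<le> dist (\<pi> ((f ^^ k) x)) (\<pi> ((f ^^ k) y))"
    and lower: "\<And>n. n \<ge> 1 \<Longrightarrow> real n * \<rho> - B \<le> ln (\<Sum>x\<in>E n. exp (\<Sum>k<n. \<phi> ((f ^^ k) x)))"
  obtains M and c :: "'b \<Rightarrow> nat" where "borel_prob M K" "f \<in> measurable M M" "distr M M f = M"
    "simple_function M c" "\<rho> \<le> lim (\<lambda>n. shannon M (itinerary f c n) / real n) + integral\<^sup>L M \<phi>"
proof -
  define S where "S n x = (\<Sum>k<n. \<phi> ((f ^^ k) x))" for n x
  have "\<exists>V. n \<ge> 1 \<longrightarrow> (\<forall>x. pmf V x = (if x \<in> E n then exp (S n x) / (\<Sum>y\<in>E n. exp (S n y)) else 0)) \<and> set_pmf V = E n" for n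
  proof (cases "n \<ge> 1")
    case True
    show ?thesis by (rule gibbs_pmf[OF E(1)[OF True] E(2)[OF True], of "S n"]) blast
  qed auto
  then obtain V where V: "\<And>n x. n \<ge> 1 \<Longrightarrow> pmf (V n) x = (if x \<in> E n then exp (S n x) / (\<Sum>y\<in>E n. exp (S n y)) else 0)"
    "\<And>n. n \<ge> 1 \<Longrightarrow> set_pmf (V n) = E n" by metis
  define P where "P n = orbit_pmf f (Suc n) (V (Suc n))" for n
  have fk: "(f ^^ k) x \<in> K" if "x \<in> K" for k x using that f(2) by (induction k) auto
  have PK: "set_pmf (P n) \<subseteq> K" for n
    unfolding P_def orbit_pmf_def using V(2)[of "Suc n"] E(3)[of "Suc n"] fk by (auto simp: set_pmf_of_set)
  obtain r M where r: "strict_mono r" and M: "borel_prob M K" and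
    conv: "\<And>u :: 'b \<Rightarrow> real. continuous_on K u \<Longrightarrow>
       (\<lambda>n. measure_pmf.expectation (P (r n)) u) \<longlonglongrightarrow> integral\<^sup>L M u"
    by (rule pmf_weak_limit[OF K PK]) (assumption | rule that)+
  interpret borel_prob M K by fact
  have fm: "f \<in> measurable M M" by (rule continuous_measurable_self[OF f])
  have Pexp: "measure_pmf.expectation (P n) u =
      (\<Sum>k<Suc n. measure_pmf.expectation (V (Suc n)) (\<lambda>x. u ((f ^^ k) x))) / real (Suc n)" for n u
    unfolding P_def by (rule orbit_pmf_expectation) (use V(2)[of "Suc n"] E(1)[of "Suc n"] in auto)
  have over_n: "(\<lambda>n. a / real (Suc (r n))) \<longlonglongrightarrow> 0" for a
    using LIMSEQ_subseq_LIMSEQ[OF LIMSEQ_Suc[OF lim_const_over_n[of a]] r] by (simp add: comp_def)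
  have inv: "distr M M f = M"
  proof (rule borel_prob_eqI_integral[of _ K])
    show "borel_prob (distr M M f) K"
      by (intro borel_prob.intro borel_prob_axioms.intro prob_space_distr fm K) (simp add: sets_M)
    show "borel_prob M K" by fact
    fix u :: "'b \<Rightarrow> real" assume u: "continuous_on K u"
    have uf: "continuous_on K (\<lambda>x. u (f x))" by (rule continuous_on_compose2[OF u f])
    have "bounded (u ` K)" using compact_continuous_image[OF u K] compact_imp_bounded by blast
    then obtain Bu where Bu: "\<And>x. x \<in> K \<Longrightarrow> \<bar>u x\<bar> \<le> Bu" by (auto simp: bounded_iff)
    \<comment> \<open>Averaging over an orbit makes the difference telescope to its two end terms,
      divided by the length.\<close>
    have diff: "norm (measure_pmf.expectation (P n) (\<lambda>x. u (f x)) - measure_pmf.expectation (P n) u) \<le> 2 * Bu / real (Suc n)" for n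
    proof -
      let ?a = "\<lambda>k. measure_pmf.expectation (V (Suc n)) (\<lambda>x. u ((f ^^ k) x))"
      have a: "\<bar>?a k\<bar> \<le> Bu" for k
      proof -
        have "norm (?a k) \<le> measure_pmf.expectation (V (Suc n)) (\<lambda>x. norm (u ((f ^^ k) x)))"
          by (rule integral_norm_bound)
        also have "\<dots> \<le> Bu"
        proof (rule measure_pmf.integral_le_const)
          have b: "AE x in measure_pmf (V (Suc n)). norm (u ((f ^^ k) x)) \<le> Bu"
            using V(2)[of "Suc n"] E(3)[of "Suc n"] fk Bu by (auto simp: AE_measure_pmf_iff)
          then show "AE x in measure_pmf (V (Suc n)). norm (u ((f ^^ k) x)) \<le> Bu" .
          show "integrable (measure_pmf (V (Suc n))) (\<lambda>x. norm (u ((f ^^ k) x)))"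
            using b by (intro measure_pmf.integrable_const_bound[where B=Bu]) auto
        qed
        finally show ?thesis by simp
      qed
      have "measure_pmf.expectation (P n) (\<lambda>x. u (f x)) - measure_pmf.expectation (P n) u =
          ((\<Sum>k<Suc n. ?a (Suc k)) - (\<Sum>k<Suc n. ?a k)) / real (Suc n)"
        unfolding Pexp by (simp add: diff_divide_distrib)
      also have "(\<Sum>k<Suc n. ?a (Suc k)) - (\<Sum>k<Suc n. ?a k) = ?a (Suc n) - ?a 0"
        unfolding sum_subtractf[symmetric] by (rule sum_lessThan_telescope)
      also have "norm ((?a (Suc n) - ?a 0) / real (Suc n)) \<le> 2 * Bu / real (Suc n)"
      proof -
        have "\<bar>?a (Suc n) - ?a 0\<bar> \<le> 2 * Bu" using a[of "Suc n"] a[of 0] by linarith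
        then have "\<bar>?a (Suc n) - ?a 0\<bar> / real (Suc n) \<le> 2 * Bu / real (Suc n)"
          by (rule divide_right_mono) simp
        then show ?thesis unfolding real_norm_def abs_divide abs_of_nat .
      qed
      finally show ?thesis .
    qed
    have "(\<lambda>n. measure_pmf.expectation (P (r n)) (\<lambda>x. u (f x)) - measure_pmf.expectation (P (r n)) u) \<longlonglongrightarrow> 0"
      by (rule Lim_null_comparison[OF always_eventually[OF allI[OF diff]] over_n])
    moreover have "(\<lambda>n. measure_pmf.expectation (P (r n)) (\<lambda>x. u (f x)) - measure_pmf.expectation (P (r n)) u)
        \<longlonglongrightarrow> (\<integral>x. u (f x) \<partial>M) - integral\<^sup>L M u"
      by (intro tendsto_diff conv u uf)
    ultimately have "(\<integral>x. u (f x) \<partial>M) = integral\<^sup>L M u" using LIMSEQ_unique by fastforce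
    then show "integral\<^sup>L (distr M M f) u = integral\<^sup>L M u"
      using integral_distr[OF fm cont_measurable[OF u]] by simp
  qed
  obtain c :: "'b \<Rightarrow> nat" where c: "finite (range c)" "simple_function M c"
    "\<And>i. cont_set {x. c x = i}" "\<And>x y. c x = c y \<Longrightarrow> dist (\<pi> x) (\<pi> y) < \<delta>"
    by (rule small_cont_partition[OF \<pi> \<delta> C]) (assumption | rule that)+
  have limH: "(\<lambda>n. shannon (measure_pmf (P (r n))) (itinerary f c q)) \<longlonglongrightarrow> shannon M (itinerary f c q)" for q
    by (rule shannon_itinerary_limit[OF f fm inv c(1,2,3) PK conv])
  \<comment> \<open>The block length \<open>q\<close> is fixed while \<open>n\<close> tends to
    infinity, so only entropies of itineraries of length \<open>q\<close>, which converge, have to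
    pass to the limit; afterwards \<open>q\<close> tends to infinity.\<close>
  have key: "real q * \<rho> \<le> shannon M (itinerary f c q) + real q * integral\<^sup>L M \<phi>" if q: "q \<ge> 1" for q
  proof -
    let ?L = "real q * (real q * ln (real (card (range c))))"
    have step: "real q * \<rho> \<le> shannon (measure_pmf (P n)) (itinerary f c q) +
        real q * measure_pmf.expectation (P n) \<phi> + (?L + real q * B) / real (Suc n)" for n
    proof -
      let ?N = "Suc n" and ?V = "measure_pmf (V (Suc n))"
      have N: "?N \<ge> 1" by simp
      have finV: "finite (set_pmf (V ?N))" using V(2)[OF N] E(1)[OF N] by simp
      have inj: "inj_on (itinerary f c ?N) (E ?N)"
      proof (rule inj_onI, rule ccontr)
        fix x y assume xy: "x \<in> E ?N" "y \<in> E ?N" "itinerary f c ?N x = itinerary f c ?N y" "x \<noteq> y"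
        obtain k where k: "k < ?N" "\<delta> \<le> dist (\<pi> ((f ^^ k) x)) (\<pi> ((f ^^ k) y))" using sep[OF N xy(1,2,4)] by blast
        then show False using c(4)[of "(f ^^ k) x" "(f ^^ k) y"] xy(3) by (simp add: itinerary_eq_iff)
      qed
      have H1: "shannon ?V (itinerary f c ?N) = ln (\<Sum>y\<in>E ?N. exp (S ?N y)) - measure_pmf.expectation (V ?N) (S ?N)"
        by (rule shannon_separated[OF E(1)[OF N] E(2)[OF N] V(1)[OF N] finite_range_itinerary(1)[OF c(1)] inj])
      have H2: "real q * shannon ?V (itinerary f c ?N) \<le> (\<Sum>k<?N. shannon ?V (\<lambda>x. itinerary f c q ((f ^^ k) x))) + ?L"
        by (rule shannon_itinerary_blocks[OF c(1) q])
      have H3: "(\<Sum>k<?N. shannon ?V (\<lambda>x. itinerary f c q ((f ^^ k) x))) \<le> real ?N * shannon (measure_pmf (P n)) (itinerary f c q)"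
        unfolding P_def by (rule shannon_orbit_pmf[OF N finV finite_range_itinerary(1)[OF c(1)]])
      have H4: "measure_pmf.expectation (V ?N) (S ?N) = real ?N * measure_pmf.expectation (P n) \<phi>"
      proof -
        have "measure_pmf.expectation (V ?N) (S ?N) = (\<Sum>k<?N. measure_pmf.expectation (V ?N) (\<lambda>x. \<phi> ((f ^^ k) x)))"
          unfolding S_def using finV by (intro Bochner_Integration.integral_sum integrable_measure_pmf_finite)
        then show ?thesis unfolding Pexp by simp
      qed
      have H5: "real ?N * \<rho> - B \<le> ln (\<Sum>y\<in>E ?N. exp (S ?N y))" unfolding S_def by (rule lower[OF N])
      have "real q * (real ?N * \<rho> - B) \<le> real q * (shannon ?V (itinerary f c ?N) + real ?N * measure_pmf.expectation (P n) \<phi>)"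
        using H5 H1 H4 by (intro mult_left_mono) auto
      also have "\<dots> \<le> real ?N * shannon (measure_pmf (P n)) (itinerary f c q) + ?L + real q * (real ?N * measure_pmf.expectation (P n) \<phi>)"
        using H2 H3 unfolding distrib_left by linarith
      finally have "real ?N * (real q * \<rho>) \<le> real ?N * (shannon (measure_pmf (P n)) (itinerary f c q) + real q * measure_pmf.expectation (P n) \<phi>) + (?L + real q * B)"
        by (simp only: algebra_simps)
      moreover have "a \<le> b + d / N" if "N * a \<le> N * b + d" "N > 0" for a b d N :: real
        using that by (simp add: field_simps)
      ultimately show ?thesis by (metis of_nat_0_less_iff zero_less_Suc)
    qed
    have "(\<lambda>n. shannon (measure_pmf (P (r n))) (itinerary f c q) +
        real q * measure_pmf.expectation (P (r n)) \<phi> + (?L + real q * B) / real (Suc (r n)))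
        \<longlonglongrightarrow> shannon M (itinerary f c q) + real q * integral\<^sup>L M \<phi> + 0"
      by (intro tendsto_intros limH conv \<phi> over_n)
    then have "real q * \<rho> \<le> shannon M (itinerary f c q) + real q * integral\<^sup>L M \<phi> + 0"
      by (rule LIMSEQ_le_const) (use step in blast)
    then show ?thesis by simp
  qed
  obtain h where h: "(\<lambda>n. shannon M (itinerary f c n) / real n) \<longlonglongrightarrow> h"
    using itinerary_entropy_rate[OF fm inv c(2)] by blast
  have "\<rho> - integral\<^sup>L M \<phi> \<le> shannon M (itinerary f c q) / real q" if "q \<ge> 1" for q
    using key[OF that] that by (simp add: field_simps)
  then have "\<rho> - integral\<^sup>L M \<phi> \<le> h" by (intro LIMSEQ_le_const[OF h]) auto
  then have "\<rho> \<le> lim (\<lambda>n. shannon M (itinerary f c n) / real n) + integral\<^sup>L M \<phi>"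
    using limI[OF h] by simp
  then show thesis by (rule that[OF M fm inv c(2)])
qed

section \<open>The natural extension and the variational inequality\<close>

lemma open_coord_nbhd:
  fixes x :: "nat \<Rightarrow> 'a::metric_space"
  shows "open {y. \<forall>j\<le>N. dist (x j) (y j) < \<eta>}"
proof -
  have "open {y :: nat \<Rightarrow> 'a. dist (x j) (y j) < \<eta>}" for j
    by (intro open_Collect_less continuous_intros continuous_on_product_coordinates)
  then have "open (\<Inter>j\<in>{..N}. {y :: nat \<Rightarrow> 'a. dist (x j) (y j) < \<eta>})" by (intro open_INT) auto
  moreover have "(\<Inter>j\<in>{..N}. {y :: nat \<Rightarrow> 'a. dist (x j) (y j) < \<eta>}) = {y. \<forall>j\<le>N. dist (x j) (y j) < \<eta>}" by auto
  ultimately show ?thesis by simp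
qed

text \<open>This concerns the metric of the function type, a weighted series over coordinates
  enumerated by \<open>from_nat\<close>; its first terms decide the distance up to
  \<open>(1 / 2) ^ n\<close>.\<close>

lemma coord_close:
  assumes "e > 0"
  shows "\<exists>N. \<exists>\<eta>>0. \<forall>x y :: nat \<Rightarrow> 'a::metric_space. (\<forall>j\<le>N. dist (x j) (y j) < \<eta>) \<longrightarrow> dist x y < e"
proof -
  obtain n where n: "(1 / 2 :: real) ^ n < e / 2" using real_arch_pow_inv[of "e / 2" "1 / 2"] assms by auto
  define N where "N = Max ((from_nat :: nat \<Rightarrow> nat) ` {..n})"
  have "dist x y < e" if a: "\<And>j. j \<le> N \<Longrightarrow> dist (x j) (y j) < e / 4" for x y :: "nat \<Rightarrow> 'a"
  proof -
    let ?S = "{dist (x (from_nat i)) (y (from_nat i)) |i. i \<le> n}"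
    have S: "?S = (\<lambda>i. dist (x (from_nat i)) (y (from_nat i))) ` {..n}" by auto
    have "Max ?S < e / 4" unfolding S
    proof (subst Max_less_iff)
      show "\<forall>v\<in>(\<lambda>i. dist (x (from_nat i)) (y (from_nat i))) ` {..n}. v < e / 4"
        using a by (auto simp: N_def intro!: Max_ge)
    qed auto
    then show ?thesis using dist_fun_le_dist_first_terms[of x y n] n by linarith
  qed
  then show ?thesis using assms by (intro exI[of _ N] exI[of _ "e / 4"]) auto
qed

text \<open>Up to index \<open>k\<close> the coordinates come from the forward orbit of
  \<open>x 0\<close>: the history of \<open>x\<close> recedes with time, and so orbits can be
  compared on the base.\<close>

lemma funpow_nat_ext_map:
  "(nat_ext_map g ^^ k) x j = (if j \<le> k then (g ^^ (k - j)) (x 0) else x (j - k))"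
proof (induction k arbitrary: j)
  case (Suc k)
  show ?case
  proof (cases j)
    case 0
    then show ?thesis using Suc[of 0] by (simp add: nat_ext_map_def)
  next
    case (Suc i)
    then show ?thesis using Suc.IH[of i] by (simp add: nat_ext_map_def)
  qed
qed auto

lemma nat_ext_map_closed: "x \<in> nat_ext g \<Longrightarrow> nat_ext_map g x \<in> nat_ext g"
  by (auto simp: nat_ext_def nat_ext_map_def split: nat.split)

lemma nat_ext_funpow_closed: "x \<in> nat_ext g \<Longrightarrow> (nat_ext_map g ^^ k) x \<in> nat_ext g"
  by (induction k) (auto intro: nat_ext_map_closed)

context expanding_system
begin

lemma continuous_coord: "continuous_on A (\<lambda>x :: nat \<Rightarrow> 'a. x i)"
  using continuous_on_subset[OF continuous_on_product_coordinates[of i]] by blast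

lemma continuous_g_coord: "continuous_on A (\<lambda>x :: nat \<Rightarrow> 'a. g (x i))"
  by (rule continuous_on_compose2[OF cont_g continuous_coord]) simp

lemma compact_nat_ext: "compact (nat_ext g)"
proof -
  have "compactin (product_topology (\<lambda>i::nat. euclidean :: 'a topology) UNIV) (PiE UNIV (\<lambda>_. UNIV))"
    unfolding compactin_PiE using compact_base by simp
  then have "compact (UNIV :: (nat \<Rightarrow> 'a) set)"
    by (simp add: euclidean_product_topology PiE_UNIV_domain)
  moreover have "closed (nat_ext g)"
  proof -
    have "nat_ext g = (\<Inter>i. {x. g (x (Suc i)) = x i})" by (auto simp: nat_ext_def)
    moreover have "closed (\<Inter>i. {x :: nat \<Rightarrow> 'a. g (x (Suc i)) = x i})"
      by (intro closed_INT ballI closed_Collect_eq continuous_g_coord continuous_coord)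
    ultimately show ?thesis by (simp only:)
  qed
  ultimately show ?thesis using closed_Int_compact[of "nat_ext g" UNIV] by simp
qed

lemma continuous_nat_ext_map: "continuous_on A (nat_ext_map g)"
proof (rule continuous_on_coordinatewise_then_product)
  fix i show "continuous_on A (\<lambda>x. nat_ext_map g x i)"
    by (cases i) (simp_all add: nat_ext_map_def continuous_coord continuous_g_coord)
qed

text \<open>A section of the projection to coordinate 0, obtained from a fixed choice of preimages;
  it carries no continuity in \<open>x\<close>.\<close>

definition past :: "'a \<Rightarrow> nat \<Rightarrow> 'a" where "past x n = (inv g ^^ n) x"

lemma past: "past x \<in> nat_ext g" "past x 0 = x"
proof -
  have "surj g" using surj_iter[of 1] by (simp add: surj_def) metis
  then show "past x \<in> nat_ext g" by (auto simp: nat_ext_def past_def surj_f_inv_f)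
qed (simp add: past_def)

lemma open_bclose: "open {x. bclose n \<delta> x w}"
proof -
  have cg: "continuous_on UNIV (g ^^ j)" for j
  proof (induction j)
    case (Suc j)
    then show ?case by (simp add: continuous_on_compose2[OF cont_g] comp_def)
  qed (simp add: id_def)
  have "open {x. dist ((g ^^ j) x) ((g ^^ j) w) < \<delta>}" for j
    by (intro open_Collect_less continuous_intros cg)
  then have "open (\<Inter>j\<in>{..<n}. {x. dist ((g ^^ j) x) ((g ^^ j) w) < \<delta>})" by (intro open_INT) auto
  moreover have "(\<Inter>j\<in>{..<n}. {x. dist ((g ^^ j) x) ((g ^^ j) w) < \<delta>}) = {x. bclose n \<delta> x w}"
    by (auto simp: bclose_def)
  ultimately show ?thesis by simp
qed

end

section \<open>Approximating a measurable partition by separated compact sets\<close>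

lemma compact_separation:
  fixes S T :: "'b::metric_space set"
  assumes "compact S" "compact T" "S \<inter> T = {}"
  shows "\<exists>d>0. \<forall>x\<in>S. \<forall>y\<in>T. d \<le> dist x y"
proof (cases "S = {} \<or> T = {}")
  case False
  have "continuous_on S (\<lambda>x. infdist x T)" by (intro continuous_intros)
  then obtain z where z: "z \<in> S" "\<forall>x\<in>S. infdist z T \<le> infdist x T"
    using continuous_attains_inf[OF assms(1), of "\<lambda>x. infdist x T"] False by blast
  have "z \<notin> T" using z(1) assms(3) by blast
  then have "infdist z T > 0"
    using False compact_imp_closed[OF assms(2)] by (intro infdist_pos_not_in_closed) auto
  moreover have "infdist z T \<le> dist x y" if "x \<in> S" "y \<in> T" for x y
    using bspec[OF z(2) that(1)] infdist_le[OF that(2), of x] by linarith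
  ultimately show ?thesis by blast
qed (auto intro: zero_less_one)

lemma finite_separation:
  fixes C :: "'i \<Rightarrow> 'b::metric_space set"
  assumes "finite I" "\<And>i. i \<in> I \<Longrightarrow> compact (C i)" "\<And>i j. i \<in> I \<Longrightarrow> j \<in> I \<Longrightarrow> i \<noteq> j \<Longrightarrow> C i \<inter> C j = {}"
  obtains e where "e > 0" "\<And>i j x y. i \<in> I \<Longrightarrow> j \<in> I \<Longrightarrow> i \<noteq> j \<Longrightarrow> x \<in> C i \<Longrightarrow> y \<in> C j \<Longrightarrow> e \<le> dist x y"
proof -
  let ?J = "{p \<in> I \<times> I. fst p \<noteq> snd p}"
  have "\<exists>d>0. \<forall>x\<in>C (fst p). \<forall>y\<in>C (snd p). d \<le> dist x y" if "p \<in> ?J" for p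
  proof (rule compact_separation)
    show "compact (C (fst p))" "compact (C (snd p))" using that by (auto intro: assms(2))
    show "C (fst p) \<inter> C (snd p) = {}" by (rule assms(3)) (use that in auto)
  qed
  then have "\<forall>p\<in>?J. \<exists>d. d > 0 \<and> (\<forall>x\<in>C (fst p). \<forall>y\<in>C (snd p). d \<le> dist x y)" by simp
  from bchoice[OF this] obtain d where
    d0: "\<forall>p\<in>?J. d p > 0 \<and> (\<forall>x\<in>C (fst p). \<forall>y\<in>C (snd p). d p \<le> dist x y)" ..
  have d: "d p > 0" "x \<in> C (fst p) \<Longrightarrow> y \<in> C (snd p) \<Longrightarrow> d p \<le> dist x y" if "p \<in> ?J" for p x y
    using bspec[OF d0 that] by simp_all
  have fin: "finite (insert 1 (d ` ?J))" using assms(1) by simp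
  define e where "e = Min (insert 1 (d ` ?J))"
  have "e > 0" unfolding e_def using fin d(1) by (subst Min_gr_iff) auto
  moreover have "e \<le> dist x y" if "i \<in> I" "j \<in> I" "i \<noteq> j" "x \<in> C i" "y \<in> C j" for i j x y
  proof -
    have J: "(i, j) \<in> ?J" using that by simp
    have "e \<le> d (i, j)" unfolding e_def by (rule Min_le[OF fin]) (use J in blast)
    also have "\<dots> \<le> dist x y" using d(2)[OF J] that by simp
    finally show ?thesis .
  qed
  ultimately show thesis using that by blast
qed

text \<open>Each cell of the partition is replaced by a large compact subset; \<open>W\<close> records the cell of a point outside these subsets and
  is \<open>None\<close> inside them.\<close>

lemma (in borel_prob) small_entropy_kernel:
  assumes P: "finite P" "P \<subseteq> sets M" "partition_on (space M) P"
    and c: "\<And>x. x \<in> space M \<Longrightarrow> x \<in> c x" "\<And>x. x \<in> space M \<Longrightarrow> c x \<in> P" and \<eta>: "\<eta> > 0"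
  obtains W :: "'b \<Rightarrow> 'b set option" and e where "simple_function M W" "shannon M W \<le> \<eta>" "e > 0"
    "\<And>x y. x \<in> space M \<Longrightarrow> y \<in> space M \<Longrightarrow> W x = W y \<Longrightarrow> dist x y < e \<Longrightarrow> c x = c y"
proof -
  define k where "k = card P + 1"
  have k: "real k > 0" by (simp add: k_def)
  \<comment> \<open>\<open>L\<close> makes the first term of \<open>shannon_small\<close> at most
    \<open>\<eta> / 2\<close>; \<kappa> is then chosen so that the measure lost by the cells makes
    the second term at most \<open>\<eta> / 2\<close> as well.\<close>
  define L where "L = max 0 (ln (2 * real k / \<eta>))"
  have L: "L \<ge> 0" "real k * exp (- L) \<le> \<eta> / 2"
  proof -
    show "L \<ge> 0" by (simp add: L_def)
    have "exp (ln (2 * real k / \<eta>)) \<le> exp L" by (simp add: L_def)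
    then have "2 * real k / \<eta> \<le> exp L" using k \<eta> by simp
    then show "real k * exp (- L) \<le> \<eta> / 2" using \<eta> by (simp add: exp_minus field_simps)
  qed
  define \<kappa> where "\<kappa> = \<eta> / (2 * (L + 1) * real k)"
  have \<kappa>: "\<kappa> > 0" using \<eta> L k by (simp add: \<kappa>_def)
  have "\<exists>C. compact C \<and> C \<subseteq> A \<and> measure M (A - C) < \<kappa>" if "A \<in> P" for A
    by (rule compact_approx[of A \<kappa>]) (use that P(2) \<kappa> in auto)
  then obtain C where C: "\<And>A. A \<in> P \<Longrightarrow> compact (C A)" "\<And>A. A \<in> P \<Longrightarrow> C A \<subseteq> A"
    "\<And>A. A \<in> P \<Longrightarrow> measure M (A - C A) < \<kappa>" by metis
  have disj: "A \<inter> B = {}" if "A \<in> P" "B \<in> P" "A \<noteq> B" for A B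
    using P(3) that by (auto simp: partition_on_def disjoint_def)
  have uniq: "A = c x" if "A \<in> P" "x \<in> A" "x \<in> space M" for A x
    using disj[OF that(1) c(2)[OF that(3)]] c(1)[OF that(3)] that(2) by blast
  obtain e where e: "e > 0" "\<And>A B x y. A \<in> P \<Longrightarrow> B \<in> P \<Longrightarrow> A \<noteq> B \<Longrightarrow> x \<in> C A \<Longrightarrow> y \<in> C B \<Longrightarrow> e \<le> dist x y"
  proof (rule finite_separation[OF P(1), of C])
    show "C i \<inter> C j = {}" if "i \<in> P" "j \<in> P" "i \<noteq> j" for i j using disj[OF that] C(2) that by blast
  qed (use C(1) in \<open>assumption | blast\<close>)+
  have CM: "C A \<in> sets M" if "A \<in> P" for A
  proof -
    have "C A = C A \<inter> K" using C(2)[OF that] sets.sets_into_space[of A M] P(2) that space_M by blast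
    then show ?thesis using Int_K_sets[OF borel_compact[OF C(1)[OF that]]] by simp
  qed
  define W where "W x = (if x \<in> C (c x) then None else Some (c x))" for x
  have Wim: "W ` space M \<subseteq> insert None (Some ` P)" using c(2) by (auto simp: W_def)
  have fin: "finite (W ` space M)" by (rule finite_subset[OF Wim]) (use P(1) in auto)
  have card: "card (W ` space M) \<le> k"
  proof -
    have "card (W ` space M) \<le> card (insert None (Some ` P))" using P(1) by (intro card_mono[OF _ Wim]) auto
    also have "\<dots> \<le> Suc (card (Some ` P))" by (rule card_insert_le_m1[of "Suc (card (Some ` P))", simplified]) simp
    also have "\<dots> \<le> k" using card_image_le[OF P(1), of Some] by (simp add: k_def)
    finally show ?thesis .
  qed
  have kernel_None: "W -` {None} \<inter> space M = (\<Union>A\<in>P. C A)"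
  proof (intro set_eqI iffI)
    fix x assume "x \<in> W -` {None} \<inter> space M"
    then show "x \<in> (\<Union>A\<in>P. C A)" using c(2) by (auto simp: W_def split: if_splits)
  next
    fix x assume "x \<in> (\<Union>A\<in>P. C A)"
    then obtain A where A: "A \<in> P" "x \<in> C A" by blast
    then have x: "x \<in> space M" using C(2) P(2) sets.sets_into_space by blast
    then have "A = c x" using uniq A C(2) by blast
    then show "x \<in> W -` {None} \<inter> space M" using A x by (simp add: W_def)
  qed
  have kernel_Some: "W -` {Some A} \<inter> space M = A - C A" if "A \<in> P" for A
  proof (intro set_eqI iffI)
    fix x assume "x \<in> W -` {Some A} \<inter> space M"
    then show "x \<in> A - C A" using c(1) by (auto simp: W_def split: if_splits)
  next
    fix x assume x: "x \<in> A - C A"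
    then have "x \<in> space M" using P(2) that sets.sets_into_space by blast
    moreover from this have "A = c x" using uniq that x by blast
    ultimately show "x \<in> W -` {Some A} \<inter> space M" using x by (simp add: W_def)
  qed
  have NoneM: "W -` {None} \<inter> space M \<in> sets M" unfolding kernel_None by (rule sets.finite_UN[OF P(1) CM])
  have sf: "simple_function M W" unfolding simple_function_def
  proof (intro conjI ballI fin)
    fix v assume "v \<in> W ` space M"
    then have "v \<in> insert None (Some ` P)" by (rule subsetD[OF Wim])
    then have "v = None \<or> (\<exists>A\<in>P. v = Some A)" by (simp add: image_iff)
    then show "W -` {v} \<inter> space M \<in> sets M"
    proof
      assume "v = None"
      then show ?thesis using NoneM by simp
    next
      assume "\<exists>A\<in>P. v = Some A"
      then obtain A where A: "A \<in> P" "v = Some A" by blast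
      show ?thesis unfolding A(2) kernel_Some[OF A(1)] by (rule sets.Diff[OF subsetD[OF P(2) A(1)] CM[OF A(1)]])
    qed
  qed
  have "prob {x \<in> space M. W x \<noteq> None} \<le> \<kappa> * real k"
  proof -
    have eq: "{x \<in> space M. W x \<noteq> None} = (\<Union>A\<in>P. A - C A)"
    proof (intro set_eqI iffI)
      fix x assume x: "x \<in> {x \<in> space M. W x \<noteq> None}"
      then have "x \<notin> C (c x)" by (auto simp: W_def split: if_splits)
      then show "x \<in> (\<Union>A\<in>P. A - C A)" using c x by blast
    next
      fix x assume "x \<in> (\<Union>A\<in>P. A - C A)"
      then obtain A where "A \<in> P" "x \<in> A - C A" by blast
      then have "x \<in> W -` {Some A} \<inter> space M" using kernel_Some by blast
      then show "x \<in> {x \<in> space M. W x \<noteq> None}" by auto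
    qed
    have "(\<lambda>A. A - C A) ` P \<subseteq> sets M"
      by (rule image_subsetI) (rule sets.Diff[OF subsetD[OF P(2)] CM])
    then have "prob {x \<in> space M. W x \<noteq> None} \<le> (\<Sum>A\<in>P. prob (A - C A))"
      unfolding eq by (rule finite_measure_subadditive_finite[OF P(1)])
    also have "\<dots> \<le> (\<Sum>A\<in>P. \<kappa>)" using C(3) by (intro sum_mono less_imp_le)
    also have "\<dots> \<le> \<kappa> * real k" using \<kappa> by (simp add: k_def)
    finally show ?thesis .
  qed
  then have "L * prob {x \<in> space M. W x \<noteq> None} \<le> L * (\<kappa> * real k)" using L(1) by (rule mult_left_mono)
  also have "L * (\<kappa> * real k) \<le> (L + 1) * (\<kappa> * real k)" using \<kappa> by (intro mult_right_mono) auto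
  also have "(L + 1) * (\<kappa> * real k) = \<eta> / 2"
  proof -
    have "u * (\<eta> / (2 * u * v) * v) = \<eta> / 2" if "u > 0" "v > 0" for u v :: real using that by simp
    from this[of "L + 1" "real k"] show ?thesis using L(1) k by (simp only: \<kappa>_def)
  qed
  finally have "shannon M W \<le> \<eta>" using shannon_small[OF sf card L(1) NoneM] L(2) by linarith
  moreover have "c x = c y" if xy: "x \<in> space M" "y \<in> space M" "W x = W y" "dist x y < e" for x y
  proof (rule ccontr)
    assume ne: "c x \<noteq> c y"
    then have "x \<in> C (c x)" "y \<in> C (c y)" using xy(3) by (auto simp: W_def split: if_splits)
    from e(2)[OF c(2)[OF xy(1)] c(2)[OF xy(2)] ne this] xy(4) show False by simp
  qed
  ultimately show thesis using that[OF sf _ e(1)] by blast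
qed

section \<open>The bound for entropy plus integral over arbitrary partitions\<close>

context potential
begin

text \<open>Points whose base orbits stay close for \<open>n\<close> steps have \<open>k\<close>th
  images that nearly agree in the coordinates up to \<open>k0\<close>, once
  \<open>k \<ge> k0\<close>, whatever their histories. The earlier symbols are recorded, and equal
  values of \<open>W\<close> rule out that such nearby images lie in different cells.\<close>

theorem variational_upper:
  assumes M: "borel_prob M (nat_ext g)" "nat_ext_map g \<in> measurable M M" "distr M M (nat_ext_map g) = M"
    and \<phi>: "continuous_on (nat_ext g) \<phi>"
    and \<phi>\<Phi>: "\<And>n x. x \<in> nat_ext g \<Longrightarrow> birkhoff_sum (nat_ext_map g) \<phi> n x \<le> \<Phi> n (x 0) + B0"
    and r: "\<And>\<delta>. \<delta> > 0 \<Longrightarrow> \<exists>Kc. \<forall>n E. bsep n \<delta> E \<longrightarrow> (\<Sum>x\<in>E. exp (\<Phi> n x)) \<le> Kc * exp (real n * r)"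
    and P: "finite P" "P \<subseteq> sets M" "partition_on (space M) P"
  shows "entropy_wrt M (nat_ext_map g) P + integral\<^sup>L M \<phi> \<le> r"
proof -
  interpret M: borel_prob M "nat_ext g" by (rule M(1))
  let ?F = "nat_ext_map g"
  have "\<exists>A. A \<in> P \<and> x \<in> A" if "x \<in> space M" for x using P(3) that by (auto simp: partition_on_def)
  then obtain c where c: "\<And>x. x \<in> space M \<Longrightarrow> x \<in> c x" "\<And>x. x \<in> space M \<Longrightarrow> c x \<in> P" by metis
  have cfib: "c -` {A} \<inter> space M = A" if "A \<in> P" for A
  proof (intro set_eqI iffI)
    fix x assume "x \<in> A"
    then have x: "x \<in> space M" using P(2) that sets.sets_into_space by blast
    have "A = c x" using P(3) that c[OF x] \<open>x \<in> A\<close> by (auto simp: partition_on_def disjoint_def)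
    then show "x \<in> c -` {A} \<inter> space M" using x by simp
  qed (use c(1) in auto)
  have sc: "simple_function M c" unfolding simple_function_def
  proof (intro conjI ballI)
    show "finite (c ` space M)" by (rule finite_subset[OF _ P(1)]) (use c(2) in auto)
    fix A assume "A \<in> c ` space M"
    then have "A \<in> P" using c(2) by blast
    then show "c -` {A} \<inter> space M \<in> sets M" using cfib P(2) by auto
  qed
  have Fk: "?F ^^ k \<in> measurable M M" for k using M(2) by (induction k) auto
  have dk: "distr M M (?F ^^ k) = M" for k
  proof (induction k)
    case (Suc k)
    have "distr M M (?F ^^ Suc k) = distr (distr M M (?F ^^ k)) M ?F"
      unfolding funpow.simps by (rule distr_distr[OF M(2) Fk, symmetric])
    then show ?case unfolding Suc M(3) .
  qed (simp add: id_def)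
  have cFk: "continuous_on (nat_ext g) (?F ^^ k)" for k
  proof (induction k)
    case (Suc k)
    have "continuous_on (nat_ext g) (\<lambda>x. ?F ((?F ^^ k) x))"
      by (rule continuous_on_compose2[OF continuous_nat_ext_map[of UNIV] Suc]) simp
    then show ?case by (simp add: comp_def)
  qed (simp add: id_def)
  have c\<phi>k: "continuous_on (nat_ext g) (\<lambda>x. \<phi> ((?F ^^ k) x))" for k
    by (rule continuous_on_compose2[OF \<phi> cFk]) (auto intro: nat_ext_funpow_closed)
  have intS: "integrable M (birkhoff_sum ?F \<phi> n)" for n
    unfolding birkhoff_sum_def by (intro Bochner_Integration.integrable_sum M.cont_integrable c\<phi>k)
  have intSe: "integral\<^sup>L M (birkhoff_sum ?F \<phi> n) = real n * integral\<^sup>L M \<phi>" for n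
  proof -
    have "(\<integral>x. \<phi> ((?F ^^ k) x) \<partial>M) = integral\<^sup>L M \<phi>" for k
      using integral_distr[OF Fk M.cont_measurable[OF \<phi>], of k] unfolding dk by simp
    moreover have "integral\<^sup>L M (birkhoff_sum ?F \<phi> n) = (\<Sum>k<n. \<integral>x. \<phi> ((?F ^^ k) x) \<partial>M)"
      unfolding birkhoff_sum_def by (intro Bochner_Integration.integral_sum M.cont_integrable c\<phi>k)
    ultimately show ?thesis by simp
  qed
  have ent: "entropy_wrt M ?F P = lim (\<lambda>n. shannon M (itinerary ?F c n) / real n)"
    by (rule M.entropy_wrt_eq[OF M(2) P(3)]) (use c in auto)
  have "lim (\<lambda>n. shannon M (itinerary ?F c n) / real n) + integral\<^sup>L M \<phi> \<le> r"
  proof (rule M.entropy_pressure_bound[OF M(2,3) sc intS intSe, where ?'e=nat and ?'d="(nat \<Rightarrow> 'a) set option"])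
    fix \<eta> :: real assume \<eta>: "\<eta> > 0"
    obtain W :: "(nat \<Rightarrow> 'a) \<Rightarrow> (nat \<Rightarrow> 'a) set option" and e where W: "simple_function M W" "shannon M W \<le> \<eta>" "e > 0"
      "\<And>x y. x \<in> space M \<Longrightarrow> y \<in> space M \<Longrightarrow> W x = W y \<Longrightarrow> dist x y < e \<Longrightarrow> c x = c y"
      by (rule M.small_entropy_kernel[OF P c \<eta>]) (assumption | rule that)+
    obtain k0 \<delta>1 where \<delta>1: "\<delta>1 > 0"
      "\<And>x y :: nat \<Rightarrow> 'a. (\<forall>j\<le>k0. dist (x j) (y j) < \<delta>1) \<Longrightarrow> dist x y < e"
      using coord_close[OF W(3)] by metis
    obtain \<delta>2 C2 where \<delta>2: "\<delta>2 > 0" "\<And>n x z. bclose n \<delta>2 z x \<Longrightarrow> \<bar>\<Phi> n z - \<Phi> n x\<bar> \<le> C2 + real n * \<eta>"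
      using Phi_unif[OF \<eta>] by blast
    define \<delta> where "\<delta> = min (\<delta>1 / 2) \<delta>2"
    have \<delta>: "\<delta> > 0" "2 * \<delta> \<le> \<delta>1" "\<delta> \<le> \<delta>2" using \<delta>1(1) \<delta>2(1) by (auto simp: \<delta>_def)
    obtain Kc where Kc: "\<And>n E. bsep n \<delta> E \<Longrightarrow> (\<Sum>x\<in>E. exp (\<Phi> n x)) \<le> Kc * exp (real n * r)"
      using r[OF \<delta>(1)] by blast
    define C where "C = exp (C2 + B0) * Kc"
    have main: "\<exists>(e :: (nat \<Rightarrow> 'a) \<Rightarrow> nat) a. simple_function M e \<and> (\<forall>x\<in>space M. birkhoff_sum ?F \<phi> n x \<le> a (e x)) \<and>
       (\<Sum>v\<in>e ` space M. exp (a v)) \<le> C * exp (real n * (r + \<eta>)) \<and>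
       (\<forall>x\<in>space M. \<forall>y\<in>space M. e x = e y \<longrightarrow> itinerary ?F W n x = itinerary ?F W n y \<longrightarrow>
          itinerary ?F c k0 x = itinerary ?F c k0 y \<longrightarrow> itinerary ?F c n x = itinerary ?F c n y)" for n
    proof -
      obtain E where E: "finite E" "bsep n \<delta> E" "\<And>x. \<exists>w\<in>E. bclose n \<delta> x w"
        using maximal_bsep[OF \<delta>(1), of UNIV n] by (metis UNIV_I)
      obtain m ws where ws: "E = ws ` {i. i < (m :: nat)}" "inj_on ws {i. i < m}"
        using finite_imp_nat_seg_image_inj_on[OF E(1)] by blast
      \<comment> \<open>\<open>ee x\<close> will be the least index of a point of the spanning set
        \<open>E\<close> close to the base orbit of \<open>x\<close>; taking the least one keeps the
        fibres measurable.\<close>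
      define Q where "Q x i \<longleftrightarrow> i < m \<and> bclose n \<delta> (x 0) (ws i)" for x :: "nat \<Rightarrow> 'a" and i
      define ee where "ee x = (LEAST i. Q x i)" for x
      have "\<exists>i. Q x i" for x
        using E(3)[of "x 0"] ws(1) by (auto simp: Q_def)
      then have Qee: "Q x (ee x)" for x unfolding ee_def by (rule LeastI_ex)
      have notQ: "\<not> Q x j" if "j < ee x" for x j using that unfolding ee_def by (rule not_less_Least)
      have eeiff: "ee x = i \<longleftrightarrow> Q x i \<and> (\<forall>j<i. \<not> Q x j)" for x i
        using Qee[of x] notQ[of _ x] by (metis linorder_neqE_nat)
      have Qs: "{x \<in> space M. Q x i} \<in> sets M" for i
      proof -
        have "open {x :: nat \<Rightarrow> 'a. bclose n \<delta> (x 0) (ws i)}"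
          using open_vimage[OF open_bclose[of n \<delta> "ws i"] continuous_coord[of UNIV 0]] by (simp add: vimage_def)
        then have "{x :: nat \<Rightarrow> 'a. bclose n \<delta> (x 0) (ws i)} \<inter> nat_ext g \<in> sets M"
          by (intro M.Int_K_sets borel_open)
        moreover have "{x \<in> space M. Q x i} = (if i < m then {x. bclose n \<delta> (x 0) (ws i)} \<inter> nat_ext g else {})"
          by (auto simp: Q_def M.space_M)
        ultimately show ?thesis by simp
      qed
      have eem: "ee x < m" for x using Qee[of x] by (simp add: Q_def)
      have see: "simple_function M ee" unfolding simple_function_def
      proof (intro conjI ballI)
        show "finite (ee ` space M)" by (rule finite_subset[of _ "{..<m}"]) (use eem in auto)
        fix i
        have "ee -` {i} \<inter> space M = {x \<in> space M. Q x i} - (\<Union>j\<in>{..<i}. {x \<in> space M. Q x j})"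
          using eeiff by auto
        then show "ee -` {i} \<inter> space M \<in> sets M" using Qs by auto
      qed
      define a where "a i = \<Phi> n (ws i) + (C2 + real n * \<eta> + B0)" for i
      have S: "birkhoff_sum ?F \<phi> n x \<le> a (ee x)" if "x \<in> space M" for x
      proof -
        have "bclose n \<delta>2 (x 0) (ws (ee x))" using Qee[of x] bclose_mono[OF _ \<delta>(3)] by (simp add: Q_def)
        from \<delta>2(2)[OF this] have "\<Phi> n (x 0) \<le> \<Phi> n (ws (ee x)) + (C2 + real n * \<eta>)" by linarith
        then show ?thesis using \<phi>\<Phi>[of x n] that unfolding a_def M.space_M by linarith
      qed
      have "(\<Sum>v\<in>ee ` space M. exp (a v)) \<le> (\<Sum>v\<in>{i. i < m}. exp (a v))"
        using eem by (intro sum_mono2) auto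
      also have "\<dots> = exp (C2 + real n * \<eta> + B0) * (\<Sum>v\<in>{i. i < m}. exp (\<Phi> n (ws v)))"
        by (simp add: a_def exp_add sum_distrib_left mult_ac)
      also have "(\<Sum>v\<in>{i. i < m}. exp (\<Phi> n (ws v))) = (\<Sum>x\<in>E. exp (\<Phi> n x))"
        unfolding ws(1) by (subst sum.reindex[OF ws(2)]) simp
      also have "exp (C2 + real n * \<eta> + B0) * \<dots> \<le> exp (C2 + real n * \<eta> + B0) * (Kc * exp (real n * r))"
        using Kc[OF E(2)] by (intro mult_left_mono) auto
      also have "\<dots> = C * exp (real n * (r + \<eta>))" by (simp add: C_def exp_add algebra_simps)
      finally have sum: "(\<Sum>v\<in>ee ` space M. exp (a v)) \<le> C * exp (real n * (r + \<eta>))" .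
      have names: "itinerary ?F c n x = itinerary ?F c n y"
        if xy: "x \<in> space M" "y \<in> space M" "ee x = ee y" "itinerary ?F W n x = itinerary ?F W n y"
          "itinerary ?F c k0 x = itinerary ?F c k0 y" for x y
        unfolding itinerary_eq_iff
      proof (intro allI impI)
        fix k assume k: "k < n"
        show "c ((?F ^^ k) x) = c ((?F ^^ k) y)"
        proof (cases "k < k0")
          case True
          then show ?thesis using xy(5) unfolding itinerary_eq_iff by blast
        next
          case False
          \<comment> \<open>From time \<open>k0\<close> on, the coordinates up to \<open>k0\<close>
            are iterates of the base point at times between \<open>k - k0\<close> and
            \<open>k\<close>, all below \<open>n\<close>.\<close>
          have "dist ((?F ^^ k) x) ((?F ^^ k) y) < e"
          proof (rule \<delta>1(2), intro allI impI)
            fix j assume j: "j \<le> k0"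
            have "k - j < n" using k by simp
            then have "dist ((g ^^ (k - j)) (x 0)) ((g ^^ (k - j)) (ws (ee x))) < \<delta>"
              "dist ((g ^^ (k - j)) (y 0)) ((g ^^ (k - j)) (ws (ee x))) < \<delta>"
              using Qee[of x] Qee[of y] unfolding xy(3) Q_def bclose_def by blast+
            then have "dist ((g ^^ (k - j)) (x 0)) ((g ^^ (k - j)) (y 0)) < \<delta>1"
              using dist_triangle2[of "(g ^^ (k - j)) (x 0)" "(g ^^ (k - j)) (y 0)" "(g ^^ (k - j)) (ws (ee x))"] \<delta>(2)
              by linarith
            then show "dist ((?F ^^ k) x j) ((?F ^^ k) y j) < \<delta>1"
              using j False by (simp add: funpow_nat_ext_map)
          qed
          moreover have "W ((?F ^^ k) x) = W ((?F ^^ k) y)" using xy(4) k unfolding itinerary_eq_iff by blast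
          moreover have "(?F ^^ k) x \<in> space M" "(?F ^^ k) y \<in> space M"
            using xy(1,2) nat_ext_funpow_closed unfolding M.space_M by blast+
          ultimately show ?thesis by (intro W(4))
        qed
      qed
      show ?thesis
        by (intro exI[of _ ee] exI[of _ a] conjI see sum ballI impI S names) assumption+
    qed
    show "\<exists>(W :: (nat \<Rightarrow> 'a) \<Rightarrow> (nat \<Rightarrow> 'a) set option) k0 C. simple_function M W \<and> shannon M W \<le> \<eta> \<and>
      (\<forall>n. \<exists>(e :: (nat \<Rightarrow> 'a) \<Rightarrow> nat) a. simple_function M e \<and> (\<forall>x\<in>space M. birkhoff_sum ?F \<phi> n x \<le> a (e x)) \<and>
         (\<Sum>v\<in>e ` space M. exp (a v)) \<le> C * exp (real n * (r + \<eta>)) \<and>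
         (\<forall>x\<in>space M. \<forall>y\<in>space M. e x = e y \<longrightarrow> itinerary ?F W n x = itinerary ?F W n y \<longrightarrow>
            itinerary ?F c k0 x = itinerary ?F c k0 y \<longrightarrow> itinerary ?F c n x = itinerary ?F c n y))"
      by (intro exI[of _ W] exI[of _ k0] exI[of _ C] conjI W(1,2) allI main)
  qed
  then show ?thesis unfolding ent .
qed

end

section \<open>The metric of the natural extension\<close>

locale nat_ext_system = expanding_system g s \<sigma> \<epsilon>\<^sub>0
  for g :: "'a::metric_space \<Rightarrow> 'a" and s \<sigma> \<epsilon>\<^sub>0 +
  fixes a :: real
  assumes a_gt: "a > 1"
begin

abbreviation K where "K \<equiv> nat_ext g"
abbreviation F where "F \<equiv> nat_ext_map g"
abbreviation d where "d \<equiv> nat_ext_dist a :: (nat \<Rightarrow> 'a) \<Rightarrow> (nat \<Rightarrow> 'a) \<Rightarrow> real"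

sublocale Metric_space K d
  by (rule Metric_space_nat_ext[OF compact_base a_gt])

lemma diameter: "\<exists>D>0. \<forall>x y :: 'a. dist x y \<le> D"
proof -
  obtain D where D: "\<And>x y :: 'a. dist x y \<le> D"
    using compact_imp_bounded[OF compact_base] by (metis UNIV_I bounded_two_points)
  have "dist x y \<le> max D 1" for x y :: 'a using D[of x y] by linarith
  then show ?thesis by (intro exI[of _ "max D 1"]) simp
qed

lemma summable_dist: "summable (\<lambda>n. dist (x n) (y n :: 'a) / a ^ n)"
proof -
  obtain D where D: "D > 0" "\<And>x y :: 'a. dist x y \<le> D" using diameter by blast
  have "summable (\<lambda>n. D * (1 / a) ^ n)"
    using a_gt by (intro summable_mult summable_geometric) auto
  then have "summable (\<lambda>n. D / a ^ n)" by (simp add: power_one_over divide_simps)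
  moreover have "\<exists>N. \<forall>n\<ge>N. norm (dist (x n) (y n) / a ^ n) \<le> D / a ^ n"
    using D a_gt by (intro exI[of _ 0]) (auto simp: divide_right_mono)
  ultimately show ?thesis by (rule summable_comparison_test[rotated])
qed

lemma coord_le: "dist (x j) (y j) \<le> a ^ j * d x y"
proof -
  have "(\<Sum>n\<in>{j}. dist (x n) (y n) / a ^ n) \<le> d x y"
    unfolding nat_ext_dist_def using a_gt by (intro sum_le_suminf summable_dist) auto
  then show ?thesis using a_gt by (simp add: field_simps)
qed

lemma dist_truncate:
  obtains D where "D > 0" "\<And>x y k. d x y \<le> (\<Sum>j<k. dist (x j) (y j) / a ^ j) + D / a ^ k"
proof -
  obtain D where D: "D > 0" "\<And>x y :: 'a. dist x y \<le> D" using diameter by blast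
  define D' where "D' = D * (1 / (1 - 1 / a))"
  have D': "D' > 0" using D(1) a_gt by (simp add: D'_def)
  have "d x y \<le> (\<Sum>j<k. dist (x j) (y j) / a ^ j) + D' / a ^ k" for x y :: "nat \<Rightarrow> 'a" and k
  proof -
    have geo: "summable (\<lambda>n. (1 / a) ^ n)" using a_gt by (intro summable_geometric) auto
    have "(\<Sum>n. dist (x (n + k)) (y (n + k)) / a ^ (n + k)) \<le> (\<Sum>n. D / a ^ k * (1 / a) ^ n)"
    proof (rule suminf_le)
      fix n
      have "dist (x (n + k)) (y (n + k)) / a ^ (n + k) \<le> D / a ^ (n + k)"
        using D(2) a_gt by (intro divide_right_mono) auto
      also have "D / a ^ (n + k) = D / a ^ k * (1 / a) ^ n"
        by (simp add: power_add power_one_over)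
      finally show "dist (x (n + k)) (y (n + k)) / a ^ (n + k) \<le> D / a ^ k * (1 / a) ^ n" .
    next
      show "summable (\<lambda>n. dist (x (n + k)) (y (n + k)) / a ^ (n + k))"
        using summable_iff_shift[of "\<lambda>n. dist (x n) (y n) / a ^ n" k] summable_dist by blast
      show "summable (\<lambda>n. D / a ^ k * (1 / a) ^ n)" by (rule summable_mult[OF geo])
    qed
    also have "\<dots> = D / a ^ k * (1 / (1 - 1 / a))"
      using a_gt by (subst suminf_mult[OF geo]) (simp add: suminf_geometric)
    also have "\<dots> = D' / a ^ k" by (simp add: D'_def)
    finally show ?thesis
      unfolding nat_ext_dist_def suminf_split_initial_segment[OF summable_dist, of x y k] by linarith
  qed
  then show thesis using that[OF D'] by blast
qed

lemma coord_close_d: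
  assumes "e > 0"
  shows "\<exists>N. \<exists>\<eta>>0. \<forall>x y :: nat \<Rightarrow> 'a. (\<forall>j\<le>N. dist (x j) (y j) < \<eta>) \<longrightarrow> d x y < e"
proof -
  obtain D where D: "D > 0" "\<And>x y k. d x y \<le> (\<Sum>j<k. dist (x j) (y j) / a ^ j) + D / a ^ k"
    using dist_truncate by blast
  obtain k where "(1 / a) ^ k < e / (2 * D)"
    using real_arch_pow_inv[of "e / (2 * D)" "1 / a"] assms D(1) a_gt by auto
  then have k: "D / a ^ k < e / 2" using D(1) a_gt by (simp add: power_one_over field_simps)
  define \<eta> where "\<eta> = e / (2 * real (k + 1))"
  have \<eta>: "\<eta> > 0" using assms by (simp add: \<eta>_def)
  have "d x y < e" if h: "\<And>j. j \<le> k \<Longrightarrow> dist (x j) (y j) < \<eta>" for x y :: "nat \<Rightarrow> 'a"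
  proof -
    have "(\<Sum>j<k. dist (x j) (y j) / a ^ j) \<le> (\<Sum>j<k. \<eta>)"
    proof (rule sum_mono)
      fix j assume "j \<in> {..<k}"
      have "dist (x j) (y j) / a ^ j \<le> dist (x j) (y j) / 1"
        using a_gt by (intro divide_left_mono) auto
      also have "\<dots> \<le> \<eta>" using h[of j] \<open>j \<in> {..<k}\<close> by simp
      finally show "dist (x j) (y j) / a ^ j \<le> \<eta>" .
    qed
    also have "\<dots> = real k * \<eta>" by simp
    also have "\<dots> \<le> e / 2" using assms by (simp add: \<eta>_def field_simps)
    finally show ?thesis using D(2)[of x y k] k by linarith
  qed
  then show ?thesis using \<eta> by blast
qed

text \<open>Both metrics are controlled by finitely many coordinates, so they induce the same
  topology on \<open>K\<close>. Thus results for the Borel sets of the function type apply to the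
  measures in \<open>invariant_measures\<close>.\<close>

lemma openin_mtopology_iff: "openin mtopology V \<longleftrightarrow> openin (top_of_set K) V"
proof
  assume V: "openin mtopology V"
  then have sub: "V \<subseteq> K" using openin_subset by fastforce
  show "openin (top_of_set K) V" unfolding openin_contains_ball
  proof (intro conjI sub ballI)
    fix x assume x: "x \<in> V"
    then obtain r where r: "r > 0" "mball x r \<subseteq> V" using V unfolding openin_mtopology by blast
    obtain N \<eta> where N: "\<eta> > 0" "\<And>x y :: nat \<Rightarrow> 'a. (\<forall>j\<le>N. dist (x j) (y j) < \<eta>) \<Longrightarrow> d x y < r"
      using coord_close_d[OF r(1)] by blast
    have "x \<in> {y. \<forall>j\<le>N. dist (x j) (y j) < \<eta>}" using N(1) by simp
    then obtain e where e: "e > 0" "ball x e \<subseteq> {y. \<forall>j\<le>N. dist (x j) (y j) < \<eta>}"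
      using open_contains_ball[THEN iffD1, OF open_coord_nbhd] by blast
    have "ball x e \<inter> K \<subseteq> V"
    proof
      fix y assume y: "y \<in> ball x e \<inter> K"
      then have "d x y < r" using N(2)[of x y] e(2) by blast
      then have "y \<in> mball x r" using y x sub by auto
      then show "y \<in> V" using r(2) by blast
    qed
    then show "\<exists>e>0. ball x e \<inter> K \<subseteq> V" using e(1) by blast
  qed
next
  assume V: "openin (top_of_set K) V"
  have sub: "V \<subseteq> K" using openin_imp_subset[OF V] .
  show "openin mtopology V" unfolding openin_mtopology
  proof (intro conjI sub allI impI)
    fix x assume x: "x \<in> V"
    then obtain e where e: "e > 0" "ball x e \<inter> K \<subseteq> V" using V unfolding openin_contains_ball by blast
    obtain N \<eta> where N: "\<eta> > 0" "\<And>x y :: nat \<Rightarrow> 'a. (\<forall>j\<le>N. dist (x j) (y j) < \<eta>) \<Longrightarrow> dist x y < e"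
      using coord_close[OF e(1)] by blast
    have "mball x (\<eta> / a ^ N) \<subseteq> V"
    proof
      fix y assume y: "y \<in> mball x (\<eta> / a ^ N)"
      have "dist (x j) (y j) < \<eta>" if "j \<le> N" for j
      proof -
        have "a ^ j * d x y \<le> a ^ N * d x y" using a_gt that by (intro mult_right_mono power_increasing) auto
        also have "\<dots> < \<eta>" using y a_gt by (simp add: field_simps)
        finally show ?thesis using coord_le[of x j y] by linarith
      qed
      then have "dist x y < e" using N(2) by blast
      then show "y \<in> V" using e(2) y by auto
    qed
    then show "\<exists>r>0. mball x r \<subseteq> V" using N(1) a_gt by (intro exI[of _ "\<eta> / a ^ N"]) simp
  qed
qed

lemma closed_K: "closed K" by (rule compact_imp_closed[OF compact_nat_ext])

lemma sigma_sets_nat_ext: "sigma_sets K {V. openin mtopology V} = sets (restrict_space borel K)"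
proof -
  have eq: "{V. openin mtopology V} = (\<inter>) K ` {S. open S}"
    by (auto simp: openin_mtopology_iff openin_open)
  have K: "K \<in> sigma_sets UNIV {S. open S}"
    using closed_K borel_closed unfolding borel_def by auto
  have "sets (restrict_space borel K) = (\<inter>) K ` sigma_sets UNIV {S. open S}"
    by (simp add: sets_restrict_space borel_def)
  also have "\<dots> = sigma_sets K ((\<inter>) K ` {S. open S})" by (rule sigma_sets_Int[OF K]) simp
  finally show ?thesis unfolding eq by simp
qed

lemma invariant_measures_iff:
  "\<mu> \<in> invariant_measures K d F \<longleftrightarrow> borel_prob \<mu> K \<and> F \<in> measurable \<mu> \<mu> \<and> distr \<mu> \<mu> F = \<mu>"
  unfolding invariant_measures_def borel_prob_def borel_prob_axioms_def mem_Collect_eq sigma_sets_nat_ext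
  using compact_nat_ext by blast

end

section \<open>Hoelder potentials\<close>

lemma powr_add_le:
  fixes u v \<alpha> :: real
  assumes "u \<ge> 0" "v \<ge> 0" "0 < \<alpha>" "\<alpha> \<le> 1"
  shows "(u + v) powr \<alpha> \<le> 2 * (u powr \<alpha> + v powr \<alpha>)"
proof -
  have "(u + v) powr \<alpha> \<le> (2 * max u v) powr \<alpha>" using assms by (intro powr_mono2) auto
  also have "\<dots> = 2 powr \<alpha> * max u v powr \<alpha>" using assms by (simp add: powr_mult)
  also have "\<dots> \<le> 2 powr 1 * max u v powr \<alpha>" using assms by (intro mult_right_mono powr_mono) auto
  also have "\<dots> \<le> 2 * (u powr \<alpha> + v powr \<alpha>)" by (auto simp: max_def)
  finally show ?thesis .
qed

lemma power_powr:
  fixes q \<alpha> :: real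
  assumes "q \<ge> 0"
  shows "(q ^ k) powr \<alpha> = (q powr \<alpha>) ^ k"
proof (cases "q = 0")
  case True
  then show ?thesis by (cases k) auto
next
  case False
  then show ?thesis using assms by (induction k) (auto simp: powr_mult)
qed

lemma sum_power_le:
  fixes q :: real
  assumes "0 \<le> q" "q < 1"
  shows "(\<Sum>k<n. q ^ k) \<le> 1 / (1 - q)" "(\<Sum>k<n. q ^ (n - k)) \<le> 1 / (1 - q)"
proof -
  have "(\<Sum>k<n. q ^ k) \<le> (\<Sum>k. q ^ k)"
    using assms by (intro sum_le_suminf summable_geometric) auto
  also have "\<dots> = 1 / (1 - q)" using assms by (simp add: suminf_geometric)
  finally show 1: "(\<Sum>k<n. q ^ k) \<le> 1 / (1 - q)" .
  have "(\<Sum>k<n. q ^ (n - k)) \<le> (\<Sum>k<n. q ^ (n - Suc k))"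
    using assms by (intro sum_mono power_decreasing) auto
  also have "\<dots> = (\<Sum>k<n. q ^ k)" by (rule sum.nat_diff_reindex)
  finally show "(\<Sum>k<n. q ^ (n - k)) \<le> 1 / (1 - q)" using 1 by linarith
qed

context nat_ext_system
begin

text \<open>After \<open>k\<close> steps only the coordinates beyond \<open>k\<close> depend on the
  histories, and these weigh at most \<open>D / a ^ k\<close> in total.\<close>

lemma orbit_dist:
  obtains D where "D > 0" "\<And>x y k. d ((F ^^ k) x) ((F ^^ k) y) \<le>
    (\<Sum>j<Suc k. dist ((g ^^ (k - j)) (x 0)) ((g ^^ (k - j)) (y 0)) / a ^ j) + D / a ^ k"
proof -
  obtain D where D: "D > 0" "\<And>x y k. d x y \<le> (\<Sum>j<k. dist (x j) (y j) / a ^ j) + D / a ^ k"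
    using dist_truncate by blast
  show thesis
  proof (rule that[OF D(1)])
    fix x y :: "nat \<Rightarrow> 'a" and k
    have "(\<Sum>j<Suc k. dist ((F ^^ k) x j) ((F ^^ k) y j) / a ^ j) =
      (\<Sum>j<Suc k. dist ((g ^^ (k - j)) (x 0)) ((g ^^ (k - j)) (y 0)) / a ^ j)"
      by (rule sum.cong) (auto simp: funpow_nat_ext_map)
    moreover have "D / a ^ Suc k \<le> D / a ^ k"
      using D(1) a_gt by (intro divide_left_mono power_increasing mult_pos_pos) auto
    ultimately show "d ((F ^^ k) x) ((F ^^ k) y) \<le>
      (\<Sum>j<Suc k. dist ((g ^^ (k - j)) (x 0)) ((g ^^ (k - j)) (y 0)) / a ^ j) + D / a ^ k"
      using D(2)[of "(F ^^ k) x" "(F ^^ k) y" "Suc k"] by linarith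
  qed
qed

definition ext_sum :: "((nat \<Rightarrow> 'a) \<Rightarrow> real) \<Rightarrow> nat \<Rightarrow> 'a \<Rightarrow> real" where
  "ext_sum \<phi> n x = birkhoff_sum F \<phi> n (past x)"

lemma hoelderD:
  assumes "hoelder_continuous_on K d \<phi>"
  obtains C \<alpha> where "C \<ge> 0" "0 < \<alpha>" "\<alpha> \<le> 1" "\<And>x y. x \<in> K \<Longrightarrow> y \<in> K \<Longrightarrow> \<bar>\<phi> x - \<phi> y\<bar> \<le> C * d x y powr \<alpha>"
proof -
  obtain C \<alpha> where C: "0 < \<alpha>" "\<alpha> \<le> 1" "\<forall>x\<in>K. \<forall>y\<in>K. \<bar>\<phi> x - \<phi> y\<bar> \<le> C * d x y powr \<alpha>"
    using assms unfolding hoelder_continuous_on_def by blast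
  have "\<bar>\<phi> x - \<phi> y\<bar> \<le> \<bar>C\<bar> * d x y powr \<alpha>" if "x \<in> K" "y \<in> K" for x y
  proof -
    have "C * d x y powr \<alpha> \<le> \<bar>C\<bar> * d x y powr \<alpha>" by (intro mult_right_mono) auto
    then show ?thesis using bspec[OF bspec[OF C(3) that(1)] that(2)] by linarith
  qed
  then show thesis using that[of "\<bar>C\<bar>" \<alpha>] C(1,2) by simp
qed

lemma hoelder_unif:
  assumes "hoelder_continuous_on K d \<phi>" "e > 0"
  shows "\<exists>N. \<exists>\<eta>>0. \<forall>x\<in>K. \<forall>y\<in>K. (\<forall>j\<le>N. dist (x j) (y j) < \<eta>) \<longrightarrow> \<bar>\<phi> x - \<phi> y\<bar> < e"
proof -
  obtain C \<alpha> where C: "C \<ge> 0" "0 < \<alpha>" "\<alpha> \<le> 1" "\<And>x y. x \<in> K \<Longrightarrow> y \<in> K \<Longrightarrow> \<bar>\<phi> x - \<phi> y\<bar> \<le> C * d x y powr \<alpha>"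
    using hoelderD[OF assms(1)] by blast
  define r where "r = (e / (C + 1)) powr (1 / \<alpha>)"
  have r: "r > 0" "r powr \<alpha> = e / (C + 1)" using assms(2) C by (simp_all add: r_def powr_powr)
  have "C * (e / (C + 1)) < e" using assms(2) C(1) by (simp add: field_simps)
  obtain N \<eta> where N: "\<eta> > 0" "\<forall>x y :: nat \<Rightarrow> 'a. (\<forall>j\<le>N. dist (x j) (y j) < \<eta>) \<longrightarrow> d x y < r"
    using coord_close_d[OF r(1)] by blast
  show ?thesis
  proof (intro exI conjI ballI impI)
    show "\<eta> > 0" by (rule N(1))
    fix x y assume xy: "x \<in> K" "y \<in> K" "\<forall>j\<le>N. dist (x j) (y j) < \<eta>"
    have "d x y < r" using N(2) xy(3) by blast
    then have "d x y powr \<alpha> \<le> r powr \<alpha>" using C(2) by (intro powr_mono2) auto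
    then have "C * d x y powr \<alpha> \<le> C * (e / (C + 1))" unfolding r(2) using C(1) by (rule mult_left_mono)
    then show "\<bar>\<phi> x - \<phi> y\<bar> < e" using C(4)[OF xy(1,2)] \<open>C * (e / (C + 1)) < e\<close> by linarith
  qed
qed

lemma hoelder_continuous:
  assumes "hoelder_continuous_on K d \<phi>"
  shows "continuous_on K \<phi>"
  unfolding continuous_on_iff
proof (intro ballI allI impI)
  fix x e assume x: "x \<in> K" and e: "(e :: real) > 0"
  obtain N \<eta> where N: "\<eta> > 0" "\<forall>x\<in>K. \<forall>y\<in>K. (\<forall>j\<le>N. dist (x j) (y j) < \<eta>) \<longrightarrow> \<bar>\<phi> x - \<phi> y\<bar> < e"
    using hoelder_unif[OF assms e] by blast
  have "x \<in> {y. \<forall>j\<le>N. dist (x j) (y j) < \<eta>}" using N(1) by simp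
  then obtain r where r: "r > 0" "ball x r \<subseteq> {y. \<forall>j\<le>N. dist (x j) (y j) < \<eta>}"
    using open_contains_ball[THEN iffD1, OF open_coord_nbhd] by blast
  have "dist (\<phi> y) (\<phi> x) < e" if y: "y \<in> K" "dist y x < r" for y
  proof -
    have "y \<in> ball x r" using y(2) by (simp add: dist_commute)
    then have "\<forall>j\<le>N. dist (x j) (y j) < \<eta>" using r(2) by blast
    then have "\<bar>\<phi> x - \<phi> y\<bar> < e" using bspec[OF bspec[OF N(2) x] y(1)] by simp
    then show ?thesis by (simp add: dist_real_def)
  qed
  then show "\<exists>\<delta>>0. \<forall>y\<in>K. dist y x < \<delta> \<longrightarrow> dist (\<phi> y) (\<phi> x) < e" using r(1) by blast
qed

text \<open>Two errors decay geometrically in opposite directions: differences of histories like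
  \<open>q ^ k\<close>, forgotten as time goes on, and differences of base orbits like
  \<open>p ^ (n - k)\<close>, contracted towards the past. Both series are bounded independently of
  \<open>n\<close>.\<close>

lemma hoelder_fibre:
  assumes "hoelder_continuous_on K d \<phi>"
  obtains C where "\<And>n x y. x \<in> K \<Longrightarrow> y \<in> K \<Longrightarrow> x 0 = y 0 \<Longrightarrow> \<bar>birkhoff_sum F \<phi> n x - birkhoff_sum F \<phi> n y\<bar> \<le> C"
    and "\<And>n x y. x \<in> K \<Longrightarrow> y \<in> K \<Longrightarrow> (\<And>j. j \<le> n \<Longrightarrow> dist ((g ^^ j) (x 0)) ((g ^^ j) (y 0)) \<le> \<epsilon>\<^sub>0 * \<sigma> ^ (n - j)) \<Longrightarrow>
      \<bar>birkhoff_sum F \<phi> n x - birkhoff_sum F \<phi> n y\<bar> \<le> C"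
proof -
  obtain C \<alpha> where C: "C \<ge> 0" "0 < \<alpha>" "\<alpha> \<le> 1" "\<And>x y. x \<in> K \<Longrightarrow> y \<in> K \<Longrightarrow> \<bar>\<phi> x - \<phi> y\<bar> \<le> C * d x y powr \<alpha>"
    using hoelderD[OF assms] by blast
  obtain D where D: "D > 0" "\<And>x y k. d ((F ^^ k) x) ((F ^^ k) y) \<le>
    (\<Sum>j<Suc k. dist ((g ^^ (k - j)) (x 0)) ((g ^^ (k - j)) (y 0)) / a ^ j) + D / a ^ k"
    using orbit_dist by blast
  define A where "A = \<epsilon>\<^sub>0 * (1 / (1 - 1 / a))"
  have A: "A > 0" using \<epsilon>0_pos a_gt by (simp add: A_def)
  define p q where "p = \<sigma> powr \<alpha>" and "q = (1 / a) powr \<alpha>"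
  have "\<sigma> powr \<alpha> < 1 powr \<alpha>" using \<sigma>_pos \<sigma>_less C(2) by (intro powr_less_mono2) auto
  then have p: "0 \<le> p" "p < 1" by (auto simp: p_def)
  have "(1 / a) powr \<alpha> < 1 powr \<alpha>" using a_gt C(2) by (intro powr_less_mono2) auto
  then have q: "0 \<le> q" "q < 1" by (auto simp: q_def)
  define C' where "C' = 2 * C * (A powr \<alpha> / (1 - p) + D powr \<alpha> / (1 - q))"
  have main: "\<bar>birkhoff_sum F \<phi> n x - birkhoff_sum F \<phi> n y\<bar> \<le> C'"
    if xy: "x \<in> K" "y \<in> K" "\<And>j. j \<le> n \<Longrightarrow> dist ((g ^^ j) (x 0)) ((g ^^ j) (y 0)) \<le> \<epsilon>\<^sub>0 * \<sigma> ^ (n - j)" for n x y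
  proof -
    have bd: "\<bar>\<phi> ((F ^^ k) x) - \<phi> ((F ^^ k) y)\<bar> \<le> 2 * C * (A powr \<alpha> * p ^ (n - k) + D powr \<alpha> * q ^ k)" if k: "k < n" for k
    proof -
      have "(\<Sum>j<Suc k. dist ((g ^^ (k - j)) (x 0)) ((g ^^ (k - j)) (y 0)) / a ^ j)
        \<le> (\<Sum>j<Suc k. \<epsilon>\<^sub>0 * \<sigma> ^ (n - k) * (1 / a) ^ j)"
      proof (rule sum_mono)
        fix j assume j: "j \<in> {..<Suc k}"
        have "dist ((g ^^ (k - j)) (x 0)) ((g ^^ (k - j)) (y 0)) \<le> \<epsilon>\<^sub>0 * \<sigma> ^ (n - (k - j))"
          using k by (intro xy(3)) simp
        also have "\<dots> \<le> \<epsilon>\<^sub>0 * \<sigma> ^ (n - k)"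
          using \<sigma>_pos \<sigma>_less \<epsilon>0_pos by (intro mult_left_mono power_decreasing) auto
        finally have "dist ((g ^^ (k - j)) (x 0)) ((g ^^ (k - j)) (y 0)) / a ^ j \<le> \<epsilon>\<^sub>0 * \<sigma> ^ (n - k) / a ^ j"
          using a_gt by (intro divide_right_mono) auto
        then show "dist ((g ^^ (k - j)) (x 0)) ((g ^^ (k - j)) (y 0)) / a ^ j \<le> \<epsilon>\<^sub>0 * \<sigma> ^ (n - k) * (1 / a) ^ j"
          by (simp add: power_one_over)
      qed
      also have "\<dots> = \<epsilon>\<^sub>0 * \<sigma> ^ (n - k) * (\<Sum>j<Suc k. (1 / a) ^ j)" by (rule sum_distrib_left[symmetric])
      also have "\<dots> \<le> \<epsilon>\<^sub>0 * \<sigma> ^ (n - k) * (1 / (1 - 1 / a))"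
        using \<epsilon>0_pos \<sigma>_pos a_gt by (intro mult_left_mono sum_power_le) auto
      also have "\<dots> = A * \<sigma> ^ (n - k)" by (simp add: A_def)
      finally have dk: "d ((F ^^ k) x) ((F ^^ k) y) \<le> A * \<sigma> ^ (n - k) + D * (1 / a) ^ k"
        using D(2)[of k x y] by (simp add: power_one_over)
      have "\<bar>\<phi> ((F ^^ k) x) - \<phi> ((F ^^ k) y)\<bar> \<le> C * d ((F ^^ k) x) ((F ^^ k) y) powr \<alpha>"
        by (intro C(4) nat_ext_funpow_closed xy)
      also have "\<dots> \<le> C * (A * \<sigma> ^ (n - k) + D * (1 / a) ^ k) powr \<alpha>"
        using C(1,2) dk by (intro mult_left_mono powr_mono2) auto
      also have "\<dots> \<le> C * (2 * ((A * \<sigma> ^ (n - k)) powr \<alpha> + (D * (1 / a) ^ k) powr \<alpha>))"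
        using C A D(1) \<sigma>_pos a_gt by (intro mult_left_mono powr_add_le) auto
      also have "(A * \<sigma> ^ (n - k)) powr \<alpha> = A powr \<alpha> * p ^ (n - k)"
        using \<sigma>_pos A by (simp add: powr_mult power_powr p_def)
      also have "(D * (1 / a) ^ k) powr \<alpha> = D powr \<alpha> * (((1 / a) ^ k) powr \<alpha>)"
        by (rule powr_mult)
      also have "((1 / a) ^ k) powr \<alpha> = q ^ k" unfolding q_def using a_gt by (intro power_powr) simp
      finally show ?thesis by (simp add: mult_ac)
    qed
    have "\<bar>birkhoff_sum F \<phi> n x - birkhoff_sum F \<phi> n y\<bar> = \<bar>\<Sum>k<n. \<phi> ((F ^^ k) x) - \<phi> ((F ^^ k) y)\<bar>"
      by (simp add: birkhoff_sum_def sum_subtractf)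
    also have "\<dots> \<le> (\<Sum>k<n. 2 * C * (A powr \<alpha> * p ^ (n - k) + D powr \<alpha> * q ^ k))"
      by (rule order_trans[OF sum_abs sum_mono]) (use bd in auto)
    also have "\<dots> = 2 * C * (A powr \<alpha> * (\<Sum>k<n. p ^ (n - k)) + D powr \<alpha> * (\<Sum>k<n. q ^ k))"
      by (simp add: sum_distrib_left[symmetric] sum.distrib)
    also have "\<dots> \<le> 2 * C * (A powr \<alpha> * (1 / (1 - p)) + D powr \<alpha> * (1 / (1 - q)))"
      using C(1) p q by (intro mult_left_mono add_mono sum_power_le) auto
    also have "\<dots> = C'" by (simp add: C'_def)
    finally show ?thesis .
  qed
  show thesis
  proof (rule that[of C'])
    fix n x y assume xy: "x \<in> K" "y \<in> K" "x 0 = y 0"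
    show "\<bar>birkhoff_sum F \<phi> n x - birkhoff_sum F \<phi> n y\<bar> \<le> C'"
      by (rule main[OF xy(1,2)]) (use xy(3) \<epsilon>0_pos \<sigma>_pos in simp)
  qed (rule main)
qed

lemma hoelder_bounded:
  assumes "hoelder_continuous_on K d \<phi>"
  obtains B where "B \<ge> 0" "\<And>x. x \<in> K \<Longrightarrow> \<bar>\<phi> x\<bar> \<le> B"
proof -
  have "bounded (\<phi> ` K)"
    using compact_continuous_image[OF hoelder_continuous[OF assms] compact_nat_ext] compact_imp_bounded by blast
  then obtain B where B: "\<And>x. x \<in> K \<Longrightarrow> \<bar>\<phi> x\<bar> \<le> B" by (auto simp: bounded_iff)
  show thesis
    by (rule that[of "max 0 B"]) (use B in fastforce)+
qed

lemma birkhoff_sum_add: "birkhoff_sum f \<phi> (m + n) x = birkhoff_sum f \<phi> m x + birkhoff_sum f \<phi> n ((f ^^ m) x)"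
  for f :: "'b \<Rightarrow> 'b"
proof (induction n)
  case (Suc n)
  have "(f ^^ (m + n)) x = (f ^^ n) ((f ^^ m) x)" by (metis add.commute comp_apply funpow_add)
  then show ?case using Suc by (simp add: birkhoff_sum_def)
qed (simp add: birkhoff_sum_def)

text \<open>\<open>(F ^^ m) (past x)\<close> and \<open>past ((g ^^ m) x)\<close> are two histories
  of the same point, so almost additivity is an instance of \<open>hoelder_fibre\<close>. The same
  constant serves for shadowing and for the comparison with the original sums.\<close>

theorem hoelder_potential:
  assumes \<phi>: "hoelder_continuous_on K d \<phi>"
  obtains C B where "potential g s \<sigma> \<epsilon>\<^sub>0 (ext_sum \<phi>) C C B"
    "\<And>n x. x \<in> K \<Longrightarrow> \<bar>birkhoff_sum F \<phi> n x - ext_sum \<phi> n (x 0)\<bar> \<le> C"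
proof -
  obtain C where C: "\<And>n x y. x \<in> K \<Longrightarrow> y \<in> K \<Longrightarrow> x 0 = y 0 \<Longrightarrow> \<bar>birkhoff_sum F \<phi> n x - birkhoff_sum F \<phi> n y\<bar> \<le> C"
    "\<And>n x y. x \<in> K \<Longrightarrow> y \<in> K \<Longrightarrow> (\<And>j. j \<le> n \<Longrightarrow> dist ((g ^^ j) (x 0)) ((g ^^ j) (y 0)) \<le> \<epsilon>\<^sub>0 * \<sigma> ^ (n - j)) \<Longrightarrow>
      \<bar>birkhoff_sum F \<phi> n x - birkhoff_sum F \<phi> n y\<bar> \<le> C"
    using hoelder_fibre[OF \<phi>] by blast
  obtain B where B: "B \<ge> 0" "\<And>x. x \<in> K \<Longrightarrow> \<bar>\<phi> x\<bar> \<le> B" using hoelder_bounded[OF \<phi>] by blast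
  have "potential g s \<sigma> \<epsilon>\<^sub>0 (ext_sum \<phi>) C C B"
  proof
    show "\<bar>ext_sum \<phi> (m + n) x - ext_sum \<phi> m x - ext_sum \<phi> n ((g ^^ m) x)\<bar> \<le> C" for m n x
    proof -
      have "\<bar>birkhoff_sum F \<phi> n ((F ^^ m) (past x)) - birkhoff_sum F \<phi> n (past ((g ^^ m) x))\<bar> \<le> C"
        by (intro C(1) nat_ext_funpow_closed past) (simp add: funpow_nat_ext_map past(2))
      then show ?thesis by (simp add: ext_sum_def birkhoff_sum_add)
    qed
    show "\<bar>ext_sum \<phi> n z - ext_sum \<phi> n x\<bar> \<le> C"
      if "\<And>j. j \<le> n \<Longrightarrow> dist ((g ^^ j) z) ((g ^^ j) x) \<le> \<epsilon>\<^sub>0 * \<sigma> ^ (n - j)" for n z x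
      unfolding ext_sum_def by (intro C(2) past(1)) (use that in \<open>simp add: past(2)\<close>)
    show "\<bar>ext_sum \<phi> n x\<bar> \<le> real n * B" for n x
    proof -
      have "\<bar>ext_sum \<phi> n x\<bar> \<le> (\<Sum>k<n. B)" unfolding ext_sum_def birkhoff_sum_def
        by (rule order_trans[OF sum_abs sum_mono]) (intro B(2) nat_ext_funpow_closed past(1))
      then show ?thesis by simp
    qed
  next
    fix \<eta> :: real assume "\<eta> > 0"
    obtain N \<delta> where N: "\<delta> > 0" "\<forall>x\<in>K. \<forall>y\<in>K. (\<forall>j\<le>N. dist (x j) (y j) < \<delta>) \<longrightarrow> \<bar>\<phi> x - \<phi> y\<bar> < \<eta>"
      using hoelder_unif[OF \<phi> \<open>\<eta> > 0\<close>] by blast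
    have "\<bar>ext_sum \<phi> n z - ext_sum \<phi> n x\<bar> \<le> real N * (2 * B) + real n * \<eta>" if bc: "bclose n \<delta> z x" for n x z
    proof -
      \<comment> \<open>During the first \<open>N\<close> iterates the histories are still among the
        relevant coordinates; those terms are bounded by \<open>2 * B\<close> each and go into the
        constant.\<close>
      have bd: "\<bar>\<phi> ((F ^^ k) (past z)) - \<phi> ((F ^^ k) (past x))\<bar> \<le> (if k < N then 2 * B else 0) + \<eta>" if k: "k < n" for k
      proof (cases "k < N")
        case True
        have "\<bar>\<phi> ((F ^^ k) (past z))\<bar> \<le> B" "\<bar>\<phi> ((F ^^ k) (past x))\<bar> \<le> B"
          by (intro B(2) nat_ext_funpow_closed past(1))+
        then show ?thesis using True \<open>\<eta> > 0\<close> by simp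
      next
        case False
        have "\<bar>\<phi> ((F ^^ k) (past z)) - \<phi> ((F ^^ k) (past x))\<bar> < \<eta>"
        proof (rule N(2)[rule_format]; (intro nat_ext_funpow_closed past(1))?)
          fix j assume "j \<le> N"
          moreover have "dist ((g ^^ (k - j)) z) ((g ^^ (k - j)) x) < \<delta>"
            using bc k unfolding bclose_def by (meson diff_le_self le_less_trans)
          ultimately show "dist ((F ^^ k) (past z) j) ((F ^^ k) (past x) j) < \<delta>"
            using False by (simp add: funpow_nat_ext_map past(2))
        qed
        then show ?thesis using False by simp
      qed
      have "\<bar>ext_sum \<phi> n z - ext_sum \<phi> n x\<bar> = \<bar>\<Sum>k<n. \<phi> ((F ^^ k) (past z)) - \<phi> ((F ^^ k) (past x))\<bar>"
        by (simp add: ext_sum_def birkhoff_sum_def sum_subtractf)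
      also have "\<dots> \<le> (\<Sum>k<n. (if k < N then 2 * B else 0) + \<eta>)"
        by (rule order_trans[OF sum_abs sum_mono]) (use bd in auto)
      also have "\<dots> = (\<Sum>k<n. if k < N then 2 * B else 0) + real n * \<eta>" by (simp add: sum.distrib)
      also have "(\<Sum>k<n. if k < N then 2 * B else 0) = (\<Sum>k\<in>{..<n} \<inter> {..<N}. 2 * B)"
        using sum.inter_restrict[of "{..<n}" "\<lambda>_. 2 * B" "{..<N}"] by (simp only: lessThan_iff finite_lessThan)
      also have "\<dots> \<le> (\<Sum>k\<in>{..<N}. 2 * B)" using B(1) by (intro sum_mono2) auto
      finally show ?thesis by simp
    qed
    then show "\<exists>\<delta>>0. \<exists>C. \<forall>n x z. bclose n \<delta> z x \<longrightarrow> \<bar>ext_sum \<phi> n z - ext_sum \<phi> n x\<bar> \<le> C + real n * \<eta>"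
      using N(1) by blast
  qed
  moreover have "\<bar>birkhoff_sum F \<phi> n x - ext_sum \<phi> n (x 0)\<bar> \<le> C" if "x \<in> K" for n x
    unfolding ext_sum_def by (intro C(1) that past(1)) (simp add: past(2))
  ultimately show thesis by (rule that)
qed

end

section \<open>Pressure of collections of orbit segments\<close>

lemma ereal_ln_mono:
  assumes "x \<le> y"
  shows "ereal_ln x \<le> ereal_ln y"
proof (cases "x \<le> 0 \<or> y = \<infinity>")
  case True
  then show ?thesis by (auto simp: ereal_ln_def)
next
  case False
  then obtain u v where "x = ereal u" "y = ereal v" "0 < u" "u \<le> v"
    using assms by (cases x; cases y) auto
  then show ?thesis by (simp add: ereal_ln_def)
qed

lemma part_sum_antimono: "\<epsilon> \<le> \<epsilon>' \<Longrightarrow> part_sum d f D \<phi> \<epsilon>' n \<le> part_sum d f D \<phi> \<epsilon> n"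
  unfolding part_sum_def
  by (rule SUP_subset_mono) (auto simp: separated_set_def intro: order_trans)

lemma pressure_at_antimono: "\<epsilon> \<le> \<epsilon>' \<Longrightarrow> pressure_at d f D \<phi> \<epsilon>' \<le> pressure_at d f D \<phi> \<epsilon>"
  unfolding pressure_at_def
  by (intro Limsup_mono always_eventually allI ereal_mult_left_mono ereal_ln_mono part_sum_antimono) auto

text \<open>Smaller scales admit more separated sets, so the limit as the scale tends to 0 exists
  and is the supremum.\<close>

lemma pressure_on_eq_SUP: "pressure_on d f D \<phi> = (SUP \<epsilon>\<in>{0<..}. pressure_at d f D \<phi> \<epsilon>)"
proof -
  let ?p = "pressure_at d f D \<phi>" and ?S = "SUP \<epsilon>\<in>{0<..}. pressure_at d f D \<phi> \<epsilon>"
  have "(?p \<longlongrightarrow> ?S) (at_right 0)"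
  proof (rule order_tendstoI)
    fix l assume "l < ?S"
    then obtain \<epsilon> where \<epsilon>: "\<epsilon> > 0" "l < ?p \<epsilon>" by (auto simp: less_SUP_iff)
    have "l < ?p x" if "x \<in> {0<..<\<epsilon>}" for x
      using \<epsilon>(2) pressure_at_antimono[of x \<epsilon> d f D \<phi>] that by (auto intro: less_le_trans)
    then show "\<forall>\<^sub>F x in at_right 0. l < ?p x"
      using \<epsilon>(1) unfolding eventually_at_right_field by (intro exI[of _ \<epsilon>]) simp
  next
    fix u assume u: "?S < u"
    have "?p x < u" if "x > 0" for x
      by (rule le_less_trans[OF _ u]) (rule SUP_upper, use that in auto)
    then show "\<forall>\<^sub>F x in at_right 0. ?p x < u"
      unfolding eventually_at_right_field by (intro exI[of _ 1]) simp
  qed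
  then show ?thesis unfolding pressure_on_def by (intro tendsto_Lim) auto
qed

lemma le_exp_of_ereal_ln:
  assumes "n \<ge> 1" "ereal S \<le> p" "ereal (1 / real n) * ereal_ln p < ereal b"
  shows "S \<le> exp (real n * b)"
proof (cases "S > 0")
  case True
  have "ereal (1 / real n) * ereal_ln (ereal S) \<le> ereal (1 / real n) * ereal_ln p"
    using assms(2) by (intro ereal_mult_left_mono ereal_ln_mono) auto
  then have "ereal (1 / real n) * ereal_ln (ereal S) < ereal b" using assms(3) by (rule le_less_trans)
  then have "ln S < real n * b" using True assms(1) by (simp add: ereal_ln_def field_simps)
  then have "exp (ln S) \<le> exp (real n * b)" by simp
  then show ?thesis using True by simp
next
  case False
  then show ?thesis using exp_ge_zero[of "real n * b"] by linarith
qed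

lemma ereal_ln_le:
  assumes "n \<ge> 1" "p \<le> ereal (exp c)"
  shows "ereal (1 / real n) * ereal_ln p \<le> ereal (c / real n)"
proof -
  have "ereal_ln p \<le> ereal c" using ereal_ln_mono[OF assms(2)] by (simp add: ereal_ln_def)
  then have "ereal (1 / real n) * ereal_ln p \<le> ereal (1 / real n) * ereal c"
    by (intro ereal_mult_left_mono) auto
  then show ?thesis by simp
qed

locale ext_potential = nat_ext_system g s \<sigma> \<epsilon>\<^sub>0 a + potential g s \<sigma> \<epsilon>\<^sub>0 \<Phi> C0 C1 B
  for g :: "'a::metric_space \<Rightarrow> 'a" and s \<sigma> \<epsilon>\<^sub>0 a \<Phi> C0 C1 B +
  fixes \<phi> :: "(nat \<Rightarrow> 'a) \<Rightarrow> real"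
  assumes \<phi>_cont: "continuous_on (nat_ext g) \<phi>"
    and \<phi>_Phi: "x \<in> nat_ext g \<Longrightarrow> \<bar>birkhoff_sum (nat_ext_map g) \<phi> n x - \<Phi> n (x 0)\<bar> \<le> C0"
begin

lemma bad_segments_iff: "(x, n) \<in> bad_segments_ext g s \<sigma> \<longleftrightarrow> x \<in> K \<and> bad n (x 0)"
proof (cases "n \<ge> 1")
  case True
  then show ?thesis
    by (auto simp: bad_segments_ext_def bad_segments_def contr_set_def bad_def not_less atLeast0LessThan field_simps)
qed (auto simp: bad_segments_ext_def bad_segments_def bad_def)

text \<open>Coordinate 0 enters \<open>d\<close> with weight 1, so separation on the base lifts to
  the natural extension at the same scale.\<close>

lemma separated_past:
  assumes "bsep n \<delta> E" "n \<ge> 1"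
  shows "separated_set d F n \<delta> (past ` E)"
  unfolding separated_set_def
proof (intro ballI impI)
  fix u v assume "u \<in> past ` E" "v \<in> past ` E" "u \<noteq> v"
  then obtain x y where xy: "x \<in> E" "y \<in> E" "x \<noteq> y" "u = past x" "v = past y" by blast
  then have "\<not> bclose n \<delta> x y" using assms(1) unfolding bsep_def by blast
  then obtain j where j: "j < n" "\<delta> \<le> dist ((g ^^ j) x) ((g ^^ j) y)" unfolding bclose_def by force
  have "\<delta> \<le> d ((F ^^ j) u) ((F ^^ j) v)"
    using j(2) coord_le[of "(F ^^ j) u" 0 "(F ^^ j) v"] by (simp add: funpow_nat_ext_map xy(4,5) past(2))
  also have "\<dots> \<le> bowen_dist d F n u v" unfolding bowen_dist_def using j(1) by (intro Max_ge) auto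
  finally show "\<delta> \<le> bowen_dist d F n u v" .
qed

lemma inj_past: "inj_on past E" by (rule inj_onI) (metis past(2))

lemma past_sum_le_part_sum:
  assumes "bsep n \<delta> E" "n \<ge> 1" "\<delta> > 0" "\<And>x. x \<in> E \<Longrightarrow> (past x, n) \<in> D"
  shows "ereal (\<Sum>x\<in>E. exp (birkhoff_sum F \<phi> n (past x))) \<le> part_sum d F D \<phi> \<delta> n"
proof -
  obtain N where "\<And>E. bsep n \<delta> E \<Longrightarrow> finite E \<and> card E \<le> N"
    by (rule bsep_card_bound[OF assms(3), of n]) (rule that)
  then have "finite E" using assms(1) by blast
  then have "past ` E \<in> {E. finite E \<and> E \<subseteq> {x. (x, n) \<in> D} \<and> separated_set d F n \<delta> E}"
    using assms(4) separated_past[OF assms(1,2)] by auto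
  then have "ereal (\<Sum>x\<in>past ` E. exp (birkhoff_sum F \<phi> n x)) \<le> part_sum d F D \<phi> \<delta> n"
    unfolding part_sum_def by (rule SUP_upper)
  then show ?thesis by (simp add: sum.reindex[OF inj_past])
qed

text \<open>The limsup bounds all sufficiently long segments; the finitely many short lengths are
  absorbed into the constant by counting separated points.\<close>

lemma bad_growth_of_pressure:
  assumes "pressure_on d F (bad_segments_ext g s \<sigma>) \<phi> < ereal b"
  shows "bad_growth b"
  unfolding bad_growth_def
proof (intro allI impI)
  fix \<delta> :: real assume \<delta>: "\<delta> > 0"
  let ?D = "bad_segments_ext g s \<sigma>"
  have "pressure_at d F ?D \<phi> \<delta> \<le> pressure_on d F ?D \<phi>"
    unfolding pressure_on_eq_SUP using \<delta> by (intro SUP_upper) auto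
  then have "limsup (\<lambda>n. ereal (1 / real n) * ereal_ln (part_sum d F ?D \<phi> \<delta> n)) < ereal b"
    using assms unfolding pressure_at_def by (rule le_less_trans)
  then have "\<forall>\<^sub>F n in sequentially. ereal (1 / real n) * ereal_ln (part_sum d F ?D \<phi> \<delta> n) < ereal b"
    by (rule Limsup_lessD)
  then obtain n0 where n0: "\<And>n. n \<ge> n0 \<Longrightarrow> ereal (1 / real n) * ereal_ln (part_sum d F ?D \<phi> \<delta> n) < ereal b"
    unfolding eventually_sequentially by blast
  have "\<forall>n. \<exists>N. \<forall>E. bsep n \<delta> E \<longrightarrow> finite E \<and> card E \<le> N"
    using bsep_card_bound[OF \<delta>] by metis
  from choice[OF this] obtain N where N: "\<forall>n E. bsep n \<delta> E \<longrightarrow> finite E \<and> card E \<le> N n" ..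
  define h where "h n = real (N n) * exp (real n * B) * exp (- real n * b)" for n
  define Cb where "Cb = exp C0 + (\<Sum>n<n0. h n)"
  have h0: "h n \<ge> 0" for n by (simp add: h_def)
  have "(\<Sum>x\<in>E. exp (\<Phi> l x)) \<le> Cb * exp (real l * b)"
    if l: "l \<ge> 1" and E: "bsep l \<delta> E" and bad: "\<forall>x\<in>E. bad l x" for l E
  proof (cases "l < n0")
    case True
    have "(\<Sum>x\<in>E. exp (\<Phi> l x)) \<le> (\<Sum>x\<in>E. exp (real l * B))"
      using Phi_bound[of l] by (intro sum_mono) (auto simp: abs_le_iff)
    also have "\<dots> = real (card E) * exp (real l * B)" by simp
    also have "\<dots> \<le> real (N l) * exp (real l * B)" using N E by (intro mult_right_mono) auto
    also have "\<dots> = h l * exp (real l * b)" by (simp add: h_def exp_minus)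
    also have "\<dots> \<le> Cb * exp (real l * b)"
    proof (intro mult_right_mono)
      have "h l \<le> (\<Sum>n<n0. h n)" using True h0 by (intro member_le_sum) auto
      then show "h l \<le> Cb" unfolding Cb_def using exp_ge_zero[of C0] by linarith
    qed simp
    finally show ?thesis .
  next
    case False
    have A: "(\<Sum>x\<in>E. exp (birkhoff_sum F \<phi> l (past x))) \<le> exp (real l * b)"
    proof (rule le_exp_of_ereal_ln[OF l past_sum_le_part_sum[OF E l \<delta>] n0])
      show "(past x, l) \<in> ?D" if "x \<in> E" for x
        using bad that by (simp add: bad_segments_iff past)
    qed (use False in simp)
    moreover have "(\<Sum>x\<in>E. exp (\<Phi> l x)) \<le> (\<Sum>x\<in>E. exp C0 * exp (birkhoff_sum F \<phi> l (past x)))"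
    proof (rule sum_mono)
      fix x
      have "\<Phi> l x \<le> C0 + birkhoff_sum F \<phi> l (past x)"
        using \<phi>_Phi[OF past(1)[of x], of l] by (simp add: past(2) abs_le_iff)
      then show "exp (\<Phi> l x) \<le> exp C0 * exp (birkhoff_sum F \<phi> l (past x))"
        by (simp add: exp_add[symmetric])
    qed
    moreover have "(\<Sum>x\<in>E. exp C0 * exp (birkhoff_sum F \<phi> l (past x))) = exp C0 * (\<Sum>x\<in>E. exp (birkhoff_sum F \<phi> l (past x)))"
      by (rule sum_distrib_left[symmetric])
    moreover have "exp C0 * exp (real l * b) \<le> Cb * exp (real l * b)"
      unfolding Cb_def using h0 by (intro mult_right_mono) (auto intro: sum_nonneg)
    ultimately show ?thesis
      using mult_left_mono[OF A exp_ge_zero[of C0]] by linarith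
  qed
  then show "\<exists>Cb. \<forall>l\<ge>1. \<forall>E. bsep l \<delta> E \<longrightarrow> (\<forall>x\<in>E. bad l x) \<longrightarrow> (\<Sum>x\<in>E. exp (\<Phi> l x)) \<le> Cb * exp (real l * b)"
    by (intro exI[of _ Cb] allI impI)
qed

text \<open>A separated subset of the natural extension is split according to the approximate positions of its first
  coordinates; within one class, the points are separated by the orbits of their base points.\<close>

lemma separated_sum_le:
  assumes r: "\<And>\<delta>. \<delta> > 0 \<Longrightarrow> \<exists>Kc. \<forall>n E. bsep n \<delta> E \<longrightarrow> (\<Sum>x\<in>E. exp (\<Phi> n x)) \<le> Kc * exp (real n * r)"
    and \<epsilon>: "\<epsilon> > 0"
  obtains M where "M > 0" "\<And>n E. n \<ge> 1 \<Longrightarrow> finite E \<Longrightarrow> E \<subseteq> K \<Longrightarrow> separated_set d F n \<epsilon> E \<Longrightarrow>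
    (\<Sum>x\<in>E. exp (birkhoff_sum F \<phi> n x)) \<le> M * exp (real n * r)"
proof -
  obtain N \<eta> where N: "\<eta> > 0" "\<forall>x y :: nat \<Rightarrow> 'a. (\<forall>j\<le>N. dist (x j) (y j) < \<eta>) \<longrightarrow> d x y < \<epsilon>"
    using coord_close_d[OF \<epsilon>] by blast
  obtain C :: "'a set" where C: "finite C" "\<And>x. \<exists>c\<in>C. dist x c < \<eta> / 2"
    by (rule finite_net[OF half_gt_zero[OF N(1)]]) (rule that)
  have "\<forall>x. \<exists>c. c \<in> C \<and> dist x c < \<eta> / 2" using C(2) by blast
  from choice[OF this] obtain c where c: "\<forall>x. c x \<in> C \<and> dist x (c x) < \<eta> / 2" ..
  obtain Kc where Kc: "\<forall>n E. bsep n \<eta> E \<longrightarrow> (\<Sum>x\<in>E. exp (\<Phi> n x)) \<le> Kc * exp (real n * r)"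
    using r[OF N(1)] by blast
  define lab where "lab x = restrict (\<lambda>j. c (x j)) {..N}" for x :: "nat \<Rightarrow> 'a"
  define L where "L = {..N} \<rightarrow>\<^sub>E C"
  have finL: "finite L" unfolding L_def using C(1) by (intro finite_PiE) auto
  have labL: "lab x \<in> L" for x using c by (auto simp: lab_def L_def)
  define M where "M = real (card L) * (exp C0 * max 0 Kc) + 1"
  have main: "(\<Sum>x\<in>E. exp (birkhoff_sum F \<phi> n x)) \<le> M * exp (real n * r)"
    if n: "n \<ge> 1" and E: "finite E" "E \<subseteq> K" "separated_set d F n \<epsilon> E" for n E
  proof -
    have cls: "(\<Sum>x | x \<in> E \<and> lab x = w. exp (birkhoff_sum F \<phi> n x)) \<le> exp C0 * max 0 Kc * exp (real n * r)" for w
    proof -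
      let ?E = "{x. x \<in> E \<and> lab x = w}"
      have far: "\<exists>k<n. \<eta> \<le> dist ((g ^^ k) (x 0)) ((g ^^ k) (y 0))" if xy: "x \<in> ?E" "y \<in> ?E" "x \<noteq> y" for x y
      proof -
        have "\<epsilon> \<le> bowen_dist d F n x y" using E(3) xy unfolding separated_set_def by blast
        moreover have "bowen_dist d F n x y \<in> (\<lambda>k. d ((F ^^ k) x) ((F ^^ k) y)) ` {..<n}"
          unfolding bowen_dist_def by (rule Max_in) (use n in \<open>auto simp: lessThan_empty_iff\<close>)
        ultimately obtain k where k: "k < n" "\<epsilon> \<le> d ((F ^^ k) x) ((F ^^ k) y)" by auto
        have "\<not> (\<forall>j\<le>N. dist ((F ^^ k) x j) ((F ^^ k) y j) < \<eta>)" using N(2) k(2) by (meson not_less)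
        then obtain j where j: "j \<le> N" "\<eta> \<le> dist ((F ^^ k) x j) ((F ^^ k) y j)" by (auto simp: not_less)
        show ?thesis
        proof (cases "j \<le> k")
          case True
          then show ?thesis using j(2) k(1) by (intro exI[of _ "k - j"]) (simp add: funpow_nat_ext_map)
        next
          case False
          \<comment> \<open>A coordinate \<open>j > k\<close> still belongs to the history; equal
            labels put the two points within \<eta> of each other there, so it cannot be the one
            that separates them.\<close>
          have "lab x (j - k) = lab y (j - k)" using xy by simp
          then have eq: "c (x (j - k)) = c (y (j - k))" using j(1) by (simp add: lab_def le_diff_conv)
          have "dist (x (j - k)) (y (j - k)) < \<eta>"
            using dist_triangle2[of "x (j - k)" "y (j - k)" "c (x (j - k))"] c[rule_format, of "x (j - k)"]
              c[rule_format, of "y (j - k)"] unfolding eq by linarith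
          then show ?thesis using j(2) False by (simp add: funpow_nat_ext_map)
        qed
      qed
      have inj: "inj_on (\<lambda>x. x 0) ?E"
      proof (rule inj_onI, rule ccontr)
        fix x y assume xy: "x \<in> ?E" "y \<in> ?E" "x 0 = y 0" "x \<noteq> y"
        obtain k where "\<eta> \<le> dist ((g ^^ k) (x 0)) ((g ^^ k) (y 0))" using far[OF xy(1,2,4)] by blast
        then show False using N(1) xy(3) by simp
      qed
      have sep: "bsep n \<eta> ((\<lambda>x. x 0) ` ?E)" unfolding bsep_def
      proof (intro ballI impI)
        fix u v assume "u \<in> (\<lambda>x. x 0) ` ?E" "v \<in> (\<lambda>x. x 0) ` ?E" "u \<noteq> v"
        then obtain x y where xy: "x \<in> ?E" "u = x 0" "y \<in> ?E" "v = y 0" by blast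
        then have "x \<noteq> y" using \<open>u \<noteq> v\<close> by blast
        then obtain k where k: "k < n" "\<eta> \<le> dist ((g ^^ k) (x 0)) ((g ^^ k) (y 0))" using far[OF xy(1,3)] by blast
        show "\<not> bclose n \<eta> u v"
        proof
          assume "bclose n \<eta> u v"
          then have "dist ((g ^^ k) u) ((g ^^ k) v) < \<eta>" using k(1) unfolding bclose_def by blast
          then show False using k(2) xy(2,4) by simp
        qed
      qed
      have "(\<Sum>x\<in>?E. exp (birkhoff_sum F \<phi> n x)) \<le> (\<Sum>x\<in>?E. exp C0 * exp (\<Phi> n (x 0)))"
      proof (rule sum_mono)
        fix x assume "x \<in> ?E"
        then have "x \<in> K" using E(2) by blast
        then have "birkhoff_sum F \<phi> n x \<le> C0 + \<Phi> n (x 0)" using \<phi>_Phi[of x n] by (simp add: abs_le_iff)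
        then show "exp (birkhoff_sum F \<phi> n x) \<le> exp C0 * exp (\<Phi> n (x 0))" by (simp add: exp_add[symmetric])
      qed
      also have "\<dots> = exp C0 * (\<Sum>u\<in>(\<lambda>x. x 0) ` ?E. exp (\<Phi> n u))"
        by (simp add: sum.reindex[OF inj] sum_distrib_left)
      also have "\<dots> \<le> exp C0 * (Kc * exp (real n * r))"
        using Kc sep by (intro mult_left_mono) auto
      also have "\<dots> \<le> exp C0 * (max 0 Kc * exp (real n * r))" by (intro mult_left_mono mult_right_mono) auto
      finally show ?thesis by (simp add: mult_ac)
    qed
    have "(\<Sum>x\<in>E. exp (birkhoff_sum F \<phi> n x)) = (\<Sum>w\<in>L. \<Sum>x | x \<in> E \<and> lab x = w. exp (birkhoff_sum F \<phi> n x))"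
      by (rule sum.group[symmetric, OF E(1) finL]) (use labL in auto)
    also have "\<dots> \<le> (\<Sum>w\<in>L. exp C0 * max 0 Kc * exp (real n * r))" by (rule sum_mono[OF cls])
    also have "\<dots> \<le> M * exp (real n * r)" by (simp add: M_def algebra_simps)
    finally show ?thesis .
  qed
  have "M > 0" by (auto simp: M_def intro!: add_nonneg_pos)
  then show thesis using main by (rule that)
qed

text \<open>Stated for every \<open>r\<close> above both \<open>rate\<close> and \<open>b\<close>,
  since the order of these two is not yet known; comparing with the pressure is what then forces
  \<open>b < rate\<close>.\<close>

lemma pressure_le:
  assumes "rate < r" "b < r" "bad_growth b"
  shows "pressure K d F \<phi> \<le> ereal r"
  unfolding pressure_def pressure_on_eq_SUP
proof (rule SUP_least)
  fix \<epsilon> :: real assume "\<epsilon> \<in> {0<..}"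
  then have \<epsilon>: "\<epsilon> > 0" by simp
  obtain C where C: "C > 0" "\<And>n. tsup n \<le> C * exp (real n * r)" using tsup_le_exp[OF assms(1)] by blast
  obtain M where M: "M > 0" "\<And>n E. n \<ge> 1 \<Longrightarrow> finite E \<Longrightarrow> E \<subseteq> K \<Longrightarrow> separated_set d F n \<epsilon> E \<Longrightarrow>
    (\<Sum>x\<in>E. exp (birkhoff_sum F \<phi> n x)) \<le> M * exp (real n * r)"
    by (rule separated_sum_le[OF bsep_sum_le[OF C(2) assms(2,3)] \<epsilon>]) (assumption | rule that)+
  have "\<forall>\<^sub>F n in sequentially. ereal (1 / real n) * ereal_ln (part_sum d F (K \<times> {1..}) \<phi> \<epsilon> n) \<le> ereal (ln M / real n + r)"
    unfolding eventually_sequentially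
  proof (intro exI[of _ 1] allI impI)
    fix n :: nat assume n: "n \<ge> 1"
    have "part_sum d F (K \<times> {1..}) \<phi> \<epsilon> n \<le> ereal (M * exp (real n * r))"
      unfolding part_sum_def using n by (intro SUP_least) (auto intro!: M(2))
    also have "M * exp (real n * r) = exp (ln M + real n * r)" using M(1) by (simp add: exp_add)
    finally have "ereal (1 / real n) * ereal_ln (part_sum d F (K \<times> {1..}) \<phi> \<epsilon> n) \<le> ereal ((ln M + real n * r) / real n)"
      by (rule ereal_ln_le[OF n])
    then show "ereal (1 / real n) * ereal_ln (part_sum d F (K \<times> {1..}) \<phi> \<epsilon> n) \<le> ereal (ln M / real n + r)"
      using n by (simp add: add_divide_distrib)
  qed
  then have "pressure_at d F (K \<times> {1..}) \<phi> \<epsilon> \<le> limsup (\<lambda>n. ereal (ln M / real n + r))"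
    unfolding pressure_at_def by (rule Limsup_mono)
  also have "\<dots> = ereal r"
  proof (rule lim_imp_Limsup)
    have "(\<lambda>n. ln M / real n + r) \<longlonglongrightarrow> 0 + r" by (intro tendsto_intros lim_const_over_n)
    then show "(\<lambda>n. ereal (ln M / real n + r)) \<longlonglongrightarrow> ereal r" by simp
  qed simp
  finally show "pressure_at d F (K \<times> {1..}) \<phi> \<epsilon> \<le> ereal r" .
qed

text \<open>\<open>b\<close> is chosen strictly between the two pressures. If
  \<open>rate \<le> b\<close>, then \<open>pressure_le\<close> bounds the full pressure by every
  \<open>r > b\<close>, against this choice.\<close>

theorem growth_gap:
  assumes "pressure_on d F (bad_segments_ext g s \<sigma>) \<phi> < pressure K d F \<phi>"
  obtains b where "bad_growth b" "b < rate"
proof -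
  obtain b where b: "pressure_on d F (bad_segments_ext g s \<sigma>) \<phi> < ereal b" "ereal b < pressure K d F \<phi>"
    using ereal_dense2[OF assms] by blast
  have bad: "bad_growth b" by (rule bad_growth_of_pressure[OF b(1)])
  have "b < rate"
  proof (rule ccontr)
    assume "\<not> b < rate"
    obtain r where r: "ereal b < ereal r" "ereal r < pressure K d F \<phi>" using ereal_dense2[OF b(2)] by blast
    then have "rate < r" "b < r" using \<open>\<not> b < rate\<close> by auto
    then show False using pressure_le[OF _ _ bad] r(2) by (auto simp: not_less[symmetric])
  qed
  with bad show thesis by (rule that)
qed

end

section \<open>Equilibrium states\<close>

text \<open>The fibres of \<open>c\<close> form an admissible partition, and naming its cells by
  symbols or by the sets themselves gives the same entropies.\<close>

lemma (in prob_space) ks_entropy_ge: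
  assumes f: "f \<in> measurable M M" and c: "simple_function M c"
  shows "ereal (lim (\<lambda>n. shannon M (itinerary f c n) / real n)) \<le> ks_entropy M f"
proof -
  define h where "h v = c -` {v} \<inter> space M" for v
  define P where "P = h ` c ` space M"
  define c' where "c' x = h (c x)" for x
  have fin: "finite (c ` space M)" and fib: "\<And>v. v \<in> c ` space M \<Longrightarrow> h v \<in> sets M"
    using simple_functionD[OF c] by (auto simp: h_def)
  have P: "partition_on (space M) P"
    unfolding partition_on_def disjoint_def by (auto simp: P_def h_def)
  have "entropy_wrt M f P = lim (\<lambda>n. shannon M (itinerary f c' n) / real n)"
    by (rule entropy_wrt_eq[OF f P]) (auto simp: c'_def P_def h_def)
  moreover have "shannon M (itinerary f c' n) = shannon M (itinerary f c n)" for n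
  proof -
    have fk: "(f ^^ k) x \<in> space M" if "x \<in> space M" for k x
      using that measurable_space[OF f] by (induction k) auto
    have c'c: "c' x = c' y \<longleftrightarrow> c x = c y" if "x \<in> space M" "y \<in> space M" for x y
      using that by (auto simp: c'_def h_def)
    have iff: "itinerary f c' n x = itinerary f c' n y \<longleftrightarrow> itinerary f c n x = itinerary f c n y"
      if "x \<in> space M" "y \<in> space M" for x y
      using that by (simp add: itinerary_eq_iff c'c fk)
    have c': "simple_function M c'" unfolding c'_def using c by (rule simple_function_compose1)
    show ?thesis
      by (intro antisym shannon_data simple_function_itinerary[OF f] c c') (simp_all add: iff)
  qed
  moreover have "ereal (entropy_wrt M f P) \<le> ks_entropy M f"
    unfolding ks_entropy_def using P fin fib by (intro SUP_upper) (auto simp: P_def)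
  ultimately show ?thesis by simp
qed

text \<open>Formulated for any \<open>potential\<close> whose sums dominate those of \<phi> up to a
  constant, so that it applies to perturbed potentials too.\<close>

lemma (in potential) free_energy_le:
  assumes M: "borel_prob M (nat_ext g)" "nat_ext_map g \<in> measurable M M" "distr M M (nat_ext_map g) = M"
    and \<phi>: "continuous_on (nat_ext g) \<phi>"
    and \<phi>\<Phi>: "\<And>n x. x \<in> nat_ext g \<Longrightarrow> birkhoff_sum (nat_ext_map g) \<phi> n x \<le> \<Phi> n (x 0) + B0"
    and b: "bad_growth b" "b < rate"
  shows "free_energy (nat_ext_map g) \<phi> M \<le> ereal rate"
proof -
  obtain C where C: "C > 0" "\<And>n. tsup n \<le> C * exp (real n * rate)" using tsup_le_rate[OF b] by blast
  have "ks_entropy M (nat_ext_map g) \<le> ereal (rate - integral\<^sup>L M \<phi>)"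
    unfolding ks_entropy_def
  proof (rule SUP_least)
    fix P assume "P \<in> {P. finite P \<and> P \<subseteq> sets M \<and> partition_on (space M) P}"
    then have P: "finite P" "P \<subseteq> sets M" "partition_on (space M) P" by auto
    have "entropy_wrt M (nat_ext_map g) P + integral\<^sup>L M \<phi> \<le> rate"
      by (rule variational_upper[OF M \<phi> \<phi>\<Phi> bsep_sum_le[OF C(2) b(2,1)] P])
    then show "ereal (entropy_wrt M (nat_ext_map g) P) \<le> ereal (rate - integral\<^sup>L M \<phi>)" by simp
  qed
  then have "free_energy (nat_ext_map g) \<phi> M \<le> ereal (rate - integral\<^sup>L M \<phi>) + ereal (integral\<^sup>L M \<phi>)"
    unfolding free_energy_def by (rule add_right_mono)
  then show ?thesis by simp
qed

text \<open>By invariance every coordinate has the law of coordinate 0. A compact set is the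
  decreasing intersection of the sets of points that share coordinate \<open>N\<close> with one of
  its points, because coordinate \<open>N\<close> determines all earlier ones.\<close>

lemma (in nat_ext_system) invariant_measure_eqI:
  assumes M: "M \<in> invariant_measures K d F" and M': "M' \<in> invariant_measures K d F"
    and eq: "\<And>S. closed S \<Longrightarrow> S \<noteq> {} \<Longrightarrow> measure M ((\<lambda>x. x 0) -` S \<inter> K) = measure M' ((\<lambda>x. x 0) -` S \<inter> K)"
  shows "M = M'"
proof -
  have cM: "(\<lambda>x :: nat \<Rightarrow> 'a. x N) \<in> borel_measurable M" if "M \<in> invariant_measures K d F" for M N
    by (rule borel_prob.cont_measurable[of M K]) (use that in \<open>auto simp: invariant_measures_iff continuous_coord\<close>)
  have coord: "measure M ((\<lambda>x. x N) -` S \<inter> K) = measure M ((\<lambda>x. x 0) -` S \<inter> K)"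
    if M: "M \<in> invariant_measures K d F" and S: "closed S" for M N S
  proof -
    have bp: "borel_prob M K" and F: "F \<in> measurable M M" "distr M M F = M"
      using M by (auto simp: invariant_measures_iff)
    have sp: "space M = K" by (rule borel_prob.space_M[OF bp])
    have Fk: "F ^^ k \<in> measurable M M" for k using F(1) by (induction k) auto
    have dk: "distr M M (F ^^ k) = M" for k
    proof (induction k)
      case (Suc k)
      have "distr M M (F ^^ Suc k) = distr (distr M M (F ^^ k)) M F"
        unfolding funpow.simps by (rule distr_distr[OF F(1) Fk, symmetric])
      then show ?case unfolding Suc F(2) .
    qed (simp add: id_def)
    have A: "(\<lambda>x. x N) -` S \<inter> K \<in> sets M"
      using measurable_sets[OF cM[OF M, of N] borel_closed[OF S]] by (simp add: sp)
    have "measure M ((\<lambda>x. x N) -` S \<inter> K) = measure (distr M M (F ^^ N)) ((\<lambda>x. x N) -` S \<inter> K)"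
      unfolding dk ..
    also have "\<dots> = measure M ((F ^^ N) -` ((\<lambda>x. x N) -` S \<inter> K) \<inter> space M)"
      by (rule measure_distr[OF Fk A])
    also have "(F ^^ N) -` ((\<lambda>x. x N) -` S \<inter> K) \<inter> space M = (\<lambda>x. x 0) -` S \<inter> K"
      by (auto simp: sp funpow_nat_ext_map nat_ext_funpow_closed)
    finally show ?thesis .
  qed
  have agree: "x j = y j" if "x \<in> K" "y \<in> K" "x N = y N" "j \<le> N" for x y :: "nat \<Rightarrow> 'a" and N j
    using that(3,4)
  proof (induction N)
    case (Suc N)
    then have "g (x (Suc N)) = g (y (Suc N))" by simp
    then have "x N = y N" using that(1,2) by (simp add: nat_ext_def)
    then show ?case using Suc by (cases "j = Suc N") auto
  qed auto
  show ?thesis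
  proof (rule borel_prob_eqI)
    show "borel_prob M K" "borel_prob M' K" using M M' by (auto simp: invariant_measures_iff)
    fix G :: "(nat \<Rightarrow> 'a) set" assume G: "closed G" "G \<noteq> {}"
    define A where "A = G \<inter> K"
    have cA: "compact A" unfolding A_def using G(1) compact_nat_ext by (rule closed_Int_compact)
    have AK: "A \<subseteq> K" by (simp add: A_def)
    define S where "S N = (\<lambda>x :: nat \<Rightarrow> 'a. x N) ` A" for N
    have cS: "closed (S N)" for N unfolding S_def
      by (intro compact_imp_closed compact_continuous_image continuous_coord cA)
    define T where "T N = (\<lambda>x :: nat \<Rightarrow> 'a. x N) -` S N \<inter> K" for N
    have decT: "decseq T"
    proof (rule decseq_SucI, rule subsetI)
      fix N x assume "x \<in> T (Suc N)"
      then obtain y where y: "y \<in> A" "x (Suc N) = y (Suc N)" "x \<in> K" by (auto simp: T_def S_def)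
      then have "x N = y N" using agree[of x y "Suc N" N] AK by auto
      then show "x \<in> T N" using y(1,3) by (auto simp: T_def S_def)
    qed
    have intT: "(\<Inter>N. T N) = A"
    proof (intro set_eqI iffI)
      fix x assume "x \<in> (\<Inter>N. T N)"
      then have x: "x \<in> K" "\<And>N. \<exists>y\<in>A. x N = y N" by (auto simp: T_def S_def)
      show "x \<in> A"
      proof (rule ccontr)
        assume "x \<notin> A"
        then have "x \<in> - A" by simp
        moreover have "open (- A)" using compact_imp_closed[OF cA] by (simp add: open_Compl)
        ultimately obtain e where e: "e > 0" "ball x e \<subseteq> - A" using open_contains_ball by blast
        obtain N \<eta> where N: "\<eta> > 0" "\<forall>x y :: nat \<Rightarrow> 'a. (\<forall>j\<le>N. dist (x j) (y j) < \<eta>) \<longrightarrow> dist x y < e"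
          using coord_close[OF e(1)] by blast
        obtain y where y: "y \<in> A" "x N = y N" using x(2) by blast
        then have "\<forall>j\<le>N. dist (x j) (y j) < \<eta>" using agree[OF x(1) subsetD[OF AK y(1)] y(2)] N(1) by simp
        then have "y \<in> ball x e" using N(2) by simp
        then show False using e(2) y(1) by blast
      qed
    next
      fix x assume "x \<in> A"
      then show "x \<in> (\<Inter>N. T N)" using AK by (auto simp: T_def S_def)
    qed
    have lim: "(\<lambda>N. measure M (T N)) \<longlonglongrightarrow> measure M A" if M: "M \<in> invariant_measures K d F" for M
    proof -
      interpret M: borel_prob M K using M by (simp add: invariant_measures_iff)
      have "range T \<subseteq> sets M"
        using measurable_sets[OF cM[OF M] borel_closed[OF cS]] by (auto simp: T_def M.space_M)
      from M.finite_Lim_measure_decseq[OF this decT] show ?thesis unfolding intT .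
    qed
    have "measure M (T N) = measure M' (T N)" for N
    proof (cases "A = {}")
      case False
      then have "S N \<noteq> {}" by (simp add: S_def)
      then have "measure M ((\<lambda>x. x 0) -` S N \<inter> K) = measure M' ((\<lambda>x. x 0) -` S N \<inter> K)" by (rule eq[OF cS])
      then show ?thesis using coord[OF M cS, of N N] coord[OF M' cS, of N N] by (simp only: T_def)
    qed (simp add: T_def S_def)
    then have "(\<lambda>N. measure M (T N)) \<longlonglongrightarrow> measure M' A" using lim[OF M'] by simp
    then show "measure M (G \<inter> K) = measure M' (G \<inter> K)"
      using lim[OF M] unfolding A_def by (rule LIMSEQ_unique[rotated])
  qed
qed

context ext_potential
begin

lemma free_energy_le_rate:
  assumes "bad_growth b" "b < rate" "M \<in> invariant_measures K d F"
  shows "free_energy F \<phi> M \<le> ereal rate"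
proof (rule free_energy_le[OF _ _ _ \<phi>_cont _ assms(1,2), where ?B0.0 = C0])
  show "birkhoff_sum F \<phi> n x \<le> \<Phi> n (x 0) + C0" if "x \<in> K" for n x
    using \<phi>_Phi[OF that, of n] by (simp add: abs_le_iff)
qed (use assms(3) in \<open>auto simp: invariant_measures_iff\<close>)

text \<open>The preimages of a point are separated at the fixed scale
  \<open>\<epsilon>\<^sub>0\<close> along base orbits, so \<open>misiurewicz\<close> applies with
  the projection to coordinate 0, although their lifts depend on chosen histories.\<close>

lemma ex_free_energy_ge_rate:
  obtains M where "M \<in> invariant_measures K d F" "ereal rate \<le> free_energy F \<phi> M"
proof -
  have "\<forall>n. \<exists>y. exp (- C0) / 2 * exp (real n * rate) \<le> tsum n y" using ex_tsum_ge by blast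
  from choice[OF this] obtain y where y: "\<forall>n. exp (- C0) / 2 * exp (real n * rate) \<le> tsum n (y n)" ..
  define E where "E n = past ` {z. (g ^^ n) z = y n}" for n
  obtain C :: "'a set" where C: "finite C" "\<And>x. \<exists>c\<in>C. dist x c < \<epsilon>\<^sub>0 / 4"
    by (rule finite_net[of "\<epsilon>\<^sub>0 / 4"]) (use \<epsilon>0_pos that in auto)
  obtain M and c :: "(nat \<Rightarrow> 'a) \<Rightarrow> nat" where M: "borel_prob M K" "F \<in> measurable M M" "distr M M F = M"
    and c: "simple_function M c" "rate \<le> lim (\<lambda>n. shannon M (itinerary F c n) / real n) + integral\<^sup>L M \<phi>"
  \<comment> \<open>One \<open>C0\<close> and \<open>ln 2\<close> come from
    \<open>ex_tsum_ge\<close>, the other \<open>C0\<close> from replacing \<Phi> by the Birkhoff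
    sums of \<phi>.\<close>
  proof (rule misiurewicz[of K F \<phi> "\<lambda>x. x 0" \<epsilon>\<^sub>0 C E rate "2 * C0 + ln 2"])
    show "compact K" by (rule compact_nat_ext)
    show "continuous_on K F" by (rule continuous_nat_ext_map)
    show "F ` K \<subseteq> K" by (auto intro: nat_ext_map_closed)
    show "continuous_on K \<phi>" by (rule \<phi>_cont)
    show "continuous_on K (\<lambda>x. x 0)" by (rule continuous_coord)
    show "\<epsilon>\<^sub>0 > 0" by (rule \<epsilon>0_pos)
    show "finite C" by (rule C)
    show "\<exists>z\<in>C. dist x z < \<epsilon>\<^sub>0 / 4" for x by (rule C)
    show "finite (E n)" for n by (simp add: E_def)
    show "E n \<noteq> {}" for n using surj_iter[of n "y n"] by (simp add: E_def)
    show "E n \<subseteq> K" for n by (auto simp: E_def past)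
    show "\<exists>k<n. \<epsilon>\<^sub>0 \<le> dist ((F ^^ k) u 0) ((F ^^ k) v 0)" if uv: "u \<in> E n" "v \<in> E n" "u \<noteq> v" for n u v
    proof -
      obtain z where z: "(g ^^ n) z = y n" "u = past z" using uv(1) unfolding E_def by (rule imageE) (simp add: that)
      obtain w where w: "(g ^^ n) w = y n" "v = past w" using uv(2) unfolding E_def by (rule imageE) (simp add: that)
      have "\<not> bclose n \<epsilon>\<^sub>0 z w" using preimages_bclose[of n z w] z w uv(3) by metis
      then obtain k where "k < n" "\<epsilon>\<^sub>0 \<le> dist ((g ^^ k) z) ((g ^^ k) w)" unfolding bclose_def by force
      then show ?thesis unfolding z(2) w(2) by (intro exI[of _ k]) (simp add: funpow_nat_ext_map past(2))
    qed
    show "real n * rate - (2 * C0 + ln 2) \<le> ln (\<Sum>x\<in>E n. exp (\<Sum>k<n. \<phi> ((F ^^ k) x)))" for n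
    proof -
      have "exp (real n * rate - (2 * C0 + ln 2)) = exp (- C0) * (exp (- C0) / 2 * exp (real n * rate))"
      proof -
        have "real n * rate - (2 * C0 + ln 2) = (- C0 + (- C0 + real n * rate)) - ln 2" by simp
        then show ?thesis by (simp only: exp_diff exp_add) (simp only: exp_ln zero_less_numeral times_divide_eq_right mult_ac)
      qed
      also have "\<dots> \<le> exp (- C0) * tsum n (y n)" using y by (intro mult_left_mono) auto
      also have "\<dots> = (\<Sum>z | (g ^^ n) z = y n. exp (- C0) * exp (\<Phi> n z))"
        by (simp add: psum_def sum_distrib_left)
      also have "\<dots> \<le> (\<Sum>z | (g ^^ n) z = y n. exp (birkhoff_sum F \<phi> n (past z)))"
      proof (rule sum_mono)
        fix z
        have "- C0 + \<Phi> n z \<le> birkhoff_sum F \<phi> n (past z)"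
          using \<phi>_Phi[OF past(1)[of z], of n] by (simp add: past(2) abs_le_iff)
        then show "exp (- C0) * exp (\<Phi> n z) \<le> exp (birkhoff_sum F \<phi> n (past z))"
          by (simp add: exp_add[symmetric])
      qed
      also have "\<dots> = (\<Sum>x\<in>E n. exp (\<Sum>k<n. \<phi> ((F ^^ k) x)))"
        unfolding E_def by (simp add: sum.reindex[OF inj_past] birkhoff_sum_def)
      finally have le: "exp (real n * rate - (2 * C0 + ln 2)) \<le> (\<Sum>x\<in>E n. exp (\<Sum>k<n. \<phi> ((F ^^ k) x)))" .
      then have "0 < (\<Sum>x\<in>E n. exp (\<Sum>k<n. \<phi> ((F ^^ k) x)))" using exp_gt_zero less_le_trans by blast
      then show ?thesis using le by (subst ln_ge_iff) auto
    qed
  qed (rule that)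
  interpret M: borel_prob M K by (rule M(1))
  have "ereal rate \<le> ereal (lim (\<lambda>n. shannon M (itinerary F c n) / real n)) + ereal (integral\<^sup>L M \<phi>)"
    using c(2) by simp
  also have "\<dots> \<le> free_energy F \<phi> M"
    unfolding free_energy_def by (intro add_right_mono M.ks_entropy_ge M(2) c(1))
  finally show thesis using that M by (simp add: invariant_measures_iff)
qed

section \<open>Comparing equilibrium states through perturbed potentials\<close>

lemma continuous_base:
  assumes "\<And>x y. \<bar>\<psi> x - \<psi> y\<bar> \<le> L * dist x (y :: 'a)"
  shows "continuous_on K (\<lambda>x. \<psi> (x 0))"
proof -
  have "(max 0 L)-lipschitz_on UNIV \<psi>"
  proof (rule lipschitz_onI)
    fix x y :: 'a
    have "L * dist x y \<le> max 0 L * dist x y" by (intro mult_right_mono) auto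
    then show "dist (\<psi> x) (\<psi> y) \<le> max 0 L * dist x y" using assms[of x y] by (simp add: dist_real_def)
  qed simp
  then show ?thesis
    by (intro continuous_on_compose2[OF lipschitz_on_continuous_on continuous_coord]) auto
qed

text \<open>An equilibrium state of \<phi> is tested against the perturbed potential: its free
  energy there is \<open>rate\<close> plus \<open>t\<close> times the integral of \<psi>, and cannot
  exceed the perturbed growth rate. So the integral bounds the right slope at 0 from below.\<close>

lemma integral_le_prate:
  assumes bad: "bad_growth b"
    and \<psi>: "\<And>x. 0 \<le> \<psi> x" "\<And>x. \<psi> x \<le> 1" "\<And>x y. \<bar>\<psi> x - \<psi> y\<bar> \<le> L * dist x y"
    and t: "0 < t" "b + t < rate"
    and M: "M \<in> invariant_measures K d F" "free_energy F \<phi> M = ereal rate"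
  shows "rate + t * (\<integral>x. \<psi> (x 0) \<partial>M) \<le> prate \<psi> t"
proof -
  interpret P: potential g s \<sigma> \<epsilon>\<^sub>0 "\<lambda>n z. \<Phi> n z + t * bsum g \<psi> n z" C0 "C1 + t * (\<bar>L\<bar> * \<epsilon>\<^sub>0 / (1 - \<sigma>))" "B + t"
    by (rule potential_perturb) (use \<psi> t in auto)
  have bp: "borel_prob M K" "F \<in> measurable M M" "distr M M F = M"
    using M(1) by (auto simp: invariant_measures_iff)
  interpret M: borel_prob M K by (rule bp)
  have pr: "prate \<psi> t = P.rate" by (simp add: prate_def)
  have c\<psi>: "continuous_on K (\<lambda>x. \<psi> (x 0))" by (rule continuous_base[OF \<psi>(3)])
  define \<phi>' where "\<phi>' x = \<phi> x + t * \<psi> (x 0)" for x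
  have c\<phi>': "continuous_on K \<phi>'" unfolding \<phi>'_def by (intro continuous_intros \<phi>_cont c\<psi>)
  have bd: "birkhoff_sum F \<phi>' n x \<le> \<Phi> n (x 0) + t * bsum g \<psi> n (x 0) + C0" if "x \<in> K" for n x
  proof -
    have "birkhoff_sum F \<phi>' n x = birkhoff_sum F \<phi> n x + t * bsum g \<psi> n (x 0)"
      by (simp add: birkhoff_sum_def \<phi>'_def bsum_def sum.distrib sum_distrib_left funpow_nat_ext_map)
    then show ?thesis using \<phi>_Phi[OF that, of n] by (simp add: abs_le_iff)
  qed
  have "b + t < P.rate" using prate_bounds(1)[OF \<psi>, of t] t by (simp add: pr)
  from P.free_energy_le[OF bp c\<phi>' bd bad_growth_perturb[OF \<psi> less_imp_le[OF t(1)] bad] this]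
  have "ks_entropy M F + ereal (integral\<^sup>L M \<phi>') \<le> ereal (prate \<psi> t)" by (simp add: free_energy_def pr)
  moreover have "integral\<^sup>L M \<phi>' = integral\<^sup>L M \<phi> + t * (\<integral>x. \<psi> (x 0) \<partial>M)"
    unfolding \<phi>'_def using M.cont_integrable[OF \<phi>_cont] M.cont_integrable[OF c\<psi>] by simp
  moreover have "ks_entropy M F + ereal (integral\<^sup>L M \<phi>) = ereal rate" using M(2) by (simp add: free_energy_def)
  \<comment> \<open>The entropy is finite because the free energy is, so it cancels.\<close>
  ultimately show ?thesis by (cases "ks_entropy M F") auto
qed

text \<open>The integral for \<open>M\<close> bounds the slope for \<psi>, the one for
  \<open>M'\<close> the slope for \<open>1 - \<psi>\<close>; up to half of the gap the perturbed
  potentials keep a gap of their own. Exchanging the measures gives equality.\<close>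

lemma base_integral_le:
  assumes bad: "bad_growth b" "b < rate"
    and \<psi>: "\<And>x. 0 \<le> \<psi> x" "\<And>x. \<psi> x \<le> 1" "\<And>x y. \<bar>\<psi> x - \<psi> y\<bar> \<le> L * dist x y"
    and M: "M \<in> invariant_measures K d F" "free_energy F \<phi> M = ereal rate"
    and M': "M' \<in> invariant_measures K d F" "free_energy F \<phi> M' = ereal rate"
  shows "(\<integral>x. \<psi> (x 0) \<partial>M) \<le> (\<integral>x. \<psi> (x 0) \<partial>M')"
proof (rule slopes_agree[OF bad \<psi>, where ?t0.0 = "(rate - b) / 2"])
  interpret M': borel_prob M' K using M'(1) by (simp add: invariant_measures_iff)
  show "(rate - b) / 2 > 0" "b + (rate - b) / 2 < rate" using bad(2) by (simp_all add: field_simps)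
  show "rate + t * (\<integral>x. \<psi> (x 0) \<partial>M) \<le> prate \<psi> t" if t: "0 < t" "t \<le> (rate - b) / 2" for t
  proof (rule integral_le_prate[OF bad(1) \<psi> t(1) _ M])
    show "b + t < rate" using t(2) bad(2) by (simp add: field_simps)
  qed
  have "(\<integral>x. 1 - \<psi> (x 0) \<partial>M') = 1 - (\<integral>x. \<psi> (x 0) \<partial>M')"
  proof -
    have "integrable M' (\<lambda>x. \<psi> (x 0))"
      by (rule M'.cont_integrable[OF continuous_base[OF \<psi>(3)]])
    then show ?thesis using M'.prob_space by simp
  qed
  moreover have "rate + t * (\<integral>x. 1 - \<psi> (x 0) \<partial>M') \<le> prate (\<lambda>x. 1 - \<psi> x) t"
    if t: "0 < t" "t \<le> (rate - b) / 2" for t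
  proof (rule integral_le_prate[OF bad(1) _ _ _ t(1) _ M', where L=L])
    show "b + t < rate" using t(2) bad(2) by (simp add: field_simps)
    show "0 \<le> 1 - \<psi> x" "1 - \<psi> x \<le> 1" for x using \<psi>(1,2)[of x] by auto
    show "\<bar>1 - \<psi> x - (1 - \<psi> y)\<bar> \<le> L * dist x y" for x y using \<psi>(3)[of x y] by simp
  qed
  ultimately show "rate + t * (1 - (\<integral>x. \<psi> (x 0) \<partial>M')) \<le> prate (\<lambda>x. 1 - \<psi> x) t"
    if "0 < t" "t \<le> (rate - b) / 2" for t using that by simp
qed

text \<open>The supremum of the free energies equals \<open>rate\<close>, so equilibrium states are
  the invariant measures of free energy \<open>rate\<close>. Lipschitz ramps decreasing to the
  indicator of a closed set turn equal integrals into equal base marginals.\<close>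

theorem unique_equilibrium_state:
  assumes bad: "bad_growth b" "b < rate"
  shows "\<exists>!\<mu>. equilibrium_state K d F \<phi> \<mu>"
proof -
  obtain M where M: "M \<in> invariant_measures K d F" "ereal rate \<le> free_energy F \<phi> M"
    by (rule ex_free_energy_ge_rate)
  have SUP: "(SUP \<nu>\<in>invariant_measures K d F. free_energy F \<phi> \<nu>) = ereal rate"
  proof (rule antisym)
    show "(SUP \<nu>\<in>invariant_measures K d F. free_energy F \<phi> \<nu>) \<le> ereal rate"
      by (intro SUP_least free_energy_le_rate[OF bad])
    show "ereal rate \<le> (SUP \<nu>\<in>invariant_measures K d F. free_energy F \<phi> \<nu>)"
      using M(2) by (rule order_trans) (rule SUP_upper[OF M(1)])
  qed
  have eq: "equilibrium_state K d F \<phi> \<mu> \<longleftrightarrow> \<mu> \<in> invariant_measures K d F \<and> free_energy F \<phi> \<mu> = ereal rate" for \<mu>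
    by (simp add: equilibrium_state_def SUP)
  show ?thesis unfolding eq
  proof (rule ex1I)
    show "M \<in> invariant_measures K d F \<and> free_energy F \<phi> M = ereal rate"
      using M free_energy_le_rate[OF bad M(1)] by (auto intro: antisym)
  next
    fix M' assume M': "M' \<in> invariant_measures K d F \<and> free_energy F \<phi> M' = ereal rate"
    have fM: "free_energy F \<phi> M = ereal rate" using M free_energy_le_rate[OF bad M(1)] by (auto intro: antisym)
    show "M' = M"
    proof (rule invariant_measure_eqI)
      fix S :: "'a set" assume S: "closed S" "S \<noteq> {}"
      define \<psi> where "\<psi> k x = max 0 (1 - real k * infdist x S)" for k :: nat and x
      have \<psi>: "0 \<le> \<psi> k x" "\<psi> k x \<le> 1" "\<bar>\<psi> k x - \<psi> k y\<bar> \<le> real k * dist x y" for k x y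
      proof -
        show "0 \<le> \<psi> k x" "\<psi> k x \<le> 1" using infdist_nonneg[of x S] by (auto simp: \<psi>_def)
        have "\<bar>real k * infdist x S - real k * infdist y S\<bar> \<le> real k * dist x y"
          using mult_left_mono[OF infdist_triangle_abs[of x S y], of "real k"]
          by (simp add: abs_mult right_diff_distrib[symmetric])
        then show "\<bar>\<psi> k x - \<psi> k y\<bar> \<le> real k * dist x y" unfolding \<psi>_def by linarith
      qed
      have int: "(\<integral>x. \<psi> k (x 0) \<partial>M) = (\<integral>x. \<psi> k (x 0) \<partial>M')" for k
        by (intro antisym base_integral_le[OF bad \<psi>] M(1) fM) (use M' in auto)
      have lim: "(\<lambda>k. \<integral>x. \<psi> k (x 0) \<partial>N) \<longlonglongrightarrow> measure N ((\<lambda>x. x 0) -` S \<inter> K)"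
        if N: "N \<in> invariant_measures K d F" for N
      proof -
        interpret N: borel_prob N K using N by (simp add: invariant_measures_iff)
        show ?thesis
          using N.measure_closed_limit[OF N.cont_measurable[OF continuous_coord[of K 0]] S]
          by (simp add: \<psi>_def N.space_M)
      qed
      show "measure M' ((\<lambda>x. x 0) -` S \<inter> K) = measure M ((\<lambda>x. x 0) -` S \<inter> K)"
        using lim[of M'] M' lim[OF M(1)] unfolding int by (auto intro: LIMSEQ_unique)
    qed (use M M' in auto)
  qed
qed

end

section \<open>From the hypotheses of the theorem to the locales\<close>

lemma local_homeomorphism_continuous:
  fixes g :: "'a::metric_space \<Rightarrow> 'b::metric_space"
  assumes "local_homeomorphism g"
  shows "continuous_on A g"
proof (rule continuous_at_imp_continuous_on, rule ballI)
  fix x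
  obtain U V h where "x \<in> U" "open U" "homeomorphism U V g h"
    using assms unfolding local_homeomorphism_def by blast
  then show "isCont g x" using continuous_on_eq_continuous_at homeomorphism_cont1 by blast
qed

text \<open>Finitely many balls of radius \<open>e / 2\<close> suffice, as every ball of radius
  \<open>e\<close> contains one of them; surjectivity of \<open>g\<close> keeps the image full at
  all later times. The sum of the finitely many times is a common bound.\<close>

lemma topologically_exact_uniform:
  fixes g :: "'a::metric_space \<Rightarrow> 'a"
  assumes compact: "compact (UNIV :: 'a set)" and exact: "topologically_exact g" and e: "e > 0"
  shows "\<exists>\<tau>. \<forall>N\<ge>\<tau>. \<forall>x. (g ^^ N) ` ball x e = UNIV"
proof -
  have ex: "\<exists>N\<ge>1. (g ^^ N) ` U = UNIV" if "open U" "U \<noteq> {}" for U :: "'a set"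
    using exact that unfolding topologically_exact_def by blast
  obtain n where "n \<ge> 1" "(g ^^ n) ` UNIV = UNIV" using ex[of UNIV] by auto
  then have "surj (g ^^ Suc (n - 1))" by simp
  then have "surj g" unfolding funpow.simps surj_def comp_def by blast
  then have surj: "surj (g ^^ k)" for k by (rule surj_fn)
  obtain C :: "'a set" where C: "finite C" "UNIV \<subseteq> (\<Union>c\<in>C. ball c (e / 2))"
    using compact[unfolded compact_eq_totally_bounded] half_gt_zero[OF e] by blast
  have "\<forall>c. \<exists>N. (g ^^ N) ` ball c (e / 2) = UNIV" using ex[OF open_ball] centre_in_ball[of _ "e / 2"] half_gt_zero[OF e] by (metis empty_iff)
  from choice[OF this] obtain N where N: "\<forall>c. (g ^^ N c) ` ball c (e / 2) = UNIV" ..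
  have "(g ^^ n) ` ball x e = UNIV" if n: "n \<ge> (\<Sum>c\<in>C. N c)" for n x
  proof -
    obtain c where c: "c \<in> C" "x \<in> ball c (e / 2)" using subsetD[OF C(2) UNIV_I[of x]] by blast
    have "N c \<le> (\<Sum>c\<in>C. N c)" using C(1) c(1) by (intro member_le_sum) auto
    then have nc: "n = (n - N c) + N c" using n by simp
    have "ball c (e / 2) \<subseteq> ball x e"
    proof
      fix y assume "y \<in> ball c (e / 2)"
      then show "y \<in> ball x e" using c(2) dist_triangle3[of x y c] by simp
    qed
    then have "(g ^^ N c) ` ball x e = UNIV" using N by blast
    then have "(g ^^ (n - N c)) ` (g ^^ N c) ` ball x e = UNIV" using surj by simp
    then show ?thesis by (subst nc) (simp add: funpow_add image_comp)
  qed
  then show ?thesis by blast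
qed

theorem theorem4p1:
  fixes g :: "'a::metric_space \<Rightarrow> 'a"
    and s :: "'a \<Rightarrow> real"
    and U :: "'a \<Rightarrow> 'a set"
    and \<epsilon>\<^sub>0 a \<sigma> :: real
    and \<phi> :: "(nat \<Rightarrow> 'a) \<Rightarrow> real"
  assumes "compact (UNIV :: 'a set)"
    and "local_homeomorphism g"
    and "\<And>x. s x > 0"
    and "bounded (range s)"
    and "\<And>x. x \<in> interior (U x)"
    and "\<And>x. inj_on g (U x)"
    and "\<And>x y z. y \<in> g ` U x \<Longrightarrow> z \<in> g ` U x \<Longrightarrow>
           dist (inv_into (U x) g y) (inv_into (U x) g z) \<le> s x * dist y z"
    and "\<epsilon>\<^sub>0 > 0"
    and "\<And>x. ball x \<epsilon>\<^sub>0 \<subseteq> U x"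
    and "\<And>x. ball (g x) \<epsilon>\<^sub>0 \<subseteq> g ` U x"
    and "topologically_exact g"
    and "a > 1"
    and "hoelder_continuous_on (nat_ext g) (nat_ext_dist a) \<phi>"
    and "0 < \<sigma>" and "\<sigma> < 1"
    and "pressure_on (nat_ext_dist a) (nat_ext_map g) (bad_segments_ext g s \<sigma>) \<phi>
           < pressure (nat_ext g) (nat_ext_dist a) (nat_ext_map g) \<phi>"
  shows "\<exists>!\<mu>. equilibrium_state (nat_ext g) (nat_ext_dist a) (nat_ext_map g) \<phi> \<mu>"
proof -
  interpret nat_ext_system g s \<sigma> \<epsilon>\<^sub>0 a
  proof
    show "continuous_on UNIV g" by (rule local_homeomorphism_continuous[OF assms(2)])
    show "\<exists>\<tau>. \<forall>N\<ge>\<tau>. \<forall>x. (g ^^ N) ` ball x e = UNIV" if "e > 0" for e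
      by (rule topologically_exact_uniform[OF assms(1,11) that])
    show "z = z'" if "g z = g z'" "dist z z' < \<epsilon>\<^sub>0" for z z'
    proof (rule inj_onD[OF assms(6)[of z] that(1)])
      show "z \<in> U z" by (rule subsetD[OF assms(9)[of z]]) (simp add: assms(8))
      show "z' \<in> U z" by (rule subsetD[OF assms(9)[of z]]) (simp add: that(2))
    qed
    \<comment> \<open>The inverse branch on \<open>U x\<close> is evaluated at \<open>y\<close> and
      at \<open>g x\<close>, where it returns \<open>x\<close>; the contraction hypothesis then
      compares the lifted point with \<open>x\<close>.\<close>
    show "\<exists>z. g z = y \<and> dist z x \<le> s x * dist y (g x)" if "dist y (g x) < \<epsilon>\<^sub>0" for x y
    proof (intro exI conjI)
      have x: "x \<in> U x" by (rule subsetD[OF interior_subset assms(5)])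
      have y: "y \<in> g ` U x" by (rule subsetD[OF assms(10)]) (use that in \<open>simp add: dist_commute\<close>)
      show "g (inv_into (U x) g y) = y" by (rule f_inv_into_f[OF y])
      have "inv_into (U x) g (g x) = x" by (rule inv_into_f_f[OF assms(6) x])
      then show "dist (inv_into (U x) g y) x \<le> s x * dist y (g x)"
        using assms(7)[OF y imageI[OF x]] by simp
    qed
  qed (rule assms)+
  obtain C B where "potential g s \<sigma> \<epsilon>\<^sub>0 (ext_sum \<phi>) C C B"
    and CB: "\<And>n x. x \<in> nat_ext g \<Longrightarrow> \<bar>birkhoff_sum (nat_ext_map g) \<phi> n x - ext_sum \<phi> n (x 0)\<bar> \<le> C"
    by (rule hoelder_potential[OF assms(13)]) (rule that)
  then interpret potential g s \<sigma> \<epsilon>\<^sub>0 "ext_sum \<phi>" C C B by blast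
  interpret ext_potential g s \<sigma> \<epsilon>\<^sub>0 a "ext_sum \<phi>" C C B \<phi>
    by unfold_locales (rule hoelder_continuous[OF assms(13)], rule CB)
  obtain b where "bad_growth b" "b < rate" by (rule growth_gap[OF assms(16)])
  then show ?thesis by (rule unique_equilibrium_state)
qed

end
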